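(* There exists a large absolute constant $C>0$ such that the following holds. Let $\alpha\in\mathbb{R}\setminus\mathbb{Q}$ satisfy $0<\beta(\alpha)<\infty$, and let $v:\mathbb{R}/\mathbb{Z}\to\mathbb{R}$ be real analytic and admit a (1-periodic) analytic extension to the strip $\{x\in\mathbb{C}: |\Im x|<C\beta(\alpha)\}$. Then there exists $\lambda_0=\lambda_0(v,\beta(\alpha))>0$ such that for every $\lambda$ with $|\lambda|<\lambda_0$ and every $\theta\in\mathbb{R}$, the operator $H_{\lambda v,\alpha,\theta}$ has purely absolutely continuous spectrum.
   Context: For $\lambda\in\mathbb{R}$, $\alpha\in\mathbb{R}$, $\theta\in\mathbb{R}$, the quasi-periodic Schrödinger operator $H_{\lambda v,\alpha,\theta}$ on $\ell^2(\mathbb{Z})$ is $(H_{\lambda v,\alpha,\theta}u)_n=u_{n+1}+u_{n-1}+\lambda v(\theta+n\alpha)u_n$. For irrational $\alpha$ with continued fraction approximants $p_n/q_n$, $\beta(\alpha)=\limsup_{n\to\infty}\frac{\ln q_{n+1}}{q_n}$. *)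

theory Defs
  imports "HOL-Analysis.Analysis" "HOL-Library.Liminf_Limsup"
begin

fun cf_x :: "real \<Rightarrow> nat \<Rightarrow> real" where
  "cf_x \<alpha> 0 = frac \<alpha>"
| "cf_x \<alpha> (Suc n) = frac (1 / cf_x \<alpha> n)"

definition cf_a :: "real \<Rightarrow> nat \<Rightarrow> nat" where
  "cf_a \<alpha> n = nat \<lfloor>1 / cf_x \<alpha> (n - 1)\<rfloor>"

fun cf_q :: "real \<Rightarrow> nat \<Rightarrow> nat" where
  "cf_q \<alpha> 0 = 1"
| "cf_q \<alpha> (Suc 0) = cf_a \<alpha> 1"
| "cf_q \<alpha> (Suc (Suc n)) = cf_a \<alpha> (Suc (Suc n)) * cf_q \<alpha> (Suc n) + cf_q \<alpha> n"

definition beta_exp :: "real \<Rightarrow> ereal" where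
  "beta_exp \<alpha> = limsup (\<lambda>n. ereal (ln (real (cf_q \<alpha> (Suc n))) / real (cf_q \<alpha> n)))"

definition schr_op :: "real \<Rightarrow> (real \<Rightarrow> real) \<Rightarrow> real \<Rightarrow> real \<Rightarrow> (int \<Rightarrow> complex) \<Rightarrow> (int \<Rightarrow> complex)" where
  "schr_op lam v \<alpha> \<theta> u = (\<lambda>n. u (n + 1) + u (n - 1) + complex_of_real (lam * v (\<theta> + real_of_int n * \<alpha>)) * u n)"

definition ell2 :: "(int \<Rightarrow> complex) set" where
  "ell2 = {\<psi>. (\<lambda>n. (cmod (\<psi> n))\<^sup>2) summable_on UNIV}"

definition inner_l2 :: "(int \<Rightarrow> complex) \<Rightarrow> (int \<Rightarrow> complex) \<Rightarrow> complex" where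
  "inner_l2 \<phi> \<psi> = (\<Sum>\<^sub>\<infinity>n. cnj (\<phi> n) * \<psi> n)"

text \<open>mu is the spectral measure of psi for the bounded self-adjoint operator H:
  a finite Borel measure on the reals whose moments are the values of the inner product of psi with H^k psi
  (for bounded H these moments determine mu uniquely).\<close>

definition is_spectral_measure :: "((int \<Rightarrow> complex) \<Rightarrow> (int \<Rightarrow> complex)) \<Rightarrow> (int \<Rightarrow> complex) \<Rightarrow> real measure \<Rightarrow> bool" where
  "is_spectral_measure H \<psi> \<mu> \<longleftrightarrow> finite_measure \<mu> \<and> sets \<mu> = sets borel \<and>
     (\<forall>k::nat. integrable \<mu> (\<lambda>x. x ^ k) \<and>
        complex_of_real (\<integral>x. x ^ k \<partial>\<mu>) = inner_l2 \<psi> ((H ^^ k) \<psi>))"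

definition purely_ac_spectrum :: "((int \<Rightarrow> complex) \<Rightarrow> (int \<Rightarrow> complex)) \<Rightarrow> bool" where
  "purely_ac_spectrum H \<longleftrightarrow>
     (\<forall>\<psi>\<in>ell2. \<exists>\<mu>. is_spectral_measure H \<psi> \<mu> \<and> absolutely_continuous lborel \<mu>)"

end

theory Submission
  imports Defs "HOL-Complex_Analysis.Complex_Analysis" "HOL-Probability.Probability"
    "HOL-Computational_Algebra.Fundamental_Theorem_Algebra" "Jordan_Normal_Form.Determinant"
begin

text \<open>
  Replace \<open>\<alpha>\<close> by a rational \<open>P/Q\<close> and pass to the Aubry dual: a finite matrix on \<open>\<int>/Q\<close> with diagonal
  \<open>2 cos(2 \<pi> (x + m P/Q))\<close> and small, exponentially decaying off-diagonal part. Finiteness of \<open>\<beta>(\<alpha>)\<close>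
  gives the small divisor bound needed to localise the dual eigenvectors, uniformly in \<open>Q\<close>. Their
  Fourier transforms are generalised eigenfunctions of the periodic approximant that are, up to a small
  proportion, uniformly bounded with Wronskian bounded away from zero; by subordinacy-type estimates on the
  Green function the spectral weights of the approximants are uniformly integrable. A weak limit of the
  approximating spectral measures is the spectral measure of the operator, and it inherits absolute continuity.
\<close>

subsection \<open>Continued fractions and small divisors\<close>

text \<open>The phase \<open>\<theta>\<close> enters the dual matrix only through the coefficients
  \<open>cc\<close>, while the dual phase is free to choose; this is why no exceptional
  \<open>\<theta>\<close> appear. The obstacle is that a dual eigenvector has no known centre and
  that some sites are resonant with their mirror images. Both are met by averaging: of two sites
  \<open>m\<close> and \<open>m + n\<close> at least one carries little of each eigenvector, for all
  \<open>m\<close> outside a set of proportion of order n exp(- B n), with B = 2 b, where b is the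
  value of beta. So the correlation of |phi_j(m)| and |phi_j(m + n)|, averaged over \<open>m\<close>
  and summed over \<open>j\<close>, decays summably with constants independent of \<open>Q\<close>.
  The size of \<open>C\<close> reflects the cost of small divisors. The Green function of a window
  may grow like exp(51 B n) while its ends are only n/200 away, which asks for the decay rate 22000
  B; the coefficients must decay twice as fast, at rate 88000 b, and sampling a function analytic in
  a strip gives half the strip width as a rate. Hence 176000 b of analyticity is consumed.\<close>

fun cf_p :: "real \<Rightarrow> nat \<Rightarrow> int" where
  "cf_p \<alpha> 0 = \<lfloor>\<alpha>\<rfloor>"
| "cf_p \<alpha> (Suc 0) = int (cf_a \<alpha> 1) * \<lfloor>\<alpha>\<rfloor> + 1"
| "cf_p \<alpha> (Suc (Suc n)) = int (cf_a \<alpha> (Suc (Suc n))) * cf_p \<alpha> (Suc n) + cf_p \<alpha> n"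

text \<open>This product of iterates of the Gauss map is the approximation error |q_n \<alpha> -
  p_n|; in product form its positivity and monotonicity are immediate.\<close>

definition cf_eta :: "real \<Rightarrow> nat \<Rightarrow> real" where
  "cf_eta \<alpha> n = (\<Prod>i\<le>n. cf_x \<alpha> i)"

lemma cf_x_irrational: "\<alpha> \<notin> \<rat> \<Longrightarrow> cf_x \<alpha> n \<notin> \<rat>"
proof (induction n)
  case 0
  have "\<alpha> = frac \<alpha> + of_int \<lfloor>\<alpha>\<rfloor>" by (simp add: frac_def)
  then show ?case using 0 by (metis Rats_add Rats_of_int cf_x.simps(1))
next
  case (Suc n)
  let ?y = "1 / cf_x \<alpha> n"
  have "cf_x \<alpha> n = 1 / ?y" by simp
  then have "?y \<notin> \<rat>" using Suc by (metis Rats_1 Rats_divide)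
  moreover have "?y = frac ?y + of_int \<lfloor>?y\<rfloor>" by (simp add: frac_def)
  ultimately show ?case by (metis Rats_add Rats_of_int cf_x.simps(2))
qed

lemma cf_x_bounds:
  assumes "\<alpha> \<notin> \<rat>" shows "0 < cf_x \<alpha> n" "cf_x \<alpha> n < 1"
proof -
  have "cf_x \<alpha> n \<noteq> 0" using cf_x_irrational[OF assms] by (metis Rats_0)
  moreover have "0 \<le> cf_x \<alpha> n \<and> cf_x \<alpha> n < 1" by (cases n) (auto simp: frac_lt_1)
  ultimately show "0 < cf_x \<alpha> n" "cf_x \<alpha> n < 1" by auto
qed

lemma cf_x_step:
  assumes "\<alpha> \<notin> \<rat>"
  shows "real (cf_a \<alpha> (Suc n)) = 1 / cf_x \<alpha> n - cf_x \<alpha> (Suc n)" "1 \<le> cf_a \<alpha> (Suc n)"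
proof -
  have "1 / cf_x \<alpha> n > 1" using cf_x_bounds[OF assms, of n] by simp
  then have f: "\<lfloor>1 / cf_x \<alpha> n\<rfloor> \<ge> 1" by linarith
  show "1 \<le> cf_a \<alpha> (Suc n)" using f unfolding cf_a_def by (subst diff_Suc_1) linarith
  show "real (cf_a \<alpha> (Suc n)) = 1 / cf_x \<alpha> n - cf_x \<alpha> (Suc n)"
    using f unfolding cf_a_def by (subst diff_Suc_1, subst of_nat_nat) (linarith, simp add: frac_def)
qed

lemma cf_eta_pos: "\<alpha> \<notin> \<rat> \<Longrightarrow> 0 < cf_eta \<alpha> n"
  unfolding cf_eta_def by (intro prod_pos) (auto simp: cf_x_bounds)

lemma cf_eta_decr: "\<alpha> \<notin> \<rat> \<Longrightarrow> cf_eta \<alpha> (Suc n) \<le> cf_eta \<alpha> n"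
  using cf_eta_pos[of \<alpha> n] cf_x_bounds[of \<alpha> "Suc n"]
  by (simp add: cf_eta_def mult_left_le)

lemma cf_eta_rec:
  assumes "\<alpha> \<notin> \<rat>"
  shows "cf_eta \<alpha> (Suc (Suc n)) = cf_eta \<alpha> n - real (cf_a \<alpha> (Suc (Suc n))) * cf_eta \<alpha> (Suc n)"
proof -
  have "cf_x \<alpha> (Suc n) \<noteq> 0" using cf_x_bounds[OF assms, of "Suc n"] by simp
  then have e: "cf_x \<alpha> (Suc n) * cf_x \<alpha> (Suc (Suc n)) = 1 - cf_a \<alpha> (Suc (Suc n)) * cf_x \<alpha> (Suc n)"
    unfolding cf_x_step(1)[OF assms, of "Suc n"] by (simp add: left_diff_distrib del: cf_x.simps)
  have "cf_eta \<alpha> (Suc (Suc n)) = cf_eta \<alpha> n * (cf_x \<alpha> (Suc n) * cf_x \<alpha> (Suc (Suc n)))"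
    by (simp add: cf_eta_def del: cf_x.simps)
  also have "\<dots> = cf_eta \<alpha> n - real (cf_a \<alpha> (Suc (Suc n))) * (cf_eta \<alpha> n * cf_x \<alpha> (Suc n))"
    unfolding e by (simp add: algebra_simps del: cf_x.simps)
  also have "cf_eta \<alpha> n * cf_x \<alpha> (Suc n) = cf_eta \<alpha> (Suc n)" by (simp add: cf_eta_def del: cf_x.simps)
  finally show ?thesis .
qed

text \<open>Numerators and denominators obey one three-term recursion, and \<open>cf_eta_rec\<close>
  is the same recursion with the sign of the partial quotient reversed; the alternating factor
  accounts for that sign.\<close>

lemma cf_approx_error:
  assumes "\<alpha> \<notin> \<rat>"
  shows "real (cf_q \<alpha> n) * \<alpha> - of_int (cf_p \<alpha> n) = (-1) ^ n * cf_eta \<alpha> n"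
proof (induction n rule: induct_nat_012)
  case 0
  then show ?case by (simp add: cf_eta_def frac_def)
next
  case 1
  have "cf_x \<alpha> 0 \<noteq> 0" using cf_x_bounds[OF assms, of 0] by simp
  moreover have "\<alpha> - of_int \<lfloor>\<alpha>\<rfloor> = cf_x \<alpha> 0" by (simp add: frac_def)
  moreover have "real (cf_a \<alpha> 1) = 1 / cf_x \<alpha> 0 - cf_x \<alpha> 1" using cf_x_step(1)[OF assms, of 0] by simp
  ultimately have "real (cf_a \<alpha> 1) * (\<alpha> - of_int \<lfloor>\<alpha>\<rfloor>) - 1 = - cf_x \<alpha> 0 * cf_x \<alpha> 1"
    by (simp add: left_diff_distrib right_diff_distrib mult.commute del: cf_x.simps)
  then show ?case by (simp add: cf_eta_def algebra_simps del: cf_x.simps)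
next
  case (ge2 n)
  have "real (cf_q \<alpha> (Suc (Suc n))) * \<alpha> - of_int (cf_p \<alpha> (Suc (Suc n)))
     = real (cf_a \<alpha> (Suc (Suc n))) * (real (cf_q \<alpha> (Suc n)) * \<alpha> - of_int (cf_p \<alpha> (Suc n)))
       + (real (cf_q \<alpha> n) * \<alpha> - of_int (cf_p \<alpha> n))" by (simp add: algebra_simps)
  also have "\<dots> = (-1) ^ Suc (Suc n) * cf_eta \<alpha> (Suc (Suc n))"
    unfolding ge2 cf_eta_rec[OF assms] by (simp add: algebra_simps)
  finally show ?case .
qed

lemma cf_det: "int (cf_q \<alpha> n) * cf_p \<alpha> (Suc n) - int (cf_q \<alpha> (Suc n)) * cf_p \<alpha> n = (-1) ^ n"
proof (induction n)
  case 0 then show ?case by simp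
next
  case (Suc n)
  then show ?case by (simp add: algebra_simps)
qed

lemma cf_q_pos: "\<alpha> \<notin> \<rat> \<Longrightarrow> 1 \<le> cf_q \<alpha> n"
  by (induction n rule: induct_nat_012) (use cf_x_step(2)[of \<alpha> 0] in auto)

lemma cf_q_mono: "\<alpha> \<notin> \<rat> \<Longrightarrow> cf_q \<alpha> n \<le> cf_q \<alpha> (Suc n)"
proof (cases n)
  case 0 assume "\<alpha> \<notin> \<rat>" then show ?thesis using 0 cf_q_pos[of \<alpha> 1] by simp
next
  case (Suc m) assume a: "\<alpha> \<notin> \<rat>"
  have "1 * cf_q \<alpha> (Suc m) \<le> cf_a \<alpha> (Suc (Suc m)) * cf_q \<alpha> (Suc m)"
    by (rule mult_right_mono) (use cf_x_step(2)[OF a] in auto)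
  then show ?thesis unfolding Suc cf_q.simps by linarith
qed

lemma cf_q_ge: "\<alpha> \<notin> \<rat> \<Longrightarrow> n \<le> cf_q \<alpha> n"
proof (induction n)
  case (Suc n)
  show ?case
  proof (cases n)
    case 0 then show ?thesis using cf_q_pos[OF Suc(2), of 1] by simp
  next
    case (Suc m)
    have "1 * cf_q \<alpha> (Suc m) \<le> cf_a \<alpha> (Suc (Suc m)) * cf_q \<alpha> (Suc m)"
      by (rule mult_right_mono) (use cf_x_step(2)[OF \<open>\<alpha> \<notin> \<rat>\<close>] in auto)
    then show ?thesis using Suc \<open>\<alpha> \<notin> \<rat> \<Longrightarrow> n \<le> cf_q \<alpha> n\<close>[OF \<open>\<alpha> \<notin> \<rat>\<close>] cf_q_pos[OF \<open>\<alpha> \<notin> \<rat>\<close>, of m]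
      unfolding Suc cf_q.simps by linarith
  qed
qed simp

text \<open>The determinant of two consecutive convergents gives q_(n+1) eta_n + q_n eta_(n+1) = 1,
  and the first summand is the larger one.\<close>

lemma cf_eta_lower:
  assumes "\<alpha> \<notin> \<rat>" shows "1 / (2 * real (cf_q \<alpha> (Suc n))) \<le> cf_eta \<alpha> n"
proof -
  have e: "real (cf_q \<alpha> n) * of_int (cf_p \<alpha> (Suc n)) - real (cf_q \<alpha> (Suc n)) * of_int (cf_p \<alpha> n) = (-1) ^ n"
    using arg_cong[OF cf_det[of \<alpha> n], of real_of_int] by simp
  have "real (cf_q \<alpha> (Suc n)) * (real (cf_q \<alpha> n) * \<alpha> - of_int (cf_p \<alpha> n))
      - real (cf_q \<alpha> n) * (real (cf_q \<alpha> (Suc n)) * \<alpha> - of_int (cf_p \<alpha> (Suc n))) = (-1) ^ n"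
    using e by (simp add: algebra_simps del: cf_q.simps cf_p.simps)
  then have "real (cf_q \<alpha> (Suc n)) * ((-1) ^ n * cf_eta \<alpha> n) + real (cf_q \<alpha> n) * ((-1)^ n * cf_eta \<alpha> (Suc n)) = (-1) ^ n"
    unfolding cf_approx_error[OF assms] by simp
  then have "(-1) ^ n * (real (cf_q \<alpha> (Suc n)) * cf_eta \<alpha> n + real (cf_q \<alpha> n) * cf_eta \<alpha> (Suc n)) = (-1) ^ n"
    by (simp add: algebra_simps)
  then have "real (cf_q \<alpha> (Suc n)) * cf_eta \<alpha> n + real (cf_q \<alpha> n) * cf_eta \<alpha> (Suc n) = 1" by simp
  moreover have "real (cf_q \<alpha> n) * cf_eta \<alpha> (Suc n) \<le> real (cf_q \<alpha> (Suc n)) * cf_eta \<alpha> n"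
    by (intro mult_mono) (use cf_q_mono[OF assms] cf_eta_decr[OF assms] cf_eta_pos[OF assms, of "Suc n"] in auto)
  ultimately have "1 \<le> 2 * real (cf_q \<alpha> (Suc n)) * cf_eta \<alpha> n" by linarith
  then show ?thesis using cf_q_pos[OF assms, of "Suc n"] by (simp add: field_simps)
qed

text \<open>Two consecutive convergents form a basis of the integer lattice, so
  \<open>(j, p)\<close> is an integer combination of them with coefficients \<open>u\<close> and
  \<open>w\<close>. The range of \<open>j\<close> excludes \<open>u = 0\<close> and equal strict
  signs of \<open>u\<close> and \<open>w\<close>; with the alternating signs of the errors the two
  contributions then add up instead of cancelling.\<close>

lemma cf_best_approx:
  fixes j :: nat and p :: int
  assumes irr: "\<alpha> \<notin> \<rat>" and j: "1 \<le> j" "j < cf_q \<alpha> (Suc n)"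
  shows "cf_eta \<alpha> n \<le> \<bar>real j * \<alpha> - of_int p\<bar>"
proof -
  define s where "s = ((-1) ^ n :: int)"
  have s2: "s * s = 1" unfolding s_def by (simp flip: power_mult_distrib)
  let ?q = "int (cf_q \<alpha> n)" and ?q' = "int (cf_q \<alpha> (Suc n))"
  let ?p = "cf_p \<alpha> n" and ?p' = "cf_p \<alpha> (Suc n)"
  have d: "?q * ?p' - ?q' * ?p = s" unfolding s_def by (rule cf_det)
  define u where "u = s * (int j * ?p' - p * ?q')"
  define w where "w = s * (p * ?q - int j * ?p)"
  have ju: "int j = u * ?q + w * ?q'"
  proof -
    have "u * ?q + w * ?q' = int j * (s * (?q * ?p' - ?q' * ?p))" unfolding u_def w_def by (simp add: algebra_simps del: cf_p.simps cf_q.simps)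
    then show ?thesis using d s2 by simp
  qed
  have pu: "p = u * ?p + w * ?p'"
  proof -
    have "u * ?p + w * ?p' = p * (s * (?q * ?p' - ?q' * ?p))" unfolding u_def w_def by (simp add: algebra_simps del: cf_p.simps cf_q.simps)
    then show ?thesis using d s2 by simp
  qed
  have qpos: "?q \<ge> 1" "?q' \<ge> 1" using cf_q_pos[OF irr, of n] cf_q_pos[OF irr, of "Suc n"] by auto
  have e: "real j * \<alpha> - of_int p = (-1) ^ n * (of_int u * cf_eta \<alpha> n - of_int w * cf_eta \<alpha> (Suc n))"
  proof -
    have "real j = of_int u * real (cf_q \<alpha> n) + of_int w * real (cf_q \<alpha> (Suc n))"
      using arg_cong[OF ju, of real_of_int] by simp
    then have "real j * \<alpha> - of_int p = of_int u * (real (cf_q \<alpha> n) * \<alpha> - of_int ?p) + of_int w * (real (cf_q \<alpha> (Suc n)) * \<alpha> - of_int ?p')"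
      by (subst pu) (simp add: algebra_simps)
    then show ?thesis unfolding cf_approx_error[OF irr] by (simp add: algebra_simps)
  qed
  then have e': "\<bar>real j * \<alpha> - of_int p\<bar> = \<bar>of_int u * cf_eta \<alpha> n - of_int w * cf_eta \<alpha> (Suc n)\<bar>"
    by (simp add: abs_mult power_abs)
  have eta: "cf_eta \<alpha> n > 0" "cf_eta \<alpha> (Suc n) > 0" using cf_eta_pos[OF irr] by auto
  have jlt: "int j < ?q'" "int j > 0" using j by auto
  have u0: "u \<noteq> 0"
  proof
    assume "u = 0"
    then have "int j = w * ?q'" using ju by simp
    then have r: "0 < w * ?q'" "w * ?q' < ?q'" using jlt by auto
    consider "w \<le> 0" | "w \<ge> 1" by linarith
    then show False
    proof cases
      case 1 then have "w * ?q' \<le> 0" using qpos by (simp add: mult_nonpos_nonneg del: cf_q.simps)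
      then show False using r by linarith
    next
      case 2 then have "1 * ?q' \<le> w * ?q'" using qpos by (intro mult_right_mono) auto
      then show False using r by linarith
    qed
  qed
  consider "u \<ge> 1" "w \<le> 0" | "u \<le> -1" "w \<ge> 0" | "u \<ge> 1" "w \<ge> 1" | "u \<le> -1" "w \<le> -1" using u0 by linarith
  then show ?thesis
  proof cases
    case 1
    have "1 * cf_eta \<alpha> n \<le> of_int u * cf_eta \<alpha> n" by (rule mult_right_mono) (use 1 eta in auto)
    moreover have "of_int w * cf_eta \<alpha> (Suc n) \<le> 0" using 1 eta by (simp add: mult_nonpos_nonneg)
    ultimately show ?thesis unfolding e' by linarith
  next
    case 2
    have "of_int u * cf_eta \<alpha> n \<le> (-1) * cf_eta \<alpha> n" by (rule mult_right_mono) (use 2 eta in auto)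
    moreover have "of_int w * cf_eta \<alpha> (Suc n) \<ge> 0" using 2 eta by simp
    ultimately show ?thesis unfolding e' by linarith
  next
    case 3
    have "1 * ?q' \<le> w * ?q'" by (rule mult_right_mono) (use 3 qpos in auto)
    moreover have "0 \<le> u * ?q" using 3 qpos by simp
    ultimately show ?thesis using ju jlt by linarith
  next
    case 4
    have "w * ?q' \<le> 0" "u * ?q \<le> 0" using 4 qpos by (auto simp: mult_nonpos_nonneg)
    then show ?thesis using ju jlt by linarith
  qed
qed

text \<open>The factor 2 gives strict room above the limsup, so eventually q_(n+1) < exp(2 b q_n).
  For large \<open>j\<close> one uses the \<open>n\<close> with q_n \<le> j < q_(n+1); the early
  denominators only shrink \<open>c\<close>.\<close>

lemma diophantine_of_beta_exp:
  assumes irr: "\<alpha> \<notin> \<rat>" and beta: "beta_exp \<alpha> = ereal b" and b: "0 < b"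
  obtains c where "0 < c" "c \<le> 1"
    "\<And>(j::nat) (p::int). 1 \<le> j \<Longrightarrow> c * exp (- (2 * b) * real j) \<le> \<bar>real j * \<alpha> - of_int p\<bar>"
proof -
  have "limsup (\<lambda>n. ereal (ln (real (cf_q \<alpha> (Suc n))) / real (cf_q \<alpha> n))) < ereal (2 * b)"
    using beta b by (simp add: beta_exp_def)
  then have "\<forall>\<^sub>F n in sequentially. ereal (ln (real (cf_q \<alpha> (Suc n))) / real (cf_q \<alpha> n)) < ereal (2 * b)"
    by (rule Limsup_lessD)
  then obtain n0 where n0: "\<And>n. n \<ge> n0 \<Longrightarrow> ln (real (cf_q \<alpha> (Suc n))) / real (cf_q \<alpha> n) < 2 * b"
    by (auto simp: eventually_sequentially)
  define c where "c = min (1/2) (cf_eta \<alpha> n0)"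
  have c: "0 < c" "c \<le> 1/2" "c \<le> cf_eta \<alpha> n0" using cf_eta_pos[OF irr] by (auto simp: c_def)
  show thesis
  proof (rule that[of c])
    fix j :: nat and p :: int assume j: "1 \<le> j"
    show "c * exp (- (2 * b) * real j) \<le> \<bar>real j * \<alpha> - of_int p\<bar>"
    proof (cases "j < cf_q \<alpha> (Suc n0)")
      case True
      have "c * exp (- (2 * b) * real j) \<le> cf_eta \<alpha> n0 * 1"
        by (intro mult_mono) (use c b in auto)
      then show ?thesis using cf_best_approx[OF irr j True, of p] by simp
    next
      case False
      define n where "n = (LEAST n. j < cf_q \<alpha> (Suc n))"
      have ex: "j < cf_q \<alpha> (Suc j)" using cf_q_ge[OF irr, of "Suc j"] by simp
      have jn: "j < cf_q \<alpha> (Suc n)" unfolding n_def by (rule LeastI[of _ j]) (rule ex)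
      have mono: "cf_q \<alpha> (Suc m) \<le> cf_q \<alpha> (Suc m')" if "m \<le> m'" for m m'
        using that by (induction m' rule: dec_induct) (auto intro: order_trans[OF _ cf_q_mono[OF irr]] simp del: cf_q.simps)
      have nn: "n0 < n"
      proof (rule ccontr)
        assume "\<not> n0 < n"
        then have "cf_q \<alpha> (Suc n) \<le> cf_q \<alpha> (Suc n0)" by (intro mono) simp
        then show False using False jn by linarith
      qed
      then obtain m where m: "n = Suc m" by (cases n) auto
      have "\<not> j < cf_q \<alpha> (Suc m)" using not_less_Least[of m "\<lambda>n. j < cf_q \<alpha> (Suc n)"] m n_def by auto
      then have qj: "cf_q \<alpha> n \<le> j" using m by simp
      have qn: "cf_q \<alpha> n \<ge> 1" "cf_q \<alpha> (Suc n) \<ge> 1" using cf_q_pos[OF irr] by auto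
      have "ln (real (cf_q \<alpha> (Suc n))) < 2 * b * real (cf_q \<alpha> n)"
        using n0[of n] nn qn by (simp add: field_simps del: cf_q.simps)
      also have "\<dots> \<le> 2 * b * real j" using qj b by simp
      finally have "real (cf_q \<alpha> (Suc n)) \<le> exp (2 * b * real j)"
        using qn by (simp add: ln_ge_iff[symmetric] ln_le_cancel_iff[symmetric, of _ "exp _"] del: cf_q.simps ln_le_cancel_iff)
      then have "1 / (2 * exp (2 * b * real j)) \<le> 1 / (2 * real (cf_q \<alpha> (Suc n)))"
        using qn by (intro divide_left_mono) (auto simp del: cf_q.simps)
      also have "\<dots> \<le> cf_eta \<alpha> n" by (rule cf_eta_lower[OF irr])
      also have "\<dots> \<le> \<bar>real j * \<alpha> - of_int p\<bar>" by (rule cf_best_approx[OF irr j jn])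
      finally have "exp (- (2 * b) * real j) / 2 \<le> \<bar>real j * \<alpha> - of_int p\<bar>"
        by (simp add: exp_minus field_simps)
      moreover have "c * exp (- (2 * b) * real j) \<le> (1/2) * exp (- (2 * b) * real j)"
        by (rule mult_right_mono) (use c in auto)
      ultimately show ?thesis by linarith
    qed
  qed (use c in auto)
qed

subsection \<open>Trigonometric products along rotations\<close>

definition ee :: "real \<Rightarrow> complex" where "ee t = cis (2 * pi * t)"

lemma norm_ee [simp]: "cmod (ee t) = 1" by (simp add: ee_def)

lemma ee_neq_0 [simp]: "ee t \<noteq> 0" by (simp add: ee_def)

lemma ee_0 [simp]: "ee 0 = 1" by (simp add: ee_def)

lemma ee_minus: "ee (- t) = cnj (ee t)" by (simp add: ee_def cis_cnj)

lemma two_cos_ee: "complex_of_real (2 * cos (2 * pi * t)) = ee t + ee (- t)"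
  by (simp add: complex_eq_iff ee_def)

text \<open>The distance from \<open>t\<close> to the nearest integer, the usual norm on the
  circle.\<close>

definition dz :: "real \<Rightarrow> real" where "dz t = \<bar>t - of_int (round t)\<bar>"

lemma dz_le: "dz t \<le> \<bar>t - of_int p\<bar>"
  unfolding dz_def by (metis abs_minus_commute round_diff_minimal)

lemma dz_nonneg [simp]: "0 \<le> dz t" by (simp add: dz_def)

lemma dz_diff: "dz (s - t) \<le> dz s + dz t"
proof -
  have "dz (s - t) \<le> \<bar>(s - t) - of_int (round s - round t)\<bar>" by (rule dz_le)
  also have "\<dots> \<le> dz s + dz t" unfolding dz_def by simp
  finally show ?thesis .
qed

lemma abs_sin_pi_add_int: "\<bar>sin (pi * (t + of_int m))\<bar> = \<bar>sin (pi * t)\<bar>"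
proof -
  have "sin (pi * of_int m) = 0" by (simp add: sin_zero_iff_int2 mult.commute)
  moreover have "\<bar>cos (pi * of_int m)\<bar> = 1"
    using \<open>sin (pi * of_int m) = 0\<close> sin_cos_squared_add[of "pi * of_int m"] by (simp add: power2_eq_1_iff)
  ultimately show ?thesis by (simp add: distrib_left sin_add abs_mult)
qed

text \<open>By concavity the minimum of the sine over [a, b] is at an endpoint, and the position of
  the midpoint relative to pi/2 decides at which one.\<close>

lemma sin_ge_of_between:
  assumes "0 \<le> a" "a \<le> t" "t \<le> b" "b \<le> pi"
  shows "a + b \<le> pi \<Longrightarrow> sin a \<le> sin t" "pi \<le> a + b \<Longrightarrow> sin b \<le> sin t"
proof -
  assume "a + b \<le> pi"
  then have "0 \<le> sin ((t - a) / 2)" "0 \<le> cos ((t + a) / 2)"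
    using assms by (auto intro!: sin_ge_zero cos_ge_zero)
  then have "0 \<le> 2 * sin ((t - a) / 2) * cos ((t + a) / 2)" by simp
  then show "sin a \<le> sin t" using sin_diff_sin[of t a] by linarith
next
  assume "pi \<le> a + b"
  then have "0 \<le> sin ((b - t) / 2)" "cos ((b + t) / 2) \<le> 0"
  proof -
    show "0 \<le> sin ((b - t) / 2)" using assms by (intro sin_ge_zero) auto
    have "b + t \<le> 2 * pi" "pi \<le> b + t" using assms \<open>pi \<le> a + b\<close> by linarith+
    then have "0 \<le> cos (pi - (b + t) / 2)" using pi_gt_zero by (intro cos_ge_zero) (auto simp: field_simps)
    then show "cos ((b + t) / 2) \<le> 0" by (simp add: cos_diff)
  qed
  then have "2 * sin ((b - t) / 2) * cos ((b + t) / 2) \<le> 0" by (simp add: mult_nonneg_nonpos)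
  then show "sin b \<le> sin t" using sin_diff_sin[of b t] by linarith
qed

text \<open>Up to pi/3 the derivative of the sine is at least 1/2, and from there to pi/2 the sine
  itself is at least 1/2.\<close>

lemma abs_sin_pi_ge_dz: "dz t \<le> 2 * \<bar>sin (pi * t)\<bar>"
proof -
  define s where "s = t - of_int (round t)"
  have s: "\<bar>s\<bar> \<le> 1/2" unfolding s_def using of_int_round_abs_le[of t] by (simp add: abs_minus_commute)
  have "\<bar>sin (pi * t)\<bar> = \<bar>sin (pi * s)\<bar>"
    using abs_sin_pi_add_int[of s "round t"] by (simp add: s_def)
  also have "\<dots> = sin (pi * \<bar>s\<bar>)"
  proof (cases "s \<ge> 0")
    case True then show ?thesis using s by (simp add: sin_ge_zero abs_of_nonneg mult_left_le order_trans[of _ "pi * (1/2)"])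
  next
    case False
    have "pi * (-s) \<le> pi * 1" using s False by (intro mult_left_mono) auto
    then have "0 \<le> sin (pi * (-s))" using s False by (intro sin_ge_zero) (auto intro: mult_nonneg_nonpos)
    then show ?thesis using False by simp
  qed
  also have "\<dots> \<ge> \<bar>s\<bar> / 2"
  proof (cases "pi * \<bar>s\<bar> \<le> pi/3")
    case True
    have "sin 0 - 0 / 2 \<le> sin (pi * \<bar>s\<bar>) - pi * \<bar>s\<bar> / 2"
    proof (rule DERIV_nonneg_imp_nondecreasing[of 0 "pi * \<bar>s\<bar>" "\<lambda>x. sin x - x / 2"])
      fix x assume x: "0 \<le> x" "x \<le> pi * \<bar>s\<bar>"
      have "x \<le> pi / 3" using x True by linarith
      then have "cos (pi/3) \<le> cos x" using x by (intro cos_monotone_0_pi_le) auto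
      then have "cos x - 1/2 \<ge> 0" by (simp add: cos_60)
      moreover have "((\<lambda>x. sin x - x / 2) has_real_derivative (cos x - 1/2)) (at x)"
        by (auto intro!: derivative_eq_intros)
      ultimately show "\<exists>y. ((\<lambda>x. sin x - x / 2) has_real_derivative y) (at x) \<and> 0 \<le> y" by blast
    qed auto
    moreover have "1 * \<bar>s\<bar> \<le> pi * \<bar>s\<bar>" by (rule mult_right_mono) (use pi_gt3 in auto)
    ultimately show ?thesis by simp
  next
    case False
    then have "sin (pi/6) \<le> sin (pi * \<bar>s\<bar>)"
      by (intro sin_monotone_2pi_le) (use s pi_gt3 in auto)
    then show ?thesis using s by (simp add: sin_30)
  qed
  finally show ?thesis unfolding dz_def s_def by simp
qed

lemma cmod_ee_diff: "cmod (ee s - ee t) = 2 * \<bar>sin (pi * (s - t))\<bar>"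
proof -
  have "(cmod (ee s - ee t))\<^sup>2 = (cos (2*pi * s) - cos (2*pi * t))\<^sup>2 + (sin (2*pi * s) - sin (2*pi * t))\<^sup>2"
    by (simp add: cmod_power2 ee_def)
  also have "\<dots> = 2 - 2 * cos (2*pi * s - 2*pi * t)"
    unfolding cos_diff using sin_cos_squared_add[of "2*pi * s"] sin_cos_squared_add[of "2*pi * t"] by (simp add: power2_eq_square algebra_simps)
  also have "2*pi * s - 2*pi * t = 2 * (pi * (s - t))" by (simp add: algebra_simps)
  also have "2 - 2 * cos (2 * (pi * (s - t))) = (2 * \<bar>sin (pi * (s - t))\<bar>)\<^sup>2"
    by (simp add: cos_double_sin power_mult_distrib)
  finally show ?thesis by (rule power2_eq_imp_eq) auto
qed

lemma ee_int [simp]: "ee (of_int m) = 1"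
  by (simp add: complex_eq_iff ee_def)

lemma ee_add: "ee (s + t) = ee s * ee t"
  by (simp add: ee_def cis_mult distrib_left)

lemma ee_diff: "ee (s - t) = ee s * cnj (ee t)"
  using ee_add[of s "- t"] by (simp add: ee_minus)

lemma cnj_ee_mult [simp]: "cnj (ee t) * ee t = 1" "ee t * cnj (ee t) = 1"
  by (simp_all flip: ee_minus ee_add)

lemma ee_power: "ee t ^ n = ee (real n * t)"
  using Complex.DeMoivre[of "2 * pi * t" n] by (simp add: mult_ac ee_def)

lemma ee_eq_1_imp_int: "ee t = 1 \<Longrightarrow> t \<in> \<int>"
proof -
  assume "ee t = 1"
  then have "cos (2 * pi * t) = 1" by (simp add: complex_eq_iff ee_def)
  then obtain n :: int where "2 * pi * t = of_int n * 2 * pi" by (auto simp: cos_one_2pi_int)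
  then show ?thesis by auto
qed

section \<open>Products over roots of unity and over orbit segments\<close>

text \<open>Both sides are monic of degree \<open>q\<close> and vanish at the \<open>q\<close>
  rotated copies of \<open>z\<close>, so their difference has more zeros than its degree allows. For
  \<open>z = 0\<close> these points coincide, hence the separate case.\<close>

lemma prod_roots_of_unity_poly:
  assumes "q > 0"
  shows "(\<Prod>r<q. [:- (z * ee (real r / real q)), 1:]) = monom 1 q - [:z ^ q:]"
proof (cases "z = 0")
  case True
  then show ?thesis using assms by (simp add: monom_altdef power_0_left)
next
  case False
  let ?P = "\<Prod>r<q. [:- (z * ee (real r / real q)), 1:]" and ?M = "monom 1 q - [:z ^ q:]"
  have degP: "degree ?P = q" by (subst degree_prod_eq_sum_degree) auto
  have leadP: "coeff ?P q = 1"
  proof -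
    have "lead_coeff ?P = 1" by (simp add: lead_coeff_prod)
    then show ?thesis using degP by simp
  qed
  have cM: "coeff ?M q = 1" using assms by (cases q) (auto simp: coeff_pCons)
  have degM: "degree ?M \<le> q" by (rule degree_diff_le) (auto simp: degree_monom_le)
  define D where "D = ?P - ?M"
  have "degree D \<le> q" unfolding D_def by (rule degree_diff_le) (use degP degM in auto)
  moreover have "coeff D q = 0" unfolding D_def using leadP cM by simp
  ultimately have dD: "D = 0 \<or> degree D < q" using leading_coeff_0_iff[of D] by (cases "degree D = q") auto
  have inj: "inj_on (\<lambda>r. z * ee (real r / real q)) {..<q}"
  proof (rule inj_onI)
    fix r s assume rs: "r \<in> {..<q}" "s \<in> {..<q}" "z * ee (real r / real q) = z * ee (real s / real q)"
    then have "cmod (ee (real r / real q) - ee (real s / real q)) = 0" using False by simp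
    then have "ee (real r / real q - real s / real q) = 1"
      using ee_add[of "real r / real q - real s / real q" "real s / real q"] rs False
      by (simp del: times_divide_eq_right)
    then have "(real r - real s) / real q \<in> \<int>" using ee_eq_1_imp_int by (simp add: diff_divide_distrib)
    then obtain k :: int where "(real r - real s) / real q = of_int k" by (auto elim: Ints_cases)
    then have "real r - real s = of_int k * real q" using assms by (simp add: field_simps)
    then have e: "int r - int s = k * int q" by (subst of_int_eq_iff[where 'a=real, symmetric]) simp
    then have "\<bar>k * int q\<bar> < int q" using rs by auto
    then have "k = 0" using assms by (simp add: abs_mult)
    then show "r = s" using e by simp
  qed
  have root: "poly D (z * ee (real r / real q)) = 0" if "r < q" for r
  proof -
    have "poly ?P (z * ee (real r / real q)) = 0"
      unfolding poly_prod using that by (intro prod_zero) auto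
    moreover have "(z * ee (real r / real q)) ^ q = z ^ q"
      unfolding power_mult_distrib ee_power using assms ee_int[of "int r"] by simp
    ultimately show ?thesis by (simp add: D_def poly_monom)
  qed
  have "D = 0"
  proof (rule ccontr)
    assume "D \<noteq> 0"
    then have "card {x. poly D x = 0} \<le> degree D" by (simp add: card_poly_roots_bound)
    moreover have "card ((\<lambda>r. z * ee (real r / real q)) ` {..<q}) \<le> card {x. poly D x = 0}"
      by (rule card_mono) (use root \<open>D \<noteq> 0\<close> poly_roots_finite in auto)
    ultimately show False using dD \<open>D \<noteq> 0\<close> inj by (simp add: card_image)
  qed
  then show ?thesis by (simp add: D_def)
qed

lemma prod_roots_of_unity:
  assumes "q > 0"
  shows "(\<Prod>r<q. (w - z * ee (real r / real q))) = w ^ q - z ^ q"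
  using arg_cong[OF prod_roots_of_unity_poly[OF assms, of z], of "\<lambda>p. poly p w"]
  by (simp add: poly_prod poly_monom)

text \<open>Cancelling X - 1 from X^q - 1 and evaluating at 1 gives the product of the chords from 1
  to the other roots of unity, and their lengths are these sines.\<close>

lemma prod_two_sin:
  assumes "q > 0"
  shows "(\<Prod>t\<in>{1..<q}. 2 * sin (pi * real t / real q)) = real q"
proof -
  let ?L = "\<Prod>r\<in>{1..<q}. [:- ee (real r / real q), 1:]" and ?S = "\<Sum>i<q. monom (1::complex) i"
  have split: "{..<q} = insert 0 {1..<q}" using assms by auto
  have "[:-1, 1:] * ?L = (\<Prod>r<q. [:- (1 * ee (real r / real q)), 1:])"
    unfolding split by (subst prod.insert) auto
  also have "\<dots> = monom 1 q - [:1 ^ q:]" by (rule prod_roots_of_unity_poly[OF assms])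
  also have "\<dots> = [:-1, 1:] * ?S"
  proof (rule poly_ext)
    fix x :: complex
    show "poly (monom 1 q - [:1 ^ q:]) x = poly ([:-1, 1:] * ?S) x"
      using power_diff_1_eq[of x q] by (simp add: poly_monom poly_sum left_diff_distrib)
  qed
  finally have "[:-1, 1:] * ?L = [:-1, 1:] * ?S" .
  then have "?L = ?S" by (subst (asm) mult_cancel_left) simp
  then have "poly ?L 1 = poly ?S 1" by simp
  then have "(\<Prod>r\<in>{1..<q}. 1 - ee (real r / real q)) = of_nat q" by (simp add: poly_prod poly_sum poly_monom)
  then have "cmod (\<Prod>r\<in>{1..<q}. 1 - ee (real r / real q)) = real q" by simp
  moreover have "cmod (1 - ee (real r / real q)) = 2 * sin (pi * real r / real q)" if "r \<in> {1..<q}" for r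
  proof -
    have "0 \<le> sin (pi * real r / real q)" using that by (intro sin_ge_zero) (auto simp: field_simps)
    then show ?thesis using cmod_ee_diff[of 0 "real r / real q"] by simp
  qed
  ultimately show ?thesis by (simp add: prod_norm[symmetric])
qed

lemma bij_mult_mod:
  fixes p l :: int and q :: nat
  assumes "q > 0" "coprime p (int q)"
  shows "bij_betw (\<lambda>i. nat ((l + int i * p) mod int q)) {..<q} {..<q}"
proof -
  let ?r = "\<lambda>i. nat ((l + int i * p) mod int q)"
  have inj: "inj_on ?r {..<q}"
  proof (rule inj_onI)
    fix i j assume ij: "i \<in> {..<q}" "j \<in> {..<q}" "?r i = ?r j"
    have "(l + int i * p) mod int q = (l + int j * p) mod int q"
      using ij(3) assms(1) by (simp add: eq_nat_nat_iff)
    then have "int q dvd (int i - int j) * p" by (simp add: mod_eq_dvd_iff algebra_simps)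
    then have "int q dvd int i - int j" using assms(2) by (simp add: coprime_commute coprime_dvd_mult_left_iff)
    moreover have "\<bar>int i - int j\<bar> < int q" using ij by auto
    ultimately have "int i - int j = 0" using dvd_imp_le_int[of "int i - int j" "int q"] by linarith
    then show "i = j" by simp
  qed
  moreover have "?r ` {..<q} \<subseteq> {..<q}"
  proof clarsimp
    fix i show "nat ((l + int i * p) mod int q) < q"
      using pos_mod_bound[of "int q" "l + int i * p"] assms(1) by linarith
  qed
  ultimately have "?r ` {..<q} = {..<q}" by (simp add: endo_inj_surj)
  then show ?thesis using inj by (simp add: bij_betw_def)
qed

text \<open>In one block each point y + i omega lies, modulo 1, between (r - 1)/q and (r + 2)/q,
  where r runs through all residues once. Without the four residues next to 0, each factor dominates
  the sine at a grid point of its own, so the product can be compared with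
  \<open>prod_two_sin\<close>.\<close>

lemma block_lower:
  fixes p :: int and q :: nat and y \<omega> :: real
  assumes q: "q > 0" and cop: "coprime p (int q)" and app: "\<bar>\<omega> - of_int p / real q\<bar> \<le> 1 / (real q * real q)"
  obtains X where "X \<subseteq> {..<q}" "card X \<le> 4"
    "1/8 \<le> (\<Prod>i\<in>{..<q} - X. 2 * \<bar>sin (pi * (y + real i * \<omega>))\<bar>)"
proof (cases "q < 5")
  case True
  \<comment> \<open>With fewer than five indices all of them may be discarded; the empty product is
    1.\<close>
  then show thesis by (intro that[of "{..<q}"]) auto
next
  case False
  define l where "l = \<lfloor>y * real q\<rfloor>"
  define f where "f = y * real q - of_int l"
  have f: "0 \<le> f" "f < 1" unfolding f_def l_def by linarith+
  define \<rho> where "\<rho> i = nat ((l + int i * p) mod int q)" for i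
  have bij: "bij_betw \<rho> {..<q} {..<q}" unfolding \<rho>_def by (rule bij_mult_mod[OF q cop])
  define X where "X = {i\<in>{..<q}. \<rho> i \<in> {0, 1, q-2, q-1}}"
  \<comment> \<open>The endpoint of that interval nearer to an integer, where the sine is smallest;
    the jump between the two cases keeps the map injective.\<close>
  define \<tau> where "\<tau> r = (if 2 * r + 1 \<le> q then r - 1 else r + 2)" for r :: nat
  have cX: "card X \<le> 4"
  proof -
    have "card X \<le> card {0, 1, q-2, q-1}"
      by (rule card_inj_on_le[of \<rho>]) (use bij in \<open>auto simp: X_def bij_betw_def intro: inj_on_subset\<close>)
    also have "\<dots> \<le> 4" by (simp add: card_insert_if)
    finally show ?thesis .
  qed
  have rng: "2 \<le> \<rho> i \<and> \<rho> i + 3 \<le> q" if "i \<in> {..<q} - X" for i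
  proof -
    have "\<rho> i < q" using bij that by (auto simp: bij_betw_def)
    then show ?thesis using that False by (auto simp: X_def)
  qed
  have pt: "2 * sin (pi * real (\<tau> (\<rho> i)) / real q) \<le> 2 * \<bar>sin (pi * (y + real i * \<omega>))\<bar>"
    if i: "i \<in> {..<q} - X" for i
  proof -
    define r where "r = \<rho> i"
    have r: "2 \<le> r" "r + 3 \<le> q" using rng[OF i] by (auto simp: r_def)
    define k where "k = (l + int i * p) div int q"
    define e where "e = real i * (\<omega> - of_int p / real q)"
    have rr: "int r = (l + int i * p) mod int q" unfolding r_def \<rho>_def using q by simp
    have "l + int i * p = int q * k + int r" unfolding k_def rr by simp
    from arg_cong[OF this, of real_of_int]
    have lk: "of_int l + real i * of_int p = real q * of_int k + real r" by simp
    have y: "y = (f + of_int l) / real q" using q by (simp add: f_def)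
    have "y + real i * \<omega> = (f + of_int l) / real q + real i * of_int p / real q + e"
      unfolding e_def by (subst y) (simp add: algebra_simps)
    also have "\<dots> = (f + (of_int l + real i * of_int p)) / real q + e" by (simp add: add_divide_distrib)
    also have "\<dots> = ((f + real r) / real q + e) + of_int k" unfolding lk using q by (simp add: add_divide_distrib)
    finally have ye: "y + real i * \<omega> = ((f + real r) / real q + e) + of_int k" .
    have "\<bar>e\<bar> \<le> real q * (1 / (real q * real q))" unfolding e_def abs_mult
      by (rule mult_mono) (use app i in auto)
    then have e: "\<bar>e\<bar> \<le> 1 / real q" using q by simp
    define a t b where "a = pi * (real r - 1) / real q" and "t = pi * ((f + real r) / real q + e)" and "b = pi * (real r + 2) / real q"
    have at: "a \<le> t"
    proof -
      have "(real r - 1) / real q \<le> (f + real r) / real q - 1 / real q"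
        using f q by (simp add: diff_divide_distrib add_divide_distrib)
      also have "\<dots> \<le> (f + real r) / real q + e" using e by linarith
      finally show ?thesis unfolding a_def t_def using mult_left_mono[of _ _ pi] by fastforce
    qed
    have tb: "t \<le> b"
    proof -
      have "(f + real r) / real q + e \<le> (f + real r) / real q + 1 / real q" using e by linarith
      also have "\<dots> \<le> (real r + 2) / real q"
        using f q by (simp add: add_divide_distrib[symmetric] divide_right_mono)
      finally show ?thesis unfolding b_def t_def using mult_left_mono[of _ _ pi] by fastforce
    qed
    have a0: "0 \<le> a" unfolding a_def using r by simp
    have bpi: "b \<le> pi"
    proof -
      have "real r + 2 \<le> real q" using r by linarith
      then have "pi * (real r + 2) \<le> pi * real q" by (intro mult_left_mono) auto
      then show ?thesis unfolding b_def using q by (simp add: divide_le_eq)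
    qed
    have ab: "a + b = pi * (real (2 * r + 1) / real q)" unfolding a_def b_def by (simp add: add_divide_distrib[symmetric] algebra_simps)
    have "sin (pi * real (\<tau> r) / real q) \<le> sin t"
    proof (cases "2 * r + 1 \<le> q")
      case True
      have "real (2 * r + 1) / real q \<le> 1" using True q by (simp only: divide_le_eq_1_pos of_nat_0_less_iff of_nat_le_iff)
      then have "a + b \<le> pi" unfolding ab using mult_left_mono[of "real (2 * r + 1) / real q" 1 pi] by simp
      then show ?thesis using sin_ge_of_between(1)[OF a0 at tb bpi] True r
        by (simp add: \<tau>_def a_def of_nat_diff)
    next
      case False
      have "1 \<le> real (2 * r + 1) / real q" using False q by (simp only: le_divide_eq_1_pos of_nat_0_less_iff of_nat_le_iff)
      then have "pi \<le> a + b" unfolding ab using mult_left_mono[of 1 "real (2 * r + 1) / real q" pi] by simp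
      then show ?thesis using sin_ge_of_between(2)[OF a0 at tb bpi] False
        by (simp add: \<tau>_def b_def add.commute)
    qed
    also have "sin t \<le> \<bar>sin (pi * (y + real i * \<omega>))\<bar>"
      unfolding ye abs_sin_pi_add_int t_def by simp
    finally show ?thesis by (simp add: r_def)
  qed
  define I where "I = (\<lambda>i. \<tau> (\<rho> i)) ` ({..<q} - X)"
  have injI: "inj_on (\<lambda>i. \<tau> (\<rho> i)) ({..<q} - X)"
  proof (rule inj_onI)
    fix i j assume ij: "i \<in> {..<q} - X" "j \<in> {..<q} - X" "\<tau> (\<rho> i) = \<tau> (\<rho> j)"
    have "\<rho> i = \<rho> j" using ij(3) rng[OF ij(1)] rng[OF ij(2)] unfolding \<tau>_def by (auto split: if_splits)
    then show "i = j" using bij ij by (auto simp: bij_betw_def inj_on_def)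
  qed
  have Isub: "I \<subseteq> {1..<q}"
  proof
    fix t assume "t \<in> I"
    then obtain i where i: "i \<in> {..<q} - X" "t = \<tau> (\<rho> i)" by (auto simp: I_def)
    show "t \<in> {1..<q}" using rng[OF i(1)] i(2) unfolding \<tau>_def by (auto split: if_splits)
  qed
  have cI: "card I = q - card X" unfolding I_def card_image[OF injI]
    by (subst card_Diff_subset) (auto simp: X_def)
  let ?s = "\<lambda>t. 2 * sin (pi * real t / real q)"
  have pos: "0 \<le> ?s t" if "t \<in> {1..<q}" for t
    using that by (auto intro!: sin_ge_zero simp: field_simps)
  have "real q = (\<Prod>t\<in>{1..<q}. ?s t)" using prod_two_sin[OF q] by simp
  also have "\<dots> = (\<Prod>t\<in>I. ?s t) * (\<Prod>t\<in>{1..<q} - I. ?s t)"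
    by (subst prod.subset_diff[OF Isub]) (auto simp: mult.commute)
  also have "\<dots> \<le> (\<Prod>t\<in>I. ?s t) * (\<Prod>t\<in>{1..<q} - I. 2)"
    by (intro mult_left_mono prod_mono prod_nonneg) (use pos Isub in auto)
  also have "(\<Prod>t\<in>{1..<q} - I. 2::real) = 2 ^ card ({1..<q} - I)" by simp
  also have "card ({1..<q} - I) = (q - 1) - card I"
    using Isub by (subst card_Diff_subset) (auto intro: finite_subset)
  \<comment> \<open>\<open>I\<close> has \<open>q - card X\<close> of the \<open>q - 1\<close> grid
    points, so at most three factors, each at most 2, are missing; this is the origin of
    1/8.\<close>
  also have "(\<Prod>t\<in>I. ?s t) * 2 ^ ((q - 1) - card I) \<le> (\<Prod>t\<in>I. ?s t) * 2 ^ 3"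
    by (intro mult_left_mono power_increasing prod_nonneg) (use pos Isub cI cX in auto)
  finally have "1/8 \<le> (\<Prod>t\<in>I. ?s t)" using q by (simp add: Suc_le_eq)
  also have "(\<Prod>t\<in>I. ?s t) = (\<Prod>i\<in>{..<q} - X. ?s (\<tau> (\<rho> i)))"
    unfolding I_def by (subst prod.reindex[OF injI]) simp
  also have "\<dots> \<le> (\<Prod>i\<in>{..<q} - X. 2 * \<bar>sin (pi * (y + real i * \<omega>))\<bar>)"
    by (intro prod_mono conjI pt pos subsetD[OF Isub]) (auto simp: I_def)
  finally show thesis by (intro that[of X] cX) (auto simp: X_def)
qed

lemma run_lower_aux:
  fixes p J0 :: int and q s :: nat and y \<omega> :: real
  assumes q: "q > 0" and cop: "coprime p (int q)" and app: "\<bar>\<omega> - of_int p / real q\<bar> \<le> 1 / (real q * real q)"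
  shows "\<exists>X. X \<subseteq> {J0..<J0 + int (s * q)} \<and> card X \<le> 4 * s \<and>
     (1/8) ^ s \<le> (\<Prod>j\<in>{J0..<J0 + int (s * q)} - X. 2 * \<bar>sin (pi * (y + of_int j * \<omega>))\<bar>)"
proof (induction s)
  case 0 then show ?case by (intro exI[of _ "{}"]) auto
next
  case (Suc s)
  let ?f = "\<lambda>j::int. 2 * \<bar>sin (pi * (y + of_int j * \<omega>))\<bar>"
  let ?J1 = "J0 + int (s * q)"
  obtain X where X: "X \<subseteq> {J0..<?J1}" "card X \<le> 4 * s" "(1/8) ^ s \<le> (\<Prod>j\<in>{J0..<?J1} - X. ?f j)"
    using Suc by auto
  obtain Y where Y: "Y \<subseteq> {..<q}" "card Y \<le> 4"
    "1/8 \<le> (\<Prod>i\<in>{..<q} - Y. 2 * \<bar>sin (pi * ((y + of_int ?J1 * \<omega>) + real i * \<omega>))\<bar>)"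
    by (rule block_lower[OF q cop app])
  define g where "g i = ?J1 + int i" for i
  have injg: "inj_on g A" for A by (auto simp: g_def inj_on_def)
  have img: "g ` {..<q} = {?J1..<?J1 + int q}"
  proof -
    have "j \<in> g ` {..<q}" if "j \<in> {?J1..<?J1 + int q}" for j
      using that by (intro image_eqI[of _ _ "nat (j - ?J1)"]) (auto simp: g_def)
    then show ?thesis by (auto simp: g_def)
  qed
  have Y2: "1/8 \<le> (\<Prod>j\<in>{?J1..<?J1 + int q} - g ` Y. ?f j)"
  proof -
    have "{?J1..<?J1 + int q} - g ` Y = g ` ({..<q} - Y)"
      unfolding img[symmetric] by (rule inj_on_image_set_diff[symmetric, OF injg[of UNIV]]) auto
    then have "(\<Prod>j\<in>{?J1..<?J1 + int q} - g ` Y. ?f j) = (\<Prod>i\<in>{..<q} - Y. ?f (g i))"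
      by (simp add: prod.reindex[OF injg])
    also have "\<dots> = (\<Prod>i\<in>{..<q} - Y. 2 * \<bar>sin (pi * ((y + of_int ?J1 * \<omega>) + real i * \<omega>))\<bar>)"
      by (simp add: g_def algebra_simps)
    finally show ?thesis using Y(3) by simp
  qed
  have un: "{J0..<J0 + int (Suc s * q)} - (X \<union> g ` Y) = ({J0..<?J1} - X) \<union> ({?J1..<?J1 + int q} - g ` Y)"
  proof -
    have gY: "g ` Y \<subseteq> {?J1..<?J1 + int q}" unfolding img[symmetric] using Y(1) by blast
    have e: "J0 + int (Suc s * q) = ?J1 + int q" by simp
    have "J0 \<le> ?J1" by simp
    then have R: "{J0..<?J1 + int q} = {J0..<?J1} \<union> {?J1..<?J1 + int q}" "{J0..<?J1} \<inter> {?J1..<?J1 + int q} = {}"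
      using ivl_disj_un_two(3)[of J0 ?J1 "?J1 + int q"] by auto
    show ?thesis unfolding e R(1) using gY X(1) R(2) by blast
  qed
  have "(1/8) ^ Suc s \<le> (\<Prod>j\<in>{J0..<?J1} - X. ?f j) * (\<Prod>j\<in>{?J1..<?J1 + int q} - g ` Y. ?f j)"
    unfolding power_Suc2 by (intro mult_mono X Y2) (auto intro: prod_nonneg)
  also have "\<dots> = (\<Prod>j\<in>{J0..<J0 + int (Suc s * q)} - (X \<union> g ` Y). ?f j)"
    unfolding un by (intro prod.union_disjoint[symmetric]) auto
  finally have 1: "(1/8) ^ Suc s \<le> (\<Prod>j\<in>{J0..<J0 + int (Suc s * q)} - (X \<union> g ` Y). ?f j)" .
  have 2: "card (X \<union> g ` Y) \<le> 4 * Suc s"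
    using card_Un_le[of X "g ` Y"] card_image_le[of Y g] X(2) Y finite_subset[OF Y(1)] by simp
  have "g ` Y \<subseteq> {?J1..<?J1 + int q}" using img Y(1) by blast
  moreover have "{?J1..<?J1 + int q} \<subseteq> {J0..<J0 + int (Suc s * q)}" "{J0..<?J1} \<subseteq> {J0..<J0 + int (Suc s * q)}"
  proof -
    have a: "J0 \<le> ?J1" "0 \<le> int q" and e: "J0 + int (Suc s * q) = ?J1 + int q" by simp_all
    show "{?J1..<?J1 + int q} \<subseteq> {J0..<J0 + int (Suc s * q)}"
      unfolding e ivl_subset by simp
    show "{J0..<?J1} \<subseteq> {J0..<J0 + int (Suc s * q)}"
      unfolding e ivl_subset by simp
  qed
  ultimately have 3: "X \<union> g ` Y \<subseteq> {J0..<J0 + int (Suc s * q)}" using X(1) by blast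
  show ?case using 1 2 3 by blast
qed

text \<open>The at most \<open>4 * s\<close> indices left out by the blocks still need a lower
  bound. By \<open>sep\<close>, of any \<open>N div 4\<close> consecutive indices at most one has a
  factor below \<open>t0\<close>, so in the whole run at most six do. Only these pay the weak bound
  \<open>\<mu>\<close>, the other omitted indices pay \<open>t0\<close>. The set \<open>H\<close>
  allows one index to be skipped, namely the node from which the distances are measured.\<close>

lemma run_lower:
  fixes p J0 :: int and q s N :: nat and y \<omega> t0 \<mu> :: real
  assumes q: "q > 0" and cop: "coprime p (int q)" and app: "\<bar>real q * \<omega> - of_int p\<bar> \<le> 1 / real N"
    and s: "1 \<le> s" "s * q \<le> N" and N: "16 \<le> N"
    and sep: "\<And>d::int. d \<noteq> 0 \<Longrightarrow> 4 * \<bar>d\<bar> \<le> int N \<Longrightarrow> 2 * t0 \<le> dz (of_int d * \<omega>)"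
    and t0: "0 < t0" "t0 \<le> 1" and \<mu>: "0 < \<mu>" "\<mu> \<le> 1" and H: "finite H" "card H \<le> 1"
    and low: "\<And>j. j \<in> {J0..<J0 + int (s * q)} - H \<Longrightarrow> \<mu> \<le> 2 * \<bar>sin (pi * (y + of_int j * \<omega>))\<bar>"
  shows "(1/16) ^ s * t0 ^ (4 * s) * \<mu> ^ 6 \<le> (\<Prod>j\<in>{J0..<J0 + int (s * q)} - H. 2 * \<bar>sin (pi * (y + of_int j * \<omega>))\<bar>)"
proof -
  let ?f = "\<lambda>j::int. 2 * \<bar>sin (pi * (y + of_int j * \<omega>))\<bar>"
  let ?R = "{J0..<J0 + int (s * q)}"
  have qN: "q \<le> N" using s by (metis mult_1 mult_le_mono1 order_trans)
  have app': "\<bar>\<omega> - of_int p / real q\<bar> \<le> 1 / (real q * real q)"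
  proof -
    have "\<bar>\<omega> - of_int p / real q\<bar> = \<bar>real q * \<omega> - of_int p\<bar> / real q"
    proof -
      have "\<omega> - of_int p / real q = (real q * \<omega> - of_int p) / real q" using q by (simp add: field_simps)
      then show ?thesis by (simp add: abs_divide)
    qed
    also have "\<dots> \<le> (1 / real q) / real q"
      using app qN q by (intro divide_right_mono) (auto intro: order_trans[OF app] simp: frac_le)
    finally show ?thesis by simp
  qed
  obtain X where X: "X \<subseteq> ?R" "card X \<le> 4 * s" "(1/8) ^ s \<le> (\<Prod>j\<in>?R - X. ?f j)"
    using run_lower_aux[OF q cop app'] by blast
  have finX: "finite X" using X(1) finite_subset by blast
  \<comment> \<open>Removing the one index of \<open>H\<close> costs a factor at most 2, and since
    \<open>s\<close> is positive the passage from 1/8 to 1/16 per block pays for it.\<close>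
  have A: "(1/16) ^ s \<le> (\<Prod>j\<in>?R - X - H. ?f j)"
  proof (cases "H \<inter> (?R - X) = {}")
    case True
    then have "?R - X - H = ?R - X" by auto
    moreover have "(1/16::real) ^ s \<le> (1/8) ^ s" by (rule power_mono) auto
    ultimately show ?thesis using X(3) by simp
  next
    case False
    then obtain a where a: "a \<in> H" "a \<in> ?R - X" by blast
    have Ha: "H = {a}" using H a using card_le_Suc0_iff_eq[OF H(1)] by auto
    have "(1/8) ^ s \<le> ?f a * (\<Prod>j\<in>?R - X - H. ?f j)"
      using X(3) prod.remove[of "?R - X" a ?f] a Ha by simp
    also have "\<dots> \<le> 2 * (\<Prod>j\<in>?R - X - H. ?f j)"
      by (intro mult_right_mono prod_nonneg) auto
    finally have "(1/8) ^ s / 2 \<le> (\<Prod>j\<in>?R - X - H. ?f j)" by simp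
    moreover have "(1/16::real) ^ s \<le> (1/8) ^ s / 2"
    proof -
      have "(1/16::real) ^ s = (1/8) ^ s * (1/2) ^ s" by (simp flip: power_mult_distrib)
      also have "\<dots> \<le> (1/8) ^ s * (1/2) ^ 1" by (intro mult_left_mono power_decreasing) (use s in auto)
      finally show ?thesis by simp
    qed
    ultimately show ?thesis by linarith
  qed
  define V where "V = {j\<in>?R. ?f j < t0}"
  define L where "L = int (N div 4)"
  have L: "L > 0" "4 * L \<le> int N" "int N \<le> 6 * L" using N unfolding L_def by auto
  have cV: "card V \<le> 6"
  proof -
    have "inj_on (\<lambda>j. (j - J0) div L) V"
    proof (rule inj_onI)
      fix i j assume ij: "i \<in> V" "j \<in> V" "(i - J0) div L = (j - J0) div L"
      have "\<bar>i - j\<bar> < L"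
      proof -
        have "i - J0 = L * ((i - J0) div L) + (i - J0) mod L" "j - J0 = L * ((j - J0) div L) + (j - J0) mod L" by simp_all
        then have "i - j = (i - J0) mod L - (j - J0) mod L" unfolding ij(3) by linarith
        then show ?thesis using pos_mod_bound[OF L(1), of "i - J0"] pos_mod_bound[OF L(1), of "j - J0"]
           pos_mod_sign[OF L(1), of "i - J0"] pos_mod_sign[OF L(1), of "j - J0"] by linarith
      qed
      show "i = j"
      proof (rule ccontr)
        assume "i \<noteq> j"
        then have "2 * t0 \<le> dz (of_int (i - j) * \<omega>)" using \<open>\<bar>i - j\<bar> < L\<close> L by (intro sep) auto
        also have "of_int (i - j) * \<omega> = (y + of_int i * \<omega>) - (y + of_int j * \<omega>)" by (simp add: algebra_simps)
        also have "dz \<dots> \<le> dz (y + of_int i * \<omega>) + dz (y + of_int j * \<omega>)" by (rule dz_diff)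
        also have "\<dots> \<le> ?f i + ?f j" by (intro add_mono abs_sin_pi_ge_dz)
        also have "\<dots> < 2 * t0" using ij by (simp add: V_def)
        finally show False by simp
      qed
    qed
    moreover have "(\<lambda>j. (j - J0) div L) ` V \<subseteq> {0..<6}"
    proof clarsimp
      fix j assume "j \<in> V"
      then have j: "0 \<le> j - J0" "j - J0 < 6 * L"
        using L(3) s(2) unfolding V_def by (auto simp del: of_nat_mult)
      have "(j - J0) div L < 6"
      proof (rule ccontr)
        assume "\<not> ?thesis"
        then have "6 * L \<le> ((j - J0) div L) * L" using L(1) by (intro mult_right_mono) auto
        moreover have "j - J0 = ((j - J0) div L) * L + (j - J0) mod L" by simp
        ultimately show False using j pos_mod_sign[OF L(1), of "j - J0"] by linarith
      qed
      then show "0 \<le> (j - J0) div L \<and> (j - J0) div L < 6"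
        using L(1) j by (simp add: pos_imp_zdiv_nonneg_iff)
    qed
    ultimately have "card V \<le> card {0..<6::int}" by (intro card_inj_on_le) auto
    then show ?thesis by simp
  qed
  have finV: "finite V" by (rule finite_subset[of _ ?R]) (auto simp: V_def)
  have B: "t0 ^ (4 * s) * \<mu> ^ 6 \<le> (\<Prod>j\<in>X - H. ?f j)"
  proof -
    have "t0 ^ (4 * s) * \<mu> ^ 6 \<le> t0 ^ card (X - H - V) * \<mu> ^ card ((X - H) \<inter> V)"
    proof (intro mult_mono power_decreasing)
      show "card (X - H - V) \<le> 4 * s" by (rule order_trans[OF card_mono[OF finX] X(2)]) auto
      show "card ((X - H) \<inter> V) \<le> 6" by (rule order_trans[OF card_mono[OF finV] cV]) auto
    qed (use t0 \<mu> in auto)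
    also have "\<dots> = (\<Prod>j\<in>X - H - V. t0) * (\<Prod>j\<in>(X - H) \<inter> V. \<mu>)" by simp
    also have "\<dots> \<le> (\<Prod>j\<in>X - H - V. ?f j) * (\<Prod>j\<in>(X - H) \<inter> V. ?f j)"
    proof (intro mult_mono prod_mono prod_nonneg conjI)
      fix j assume "j \<in> X - H - V" then show "t0 \<le> ?f j" using X(1) by (auto simp: V_def)
    next
      fix j assume "j \<in> (X - H) \<inter> V" then show "\<mu> \<le> ?f j" using X(1) by (intro low) auto
    qed (use t0 \<mu> in auto)
    also have "\<dots> = (\<Prod>j\<in>X - H. ?f j)"
    proof -
      have "X - H = (X - H - V) \<union> ((X - H) \<inter> V)" by auto
      moreover have "(X - H - V) \<inter> ((X - H) \<inter> V) = {}" by auto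
      ultimately show ?thesis
        using prod.union_disjoint[of "X - H - V" "(X - H) \<inter> V" ?f] finX by (metis finite_Diff finite_Int)
    qed
    finally show ?thesis .
  qed
  have "(1/16) ^ s * (t0 ^ (4 * s) * \<mu> ^ 6) \<le> (\<Prod>j\<in>?R - X - H. ?f j) * (\<Prod>j\<in>X - H. ?f j)"
    by (intro mult_mono A B prod_nonneg) (use t0 \<mu> in auto)
  also have "\<dots> = (\<Prod>j\<in>?R - H. ?f j)"
  proof -
    have "?R - H = (?R - X - H) \<union> (X - H)" using X(1) by auto
    moreover have "(?R - X - H) \<inter> (X - H) = {}" by auto
    ultimately show ?thesis
      using prod.union_disjoint[of "?R - X - H" "X - H" ?f] finX by (metis finite_Diff finite_atLeastLessThan_int)
  qed
  finally show ?thesis by (simp add: mult.assoc)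
qed

text \<open>Since \<open>cmod w - 1\<close> bounds every factor of the rational product from below,
  replacing p/q by omega changes each factor by a relative amount of at most x/q with x = 2 pi /
  (cmod w - 1), which compounds to exp x. For p/q the product is exactly the modulus of
  \<open>w ^ q - ee y ^ q\<close>.\<close>

lemma block_upper:
  fixes p :: int and q :: nat and y \<omega> :: real and w :: complex
  assumes q: "q > 0" and cop: "coprime p (int q)" and app: "\<bar>\<omega> - of_int p / real q\<bar> \<le> 1 / (real q * real q)"
    and w: "1 < cmod w"
  shows "(\<Prod>i<q. cmod (w - ee (y + real i * \<omega>))) \<le> (1 + cmod w ^ q) * exp (2 * pi / (cmod w - 1))"
proof -
  let ?x = "2 * pi / (cmod w - 1)"
  have x0: "0 \<le> ?x" using w by simp
  let ?g = "\<lambda>i. cmod (w - ee (y + real i * (of_int p / real q)))"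
  have fac: "cmod (w - ee (y + real i * \<omega>)) \<le> ?g i * (1 + ?x / real q)" if i: "i < q" for i
  proof -
    have 1: "cmod (w - ee (y + real i * \<omega>)) \<le> ?g i + cmod (ee (y + real i * (of_int p / real q)) - ee (y + real i * \<omega>))"
      using norm_triangle_ineq[of "w - ee (y + real i * (of_int p / real q))" "ee (y + real i * (of_int p / real q)) - ee (y + real i * \<omega>)"] by simp
    have "cmod (ee (y + real i * (of_int p / real q)) - ee (y + real i * \<omega>)) \<le> 2 * (pi * \<bar>real i * (\<omega> - of_int p / real q)\<bar>)"
    proof -
      have "\<bar>pi * (y + real i * (of_int p / real q) - (y + real i * \<omega>))\<bar> = pi * \<bar>- (real i * (\<omega> - of_int p / real q))\<bar>"
        by (simp only: abs_mult abs_of_pos[OF pi_gt_zero]) (simp only: right_diff_distrib, simp)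
      then show ?thesis unfolding cmod_ee_diff
        using abs_sin_x_le_abs_x[of "pi * (y + real i * (of_int p / real q) - (y + real i * \<omega>))"] by simp
    qed
    also have "\<bar>real i * (\<omega> - of_int p / real q)\<bar> \<le> real q * (1 / (real q * real q))"
      unfolding abs_mult by (intro mult_mono) (use i app in auto)
    also have "\<dots> = 1 / real q" using q by simp
    finally have 2: "cmod (ee (y + real i * (of_int p / real q)) - ee (y + real i * \<omega>)) \<le> 2 * pi / real q" by simp
    have "cmod w - 1 \<le> ?g i" using norm_triangle_ineq2[of w "ee (y + real i * (of_int p / real q))"] by simp
    then have "(cmod w - 1) * (?x / real q) \<le> ?g i * (?x / real q)" using x0 q w by (intro mult_right_mono divide_nonneg_pos) auto
    moreover have "(cmod w - 1) * (?x / real q) = 2 * pi / real q" using w by simp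
    ultimately show ?thesis using 1 2 by (simp add: distrib_left)
  qed
  have "(\<Prod>i<q. cmod (w - ee (y + real i * \<omega>))) \<le> (\<Prod>i<q. ?g i * (1 + ?x / real q))"
    by (intro prod_mono) (use fac in auto)
  also have "\<dots> = (\<Prod>i<q. ?g i) * (1 + ?x / real q) ^ q" by (simp add: prod.distrib)
  finally have up: "(\<Prod>i<q. cmod (w - ee (y + real i * \<omega>))) \<le> (\<Prod>i<q. ?g i) * (1 + ?x / real q) ^ q" .
  have ex: "(1 + ?x / real q) ^ q \<le> exp ?x"
  proof -
    have "(1 + ?x / real q) ^ q \<le> exp (?x / real q) ^ q" using x0 q w by (intro power_mono add_nonneg_nonneg divide_nonneg_pos) auto
    then show ?thesis using q by (simp add: exp_of_nat_mult[symmetric])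
  qed
  have "(\<Prod>i<q. ?g i) = cmod (\<Prod>i<q. w - ee y * ee (real (nat ((0 + int i * p) mod int q)) / real q))"
    unfolding prod_norm[symmetric]
  proof (rule prod.cong)
    fix i
    define k where "k = (int i * p) div int q"
    define r where "r = nat ((0 + int i * p) mod int q)"
    have "int r = (int i * p) mod int q" using q by (simp add: r_def)
    then have "int i * p = int q * k + int r" by (simp add: k_def)
    from arg_cong[OF this, of real_of_int] have "real i * of_int p = real q * of_int k + real r" by simp
    then have "real i * (of_int p / real q) = of_int k + real r / real q" using q by (simp add: field_simps)
    then have "ee (y + real i * (of_int p / real q)) = ee y * ee (real r / real q)"
      using ee_add[of y "of_int k + real r / real q"] ee_add[of "of_int k" "real r / real q"] by simp
    then show "?g i = cmod (w - ee y * ee (real (nat ((0 + int i * p) mod int q)) / real q))" by (simp add: r_def)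
  qed simp
  also have "(\<Prod>i<q. w - ee y * ee (real (nat ((0 + int i * p) mod int q)) / real q)) = (\<Prod>r<q. w - ee y * ee (real r / real q))"
    by (rule prod.reindex_bij_betw[OF bij_mult_mod[OF q cop]])
  also have "\<dots> = w ^ q - ee y ^ q" by (rule prod_roots_of_unity[OF q])
  also have "cmod (w ^ q - ee y ^ q) \<le> 1 + cmod w ^ q"
    using norm_triangle_ineq4[of "w ^ q" "ee y ^ q"] by (simp add: norm_power)
  finally have gg: "(\<Prod>i<q. ?g i) \<le> 1 + cmod w ^ q" .
  have "(\<Prod>i<q. ?g i) * (1 + ?x / real q) ^ q \<le> (1 + cmod w ^ q) * exp ?x"
    by (intro mult_mono gg ex) (use x0 q w in \<open>auto intro!: add_nonneg_nonneg zero_le_power divide_nonneg_pos\<close>)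
  then show ?thesis using up by linarith
qed

subsection \<open>Determinants and Green functions of finite windows\<close>

text \<open>The divided difference: \<open>p\<close> equals its Lagrange interpolant, whose basis
  polynomials are monic of degree \<open>d\<close> up to the displayed denominators.\<close>

lemma coeff_lagrange:
  fixes p :: "complex poly"
  assumes fin: "finite A" and card: "card A = Suc d" and deg: "degree p \<le> d"
  shows "coeff p d = (\<Sum>a\<in>A. poly p a / (\<Prod>b\<in>A - {a}. a - b))"
proof -
  define Q where "Q a = (\<Prod>b\<in>A - {a}. [:- b, 1:])" for a
  define L where "L = (\<Sum>a\<in>A. Polynomial.smult (poly p a / (\<Prod>b\<in>A - {a}. a - b)) (Q a))"
  have degQ: "degree (Q a) = d" if "a \<in> A" for a
    unfolding Q_def using that fin card by (subst degree_prod_eq_sum_degree) auto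
  have leadQ: "coeff (Q a) d = 1" if "a \<in> A" for a
  proof -
    have "lead_coeff (Q a) = 1" unfolding Q_def by (simp add: lead_coeff_prod)
    then show ?thesis using degQ[OF that] by simp
  qed
  have degL: "degree L \<le> d" unfolding L_def
    by (intro degree_sum_le fin) (use degQ in \<open>auto intro: order_trans[OF degree_smult_le]\<close>)
  have polyQ: "poly (Q a) x = (\<Prod>b\<in>A - {a}. x - b)" for a x
    unfolding Q_def by (simp add: poly_prod)
  have Lx: "poly L x = poly p x" if x: "x \<in> A" for x
  proof -
    have z: "poly (Q a) x = 0" if "a \<in> A - {x}" for a
      unfolding polyQ using that x fin by (intro prod_zero) auto
    have nz: "(\<Prod>b\<in>A - {x}. x - b) \<noteq> 0" using fin by simp
    have "poly L x = (\<Sum>a\<in>A. poly p a / (\<Prod>b\<in>A - {a}. a - b) * poly (Q a) x)"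
      unfolding L_def by (simp add: poly_sum)
    also have "\<dots> = poly p x / (\<Prod>b\<in>A - {x}. x - b) * poly (Q x) x"
      by (subst sum.remove[OF fin x]) (simp add: z)
    also have "\<dots> = poly p x" using nz by (simp add: polyQ)
    finally show ?thesis .
  qed
  have "L - p = 0"
  proof (rule ccontr)
    assume nz: "L - p \<noteq> 0"
    have "card A \<le> card {x. poly (L - p) x = 0}"
      by (rule card_mono) (use poly_roots_finite[OF nz] Lx in auto)
    also have "\<dots> \<le> degree (L - p)" by (rule card_poly_roots_bound[OF nz])
    also have "\<dots> \<le> d" by (rule degree_diff_le[OF degL deg])
    finally show False using card by simp
  qed
  then have "coeff p d = coeff L d" by simp
  also have "\<dots> = (\<Sum>a\<in>A. poly p a / (\<Prod>b\<in>A - {a}. a - b))"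
    unfolding L_def by (simp add: coeff_sum leadQ)
  finally show ?thesis .
qed

text \<open>If all values were small, the divided difference could not have modulus 1. This turns
  good spacing of the nodes into a lower bound at one of them.\<close>

lemma exists_large_value:
  fixes p :: "complex poly"
  assumes fin: "finite A" and card: "card A = Suc d" and deg: "degree p \<le> d" and c: "cmod (coeff p d) = 1"
    and m: "0 < m" "\<And>a. a \<in> A \<Longrightarrow> m \<le> (\<Prod>b\<in>A - {a}. cmod (a - b))"
  shows "\<exists>a\<in>A. m / real (Suc d) \<le> cmod (poly p a)"
proof (rule ccontr)
  assume "\<not> ?thesis"
  then have small: "cmod (poly p a) < m / real (Suc d)" if "a \<in> A" for a using that by auto
  have "1 \<le> (\<Sum>a\<in>A. cmod (poly p a / (\<Prod>b\<in>A - {a}. a - b)))"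
    using norm_sum[of "\<lambda>a. poly p a / (\<Prod>b\<in>A - {a}. a - b)" A] coeff_lagrange[OF fin card deg] c by simp
  also have "\<dots> < (\<Sum>a\<in>A. 1 / real (Suc d))"
  proof (rule sum_strict_mono)
    show "finite A" "A \<noteq> {}" using fin card by auto
    fix a assume a: "a \<in> A"
    have "cmod (poly p a / (\<Prod>b\<in>A - {a}. a - b)) = cmod (poly p a) / (\<Prod>b\<in>A - {a}. cmod (a - b))"
      by (simp add: norm_divide prod_norm)
    also have "\<dots> \<le> cmod (poly p a) / m" using m(1) m(2)[OF a] by (intro divide_left_mono) auto
    also have "\<dots> < (m / real (Suc d)) / m" using small[OF a] m(1) by (intro divide_strict_right_mono) auto
    also have "\<dots> = 1 / real (Suc d)" using m(1) by simp
    finally show "cmod (poly p a / (\<Prod>b\<in>A - {a}. a - b)) < 1 / real (Suc d)" .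
  qed
  also have "\<dots> = 1" using card by simp
  finally show False by simp
qed

section \<open>Leibniz expansions with exponential weights\<close>

text \<open>Formulated over any commutative ring, so that it applies to complex matrices and to
  matrices of polynomials alike.\<close>

definition fdet :: "nat \<Rightarrow> (nat \<Rightarrow> nat \<Rightarrow> 'a::comm_ring_1) \<Rightarrow> 'a" where
  "fdet k M = det (mat k k (\<lambda>(i, j). M i j))"

lemma fdet_leibniz: "fdet k M = (\<Sum>p | p permutes {0..<k}. signof p * (\<Prod>i = 0..<k. M i (p i)))"
  unfolding fdet_def
  by (subst det_def'[of _ k]) (auto intro!: sum.cong prod.cong arg_cong2[of _ _ _ _ "(*)"] simp: permutes_in_image)

text \<open>Expanding the product of row sums gives one term for every map of the index set into
  itself, and permutations are among these maps.\<close>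

lemma sum_permutes_prod_le:
  fixes g :: "nat \<Rightarrow> nat \<Rightarrow> real"
  assumes "\<And>i j. 0 \<le> g i j"
  shows "(\<Sum>p | p permutes {0..<k}. \<Prod>i = 0..<k. g i (p i)) \<le> (\<Prod>i = 0..<k. \<Sum>j = 0..<k. g i j)"
proof -
  let ?r = "\<lambda>p. restrict p {0..<k}"
  have inj: "inj_on ?r {p. p permutes {0..<k}}"
  proof (rule inj_onI)
    fix p p' assume a: "p \<in> {p. p permutes {0..<k}}" "p' \<in> {p. p permutes {0..<k}}" "?r p = ?r p'"
    show "p = p'"
    proof
      fix x show "p x = p' x"
      proof (cases "x \<in> {0..<k}")
        case True then show ?thesis using fun_cong[OF a(3), of x] by simp
      next
        case False then show ?thesis using a(1,2) by (simp add: permutes_def)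
      qed
    qed
  qed
  have "(\<Sum>p | p permutes {0..<k}. \<Prod>i = 0..<k. g i (p i)) = (\<Sum>h\<in>?r ` {p. p permutes {0..<k}}. \<Prod>i = 0..<k. g i (h i))"
    by (subst sum.reindex[OF inj]) (auto intro!: sum.cong prod.cong)
  also have "\<dots> \<le> (\<Sum>h\<in>PiE {0..<k} (\<lambda>_. {0..<k}). \<Prod>i = 0..<k. g i (h i))"
    by (intro sum_mono2) (auto intro!: finite_PiE prod_nonneg assms simp: permutes_in_image PiE_iff)
  also have "\<dots> = (\<Prod>i = 0..<k. \<Sum>j = 0..<k. g i j)"
    by (subst prod_sum_PiE) auto
  finally show ?thesis .
qed

lemma abs_real_sign [simp]: "\<bar>real_of_int (sign p)\<bar> = 1"
  by (simp add: sign_def)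

lemma skip_index_image:
  fixes y k :: nat
  assumes "y < k"
  shows "(\<lambda>i. if i < y then i else Suc i) ` {0..<k - 1} = {0..<k} - {y}" (is "?g ` _ = _")
proof (intro equalityI subsetI)
  fix r assume "r \<in> {0..<k} - {y}"
  then show "r \<in> ?g ` {0..<k - 1}"
    using assms by (intro image_eqI[of _ _ "if r < y then r else r - 1"]) auto
next
  fix r assume "r \<in> ?g ` {0..<k - 1}"
  then obtain i where "i < k - 1" "r = ?g i" by auto
  then show "r \<in> {0..<k} - {y}" using assms by (auto split: if_splits)
qed

lemma prod_skip_index:
  assumes "y < k"
  shows "(\<Prod>i = 0..<k - 1. f (if i < y then i else Suc i)) = (\<Prod>r\<in>{0..<k} - {y}. f r)"
proof -
  let ?g = "\<lambda>i. if i < y then i else Suc i"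
  have inj: "inj_on ?g {0..<k - 1}" by (auto simp: inj_on_def split: if_splits)
  have im: "?g ` {0..<k - 1} = {0..<k} - {y}" by (rule skip_index_image[OF assms])
  show ?thesis unfolding im[symmetric] by (subst prod.reindex[OF inj]) simp
qed

lemma sum_skip_index:
  fixes f :: "nat \<Rightarrow> 'a::comm_monoid_add"
  assumes "y < k"
  shows "(\<Sum>i = 0..<k - 1. f (if i < y then i else Suc i)) = (\<Sum>r\<in>{0..<k} - {y}. f r)"
proof -
  let ?g = "\<lambda>i. if i < y then i else Suc i"
  have inj: "inj_on ?g {0..<k - 1}" by (auto simp: inj_on_def split: if_splits)
  have im: "?g ` {0..<k - 1} = {0..<k} - {y}" by (rule skip_index_image[OF assms])
  show ?thesis unfolding im[symmetric] by (subst sum.reindex[OF inj]) simp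
qed

text \<open>In every term of the expansion of the minor the row indices sum to the total minus
  \<open>y\<close> and the column indices to the total minus \<open>z\<close>, so the displacements
  from row to column have lengths adding up to at least |y - z|. The weights exp(\<kappa> |r - c|)
  therefore buy the decay factor, and the weighted row sums bound the rest.\<close>

lemma minor_bound:
  fixes M :: "nat \<Rightarrow> nat \<Rightarrow> complex" and R :: "nat \<Rightarrow> real"
  assumes \<kappa>: "0 \<le> \<kappa>" and yk: "y < k" and zk: "z < k"
    and R: "\<And>r. r < k \<Longrightarrow> (\<Sum>c = 0..<k. cmod (M r c) * exp (\<kappa> * \<bar>real r - real c\<bar>)) \<le> R r"
  shows "cmod (det (mat_delete (mat k k (\<lambda>(i, j). M i j)) y z)) \<le> exp (- \<kappa> * \<bar>real y - real z\<bar>) * (\<Prod>r\<in>{0..<k} - {y}. R r)"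
proof -
  let ?a = "\<lambda>i. if i < y then i else Suc i" and ?b = "\<lambda>j. if j < z then j else Suc j"
  define K where "K = k - 1"
  define N where "N i j = M (?a i) (?b j)" for i j
  have del: "mat_delete (mat k k (\<lambda>(i, j). M i j)) y z = mat K K (\<lambda>(i, j). N i j)"
    unfolding mat_delete_def N_def K_def using yk zk by (intro eq_matI) auto
  define g where "g i j = cmod (N i j) * exp (\<kappa> * \<bar>real (?a i) - real (?b j)\<bar>)" for i j
  have g0: "0 \<le> g i j" for i j by (simp add: g_def)
  have tm: "(\<Prod>i = 0..<K. cmod (N i (p i))) \<le> exp (- \<kappa> * \<bar>real y - real z\<bar>) * (\<Prod>i = 0..<K. g i (p i))"
    if p: "p permutes {0..<K}" for p
  proof -
    have s1: "(\<Sum>i = 0..<K. real (?a i)) = (\<Sum>r = 0..<k. real r) - real y"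
      unfolding K_def using sum_skip_index[OF yk, of real] sum.remove[of "{0..<k}" y real] yk by simp
    have "(\<Sum>i = 0..<K. real (?b (p i))) = (\<Sum>i = 0..<K. real (?b i))"
      by (rule sum.permute[OF p, of "\<lambda>i. real (?b i)", symmetric, unfolded o_def])
    also have "\<dots> = (\<Sum>r = 0..<k. real r) - real z"
      unfolding K_def using sum_skip_index[OF zk, of real] sum.remove[of "{0..<k}" z real] zk by simp
    finally have s2: "(\<Sum>i = 0..<K. real (?b (p i))) = (\<Sum>r = 0..<k. real r) - real z" .
    have "\<bar>real y - real z\<bar> = \<bar>\<Sum>i = 0..<K. (real (?a i) - real (?b (p i)))\<bar>"
      unfolding sum_subtractf s1 s2 by simp
    also have "\<dots> \<le> (\<Sum>i = 0..<K. \<bar>real (?a i) - real (?b (p i))\<bar>)" by (rule sum_abs)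
    finally have D: "\<bar>real y - real z\<bar> \<le> (\<Sum>i = 0..<K. \<bar>real (?a i) - real (?b (p i))\<bar>)" .
    have "(\<Prod>i = 0..<K. g i (p i)) = (\<Prod>i = 0..<K. cmod (N i (p i))) * exp (\<kappa> * (\<Sum>i = 0..<K. \<bar>real (?a i) - real (?b (p i))\<bar>))"
      unfolding g_def prod.distrib sum_distrib_left by (simp add: exp_sum)
    also have "\<dots> \<ge> (\<Prod>i = 0..<K. cmod (N i (p i))) * exp (\<kappa> * \<bar>real y - real z\<bar>)"
      using D \<kappa> by (intro mult_left_mono) (auto intro: prod_nonneg mult_left_mono)
    finally have "(\<Prod>i = 0..<K. cmod (N i (p i))) * exp (\<kappa> * \<bar>real y - real z\<bar>) * exp (- \<kappa> * \<bar>real y - real z\<bar>)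
        \<le> (\<Prod>i = 0..<K. g i (p i)) * exp (- \<kappa> * \<bar>real y - real z\<bar>)"
      by (rule mult_right_mono) simp
    moreover have "exp (\<kappa> * \<bar>real y - real z\<bar>) * exp (- \<kappa> * \<bar>real y - real z\<bar>) = 1" by (simp flip: exp_add)
    ultimately show ?thesis by (simp only: mult.assoc mult_1_right) (simp only: mult.commute)
  qed
  have "cmod (fdet K N) \<le> (\<Sum>p | p permutes {0..<K}. cmod (signof p * (\<Prod>i = 0..<K. N i (p i))))"
    unfolding fdet_leibniz by (rule norm_sum)
  also have "\<dots> = (\<Sum>p | p permutes {0..<K}. \<Prod>i = 0..<K. cmod (N i (p i)))"
    by (simp add: norm_mult prod_norm)
  also have "\<dots> \<le> (\<Sum>p | p permutes {0..<K}. exp (- \<kappa> * \<bar>real y - real z\<bar>) * (\<Prod>i = 0..<K. g i (p i)))"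
    by (intro sum_mono tm) auto
  also have "\<dots> \<le> exp (- \<kappa> * \<bar>real y - real z\<bar>) * (\<Prod>i = 0..<K. \<Sum>j = 0..<K. g i j)"
    unfolding sum_distrib_left[symmetric] by (intro mult_left_mono sum_permutes_prod_le g0) auto
  also have "(\<Prod>i = 0..<K. \<Sum>j = 0..<K. g i j) \<le> (\<Prod>i = 0..<K. R (?a i))"
  proof (intro prod_mono conjI sum_nonneg g0)
    fix i assume "i \<in> {0..<K}"
    then have ai: "?a i < k" unfolding K_def using yk by auto
    let ?h = "\<lambda>c. cmod (M (?a i) c) * exp (\<kappa> * \<bar>real (?a i) - real c\<bar>)"
    have "(\<Sum>j = 0..<K. g i j) = (\<Sum>c\<in>{0..<k} - {z}. ?h c)"
      unfolding g_def N_def K_def by (rule sum_skip_index[OF zk, of ?h])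
    also have "\<dots> \<le> (\<Sum>c = 0..<k. ?h c)" by (intro sum_mono2) auto
    also have "\<dots> \<le> R (?a i)" by (rule R[OF ai])
    finally show "(\<Sum>j = 0..<K. g i j) \<le> R (?a i)" .
  qed
  also have "(\<Prod>i = 0..<K. R (?a i)) = (\<Prod>r\<in>{0..<k} - {y}. R r)"
    unfolding K_def by (rule prod_skip_index[OF yk])
  finally show ?thesis unfolding del fdet_def by simp
qed

text \<open>Cramer's rule. The minor misses the factor of row \<open>y\<close>; since that factor is
  at least \<open>\<epsilon>\<close>, division by \<open>\<epsilon>\<close> lets the product run
  over all rows.\<close>

lemma green_function_bound:
  fixes M :: "nat \<Rightarrow> nat \<Rightarrow> complex" and R :: "nat \<Rightarrow> real"
  assumes \<kappa>: "0 \<le> \<kappa>" and \<epsilon>: "0 < \<epsilon>" "\<And>r. r < k \<Longrightarrow> \<epsilon> \<le> R r"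
    and R: "\<And>r. r < k \<Longrightarrow> (\<Sum>c = 0..<k. cmod (M r c) * exp (\<kappa> * \<bar>real r - real c\<bar>)) \<le> R r"
    and d: "fdet k M \<noteq> 0"
  obtains G where "\<And>i z. i < k \<Longrightarrow> z < k \<Longrightarrow> (\<Sum>y = 0..<k. G i y * M y z) = (if i = z then 1 else 0)"
    "\<And>i y. i < k \<Longrightarrow> y < k \<Longrightarrow> cmod (G i y) \<le> exp (- \<kappa> * \<bar>real i - real y\<bar>) * (\<Prod>r = 0..<k. R r) / \<epsilon> / cmod (fdet k M)"
proof -
  let ?A = "mat k k (\<lambda>(i, j). M i j)"
  have A: "?A \<in> carrier_mat k k" by simp
  define G where "G i y = cofactor ?A y i / fdet k M" for i y
  have G1: "(\<Sum>y = 0..<k. G i y * M y z) = (if i = z then 1 else 0)" if iz: "i < k" "z < k" for i z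
  proof -
    have "(adj_mat ?A * ?A) $$ (i, z) = (det ?A \<cdot>\<^sub>m 1\<^sub>m k) $$ (i, z)" using adj_mat(3)[OF A] by simp
    then have "(\<Sum>y = 0..<k. cofactor ?A y i * M y z) = det ?A * (if i = z then 1 else 0)"
      using iz by (simp add: adj_mat_def scalar_prod_def)
    moreover have "(\<Sum>y = 0..<k. G i y * M y z) = (\<Sum>y = 0..<k. cofactor ?A y i * M y z) / fdet k M"
      by (simp add: G_def sum_divide_distrib)
    ultimately show ?thesis using d unfolding fdet_def by simp
  qed
  have G2: "cmod (G i y) \<le> exp (- \<kappa> * \<bar>real i - real y\<bar>) * (\<Prod>r = 0..<k. R r) / \<epsilon> / cmod (fdet k M)" if iy: "i < k" "y < k" for i y
  proof -
    have P: "(\<Prod>r = 0..<k. R r) = R y * (\<Prod>r\<in>{0..<k} - {y}. R r)" using iy by (subst prod.remove[of "{0..<k}" y]) auto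
    have P0: "0 \<le> (\<Prod>r\<in>{0..<k} - {y}. R r)" using \<epsilon> by (intro prod_nonneg) (force intro: order_trans[of 0 \<epsilon>])
    have "\<epsilon> * (\<Prod>r\<in>{0..<k} - {y}. R r) \<le> (\<Prod>r = 0..<k. R r)" unfolding P using \<epsilon>(2) iy P0 by (intro mult_right_mono) auto
    then have Q: "(\<Prod>r\<in>{0..<k} - {y}. R r) \<le> (\<Prod>r = 0..<k. R r) / \<epsilon>" using \<epsilon>(1) by (simp add: field_simps)
    have "cmod (cofactor ?A y i) = cmod (det (mat_delete ?A y i))" by (simp add: cofactor_def norm_mult norm_power)
    also have "\<dots> \<le> exp (- \<kappa> * \<bar>real y - real i\<bar>) * (\<Prod>r\<in>{0..<k} - {y}. R r)"
      by (rule minor_bound[OF \<kappa> iy(2,1) R])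
    also have "\<dots> \<le> exp (- \<kappa> * \<bar>real i - real y\<bar>) * ((\<Prod>r = 0..<k. R r) / \<epsilon>)"
      unfolding abs_minus_commute[of "real i"] by (rule mult_left_mono[OF Q]) simp
    finally show ?thesis unfolding G_def norm_divide by (intro divide_right_mono) (auto simp: mult.assoc)
  qed
  show thesis by (rule that[OF G1 G2])
qed

section \<open>Window determinants as functions of the phase\<close>

text \<open>The phase \<open>t\<close> sits at the centre of the window, so that reversal combined with transposition
  replaces \<open>t\<close> by \<open>- t\<close> and the determinant is even in \<open>t\<close>.\<close>

definition toep :: "nat \<Rightarrow> real \<Rightarrow> (int \<Rightarrow> complex) \<Rightarrow> complex \<Rightarrow> real \<Rightarrow> nat \<Rightarrow> nat \<Rightarrow> complex" where
  "toep k \<omega> c E t i j = (if i = j then complex_of_real (2 * cos (2 * pi * (t + (real i - (real k - 1) / 2) * \<omega>))) - E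
      else c (int i - int j))"

text \<open>The entries of \<open>toep\<close> multiplied by the variable w = \<open>ee t\<close>,
  which clears the negative power in the cosine.\<close>

definition toep_poly :: "nat \<Rightarrow> real \<Rightarrow> (int \<Rightarrow> complex) \<Rightarrow> complex \<Rightarrow> nat \<Rightarrow> nat \<Rightarrow> complex poly" where
  "toep_poly k \<omega> c E i j = (if i = j then [:ee (- ((real i - (real k - 1) / 2) * \<omega>)), - E, ee ((real i - (real k - 1) / 2) * \<omega>):]
      else [:0, c (int i - int j):])"

lemma poly_signof [simp]: "poly (signof p) (x::complex) = signof p"
  by (simp add: sign_def)

lemma poly_toep_poly:
  "poly (toep_poly k \<omega> c E i j) (ee t) = ee t * toep k \<omega> c E t i j"
proof (cases "i = j")
  case True
  define s where "s = (real i - (real k - 1) / 2) * \<omega>"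
  have arith: "w * C = w * w * e2 + e1 \<Longrightarrow> poly [:e1, - E, e2:] w = w * (C - E)" for w C e1 e2 :: complex
    by (simp add: algebra_simps)
  have "ee t * complex_of_real (2 * cos (2 * pi * (t + s))) = ee t * ee (t + s) + ee t * ee (- (t + s))"
    unfolding two_cos_ee[of "t + s"] by (rule distrib_left)
  also have "ee t * ee (- (t + s)) = ee (- s)" unfolding ee_add[symmetric] by simp
  also have "ee t * ee (t + s) = ee t * ee t * ee s" unfolding ee_add by (rule mult.assoc[symmetric])
  finally have "poly [:ee (- s), - E, ee s:] (ee t) = ee t * (complex_of_real (2 * cos (2 * pi * (t + s))) - E)"
    by (rule arith)
  then have "poly (toep_poly k \<omega> c E i i) (ee t) = ee t * toep k \<omega> c E t i i"
    unfolding toep_poly_def toep_def s_def if_P[OF refl] .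
  then show ?thesis using True by simp
next
  case False
  then show ?thesis by (simp add: toep_poly_def toep_def)
qed

lemma poly_fdet_toep: "poly (fdet k (toep_poly k \<omega> c E)) (ee t) = ee t ^ k * fdet k (toep k \<omega> c E t)"
proof -
  have "poly (fdet k (toep_poly k \<omega> c E)) (ee t)
      = (\<Sum>p | p permutes {0..<k}. signof p * (\<Prod>i = 0..<k. ee t * toep k \<omega> c E t i (p i)))"
    unfolding fdet_leibniz by (simp add: poly_sum poly_prod poly_toep_poly)
  also have "\<dots> = (\<Sum>p | p permutes {0..<k}. ee t ^ k * (signof p * (\<Prod>i = 0..<k. toep k \<omega> c E t i (p i))))"
    by (simp add: prod.distrib mult_ac)
  finally show ?thesis unfolding fdet_leibniz sum_distrib_left .
qed

lemma degree_toep_poly: "degree (toep_poly k \<omega> c E i j) \<le> (if i = j then 2 else 1)"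
  by (auto simp: toep_poly_def)

text \<open>Diagonal entries have degree 2 and all others at most 1, so only the identity
  permutation reaches degree \<open>2 * k\<close>, with a product of unimodular numbers as
  coefficient.\<close>

lemma fdet_toep_poly:
  shows "degree (fdet k (toep_poly k \<omega> c E)) \<le> 2 * k" "cmod (coeff (fdet k (toep_poly k \<omega> c E)) (2 * k)) = 1"
proof -
  let ?T = "toep_poly k \<omega> c E"
  define g where "g p = signof p * (\<Prod>i = 0..<k. ?T i (p i))" for p
  have sg: "degree (signof p :: complex poly) = 0" for p by (simp add: sign_def)
  have dg: "degree (g p) \<le> (\<Sum>i = 0..<k. degree (?T i (p i)))" for p
  proof -
    have "degree (g p) \<le> degree (signof p :: complex poly) + degree (\<Prod>i = 0..<k. ?T i (p i))"
      unfolding g_def by (rule degree_mult_le)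
    also have "\<dots> \<le> (\<Sum>i = 0..<k. degree (?T i (p i)))" unfolding sg using degree_prod_sum_le[of "{0..<k}" "\<lambda>i. ?T i (p i)"] by (simp add: o_def)
    finally show ?thesis .
  qed
  have le2: "degree (?T i j) \<le> 2" for i j using degree_toep_poly[of k \<omega> c E i j] by (auto split: if_splits)
  have d2: "degree (g p) \<le> 2 * k" for p
    using dg[of p] sum_mono[of "{0..<k}" "\<lambda>i. degree (?T i (p i))" "\<lambda>_. 2"] le2 by (force intro: order_trans)
  show "degree (fdet k ?T) \<le> 2 * k" unfolding fdet_leibniz g_def[symmetric]
    by (rule degree_sum_le) (auto intro: d2 finite_permutations)
  have z: "coeff (g p) (2 * k) = 0" if p: "p permutes {0..<k}" "p \<noteq> id" for p
  proof -
    obtain i where i: "p i \<noteq> i" using p(2) by (auto simp: fun_eq_iff)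
    then have ik: "i \<in> {0..<k}" using p(1) by (auto simp: permutes_def)
    have "(\<Sum>i = 0..<k. degree (?T i (p i))) < (\<Sum>i = 0..<k. 2)"
      by (rule sum_strict_mono_ex1) (use le2 ik i degree_toep_poly[of k \<omega> c E i "p i"] in \<open>auto intro!: bexI[of _ i]\<close>)
    then have "degree (g p) < 2 * k" using dg[of p] by simp
    then show ?thesis by (rule coeff_eq_0)
  qed
  have "coeff (fdet k ?T) (2 * k) = (\<Sum>p | p permutes {0..<k}. coeff (g p) (2 * k))"
    unfolding fdet_leibniz g_def[symmetric] by (simp add: coeff_sum)
  also have "\<dots> = coeff (g id) (2 * k)"
    by (subst sum.remove[of _ id]) (auto simp: z finite_permutations permutes_id)
  also have "\<dots> = (\<Prod>i = 0..<k. ee ((real i - (real k - 1) / 2) * \<omega>))"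
  proof -
    let ?Q = "\<lambda>i. [:ee (- ((real i - (real k - 1) / 2) * \<omega>)), - E, ee ((real i - (real k - 1) / 2) * \<omega>):]"
    have gid: "g id = (\<Prod>i = 0..<k. ?Q i)" unfolding g_def by (simp add: toep_poly_def)
    have nz: "?Q i \<noteq> 0" "degree (?Q i) = 2" "lead_coeff (?Q i) = ee ((real i - (real k - 1) / 2) * \<omega>)" for i
      by (auto simp: ee_neq_0)
    have "degree (\<Prod>i = 0..<k. ?Q i) = 2 * k"
      by (subst degree_prod_eq_sum_degree) (simp_all add: nz(2) ee_neq_0)
    moreover have "lead_coeff (\<Prod>i = 0..<k. ?Q i) = (\<Prod>i = 0..<k. ee ((real i - (real k - 1) / 2) * \<omega>))"
      unfolding lead_coeff_prod nz(3) ..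
    ultimately show ?thesis unfolding gid by simp
  qed
  finally show "cmod (coeff (fdet k ?T) (2 * k)) = 1" by (simp add: prod_norm[symmetric])
qed

text \<open>Reversing the rows and reversing the columns contribute the sign of the same
  permutation, so the signs cancel.\<close>

lemma fdet_reverse_transpose:
  fixes M :: "nat \<Rightarrow> nat \<Rightarrow> complex"
  shows "fdet k (\<lambda>i j. M (k - 1 - j) (k - 1 - i)) = fdet k M"
proof -
  define \<rho> where "\<rho> i = (if i < k then k - 1 - i else i)" for i
  have \<rho>: "\<rho> permutes {0..<k}"
  proof (rule bij_imp_permutes)
    show "bij_betw \<rho> {0..<k} {0..<k}"
      by (rule bij_betw_byWitness[of _ \<rho>]) (auto simp: \<rho>_def)
  qed (auto simp: \<rho>_def)
  let ?A = "mat k k (\<lambda>(i, j). M i j)"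
  let ?B = "mat k k (\<lambda>(i, j). ?A $$ (\<rho> i, j))"
  let ?C = "mat k k (\<lambda>(i, j). (transpose_mat ?B) $$ (\<rho> i, j))"
  have B: "det ?B = signof \<rho> * det ?A" by (rule det_permute_rows[OF _ \<rho>]) simp
  have C: "det ?C = signof \<rho> * det (transpose_mat ?B)" by (rule det_permute_rows[OF _ \<rho>]) simp
  have "det (transpose_mat ?B) = det ?B" by (rule det_transpose[of _ k]) simp
  then have "det ?C = (signof \<rho> * signof \<rho>) * det ?A" using B C by simp
  also have "signof \<rho> * signof \<rho> = (1::complex)" by (simp add: sign_def)
  finally have "det ?C = det ?A" by simp
  moreover have "?C = mat k k (\<lambda>(i, j). M (k - 1 - j) (k - 1 - i))"
    by (rule eq_matI) (auto simp: \<rho>_def)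
  ultimately show ?thesis unfolding fdet_def by simp
qed

lemma fdet_toep_minus: "fdet k (toep k \<omega> c E (- t)) = fdet k (toep k \<omega> c E t)"
proof -
  have "fdet k (toep k \<omega> c E (- t)) = fdet k (\<lambda>i j. toep k \<omega> c E t (k - 1 - j) (k - 1 - i))"
    unfolding fdet_def
  proof (intro arg_cong[of _ _ det] eq_matI)
    fix i j assume "i < dim_row (mat k k (\<lambda>(i, j). toep k \<omega> c E t (k - 1 - j) (k - 1 - i)))"
      "j < dim_col (mat k k (\<lambda>(i, j). toep k \<omega> c E t (k - 1 - j) (k - 1 - i)))"
    then have ij: "i < k" "j < k" by auto
    have r: "real (k - 1 - j) = real k - 1 - real j" "int (k - 1 - j) - int (k - 1 - i) = int i - int j" using ij by auto
    have cs: "cos (2 * pi * (- t + u)) = cos (2 * pi * (t - u))" for u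
    proof -
      have "2 * pi * (- t + u) = - (2 * pi * (t - u))" by (simp add: algebra_simps)
      then show ?thesis by (simp only: cos_minus)
    qed
    have "t - (real j - (real k - 1) / 2) * \<omega> = t + (real (k - 1 - j) - (real k - 1) / 2) * \<omega>"
      unfolding r(1) by (simp add: field_simps)
    then have "toep k \<omega> c E (- t) i j = toep k \<omega> c E t (k - 1 - j) (k - 1 - i)"
    proof (cases "i = j")
      case True
      then show ?thesis using \<open>t - _ = _\<close> by (simp only: toep_def cs if_True simp_thms)
    next
      case False
      then have "k - 1 - j \<noteq> k - 1 - i" using ij by auto
      then show ?thesis using False r(2) by (simp only: toep_def if_False)
    qed
    then show "mat k k (\<lambda>(i, j). toep k \<omega> c E (- t) i j) $$ (i, j) = mat k k (\<lambda>(i, j). toep k \<omega> c E t (k - 1 - j) (k - 1 - i)) $$ (i, j)"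
      using ij by simp
  qed auto
  then show ?thesis by (simp only: fdet_reverse_transpose)
qed

text \<open>Since the determinant is even in the phase, each \<open>a\<close> supplies two nodes,
  \<open>ee (y a)\<close> and \<open>ee (- y a)\<close>. These are \<open>2 * k + 2\<close> nodes
  for a polynomial of degree \<open>2 * k\<close>; one is discarded, and the factor lost with it, a
  chord of length at most 2, explains the 2 in front of \<open>2 * k + 1\<close>.\<close>

lemma fdet_toep_large:
  fixes A :: "int set" and y :: "int \<Rightarrow> real"
  assumes fin: "finite A" and card: "card A = Suc k" and m: "0 < m"
    and low: "\<And>a. a \<in> A \<Longrightarrow> m \<le> (\<Prod>b\<in>A - {a}. cmod (ee (y a) - ee (y b))) * (\<Prod>b\<in>A. cmod (ee (y a) - ee (- y b)))"
  shows "\<exists>a\<in>A. m / (2 * real (2 * k + 1)) \<le> cmod (fdet k (toep k \<omega> c E (y a)))"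
proof -
  define nd where "nd = (\<lambda>(a, \<sigma>::bool). ee (if \<sigma> then y a else - y a))"
  have norm_nd: "cmod (nd v) = 1" for v by (cases v) (simp add: nd_def)
  let ?W = "A \<times> UNIV"
  let ?pr = "\<lambda>v. \<Prod>v'\<in>?W - {v}. cmod (nd v - nd v')"
  have conj: "cmod (ee (- s) - ee (- t)) = cmod (ee s - ee t)" for s t
  proof -
    have "pi * (- s - - t) = - (pi * (s - t))" by (simp add: algebra_simps)
    then show ?thesis unfolding cmod_ee_diff by (simp only: sin_minus abs_minus_cancel)
  qed
  have full: "m \<le> ?pr v" if v: "v \<in> ?W" for v
  proof -
    obtain a \<sigma> where v': "v = (a, \<sigma>)" "a \<in> A" using v by auto
    have sp: "?W - {v} = ((\<lambda>b. (b, \<sigma>)) ` (A - {a})) \<union> ((\<lambda>b. (b, \<not> \<sigma>)) ` A)"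
      using v' by auto
    have "?pr v = (\<Prod>v'\<in>(\<lambda>b. (b, \<sigma>)) ` (A - {a}). cmod (nd v - nd v')) * (\<Prod>v'\<in>(\<lambda>b. (b, \<not> \<sigma>)) ` A. cmod (nd v - nd v'))"
      unfolding sp by (rule prod.union_disjoint) (use fin in auto)
    also have "\<dots> = (\<Prod>b\<in>A - {a}. cmod (nd (a, \<sigma>) - nd (b, \<sigma>))) * (\<Prod>b\<in>A. cmod (nd (a, \<sigma>) - nd (b, \<not> \<sigma>)))"
      unfolding v'(1) using prod.reindex[of "\<lambda>b. (b, \<sigma>)" "A - {a}" "\<lambda>v'. cmod (nd (a, \<sigma>) - nd v')"]
        prod.reindex[of "\<lambda>b. (b, \<not> \<sigma>)" A "\<lambda>v'. cmod (nd (a, \<sigma>) - nd v')"] by (simp add: inj_on_def o_def)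
    also have "\<dots> = (\<Prod>b\<in>A - {a}. cmod (ee (y a) - ee (y b))) * (\<Prod>b\<in>A. cmod (ee (y a) - ee (- y b)))"
      using conj[of "y a"] conj[of "y a" "- y _"] unfolding nd_def by (cases \<sigma>) simp_all
    finally show ?thesis using low[OF v'(2)] by simp
  qed
  have injW: "inj_on nd ?W"
  proof (rule inj_onI, rule ccontr)
    fix v v' assume "v \<in> ?W" "v' \<in> ?W" "nd v = nd v'" "v \<noteq> v'"
    then have "?pr v = 0" using fin by (intro prod_zero) (auto intro!: bexI[of _ v'])
    then show False using full[OF \<open>v \<in> ?W\<close>] m by simp
  qed
  obtain a0 where a0: "a0 \<in> A" using card by fastforce
  define v0 where "v0 = (a0, True)"
  have v0: "v0 \<in> ?W" using a0 by (simp add: v0_def)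
  define W where "W = nd ` (?W - {v0})"
  have injW': "inj_on nd (?W - {v0})" using injW by (rule inj_on_subset) auto
  have cW: "card W = Suc (2 * k)"
    unfolding W_def card_image[OF injW'] using v0 fin card by (subst card_Diff_subset) (auto simp: card_cartesian_product)
  have mW: "m / 2 \<le> (\<Prod>b\<in>W - {a}. cmod (a - b))" if aW: "a \<in> W" for a
  proof -
    obtain v where v: "v \<in> ?W - {v0}" "a = nd v" using aW by (auto simp: W_def)
    have "W - {a} = nd ` (?W - {v0} - {v})" unfolding W_def v(2) using injW' v(1)
      by (auto simp: inj_on_def)
    then have "(\<Prod>b\<in>W - {a}. cmod (a - b)) = (\<Prod>v'\<in>?W - {v0} - {v}. cmod (nd v - nd v'))"
      using v(2) by (simp add: prod.reindex[OF inj_on_subset[OF injW']])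
    moreover have "?pr v = cmod (nd v - nd v0) * (\<Prod>v'\<in>?W - {v} - {v0}. cmod (nd v - nd v'))"
      using v v0 fin by (intro prod.remove) auto
    moreover have "?W - {v} - {v0} = ?W - {v0} - {v}" by auto
    moreover have "cmod (nd v - nd v0) \<le> 2"
      using norm_triangle_ineq4[of "nd v" "nd v0"] by (simp add: norm_nd)
    moreover have "0 \<le> (\<Prod>v'\<in>?W - {v0} - {v}. cmod (nd v - nd v'))" by (intro prod_nonneg) auto
    ultimately have "m \<le> 2 * (\<Prod>b\<in>W - {a}. cmod (a - b))"
      using full[of v] v(1) mult_right_mono[of "cmod (nd v - nd v0)" 2 "\<Prod>b\<in>W - {a}. cmod (a - b)"] by auto
    then show ?thesis by simp
  qed
  have "\<exists>a\<in>W. (m / 2) / real (Suc (2 * k)) \<le> cmod (poly (fdet k (toep_poly k \<omega> c E)) a)"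
    by (rule exists_large_value[OF _ cW fdet_toep_poly]) (use m mW fin in \<open>auto simp: W_def\<close>)
  then obtain a \<sigma> where a: "a \<in> A" "(m / 2) / real (Suc (2 * k)) \<le> cmod (poly (fdet k (toep_poly k \<omega> c E)) (nd (a, \<sigma>)))"
    by (auto simp: W_def)
  have "cmod (poly (fdet k (toep_poly k \<omega> c E)) (nd (a, \<sigma>))) = cmod (fdet k (toep k \<omega> c E (y a)))"
    unfolding nd_def by (auto simp: poly_fdet_toep norm_mult norm_power fdet_toep_minus split: if_splits)
  then show ?thesis using a by (intro bexI[of _ a]) auto
qed

text \<open>Let \<delta> be the error q omega - p. Either \<open>d\<close> is a nonzero multiple of
  \<open>q\<close> and the distance is at least |\<delta>|, or \<open>d * p\<close> misses the
  relevant multiple of \<open>q\<close> by at least 1 and the perturbation d \<delta> takes away at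
  most 1/4.\<close>

lemma dz_int_mult_ge:
  fixes d p :: int and q N :: nat and \<omega> :: real
  assumes q: "q > 0" and cop: "coprime p (int q)" and app: "\<bar>real q * \<omega> - of_int p\<bar> \<le> 1 / real N" and qN: "q \<le> N"
    and g: "g \<le> dz (real q * \<omega>)" and d: "d \<noteq> 0" "4 * \<bar>d\<bar> \<le> int N"
  shows "(3/4) * g \<le> dz (of_int d * \<omega>)"
proof -
  have N0: "0 < N" using q qN by simp
  have dN: "4 * \<bar>real_of_int d\<bar> \<le> real N" using d(2) by linarith
  define \<delta> where "\<delta> = real q * \<omega> - of_int p"
  have \<delta>: "\<bar>\<delta>\<bar> \<le> 1 / real N" "g \<le> \<bar>\<delta>\<bar>"
    using app order_trans[OF g dz_le[of _ p]] by (auto simp: \<delta>_def)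
  have gq: "g \<le> 1 / real q" 
  proof -
    have "1 / real N \<le> 1 / real q" using qN q by (intro divide_left_mono) auto
    then show ?thesis using \<delta> by linarith
  qed
  have om: "\<omega> = (of_int p + \<delta>) / real q" using q by (simp add: \<delta>_def)
  define r where "r = round (of_int d * \<omega>)"
  have dzr: "dz (of_int d * \<omega>) = \<bar>of_int (d * p - r * int q) + of_int d * \<delta>\<bar> / real q"
  proof -
    have "of_int d * \<omega> - of_int r = (of_int (d * p - r * int q) + of_int d * \<delta>) / real q"
      unfolding om using q by (simp add: field_simps)
    then show ?thesis unfolding dz_def r_def[symmetric] by simp
  qed
  have d\<delta>: "\<bar>of_int d * \<delta>\<bar> \<le> 1/4"
  proof -
    have "\<bar>of_int d\<bar> * \<bar>\<delta>\<bar> \<le> (real N / 4) * (1 / real N)" using dN \<delta>(1) by (intro mult_mono) auto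
    then show ?thesis using N0 by (simp add: abs_mult)
  qed
  show ?thesis
  proof (cases "d * p - r * int q = 0")
    case True
    then have "int q dvd d * p" by (metis dvd_triv_right eq_iff_diff_eq_0)
    then have "int q dvd d" using cop by (simp add: coprime_commute coprime_dvd_mult_left_iff)
    then have "int q \<le> \<bar>d\<bar>" using dvd_imp_le_int[OF d(1)] by fastforce
    then have "real q \<le> \<bar>real_of_int d\<bar>" by linarith
    then have "real q * \<bar>\<delta>\<bar> \<le> \<bar>of_int d * \<delta>\<bar>" by (simp add: abs_mult mult_right_mono)
    then have "\<bar>\<delta>\<bar> \<le> dz (of_int d * \<omega>)" unfolding dzr True using q by (simp add: field_simps)
    then show ?thesis using \<delta>(2) by linarith
  next
    case False
    then have "1 \<le> \<bar>real_of_int (d * p - r * int q)\<bar>" by linarith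
    then have "3/4 \<le> \<bar>of_int (d * p - r * int q) + of_int d * \<delta>\<bar>" using d\<delta> by linarith
    then have "3/4 / real q \<le> dz (of_int d * \<omega>)" unfolding dzr using q by (intro divide_right_mono) auto
    then show ?thesis using gq by simp
  qed
qed

text \<open>Multiplied by \<open>w^k\<close>, the determinant is a polynomial of degree \<open>2 k\<close> in \<open>w = ee t\<close> with unimodular
  leading coefficient. Interpolating it at \<open>2 k + 1\<close> of the phases attached to windows around \<open>m\<close> and
  \<open>m + n\<close> (and their negatives) shows that it cannot be small for all these windows.\<close>

lemma exists_large_det:
  fixes p m :: int and q s N n k :: nat and \<omega> x c0 B :: real and c :: "int \<Rightarrow> complex" and E :: complex
  assumes q: "q > 0" and cop: "coprime p (int q)" and app: "\<bar>real q * \<omega> - of_int p\<bar> \<le> 1 / real N"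
    and s: "1 \<le> s" "s * q \<le> N" and N: "16 \<le> N" "40 * N \<le> n" and k: "Suc k = 2 * s * q"
    and c0: "0 < c0" "c0 \<le> 1" and B: "0 < B"
    and dc: "\<And>d::int. d \<noteq> 0 \<Longrightarrow> \<bar>d\<bar> < 2 * int n \<Longrightarrow> c0 * exp (- B * real_of_int \<bar>d\<bar>) \<le> dz (of_int d * \<omega>)"
    and nr: "\<And>s'::int. \<bar>s'\<bar> \<le> 3 * int n \<Longrightarrow> exp (- B * real n) \<le> dz (2 * x + of_int (2 * m + s') * \<omega>)"
  shows "\<exists>a. (m - int (s * q) - int (s * q div 2) \<le> a \<and> a < m - int (s * q div 2) \<or>
      m + int n - int (s * q) - int (s * q div 2) \<le> a \<and> a < m + int n - int (s * q div 2)) \<and>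
    ((1/16) ^ s * ((3/8) * c0 * exp (- B * real q)) ^ (4 * s)) ^ 4 * (c0 * exp (- (2 * B) * real n)) ^ 24 / (2 * real (2 * k + 1))
     \<le> cmod (fdet k (toep k \<omega> c E (x + (of_int a + (real k - 1) / 2) * \<omega>)))"
proof -
  define u where "u = int (s * q)"
  define h where "h = int (s * q div 2)"
  have uh: "0 < u" "2 * h \<le> u" "0 \<le> h" "40 * u \<le> int n" "u \<le> int N"
  proof -
    define v where "v = s * q"
    have v: "0 < v" "v \<le> N" using s q by (auto simp: v_def)
    show "0 < u" "2 * h \<le> u" "0 \<le> h" "40 * u \<le> int n" "u \<le> int N"
      unfolding u_def h_def v_def[symmetric] using v N by auto
  qed
  \<comment> \<open>The elements are left ends of windows of length \<open>k = 2 * u - 1\<close>.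
    The shift by \<open>h\<close>, about half of \<open>u\<close>, keeps the sites \<open>m\<close>
    and \<open>m + n\<close> away from both ends of their windows by about u/2.\<close>
  define J1 where "J1 = {m - u - h..<(m - u - h) + u}"
  define J2 where "J2 = {m + int n - u - h..<(m + int n - u - h) + u}"
  define A where "A = J1 \<union> J2"
  define y where "y a = x + (of_int a + (real k - 1) / 2) * \<omega>" for a :: int
  define t0 where "t0 = (3/8) * c0 * exp (- B * real q)"
  define \<mu> where "\<mu> = c0 * exp (- (2 * B) * real n)"
  have disj: "J1 \<inter> J2 = {}" unfolding J1_def J2_def using uh by auto
  have fin: "finite J1" "finite J2" "finite A" by (auto simp: J1_def J2_def A_def)
  have cardA: "card A = Suc k"
  proof -
    have "nat u = s * q" by (simp add: u_def del: of_nat_mult)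
    then have "card J1 = s * q" "card J2 = s * q" by (simp_all add: J1_def J2_def)
    then show ?thesis unfolding A_def card_Un_disjoint[OF fin(1,2) disj] k by simp
  qed
  have qN: "q \<le> N" using mult_le_mono1[OF s(1), of q] s(2) by linarith
  have qn: "int q < 2 * int n" using qN N by linarith
  have t0: "0 < t0" "t0 \<le> 1"
  proof -
    show "0 < t0" using c0 by (simp add: t0_def)
    have "c0 * exp (- B * real q) \<le> 1 * 1" using c0 B by (intro mult_mono) auto
    then show "t0 \<le> 1" by (simp add: t0_def)
  qed
  have \<mu>: "0 < \<mu>" "\<mu> \<le> 1"
  proof -
    show "0 < \<mu>" using c0 by (simp add: \<mu>_def)
    have "c0 * exp (- (2 * B) * real n) \<le> 1 * 1" using c0 B by (intro mult_mono) auto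
    then show "\<mu> \<le> 1" by (simp add: \<mu>_def)
  qed
  have sep: "2 * t0 \<le> dz (of_int d * \<omega>)" if "d \<noteq> 0" "4 * \<bar>d\<bar> \<le> int N" for d :: int
  proof -
    have "c0 * exp (- B * real q) \<le> dz (real q * \<omega>)" using dc[of "int q"] q qn by simp
    from dz_int_mult_ge[OF q cop app qN this that] show ?thesis by (simp add: t0_def)
  qed
  \<comment> \<open>Sums of two phases involve the index \<open>a + b + k - 1\<close>; its distance
    from \<open>2 * m\<close> is at most 3 n, which is the range of shifts in
    \<open>nr\<close>.\<close>
  have bnd: "\<bar>a - b\<bar> < 2 * int n" "\<bar>a + b + int k - 1 - 2 * m\<bar> \<le> 3 * int n" if "a \<in> A" "b \<in> A" for a b
  proof -
    have "int k = 2 * u - 1" using arg_cong[OF k, of int] unfolding u_def by simp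
    moreover have "m - u - h \<le> a" "a < m + int n" "m - u - h \<le> b" "b < m + int n"
      using that uh unfolding A_def J1_def J2_def by auto
    ultimately show "\<bar>a - b\<bar> < 2 * int n" "\<bar>a + b + int k - 1 - 2 * m\<bar> \<le> 3 * int n" using uh by linarith+
  qed
  have low1: "\<mu> \<le> 2 * \<bar>sin (pi * (- (of_int a * \<omega>) + of_int b * \<omega>))\<bar>" if ab: "a \<in> A" "b \<in> A" "b \<noteq> a" for a b
  proof -
    have "\<mu> \<le> c0 * exp (- B * real_of_int \<bar>b - a\<bar>)"
    proof -
      have "B * real_of_int \<bar>b - a\<bar> \<le> B * (2 * real n)"
        using bnd(1)[OF ab(2,1)] B by (intro mult_left_mono) linarith+
      then show ?thesis unfolding \<mu>_def using c0 by (intro mult_left_mono) auto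
    qed
    also have "\<dots> \<le> dz (of_int (b - a) * \<omega>)" using bnd(1)[OF ab(2,1)] ab by (intro dc) auto
    also have "\<dots> \<le> 2 * \<bar>sin (pi * (of_int (b - a) * \<omega>))\<bar>" by (rule abs_sin_pi_ge_dz)
    also have "of_int (b - a) * \<omega> = - (of_int a * \<omega>) + of_int b * \<omega>" by (simp add: algebra_simps)
    finally show ?thesis .
  qed
  have low2: "\<mu> \<le> 2 * \<bar>sin (pi * ((2 * x + of_int (a + int k - 1) * \<omega>) + of_int b * \<omega>))\<bar>" if ab: "a \<in> A" "b \<in> A" for a b
  proof -
    have "\<mu> \<le> 1 * exp (- B * real n)" unfolding \<mu>_def using c0 B by (intro mult_mono) auto
    also have "\<dots> \<le> dz (2 * x + of_int (2 * m + (a + b + int k - 1 - 2 * m)) * \<omega>)"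
      using nr[OF bnd(2)[OF ab]] by simp
    also have "\<dots> \<le> 2 * \<bar>sin (pi * (2 * x + of_int (2 * m + (a + b + int k - 1 - 2 * m)) * \<omega>))\<bar>" by (rule abs_sin_pi_ge_dz)
    also have "2 * x + of_int (2 * m + (a + b + int k - 1 - 2 * m)) * \<omega> = (2 * x + of_int (a + int k - 1) * \<omega>) + of_int b * \<omega>"
      by (simp add: algebra_simps)
    finally show ?thesis .
  qed
  define \<nu> where "\<nu> = (1/16) ^ s * t0 ^ (4 * s) * \<mu> ^ 6"
  have \<nu>0: "0 < \<nu>" using t0 \<mu> by (simp add: \<nu>_def)
  have run: "\<nu> \<le> (\<Prod>b\<in>J - H. 2 * \<bar>sin (pi * (z + of_int b * \<omega>))\<bar>)"
    if "J = J1 \<or> J = J2" "finite H" "card H \<le> 1"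
      "\<And>b. b \<in> J - H \<Longrightarrow> \<mu> \<le> 2 * \<bar>sin (pi * (z + of_int b * \<omega>))\<bar>" for J H z
  proof -
    have "\<exists>J0. J = {J0..<J0 + int (s * q)}" using that(1) unfolding J1_def J2_def u_def by blast
    then obtain J0 where J0: "J = {J0..<J0 + int (s * q)}" by blast
    show ?thesis unfolding \<nu>_def J0
      by (rule run_lower[OF q cop app s N(1) sep t0 \<mu> that(2,3)]) (use that(4) J0 in auto)
  qed
  \<comment> \<open>Two runs for the differences and two for the sums of phases, each with at most
    six weak factors: hence the powers 4 and 24.\<close>
  have main: "\<nu> ^ 4 \<le> (\<Prod>b\<in>A - {a}. cmod (ee (y a) - ee (y b))) * (\<Prod>b\<in>A. cmod (ee (y a) - ee (- y b)))"
    if a: "a \<in> A" for a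
  proof -
    have e1: "cmod (ee (y a) - ee (y b)) = 2 * \<bar>sin (pi * (- (of_int a * \<omega>) + of_int b * \<omega>))\<bar>" for b
    proof -
      have "pi * (y a - y b) = - (pi * (- (of_int a * \<omega>) + of_int b * \<omega>))" by (simp add: y_def algebra_simps)
      then show ?thesis unfolding cmod_ee_diff by (simp only: sin_minus abs_minus_cancel)
    qed
    have e2: "cmod (ee (y a) - ee (- y b)) = 2 * \<bar>sin (pi * ((2 * x + of_int (a + int k - 1) * \<omega>) + of_int b * \<omega>))\<bar>" for b
    proof -
      have "y a - - y b = (2 * x + of_int (a + int k - 1) * \<omega>) + of_int b * \<omega>" by (simp add: y_def field_simps)
      then show ?thesis unfolding cmod_ee_diff by simp
    qed
    have "\<nu> * \<nu> \<le> (\<Prod>b\<in>J1 - {a}. cmod (ee (y a) - ee (y b))) * (\<Prod>b\<in>J2 - {a}. cmod (ee (y a) - ee (y b)))"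
      unfolding e1 by (intro mult_mono run prod_nonneg low1 a) (use \<nu>0 in \<open>auto simp: A_def\<close>)
    also have "\<dots> = (\<Prod>b\<in>(J1 - {a}) \<union> (J2 - {a}). cmod (ee (y a) - ee (y b)))"
      using fin disj by (intro prod.union_disjoint[symmetric]) auto
    also have "(J1 - {a}) \<union> (J2 - {a}) = A - {a}" by (auto simp: A_def)
    finally have 1: "\<nu> * \<nu> \<le> (\<Prod>b\<in>A - {a}. cmod (ee (y a) - ee (y b)))" .
    have "\<nu> * \<nu> \<le> (\<Prod>b\<in>J1 - {}. cmod (ee (y a) - ee (- y b))) * (\<Prod>b\<in>J2 - {}. cmod (ee (y a) - ee (- y b)))"
      unfolding e2 by (intro mult_mono run prod_nonneg low2 a) (use \<nu>0 in \<open>auto simp: A_def\<close>)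
    also have "\<dots> = (\<Prod>b\<in>A. cmod (ee (y a) - ee (- y b)))"
      unfolding A_def by (simp only: Diff_empty prod.union_disjoint[OF fin(1,2) disj])
    finally have 2: "\<nu> * \<nu> \<le> (\<Prod>b\<in>A. cmod (ee (y a) - ee (- y b)))" .
    have "\<nu> ^ 4 = (\<nu> * \<nu>) * (\<nu> * \<nu>)" by (simp add: power4_eq_xxxx)
    also have "\<dots> \<le> (\<Prod>b\<in>A - {a}. cmod (ee (y a) - ee (y b))) * (\<Prod>b\<in>A. cmod (ee (y a) - ee (- y b)))"
      by (intro mult_mono 1 2 prod_nonneg) (use \<nu>0 in auto)
    finally show ?thesis .
  qed
  obtain a where a: "a \<in> A" "\<nu> ^ 4 / (2 * real (2 * k + 1)) \<le> cmod (fdet k (toep k \<omega> c E (y a)))"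
    using fdet_toep_large[OF fin(3) cardA zero_less_power[OF \<nu>0] main] by blast
  have "\<nu> ^ 4 = ((1/16) ^ s * t0 ^ (4 * s)) ^ 4 * \<mu> ^ 24" by (simp add: \<nu>_def power_mult_distrib flip: power_mult)
  then show ?thesis
    using a unfolding y_def t0_def \<mu>_def by (intro exI[of _ a]) (auto simp: A_def J1_def J2_def u_def h_def)
qed

section \<open>Upper bounds for the product of the rows\<close>

lemma cmod_two_cos_diff:
  "cmod (complex_of_real (2 * cos (2 * pi * t) - 2 * cos (2 * pi * \<tau>))) = cmod (ee t - ee \<tau>) * cmod (ee (- t) - ee \<tau>)"
proof -
  have "(ee t - ee \<tau>) * (ee (- t) - ee \<tau>) = ee \<tau> * ((ee \<tau> + ee (- \<tau>)) - (ee t + ee (- t)))"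
    by (simp add: algebra_simps ee_minus)
  then have "cmod ((ee t - ee \<tau>) * (ee (- t) - ee \<tau>)) = cmod ((ee \<tau> + ee (- \<tau>)) - (ee t + ee (- t)))"
    by (simp add: norm_mult)
  also have "\<dots> = cmod ((ee t + ee (- t)) - (ee \<tau> + ee (- \<tau>)))" by (rule norm_minus_commute)
  finally show ?thesis unfolding norm_mult of_real_diff two_cos_ee by simp
qed

text \<open>For unit vectors u, v and r = exp \<rho> one has |r u - v|^2 = (r - 1)^2 + r |u - v|^2,
  and r - 1 is at least \<rho>.\<close>

lemma cmod_sub_scaled_ge:
  assumes "0 \<le> \<rho>"
  shows "(cmod (ee t - ee \<tau>))\<^sup>2 + \<rho>\<^sup>2 \<le> (cmod (exp (of_real \<rho>) * ee \<tau> - ee t))\<^sup>2"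
proof -
  define r where "r = exp \<rho>"
  have ring_id: "(r * a - b)\<^sup>2 + (r * c - d)\<^sup>2 = r\<^sup>2 * (a\<^sup>2 + c\<^sup>2) + (b\<^sup>2 + d\<^sup>2) - 2 * r * (b * a + d * c)" for a b c d :: real
    by (simp add: power2_eq_square algebra_simps)
  have r: "1 + \<rho> \<le> r" "1 \<le> r" using exp_ge_add_one_self[of \<rho>] assms by (auto simp: r_def)
  define C where "C = cos (2 * pi * t) * cos (2 * pi * \<tau>) + sin (2 * pi * t) * sin (2 * pi * \<tau>)"
  have u: "(cos (2 * pi * t))\<^sup>2 + (sin (2 * pi * t))\<^sup>2 = 1" "(cos (2 * pi * \<tau>))\<^sup>2 + (sin (2 * pi * \<tau>))\<^sup>2 = 1" by simp_all
  have C: "C \<le> 1" unfolding C_def cos_diff[symmetric] by simp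
  have 1: "(cmod (ee t - ee \<tau>))\<^sup>2 = 2 - 2 * C"
  proof -
    have "(cmod (ee t - ee \<tau>))\<^sup>2 = (cos (2 * pi * t) - cos (2 * pi * \<tau>))\<^sup>2 + (sin (2 * pi * t) - sin (2 * pi * \<tau>))\<^sup>2"
      by (simp add: cmod_power2 ee_def)
    also have "\<dots> = ((cos (2 * pi * t))\<^sup>2 + (sin (2 * pi * t))\<^sup>2) + ((cos (2 * pi * \<tau>))\<^sup>2 + (sin (2 * pi * \<tau>))\<^sup>2) - 2 * C"
      unfolding C_def by (simp only: power2_diff) (simp add: algebra_simps)
    finally show ?thesis unfolding u by simp
  qed
  have "complex_of_real r * ee \<tau> - ee t = Complex (r * cos (2 * pi * \<tau>) - cos (2 * pi * t)) (r * sin (2 * pi * \<tau>) - sin (2 * pi * t))"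
    by (simp add: complex_eq_iff ee_def)
  then have "(cmod (complex_of_real r * ee \<tau> - ee t))\<^sup>2 = (r * cos (2 * pi * \<tau>) - cos (2 * pi * t))\<^sup>2 + (r * sin (2 * pi * \<tau>) - sin (2 * pi * t))\<^sup>2"
    by (simp add: cmod_power2)
  also have "\<dots> = r\<^sup>2 * ((cos (2 * pi * \<tau>))\<^sup>2 + (sin (2 * pi * \<tau>))\<^sup>2) + ((cos (2 * pi * t))\<^sup>2 + (sin (2 * pi * t))\<^sup>2) - 2 * r * C"
    unfolding C_def by (rule ring_id)
  also have "\<dots> = (r - 1)\<^sup>2 + r * (2 - 2 * C)" unfolding u by (simp add: power2_eq_square algebra_simps)
  also have "\<dots> \<ge> \<rho>\<^sup>2 + 1 * (2 - 2 * C)"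
    using r C assms by (intro add_mono power_mono mult_right_mono) auto
  finally show ?thesis unfolding 1 r_def exp_of_real by simp
qed

text \<open>Moving the node \<open>ee \<tau>\<close> off the unit circle absorbs an additive
  constant into the factorised form, so that the product formulas over roots of unity stay
  applicable.\<close>

lemma two_cos_diff_le:
  assumes "0 \<le> \<rho>"
  shows "\<bar>2 * cos (2 * pi * t) - 2 * cos (2 * pi * \<tau>)\<bar> + \<rho>\<^sup>2
    \<le> cmod (exp (of_real \<rho>) * ee \<tau> - ee t) * cmod (exp (of_real \<rho>) * ee \<tau> - ee (- t))"
proof -
  let ?d1 = "cmod (ee t - ee \<tau>)" and ?d2 = "cmod (ee (- t) - ee \<tau>)"
  let ?a = "cmod (exp (of_real \<rho>) * ee \<tau> - ee t)" and ?b = "cmod (exp (of_real \<rho>) * ee \<tau> - ee (- t))"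
  have "\<bar>2 * cos (2 * pi * t) - 2 * cos (2 * pi * \<tau>)\<bar> = ?d1 * ?d2"
    using cmod_two_cos_diff[of t \<tau>] by (simp only: norm_of_real)
  moreover have "(?d1 * ?d2 + \<rho>\<^sup>2)\<^sup>2 \<le> (?a * ?b)\<^sup>2"
  proof -
    have "(?d1 * ?d2 + \<rho>\<^sup>2)\<^sup>2 \<le> (?d1\<^sup>2 + \<rho>\<^sup>2) * (?d2\<^sup>2 + \<rho>\<^sup>2)"
    proof -
      have "0 \<le> \<rho>\<^sup>2 * (?d1 - ?d2)\<^sup>2" by simp
      then show ?thesis by (simp add: power2_eq_square algebra_simps)
    qed
    also have "\<dots> \<le> ?a\<^sup>2 * ?b\<^sup>2" using cmod_sub_scaled_ge[OF assms] by (intro mult_mono) auto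
    finally show ?thesis by (simp add: power_mult_distrib)
  qed
  ultimately show ?thesis using power2_le_imp_le[of "?d1 * ?d2 + \<rho>\<^sup>2" "?a * ?b"] by simp
qed

lemma run_upper:
  fixes p :: int and q l :: nat and y \<omega> \<rho> \<tau> :: real
  assumes q: "q > 0" and cop: "coprime p (int q)" and app: "\<bar>\<omega> - of_int p / real q\<bar> \<le> 1 / (real q * real q)"
    and \<rho>: "0 < \<rho>"
  shows "(\<Prod>i<l * q. cmod (exp (of_real \<rho>) * ee \<tau> - ee (y + real i * \<omega>))) \<le> (2 * exp (\<rho> * real q) * exp (2 * pi / \<rho>)) ^ l"
proof (induction l)
  case 0 then show ?case by simp
next
  case (Suc l)
  let ?w = "exp (of_real \<rho>) * ee \<tau>"
  have w: "cmod ?w = exp \<rho>" by (simp add: norm_mult)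
  have er: "\<rho> \<le> exp \<rho> - 1" using exp_ge_add_one_self[of \<rho>] by linarith
  have "(\<Prod>i<q. cmod (?w - ee ((y + real (l * q) * \<omega>) + real i * \<omega>))) \<le> (1 + cmod ?w ^ q) * exp (2 * pi / (cmod ?w - 1))"
    by (rule block_upper[OF q cop app]) (use \<rho> w in simp)
  also have "\<dots> \<le> (2 * exp (\<rho> * real q)) * exp (2 * pi / \<rho>)"
  proof (intro mult_mono)
    show "1 + cmod ?w ^ q \<le> 2 * exp (\<rho> * real q)"
      unfolding w using \<rho> by (simp add: exp_of_nat_mult[symmetric] mult.commute)
    show "exp (2 * pi / (cmod ?w - 1)) \<le> exp (2 * pi / \<rho>)"
      unfolding w using er \<rho> by (auto intro!: divide_left_mono)
  qed (use \<rho> in auto)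
  finally have 1: "(\<Prod>i<q. cmod (?w - ee ((y + real (l * q) * \<omega>) + real i * \<omega>))) \<le> 2 * exp (\<rho> * real q) * exp (2 * pi / \<rho>)" .
  have "(\<Prod>i<Suc l * q. cmod (?w - ee (y + real i * \<omega>)))
     = (\<Prod>i<l * q. cmod (?w - ee (y + real i * \<omega>))) * (\<Prod>i<q. cmod (?w - ee (y + real (l * q + i) * \<omega>)))"
  proof -
    have "(\<Prod>i<a + b. f i) = (\<Prod>i<a. f i) * (\<Prod>i<b. f (a + i))" for f :: "nat \<Rightarrow> real" and a b
      by (induction b) (simp_all add: mult.assoc)
    from this[of _ "l * q" q] show ?thesis by (simp add: add.commute)
  qed
  also have "(\<Prod>i<q. cmod (?w - ee (y + real (l * q + i) * \<omega>))) = (\<Prod>i<q. cmod (?w - ee ((y + real (l * q) * \<omega>) + real i * \<omega>)))"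
    by (intro prod.cong refl) (simp add: algebra_simps)
  also have "(\<Prod>i<l * q. cmod (?w - ee (y + real i * \<omega>))) * \<dots> \<le> (2 * exp (\<rho> * real q) * exp (2 * pi / \<rho>)) ^ l * (2 * exp (\<rho> * real q) * exp (2 * pi / \<rho>))"
    by (intro mult_mono Suc 1 prod_nonneg) auto
  finally show ?case by (simp add: mult.commute)
qed

text \<open>An energy slightly outside [-2, 2] is moved to the nearest value of 2 cos; with \<rho>^2
  = 2 \<epsilon> the displaced node pays for this move and for the added \<open>\<epsilon>\<close>.
  The index \<open>k\<close> is supplied to complete \<open>2 * s\<close> blocks, and its factor is
  at least \<open>2 * \<epsilon>\<close>.\<close>

lemma prod_rows_upper:
  fixes p :: int and q s k :: nat and y \<omega> \<epsilon> e :: real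
  assumes q: "q > 0" and cop: "coprime p (int q)" and app: "\<bar>\<omega> - of_int p / real q\<bar> \<le> 1 / (real q * real q)"
    and k: "Suc k = 2 * s * q" and \<epsilon>: "0 < \<epsilon>" and e: "\<bar>e\<bar> \<le> 2 + \<epsilon>"
  shows "(\<Prod>i = 0..<k. \<bar>2 * cos (2 * pi * (y + real i * \<omega>)) - e\<bar> + \<epsilon>)
    \<le> (2 * exp (sqrt (2 * \<epsilon>) * real q) * exp (2 * pi / sqrt (2 * \<epsilon>))) ^ (4 * s) / (2 * \<epsilon>)"
proof -
  define \<rho> where "\<rho> = sqrt (2 * \<epsilon>)"
  have \<rho>: "0 < \<rho>" "\<rho>\<^sup>2 = 2 * \<epsilon>" using \<epsilon> by (auto simp: \<rho>_def)
  define e' where "e' = max (-2) (min 2 e)"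
  have e': "\<bar>e' / 2\<bar> \<le> 1" "\<bar>e - e'\<bar> \<le> \<epsilon>" using e \<epsilon> by (auto simp: e'_def max_def min_def)
  define \<tau> where "\<tau> = arccos (e' / 2) / (2 * pi)"
  have tau: "2 * cos (2 * pi * \<tau>) = e'" using e'(1) by (simp add: \<tau>_def cos_arccos_abs)
  let ?w = "exp (of_real \<rho>) * ee \<tau>"
  let ?g = "\<lambda>i. cmod (?w - ee (y + real i * \<omega>)) * cmod (?w - ee (- (y + real i * \<omega>)))"
  have g: "\<bar>2 * cos (2 * pi * (y + real i * \<omega>)) - e\<bar> + \<epsilon> \<le> ?g i" for i
    using two_cos_diff_le[of \<rho> "y + real i * \<omega>" \<tau>] \<rho> e'(2) unfolding tau by linarith
  have gk: "2 * \<epsilon> \<le> ?g k"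
    using two_cos_diff_le[of \<rho> "y + real k * \<omega>" \<tau>] \<rho> by (smt (verit) abs_ge_zero)
  have app2: "\<bar>- \<omega> - of_int (- p) / real q\<bar> \<le> 1 / (real q * real q)" using app by (simp add: abs_minus_commute)
  have cop2: "coprime (- p) (int q)" using cop by simp
  have neg: "- (y + real i * \<omega>) = - y + real i * (- \<omega>)" for i by simp
  have "(\<Prod>i = 0..<k. \<bar>2 * cos (2 * pi * (y + real i * \<omega>)) - e\<bar> + \<epsilon>) \<le> (\<Prod>i = 0..<k. ?g i)"
    using \<epsilon> by (intro prod_mono conjI g) auto
  moreover have "(\<Prod>i = 0..<k. ?g i) * (2 * \<epsilon>) \<le> (\<Prod>i = 0..<k. ?g i) * ?g k"
    by (intro mult_left_mono gk prod_nonneg) auto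
  moreover have "(\<Prod>i = 0..<k. ?g i) * ?g k = (\<Prod>i<2 * s * q. ?g i)"
    unfolding k[symmetric] by (simp add: atLeast0LessThan)
  moreover have "(\<Prod>i<2 * s * q. ?g i) \<le> (2 * exp (\<rho> * real q) * exp (2 * pi / \<rho>)) ^ (2 * s) * (2 * exp (\<rho> * real q) * exp (2 * pi / \<rho>)) ^ (2 * s)"
    unfolding prod.distrib neg
    by (intro mult_mono run_upper[OF q cop app \<rho>(1)] run_upper[OF q cop2 app2 \<rho>(1)] prod_nonneg) auto
  moreover have "(\<Prod>i = 0..<k. \<bar>2 * cos (2 * pi * (y + real i * \<omega>)) - e\<bar> + \<epsilon>) * (2 * \<epsilon>) \<le> (\<Prod>i = 0..<k. ?g i) * (2 * \<epsilon>)"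
    using calculation(1) \<epsilon> by (intro mult_right_mono) auto
  ultimately have "(\<Prod>i = 0..<k. \<bar>2 * cos (2 * pi * (y + real i * \<omega>)) - e\<bar> + \<epsilon>) * (2 * \<epsilon>)
      \<le> (2 * exp (\<rho> * real q) * exp (2 * pi / \<rho>)) ^ (2 * s) * (2 * exp (\<rho> * real q) * exp (2 * pi / \<rho>)) ^ (2 * s)"
    by linarith
  also have "\<dots> = (2 * exp (\<rho> * real q) * exp (2 * pi / \<rho>)) ^ (4 * s)" by (simp flip: power_add)
  finally show ?thesis unfolding \<rho>_def using \<epsilon> by (simp add: field_simps)
qed

section \<open>A good window at one of two sites\<close>

definition green_on :: "nat \<Rightarrow> (nat \<Rightarrow> nat \<Rightarrow> complex) \<Rightarrow> (nat \<Rightarrow> nat \<Rightarrow> complex) \<Rightarrow> bool" where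
  "green_on k M G \<longleftrightarrow> (\<forall>i<k. \<forall>z<k. (\<Sum>y = 0..<k. G i y * M y z) = (if i = z then 1 else 0))"

text \<open>The logarithms of |2 cos - e| for |e| \<le> 2 and of the chords between nodes average to
  zero over the circle. Numerator and denominator in Cramer's rule therefore lose only through small
  divisors and through constants per block, which \<open>L\<close> collects. The determinant bound
  is available for one of the two windows only, hence the alternative.\<close>

lemma green_dichotomy_aux:
  fixes B c0 \<epsilon> \<omega> x e \<kappa> L :: real and n :: nat and m :: int and c :: "int \<Rightarrow> complex"
  assumes B: "0 < B" and c0: "0 < c0" "c0 \<le> 1" and \<epsilon>: "0 < \<epsilon>" "sqrt (2 * \<epsilon>) \<le> B"
    and L: "ln 2 + 2 * pi / sqrt (2 * \<epsilon>) \<le> L" "4 * ln 16 + 16 * ln (8 / (3 * c0)) \<le> L"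
    and n: "1000 \<le> n" "40 * (exp L / c0 + 2) \<le> real n" "real n / (2 * \<epsilon>\<^sup>2 * c0 ^ 24) \<le> exp (B * real n)"
    and dc: "\<And>d::int. d \<noteq> 0 \<Longrightarrow> \<bar>d\<bar> < 2 * int n \<Longrightarrow> c0 * exp (- B * real_of_int \<bar>d\<bar>) \<le> dz (of_int d * \<omega>)"
    and nr: "\<And>s'::int. \<bar>s'\<bar> \<le> 3 * int n \<Longrightarrow> exp (- B * real n) \<le> dz (2 * x + of_int (2 * m + s') * \<omega>)"
    and e: "\<bar>e\<bar> \<le> 2 + \<epsilon>" and \<kappa>: "0 \<le> \<kappa>"
    and row: "\<And>k r. k \<le> n \<Longrightarrow> r < k \<Longrightarrow> (\<Sum>j\<in>{0..<k} - {r}. cmod (c (int r - int j)) * exp (\<kappa> * \<bar>real r - real j\<bar>)) \<le> \<epsilon>"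
  obtains a k G m' where "m' = m \<or> m' = m + int n" "k \<le> n"
    "of_int a + real n / 200 \<le> real_of_int m'" "of_int m' + real n / 200 \<le> of_int a + real k"
    "green_on k (toep k \<omega> c (complex_of_real e) (x + (of_int a + (real k - 1) / 2) * \<omega>)) G"
    "\<And>i y. i < k \<Longrightarrow> y < k \<Longrightarrow> cmod (G i y) \<le> exp (51 * B * real n - \<kappa> * \<bar>real i - real y\<bar>)"
proof -
  define N where "N = n div 40"
  have N: "16 \<le> N" "40 * N \<le> n" "n \<le> 40 * N + 39" using n(1) by (auto simp: N_def)
  have N0: "0 < N" using N by simp
  have Nr: "40 * real N \<le> real n" "real n \<le> 40 * real N + 39" using N(2,3) by linarith+
  obtain p q' where pq: "coprime p q'" "0 < q'" "q' \<le> int N" "\<bar>of_int q' * \<omega> - of_int p\<bar> < 1 / real N"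
    by (rule Dirichlet_approx_coprime[OF N0])
  define q where "q = nat q'"
  have q: "q > 0" "coprime p (int q)" "q \<le> N" "\<bar>real q * \<omega> - of_int p\<bar> \<le> 1 / real N"
    using pq by (auto simp: q_def)
  define s where "s = N div q"
  have s: "1 \<le> s" "s * q \<le> N" "N \<le> 2 * (s * q)"
  proof -
    show "1 \<le> s" unfolding s_def using q by (simp add: div_greater_zero_iff Suc_le_eq)
    show "s * q \<le> N" unfolding s_def by (rule div_times_less_eq_dividend)
    have "N = s * q + N mod q" unfolding s_def by simp
    moreover have "N mod q < q" using q by simp
    moreover have "q \<le> s * q" using \<open>1 \<le> s\<close> by simp
    ultimately show "N \<le> 2 * (s * q)" by linarith
  qed
  define k where "k = 2 * s * q - 1"
  have k: "Suc k = 2 * s * q" unfolding k_def using s q by simp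
  have kn: "k \<le> n" "2 * real (2 * k + 1) \<le> real n"
  proof -
    have "Suc k \<le> 2 * N" using k s by simp
    then have "4 * k + 2 \<le> n" using N(2) by simp
    then have "2 * (2 * k + 1) \<le> n" "k \<le> n" by simp_all
    then have "real (2 * (2 * k + 1)) \<le> real n" by (simp only: of_nat_le_iff)
    then show "k \<le> n" "2 * real (2 * k + 1) \<le> real n" using \<open>k \<le> n\<close> by simp_all
  qed
  have app': "\<bar>\<omega> - of_int p / real q\<bar> \<le> 1 / (real q * real q)"
  proof -
    have "\<omega> - of_int p / real q = (real q * \<omega> - of_int p) / real q" using q by (simp add: field_simps)
    then have "\<bar>\<omega> - of_int p / real q\<bar> = \<bar>real q * \<omega> - of_int p\<bar> / real q" by simp
    also have "\<dots> \<le> (1 / real q) / real q"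
    proof (intro divide_right_mono)
      have "1 / real N \<le> 1 / real q" using q by (intro divide_left_mono) auto
      then show "\<bar>real q * \<omega> - of_int p\<bar> \<le> 1 / real q" using q(4) by linarith
    qed simp
    finally show ?thesis by simp
  qed
  \<comment> \<open>A small \<open>q\<close> would contradict the divisor bound, because Dirichlet's
    theorem at scale \<open>N\<close> puts q omega too close to an integer. So the constant cost
    \<open>L\<close> of a block is at most \<open>B * q\<close>, and \<open>s\<close> blocks cost at
    most B n / 40.\<close>
  have qL: "L \<le> B * real q"
  proof (rule ccontr)
    assume "\<not> ?thesis"
    then have "exp (B * real q) < exp L" by simp
    have "int q < 2 * int n" using q N by linarith
    then have "c0 * exp (- B * real q) \<le> dz (real q * \<omega>)" using dc[of "int q"] q by simp
    also have "\<dots> \<le> 1 / real N" using dz_le[of "real q * \<omega>" p] q(4) by linarith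
    finally have "c0 * real N \<le> exp (B * real q)" using N0 by (simp add: exp_minus field_simps)
    then have "c0 * real N < exp L" using \<open>exp (B * real q) < exp L\<close> by linarith
    then have "real N < exp L / c0" using c0 by (simp add: field_simps)
    moreover have "X + 1 \<le> real N" if "40 * (X + 2) \<le> real n" for X using that Nr(2) by argo
    from this[OF n(2)] have "exp L / c0 + 1 \<le> real N" .
    ultimately show False by simp
  qed
  have sqB: "B * (real s * real q) \<le> B * real n / 40"
  proof -
    have "real (s * q) \<le> real N" using s(2) by (simp only: of_nat_le_iff)
    then have "real (s * q) \<le> real n / 40" using Nr(1) by linarith
    then have "B * real (s * q) \<le> B * (real n / 40)" using B by (intro mult_left_mono) auto
    then show ?thesis by simp
  qed
  have sL: "real s * L \<le> B * real n / 40"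
  proof -
    have "real s * L \<le> real s * (B * real q)" using qL by (intro mult_left_mono) auto
    then show ?thesis using sqB by (simp add: mult_ac)
  qed
  obtain a where a: "m - int (s * q) - int (s * q div 2) \<le> a \<and> a < m - int (s * q div 2) \<or>
      m + int n - int (s * q) - int (s * q div 2) \<le> a \<and> a < m + int n - int (s * q div 2)"
    "((1/16) ^ s * ((3/8) * c0 * exp (- B * real q)) ^ (4 * s)) ^ 4 * (c0 * exp (- (2 * B) * real n)) ^ 24 / (2 * real (2 * k + 1))
     \<le> cmod (fdet k (toep k \<omega> c (complex_of_real e) (x + (of_int a + (real k - 1) / 2) * \<omega>)))"
    using exists_large_det[OF q(1,2,4) s(1,2) N(1,2) k c0 B dc nr] by blast
  define t where "t = x + (of_int a + (real k - 1) / 2) * \<omega>"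
  let ?M = "toep k \<omega> c (complex_of_real e) t"
  let ?R = "\<lambda>r. \<bar>2 * cos (2 * pi * ((x + of_int a * \<omega>) + real r * \<omega>)) - e\<bar> + \<epsilon>"
  have det_low: "exp (- 49 * B * real n) * c0 ^ 24 / real n \<le> cmod (fdet k ?M)"
  proof -
    have l16: "(1/16::real) = exp (- ln 16)" by (simp add: exp_minus)
    have l38: "(3/8) * c0 = exp (- ln (8 / (3 * c0)))" using c0 by (simp add: exp_minus)
    have "((1/16) ^ s * ((3/8) * c0 * exp (- B * real q)) ^ (4 * s)) ^ 4 * (c0 * exp (- (2 * B) * real n)) ^ 24
        = exp (- (real s * (4 * ln 16 + 16 * ln (8 / (3 * c0)))) - 16 * (B * (real s * real q)) - 48 * (B * real n)) * c0 ^ 24"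
      unfolding l16 l38 by (simp add: power_mult_distrib exp_of_nat_mult[symmetric] exp_add[symmetric] algebra_simps flip: power_mult)
    moreover have "real s * (4 * ln 16 + 16 * ln (8 / (3 * c0))) \<le> real s * L" using L(2) by (intro mult_left_mono) auto
    \<comment> \<open>The 24 weak factors cost 48 B n; the term 16 B s q and the block constants
      together stay below 17 B n / 40.\<close>
    then have "- 49 * B * real n \<le> - (real s * (4 * ln 16 + 16 * ln (8 / (3 * c0)))) - 16 * (B * (real s * real q)) - 48 * (B * real n)"
    proof -
      assume T: "real s * (4 * ln 16 + 16 * ln (8 / (3 * c0))) \<le> real s * L"
      have "0 \<le> B * real n" using B by simp
      moreover have "- 49 * B * real n = - 49 * (B * real n)" by simp
      ultimately show ?thesis using T sL sqB by linarith
    qed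
    then have "exp (- 49 * B * real n) * c0 ^ 24 \<le> exp (- (real s * (4 * ln 16 + 16 * ln (8 / (3 * c0)))) - 16 * (B * (real s * real q)) - 48 * (B * real n)) * c0 ^ 24"
      using c0 by (intro mult_right_mono) auto
    ultimately have "exp (- 49 * B * real n) * c0 ^ 24 \<le> ((1/16) ^ s * ((3/8) * c0 * exp (- B * real q)) ^ (4 * s)) ^ 4 * (c0 * exp (- (2 * B) * real n)) ^ 24"
      by linarith
    then have "exp (- 49 * B * real n) * c0 ^ 24 / real n \<le> ((1/16) ^ s * ((3/8) * c0 * exp (- B * real q)) ^ (4 * s)) ^ 4 * (c0 * exp (- (2 * B) * real n)) ^ 24 / (2 * real (2 * k + 1))"
      using kn(2) c0 by (intro frac_le) auto
    then show ?thesis using a(2) unfolding t_def by linarith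
  qed
  have n0: "0 < real n" using n by simp
  have det_pos: "0 < exp (- 49 * B * real n) * c0 ^ 24 / real n" using c0 n0 by simp
  then have d: "fdet k ?M \<noteq> 0" using det_low by auto
  have Rp: "(\<Prod>r = 0..<k. ?R r) \<le> exp (B * real n) / (2 * \<epsilon>)"
  proof -
    let ?r = "sqrt (2 * \<epsilon>)"
    have "(\<Prod>r = 0..<k. ?R r) \<le> (2 * exp (?r * real q) * exp (2 * pi / ?r)) ^ (4 * s) / (2 * \<epsilon>)"
      by (rule prod_rows_upper[OF q(1,2) app' k \<epsilon>(1) e])
    also have "(2 * exp (?r * real q) * exp (2 * pi / ?r)) ^ (4 * s) = exp (4 * (real s * (ln 2 + 2 * pi / ?r)) + 4 * (?r * (real s * real q)))"
    proof -
      have "2 * exp (?r * real q) * exp (2 * pi / ?r) = exp (ln 2 + ?r * real q + 2 * pi / ?r)" by (simp add: exp_add)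
      then show ?thesis by (simp add: exp_of_nat_mult[symmetric] algebra_simps)
    qed
    also have "\<dots> \<le> exp (B * real n)"
    proof -
      have 1: "real s * (ln 2 + 2 * pi / ?r) \<le> real s * L" using L(1) by (intro mult_left_mono) auto
      have 2: "?r * (real s * real q) \<le> B * (real s * real q)" using \<epsilon>(2) by (intro mult_right_mono) auto
      have "0 \<le> B * real n" using B by simp
      then have "4 * (real s * (ln 2 + 2 * pi / ?r)) + 4 * (?r * (real s * real q)) \<le> B * real n" using 1 2 sL sqB by linarith
      then show ?thesis by simp
    qed
    finally show ?thesis using \<epsilon> by (simp add: divide_right_mono)
  qed
  have diag: "toep k \<omega> c (complex_of_real e) t r r = complex_of_real (2 * cos (2 * pi * ((x + of_int a * \<omega>) + real r * \<omega>)) - e)" for r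
  proof -
    have "t + (real r - (real k - 1) / 2) * \<omega> = (x + of_int a * \<omega>) + real r * \<omega>" by (simp add: t_def algebra_simps)
    then show ?thesis by (simp add: toep_def)
  qed
  have rows: "(\<Sum>j = 0..<k. cmod (?M r j) * exp (\<kappa> * \<bar>real r - real j\<bar>)) \<le> ?R r" if r: "r < k" for r
  proof -
    have "(\<Sum>j = 0..<k. cmod (?M r j) * exp (\<kappa> * \<bar>real r - real j\<bar>))
       = cmod (?M r r) + (\<Sum>j\<in>{0..<k} - {r}. cmod (?M r j) * exp (\<kappa> * \<bar>real r - real j\<bar>))"
      using r by (subst sum.remove[of _ r]) auto
    also have "(\<Sum>j\<in>{0..<k} - {r}. cmod (?M r j) * exp (\<kappa> * \<bar>real r - real j\<bar>)) = (\<Sum>j\<in>{0..<k} - {r}. cmod (c (int r - int j)) * exp (\<kappa> * \<bar>real r - real j\<bar>))"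
      by (intro sum.cong) (auto simp: toep_def)
    also have "\<dots> \<le> \<epsilon>" by (rule row[OF kn(1) r])
    finally show ?thesis unfolding diag norm_of_real by simp
  qed
  obtain G where G: "\<And>i z. i < k \<Longrightarrow> z < k \<Longrightarrow> (\<Sum>y = 0..<k. G i y * ?M y z) = (if i = z then 1 else 0)"
    "\<And>i y. i < k \<Longrightarrow> y < k \<Longrightarrow> cmod (G i y) \<le> exp (- \<kappa> * \<bar>real i - real y\<bar>) * (\<Prod>r = 0..<k. ?R r) / \<epsilon> / cmod (fdet k ?M)"
    by (rule green_function_bound[OF \<kappa> \<epsilon>(1), of k ?R ?M]) (use rows d in auto)
  have Gb: "cmod (G i y) \<le> exp (51 * B * real n - \<kappa> * \<bar>real i - real y\<bar>)" if iy: "i < k" "y < k" for i y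
  proof -
    let ?K = "exp (- \<kappa> * \<bar>real i - real y\<bar>)"
    have "?K * (\<Prod>r = 0..<k. ?R r) / \<epsilon> / cmod (fdet k ?M) \<le> ?K * (exp (B * real n) / (2 * \<epsilon>)) / \<epsilon> / (exp (- 49 * B * real n) * c0 ^ 24 / real n)"
      using Rp det_low det_pos \<epsilon> by (intro frac_le divide_right_mono mult_left_mono divide_nonneg_nonneg mult_nonneg_nonneg) auto
    also have "\<dots> = ?K * exp (B * real n) * exp (49 * B * real n) * (real n / (2 * \<epsilon>\<^sup>2 * c0 ^ 24))"
      using n0 \<epsilon> c0 by (simp add: exp_minus field_simps power2_eq_square)
    \<comment> \<open>The sum 51 consists of 49 from the determinant, 1 from the product of the rows
      and 1 for the polynomial factor.\<close>
    also have "\<dots> \<le> ?K * exp (B * real n) * exp (49 * B * real n) * exp (B * real n)"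
      using n(3) by (intro mult_left_mono) auto
    also have "\<dots> = exp (51 * B * real n - \<kappa> * \<bar>real i - real y\<bar>)" by (simp add: exp_add[symmetric] algebra_simps)
    finally show ?thesis using G(2)[OF iy] by linarith
  qed
  define v where "v = s * q"
  \<comment> \<open>The margin to either end is at least v/2 - 1, hence at least n/160 - 5/4, and
    this bound reaches n/200 precisely from n = 1000 on.\<close>
  have v: "real v \<ge> real n / 80 - 1/2" "real (v div 2) \<ge> real v / 2 - 1/2" "real (v div 2) \<le> real v / 2" "real k = 2 * real v - 1"
  proof -
    have "real N \<le> real (2 * v)" using s(3) unfolding v_def by (simp only: of_nat_le_iff)
    then show "real v \<ge> real n / 80 - 1/2" using Nr(2) by simp
    show "real (v div 2) \<ge> real v / 2 - 1/2" "real (v div 2) \<le> real v / 2" by linarith+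
    show "real k = 2 * real v - 1" using arg_cong[OF k, of real] unfolding v_def by simp
  qed
  have gr: "green_on k ?M G" unfolding green_on_def using G(1) by blast
  from a(1) show thesis
  proof
    assume a1: "m - int (s * q) - int (s * q div 2) \<le> a \<and> a < m - int (s * q div 2)"
    then have "real_of_int m - real v - real (v div 2) \<le> of_int a" "of_int a \<le> real_of_int m - real (v div 2) - 1"
      unfolding v_def by linarith+
    then show thesis using v n(1) by (intro that[of m k a G] gr[unfolded t_def] Gb kn) auto
  next
    assume a1: "m + int n - int (s * q) - int (s * q div 2) \<le> a \<and> a < m + int n - int (s * q div 2)"
    then have "real_of_int (m + int n) - real v - real (v div 2) \<le> of_int a" "of_int a \<le> real_of_int (m + int n) - real (v div 2) - 1"
      unfolding v_def by linarith+
    then show thesis using v n(1) by (intro that[of "m + int n" k a G] gr[unfolded t_def] Gb kn) auto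
  qed
qed

subsection \<open>Decay of eigenvectors on the cycle\<close>

text \<open>The distance of \<open>d\<close> from the nearest multiple of \<open>Q\<close>, that is,
  the metric of the cycle of length \<open>Q\<close>.\<close>

definition cyn :: "nat \<Rightarrow> int \<Rightarrow> int" where
  "cyn Q d = min (d mod int Q) (int Q - d mod int Q)"

lemma cyn_le:
  assumes "Q > 0" shows "cyn Q d \<le> \<bar>d + k * int Q\<bar>"
proof -
  define r where "r = d mod int Q"
  define t where "t = d div int Q + k"
  have r: "0 \<le> r" "r < int Q" using assms by (auto simp: r_def)
  have e: "d + k * int Q = r + t * int Q" unfolding r_def t_def by (simp add: algebra_simps)
  consider "t \<ge> 0" | "t \<le> -1" by linarith
  then show ?thesis
  proof cases
    case 1
    then have "0 \<le> t * int Q" by simp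
    then show ?thesis unfolding e cyn_def r_def[symmetric] using r by linarith
  next
    case 2
    then have "t * int Q \<le> (-1) * int Q" by (intro mult_right_mono) auto
    then show ?thesis unfolding e cyn_def r_def[symmetric] using r by linarith
  qed
qed

lemma cyn_attained:
  assumes "Q > 0" shows "\<exists>k. cyn Q d = \<bar>d + k * int Q\<bar>"
proof -
  have d: "d + (- (d div int Q)) * int Q = d mod int Q"
    using minus_div_mult_eq_mod[of d "int Q"] by simp
  have d': "d + (- (d div int Q) - 1) * int Q = d mod int Q - int Q"
    using d by (simp add: left_diff_distrib)
  have r: "0 \<le> d mod int Q" "d mod int Q < int Q" using assms by auto
  show ?thesis
  proof (cases "d mod int Q \<le> int Q - d mod int Q")
    case True
    then have "cyn Q d = \<bar>d + (- (d div int Q)) * int Q\<bar>" unfolding d cyn_def using r by simp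
    then show ?thesis by blast
  next
    case False
    then have "cyn Q d = \<bar>d + (- (d div int Q) - 1) * int Q\<bar>" unfolding d' cyn_def using r by simp
    then show ?thesis by blast
  qed
qed

lemma cyn_nonneg: "Q > 0 \<Longrightarrow> 0 \<le> cyn Q d"
  using pos_mod_bound[of "int Q" d] pos_mod_sign[of "int Q" d] unfolding cyn_def by linarith

lemma cyn_triangle:
  assumes Q: "Q > 0" shows "cyn Q (d + d') \<le> cyn Q d + cyn Q d'"
proof -
  obtain k k' where k: "cyn Q d = \<bar>d + k * int Q\<bar>" "cyn Q d' = \<bar>d' + k' * int Q\<bar>"
    using cyn_attained[OF Q] by meson
  have "cyn Q (d + d') \<le> \<bar>(d + d') + (k + k') * int Q\<bar>" by (rule cyn_le[OF Q])
  also have "(d + d') + (k + k') * int Q = (d + k * int Q) + (d' + k' * int Q)" by (simp add: distrib_right)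
  finally show ?thesis unfolding k by linarith
qed

lemma cyn_minus:
  assumes Q: "Q > 0" shows "cyn Q (- d) = cyn Q d"
proof -
  have "cyn Q (- d) \<le> cyn Q d" for d
  proof -
    obtain k where k: "cyn Q d = \<bar>d + k * int Q\<bar>" using cyn_attained[OF Q] by blast
    have "cyn Q (- d) \<le> \<bar>- d + (- k) * int Q\<bar>" by (rule cyn_le[OF Q])
    also have "\<dots> = \<bar>d + k * int Q\<bar>" by simp
    finally show ?thesis unfolding k .
  qed
  from this[of d] this[of "- d"] show ?thesis by simp
qed

lemma cyn_between:
  assumes "0 \<le> d" "d < int Q" shows "cyn Q d = min d (int Q - d)"
  using assms by (simp add: cyn_def)

lemma cyn_small:
  assumes "Q > 0" "2 * \<bar>d\<bar> \<le> int Q" shows "cyn Q d = \<bar>d\<bar>"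
proof (cases "d \<ge> 0")
  case True then show ?thesis using assms by (simp add: cyn_between)
next
  case False
  then have "cyn Q (- d) = - d" using assms by (simp add: cyn_between)
  then show ?thesis using cyn_minus[OF assms(1), of d] False by simp
qed

text \<open>Fibres of size at most two leave twice a geometric series, and 1 / (1 - exp (- t)) is at
  most 1 + 1/t.\<close>

lemma sum_exp_fibre_le:
  fixes f :: "'a \<Rightarrow> int" and t :: real
  assumes fin: "finite A" and f0: "\<And>a. a \<in> A \<Longrightarrow> 0 \<le> f a" and fib: "\<And>d. card {a\<in>A. f a = d} \<le> 2" and t: "0 < t"
  shows "(\<Sum>a\<in>A. exp (- t * of_int (f a))) \<le> 2 * (1 + 1 / t)"
proof -
  obtain M where M: "\<And>a. a \<in> A \<Longrightarrow> f a < int M"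
  proof -
    have "\<exists>M. \<forall>a\<in>A. f a < int M"
    proof (intro exI ballI)
      fix a assume "a \<in> A"
      then have "f a \<le> Max (f ` A)" using fin by simp
      then show "f a < int (nat (Max (f ` A) + 1))" using f0[OF \<open>a \<in> A\<close>] by linarith
    qed
    then show thesis using that by blast
  qed
  let ?x = "exp (- t)"
  have x: "0 < ?x" "?x < 1" using t by auto
  have "(\<Sum>a\<in>A. exp (- t * of_int (f a))) = (\<Sum>a\<in>A. ?x ^ nat (f a))"
    using f0 by (intro sum.cong refl) (simp add: exp_of_nat_mult[symmetric] mult.commute)
  also have "\<dots> = (\<Sum>d<M. \<Sum>a\<in>{a\<in>A. nat (f a) = d}. ?x ^ nat (f a))"
  proof (rule sum.group[symmetric, OF fin])
    show "(\<lambda>a. nat (f a)) ` A \<subseteq> {..<M}"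
    proof
      fix d assume "d \<in> (\<lambda>a. nat (f a)) ` A"
      then obtain a where "a \<in> A" "d = nat (f a)" by blast
      then show "d \<in> {..<M}" using M[of a] f0[of a] by simp
    qed
  qed simp
  also have "\<dots> = (\<Sum>d<M. real (card {a\<in>A. nat (f a) = d}) * ?x ^ d)" by simp
  also have "\<dots> \<le> (\<Sum>d<M. 2 * ?x ^ d)"
  proof (intro sum_mono mult_right_mono)
    fix d
    have "{a\<in>A. nat (f a) = d} \<subseteq> {a\<in>A. f a = int d}" using f0 by force
    then have "card {a\<in>A. nat (f a) = d} \<le> 2"
      using card_mono[of "{a\<in>A. f a = int d}" "{a\<in>A. nat (f a) = d}"] fib[of "int d"] fin by simp
    then show "real (card {a\<in>A. nat (f a) = d}) \<le> 2" by simp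
  qed auto
  also have "\<dots> = 2 * ((1 - ?x ^ M) / (1 - ?x))" using x by (simp add: sum_distrib_left[symmetric] sum_gp_strict)
  also have "\<dots> \<le> 2 * (1 + 1 / t)"
  proof -
    have "(1 - ?x ^ M) / (1 - ?x) \<le> 1 / (1 - ?x)" using x by (intro divide_right_mono) auto
    also have "\<dots> \<le> 1 + 1 / t"
    proof -
      have "1 + t \<le> exp t" by simp
      then have "?x \<le> 1 / (1 + t)" using t by (simp add: exp_minus field_simps)
      then have "t / (1 + t) \<le> 1 - ?x" using t by (simp add: field_simps)
      then have "1 / (1 - ?x) \<le> 1 / (t / (1 + t))" using t x by (intro divide_left_mono) auto
      then show ?thesis using t by (simp add: add_divide_distrib)
    qed
    finally show ?thesis by (intro mult_left_mono) auto
  qed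
  finally show ?thesis .
qed

lemma bij_betw_mod_period:
  assumes Q: "Q > 0" shows "bij_betw (\<lambda>l. l mod int Q) {a..<a + int Q} {0..<int Q}"
proof -
  have inj: "inj_on (\<lambda>l. l mod int Q) {a..<a + int Q}"
  proof (rule inj_onI)
    fix l l' assume l: "l \<in> {a..<a + int Q}" "l' \<in> {a..<a + int Q}" "l mod int Q = l' mod int Q"
    then have "int Q dvd l - l'" by (simp add: mod_eq_dvd_iff)
    moreover have "\<bar>l - l'\<bar> < int Q" using l by auto
    ultimately show "l = l'" using dvd_imp_le_int[of "l - l'" "int Q"] by fastforce
  qed
  moreover have "(\<lambda>l. l mod int Q) ` {a..<a + int Q} = {0..<int Q}"
    by (rule card_subset_eq) (use Q in \<open>auto simp: card_image[OF inj]\<close>)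
  ultimately show ?thesis by (simp add: bij_betw_def)
qed

lemma sum_period:
  fixes f :: "int \<Rightarrow> 'a::comm_monoid_add"
  assumes Q: "Q > 0" and per: "\<And>l. f (l + int Q) = f l"
  shows "(\<Sum>l\<in>{a..<a + int Q}. f l) = (\<Sum>l\<in>{0..<int Q}. f l)" and "f (l mod int Q) = f l"
proof -
  have pn: "f (l + int k * int Q) = f l" for l k
  proof (induction k)
    case (Suc k) then show ?case using per[of "l + int k * int Q"] by (simp add: algebra_simps)
  qed simp
  have m: "f (l mod int Q) = f l" for l
  proof (cases "l div int Q \<ge> 0")
    case True
    then have "l = l mod int Q + int (nat (l div int Q)) * int Q" by simp
    then show ?thesis using pn[of "l mod int Q" "nat (l div int Q)"] by simp
  next
    case False
    then have "l mod int Q = l + int (nat (- (l div int Q))) * int Q"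
      using minus_div_mult_eq_mod[of l "int Q"] by simp
    then show ?thesis using pn[of l "nat (- (l div int Q))"] by simp
  qed
  then show "f (l mod int Q) = f l" .
  show "(\<Sum>l\<in>{a..<a + int Q}. f l) = (\<Sum>l\<in>{0..<int Q}. f l)"
    using sum.reindex_bij_betw[OF bij_betw_mod_period[OF Q], of f a] by (simp add: m)
qed

lemma sum_exp_cyn_le:
  fixes t :: real
  assumes Q: "Q > 0" and t: "0 < t"
  shows "(\<Sum>l\<in>{0..<int Q}. exp (- t * of_int (cyn Q (m - l)))) \<le> 2 * (1 + 1 / t)"
proof (rule sum_exp_fibre_le)
  show "card {l \<in> {0..<int Q}. cyn Q (m - l) = d} \<le> 2" for d
  proof -
    have "{l \<in> {0..<int Q}. cyn Q (m - l) = d} \<subseteq> {(m - d) mod int Q, (m + d) mod int Q}"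
    proof
      fix l assume "l \<in> {l \<in> {0..<int Q}. cyn Q (m - l) = d}"
      then have l: "0 \<le> l" "l < int Q" "cyn Q (m - l) = d" by auto
      obtain k where k: "d = \<bar>m - l + k * int Q\<bar>" using cyn_attained[OF Q, of "m - l"] l(3) by auto
      then have "m - l + k * int Q = d \<or> m - l + k * int Q = - d" by linarith
      then have "l = (m - d) + k * int Q \<or> l = (m + d) + k * int Q" by linarith
      then have "l mod int Q = (m - d) mod int Q \<or> l mod int Q = (m + d) mod int Q" by auto
      then show "l \<in> {(m - d) mod int Q, (m + d) mod int Q}" using l by simp
    qed
    then have "card {l \<in> {0..<int Q}. cyn Q (m - l) = d} \<le> card {(m - d) mod int Q, (m + d) mod int Q}"
      by (intro card_mono) auto
    also have "\<dots> \<le> 2" by (simp add: card_insert_if)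
    finally show ?thesis .
  qed
qed (use t in \<open>auto simp: cyn_nonneg[OF Q]\<close>)


text \<open>Applying the Green function of the window to the eigenvalue equation expresses the value
  at \<open>m'\<close> through values outside the window. Coefficients decaying at rate
  \<open>2 * \<kappa>\<close> and a Green function decaying at rate \<open>\<kappa>\<close> compose
  to a kernel of rate \<open>\<kappa>\<close>; half of it outweighs the growth of the Green
  function, the other half remains as the weight. The diagonal of \<open>toep\<close> does not
  contain \<open>c 0\<close>, so this mean value stands on the right and \<open>e\<close> is the
  energy relative to it.\<close>

lemma dual_decay:
  fixes B c0 \<epsilon> \<epsilon>1 \<omega> x e \<kappa> L :: real and n Q :: nat and m :: int and c \<phi> :: "int \<Rightarrow> complex"
  assumes B: "0 < B" and c0: "0 < c0" "c0 \<le> 1" and \<epsilon>: "0 < \<epsilon>" "sqrt (2 * \<epsilon>) \<le> B"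
    and L: "ln 2 + 2 * pi / sqrt (2 * \<epsilon>) \<le> L" "4 * ln 16 + 16 * ln (8 / (3 * c0)) \<le> L"
    and n: "1000 \<le> n" "40 * (exp L / c0 + 2) \<le> real n" "real n / (2 * \<epsilon>\<^sup>2 * c0 ^ 24) \<le> exp (B * real n)"
      "real n \<le> exp (B * real n)" "2 * n \<le> Q"
    and dc: "\<And>d::int. d \<noteq> 0 \<Longrightarrow> \<bar>d\<bar> < 2 * int n \<Longrightarrow> c0 * exp (- B * real_of_int \<bar>d\<bar>) \<le> dz (of_int d * \<omega>)"
    and nr: "\<And>s'::int. \<bar>s'\<bar> \<le> 3 * int n \<Longrightarrow> exp (- B * real n) \<le> dz (2 * x + of_int (2 * m + s') * \<omega>)"
    and e: "\<bar>e\<bar> \<le> 2 + \<epsilon>" and \<kappa>: "\<kappa> = 22000 * B"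
    and \<epsilon>1: "0 \<le> \<epsilon>1" "\<epsilon>1 \<le> 1" "\<epsilon>1 * (2 * (1 + 1 / \<kappa>)) \<le> \<epsilon>"
    and c: "\<And>d. cmod (c d) \<le> \<epsilon>1 * exp (- (2 * \<kappa>) * of_int (cyn Q d))" "\<And>d. c (d + int Q) = c d"
    and \<phi>: "\<And>l. \<phi> (l + int Q) = \<phi> l"
    and ev: "\<And>i. complex_of_real (2 * cos (2 * pi * (x + of_int i * \<omega>)) - e) * \<phi> i + (\<Sum>l\<in>{0..<int Q}. c (i - l) * \<phi> l) = c 0 * \<phi> i"
  obtains m' where "m' = m \<or> m' = m + int n"
    "cmod (\<phi> m') \<le> exp (- B * real n) * (\<Sum>l\<in>{0..<int Q}. exp (- (\<kappa> / 2) * of_int (cyn Q (m' - l))) * cmod (\<phi> l))"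
proof -
  have Q: "Q > 0" using n by linarith
  have \<kappa>0: "0 < \<kappa>" using \<kappa> B by simp
  have row: "(\<Sum>j\<in>{0..<k} - {r}. cmod (c (int r - int j)) * exp (\<kappa> * \<bar>real r - real j\<bar>)) \<le> \<epsilon>"
    if kr: "k \<le> n" "r < k" for k r
  proof -
    have "(\<Sum>j\<in>{0..<k} - {r}. cmod (c (int r - int j)) * exp (\<kappa> * \<bar>real r - real j\<bar>))
        \<le> (\<Sum>j\<in>{0..<k} - {r}. \<epsilon>1 * exp (- \<kappa> * of_int \<bar>int r - int j\<bar>))"
    proof (rule sum_mono)
      fix j assume j: "j \<in> {0..<k} - {r}"
      have "\<bar>int r - int j\<bar> \<le> int n" using j kr by auto
      moreover have "2 * int n \<le> int Q" using n(5) by simp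
      ultimately have "2 * \<bar>int r - int j\<bar> \<le> int Q" by (smt (verit))
      then have cy: "cyn Q (int r - int j) = \<bar>int r - int j\<bar>" by (rule cyn_small[OF Q])
      have rj: "\<bar>real r - real j\<bar> = of_int \<bar>int r - int j\<bar>" by simp
      have "cmod (c (int r - int j)) * exp (\<kappa> * \<bar>real r - real j\<bar>)
          \<le> (\<epsilon>1 * exp (- (2 * \<kappa>) * of_int \<bar>int r - int j\<bar>)) * exp (\<kappa> * of_int \<bar>int r - int j\<bar>)"
        unfolding rj by (rule mult_right_mono) (use c(1)[of "int r - int j"] cy in auto)
      also have "\<dots> = \<epsilon>1 * exp (- \<kappa> * of_int \<bar>int r - int j\<bar>)"
        by (simp add: mult.assoc exp_add[symmetric])
      finally show "cmod (c (int r - int j)) * exp (\<kappa> * \<bar>real r - real j\<bar>) \<le> \<epsilon>1 * exp (- \<kappa> * of_int \<bar>int r - int j\<bar>)" .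
    qed
    also have "\<dots> = \<epsilon>1 * (\<Sum>j\<in>{0..<k} - {r}. exp (- \<kappa> * of_int \<bar>int r - int j\<bar>))" by (simp add: sum_distrib_left)
    also have "\<dots> \<le> \<epsilon>1 * (2 * (1 + 1 / \<kappa>))"
    proof (intro mult_left_mono sum_exp_fibre_le)
      fix d :: int
      have "{a \<in> {0..<k} - {r}. \<bar>int r - int a\<bar> = d} \<subseteq> {nat (int r - d), nat (int r + d)}" by auto
      then have "card {a \<in> {0..<k} - {r}. \<bar>int r - int a\<bar> = d} \<le> card {nat (int r - d), nat (int r + d)}"
        by (intro card_mono) auto
      also have "\<dots> \<le> 2" by (simp add: card_insert_if)
      finally show "card {a \<in> {0..<k} - {r}. \<bar>int r - int a\<bar> = d} \<le> 2" .
    qed (use \<kappa>0 \<epsilon>1 in auto)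
    also have "\<dots> \<le> \<epsilon>" by (rule \<epsilon>1(3))
    finally show ?thesis .
  qed
  obtain a k G m' where g: "m' = m \<or> m' = m + int n" "k \<le> n"
    "of_int a + real n / 200 \<le> real_of_int m'" "of_int m' + real n / 200 \<le> of_int a + real k"
    "green_on k (toep k \<omega> c (complex_of_real e) (x + (of_int a + (real k - 1) / 2) * \<omega>)) G"
    "\<And>i y. i < k \<Longrightarrow> y < k \<Longrightarrow> cmod (G i y) \<le> exp (51 * B * real n - \<kappa> * \<bar>real i - real y\<bar>)"
    by (rule green_dichotomy_aux[OF B c0 \<epsilon> L n(1-3) dc nr e less_imp_le[OF \<kappa>0] row]) (assumption | (rule that; assumption))+
  let ?M = "toep k \<omega> c (complex_of_real e) (x + (of_int a + (real k - 1) / 2) * \<omega>)"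
  have n1: "real n / 200 \<ge> 5" using n(1) by simp
  have am: "a \<le> m'" "m' < a + int k" using g(3,4) n1 by linarith+
  define i0 where "i0 = nat (m' - a)"
  have i0: "i0 < k" "int i0 = m' - a" using am by (auto simp: i0_def)
  have kQ: "int k < int Q" "a + int k \<le> a + int Q" using g(2) n by linarith+
  define W where "W = {a + int k..<a + int Q}"
  have site: "(\<Sum>z = 0..<k. ?M y z * \<phi> (a + int z)) = - (\<Sum>l\<in>W. c (a + int y - l) * \<phi> l)" if y: "y < k" for y
  proof -
    let ?i = "a + int y"
    have diag: "?M y y = complex_of_real (2 * cos (2 * pi * (x + of_int ?i * \<omega>)) - e)"
    proof -
      have "x + (of_int a + (real k - 1) / 2) * \<omega> + (real y - (real k - 1) / 2) * \<omega> = x + of_int ?i * \<omega>"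
        by (simp add: algebra_simps)
      then show ?thesis by (simp only: toep_def if_True simp_thms of_real_diff)
    qed
    have "(\<Sum>l\<in>{0..<int Q}. c (?i - l) * \<phi> l) = (\<Sum>l\<in>{a..<a + int Q}. c (?i - l) * \<phi> l)"
    proof (rule sum_period(1)[OF Q, symmetric])
      fix l show "c (?i - (l + int Q)) * \<phi> (l + int Q) = c (?i - l) * \<phi> l"
      proof -
        have e: "?i - l = (?i - (l + int Q)) + int Q" by simp
        show ?thesis unfolding e c(2) \<phi> ..
      qed
    qed
    also have "\<dots> = (\<Sum>l\<in>{a..<a + int k}. c (?i - l) * \<phi> l) + (\<Sum>l\<in>W. c (?i - l) * \<phi> l)"
    proof -
      have "{a..<a + int Q} = {a..<a + int k} \<union> W"
        unfolding W_def using ivl_disj_un_two(3)[of a "a + int k" "a + int Q"] kQ by simp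
      moreover have "{a..<a + int k} \<inter> W = {}" unfolding W_def by auto
      ultimately show ?thesis by (simp add: sum.union_disjoint W_def)
    qed
    also have "(\<Sum>l\<in>{a..<a + int k}. c (?i - l) * \<phi> l) = (\<Sum>z = 0..<k. c (int y - int z) * \<phi> (a + int z))"
      by (rule sum.reindex_bij_witness[of _ "\<lambda>z. a + int z" "\<lambda>l. nat (l - a)"]) (auto simp: algebra_simps)
    also have "\<dots> = c 0 * \<phi> ?i + (\<Sum>z\<in>{0..<k} - {y}. c (int y - int z) * \<phi> (a + int z))"
      using y by (subst sum.remove[of _ y]) auto
    finally have S: "(\<Sum>l\<in>{0..<int Q}. c (?i - l) * \<phi> l) = c 0 * \<phi> ?i + (\<Sum>z\<in>{0..<k} - {y}. c (int y - int z) * \<phi> (a + int z)) + (\<Sum>l\<in>W. c (?i - l) * \<phi> l)" .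
    have "(\<Sum>z = 0..<k. ?M y z * \<phi> (a + int z)) = ?M y y * \<phi> ?i + (\<Sum>z\<in>{0..<k} - {y}. ?M y z * \<phi> (a + int z))"
      using y by (subst sum.remove[of _ y]) auto
    also have "(\<Sum>z\<in>{0..<k} - {y}. ?M y z * \<phi> (a + int z)) = (\<Sum>z\<in>{0..<k} - {y}. c (int y - int z) * \<phi> (a + int z))"
      by (intro sum.cong) (auto simp: toep_def)
    finally have T: "(\<Sum>z = 0..<k. ?M y z * \<phi> (a + int z)) = ?M y y * \<phi> ?i + (\<Sum>z\<in>{0..<k} - {y}. c (int y - int z) * \<phi> (a + int z))" .
    have ar: "D + (C + A + V) = C \<Longrightarrow> D + A + V = 0" for D A V C :: complex by (simp add: algebra_simps)
    from ev[of ?i, unfolded S] have "?M y y * \<phi> ?i + (\<Sum>z\<in>{0..<k} - {y}. c (int y - int z) * \<phi> (a + int z)) + (\<Sum>l\<in>W. c (?i - l) * \<phi> l) = 0"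
      unfolding diag by (rule ar)
    then show ?thesis unfolding T eq_neg_iff_add_eq_0 .
  qed
  have "\<phi> m' = (\<Sum>z = 0..<k. (if i0 = z then 1 else 0) * \<phi> (a + int z))"
    using i0 by (simp add: if_distrib[of "\<lambda>u. u * _"] cong: if_cong)
  also have "\<dots> = (\<Sum>z = 0..<k. (\<Sum>y = 0..<k. G i0 y * ?M y z) * \<phi> (a + int z))"
    using g(5) i0 unfolding green_on_def by (intro sum.cong) auto
  also have "\<dots> = (\<Sum>z = 0..<k. \<Sum>y = 0..<k. G i0 y * (?M y z * \<phi> (a + int z)))"
    by (simp add: sum_distrib_right mult.assoc)
  also have "\<dots> = (\<Sum>y = 0..<k. \<Sum>z = 0..<k. G i0 y * (?M y z * \<phi> (a + int z)))" by (rule sum.swap)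
  also have "\<dots> = (\<Sum>y = 0..<k. G i0 y * (- (\<Sum>l\<in>W. c (a + int y - l) * \<phi> l)))"
    by (intro sum.cong refl) (simp add: sum_distrib_left[symmetric] site)
  finally have rep: "\<phi> m' = (\<Sum>y = 0..<k. G i0 y * (- (\<Sum>l\<in>W. c (a + int y - l) * \<phi> l)))" .
  have ptw: "cmod (G i0 y) * cmod (c (a + int y - l)) \<le> \<epsilon>1 * exp (51 * B * real n) * exp (- \<kappa> * of_int (cyn Q (m' - l)))" if y: "y < k" for y l
  proof -
    have "cyn Q (m' - l) \<le> cyn Q (m' - (a + int y)) + cyn Q (a + int y - l)"
      using cyn_triangle[OF Q, of "m' - (a + int y)" "a + int y - l"] by simp
    also have "cyn Q (m' - (a + int y)) \<le> \<bar>m' - (a + int y)\<bar>" using cyn_le[OF Q, of _ 0] by simp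
    finally have "real_of_int (cyn Q (m' - l)) \<le> of_int (\<bar>m' - (a + int y)\<bar> + cyn Q (a + int y - l))" by simp
    then have t: "real_of_int (cyn Q (m' - l)) \<le> \<bar>real i0 - real y\<bar> + of_int (cyn Q (a + int y - l))"
    proof -
      have "m' - (a + int y) = int i0 - int y" using i0(2) by simp
      then have "real_of_int \<bar>m' - (a + int y)\<bar> = \<bar>real i0 - real y\<bar>" by simp
      then show ?thesis using \<open>real_of_int (cyn Q (m' - l)) \<le> of_int (\<bar>m' - (a + int y)\<bar> + cyn Q (a + int y - l))\<close> by (simp only: of_int_add)
    qed
    have cy: "0 \<le> real_of_int (cyn Q (a + int y - l))" using cyn_nonneg[OF Q] by simp
    have "\<kappa> * of_int (cyn Q (m' - l)) \<le> \<kappa> * (\<bar>real i0 - real y\<bar> + of_int (cyn Q (a + int y - l)))"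
      using t \<kappa>0 by (intro mult_left_mono) auto
    also have "\<dots> \<le> \<kappa> * \<bar>real i0 - real y\<bar> + 2 * \<kappa> * of_int (cyn Q (a + int y - l))"
      using mult_nonneg_nonneg[OF less_imp_le[OF \<kappa>0] cy] by (simp add: algebra_simps)
    finally have t2: "- (\<kappa> * \<bar>real i0 - real y\<bar>) - 2 * \<kappa> * of_int (cyn Q (a + int y - l)) \<le> - \<kappa> * of_int (cyn Q (m' - l))" by simp
    have "cmod (G i0 y) * cmod (c (a + int y - l)) \<le> exp (51 * B * real n - \<kappa> * \<bar>real i0 - real y\<bar>) * (\<epsilon>1 * exp (- (2 * \<kappa>) * of_int (cyn Q (a + int y - l))))"
      by (intro mult_mono g(6) c(1) i0 y) auto
    also have "\<dots> = \<epsilon>1 * exp (51 * B * real n) * exp (- (\<kappa> * \<bar>real i0 - real y\<bar>) - 2 * \<kappa> * of_int (cyn Q (a + int y - l)))"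
    proof -
      have "exp (X - Y) * (u * exp (- (2 * \<kappa>) * Z)) = u * exp X * exp (- Y - 2 * \<kappa> * Z)" for X Y Z u :: real
      proof -
        have "exp (X - Y) * exp (- (2 * \<kappa>) * Z) = exp X * exp (- Y - 2 * \<kappa> * Z)" unfolding mult_exp_exp by simp
        then show ?thesis by (simp only: mult.assoc mult.left_commute)
      qed
      then show ?thesis .
    qed
    also have "\<dots> \<le> \<epsilon>1 * exp (51 * B * real n) * exp (- \<kappa> * of_int (cyn Q (m' - l)))"
      using t2 \<epsilon>1 by (intro mult_left_mono) auto
    finally show ?thesis .
  qed
  \<comment> \<open>Either way around the cycle from \<open>m'\<close> to \<open>l\<close> leaves
    the window through its right or its left end, and both ends are at least n/200 away.\<close>
  have far: "real n / 200 \<le> of_int (cyn Q (m' - l))" if l: "l \<in> W" for l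
  proof -
    have d: "0 \<le> l - m'" "l - m' < int Q" using l am unfolding W_def by auto
    have "cyn Q (m' - l) = min (l - m') (int Q - (l - m'))"
      using cyn_between[OF d] cyn_minus[OF Q, of "l - m'"] by simp
    moreover have "real n / 200 \<le> of_int (l - m')" using l g(4) unfolding W_def by auto
    moreover have "real n / 200 \<le> of_int (int Q - (l - m'))"
    proof -
      have "m' - a \<le> int Q - (l - m')" using l unfolding W_def by auto
      then have "real_of_int (m' - a) \<le> of_int (int Q - (l - m'))" by (simp only: of_int_le_iff)
      then show ?thesis using g(3) by simp
    qed
    ultimately show ?thesis by (simp add: min_def)
  qed
  have small: "real k * (\<epsilon>1 * exp (51 * B * real n) * exp (- \<kappa> * of_int (cyn Q (m' - l)))) \<le> exp (- B * real n) * exp (- (\<kappa> / 2) * of_int (cyn Q (m' - l)))" if l: "l \<in> W" for l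
  proof -
    let ?d = "real_of_int (cyn Q (m' - l))"
    have "(\<kappa> / 2) * (real n / 200) \<le> (\<kappa> / 2) * ?d" using far[OF l] \<kappa>0 by (intro mult_left_mono) auto
    \<comment> \<open>This is where 22000 comes from: 55 has to cover 51 for the Green function, 1
      for the number of rows and 1 for the gain exp(- B n).\<close>
    moreover have "(\<kappa> / 2) * (real n / 200) = 55 * (B * real n)" using \<kappa> by simp
    ultimately have k1: "55 * (B * real n) \<le> (\<kappa> / 2) * ?d" by linarith
    have "real k * \<epsilon>1 \<le> exp (B * real n) * 1" using g(2) n(4) \<epsilon>1 by (intro mult_mono) auto
    then have "real k * \<epsilon>1 * (exp (51 * B * real n) * exp (- \<kappa> * ?d)) \<le> exp (B * real n) * (exp (51 * B * real n) * exp (- \<kappa> * ?d))"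
      by (intro mult_right_mono) auto
    also have "\<dots> = exp (52 * B * real n - \<kappa> * ?d)" by (simp add: exp_add[symmetric] algebra_simps)
    also have "\<dots> \<le> exp (- B * real n + - (\<kappa> / 2) * ?d)"
    proof -
      have "0 \<le> B * real n" using B by simp
      moreover have "\<kappa> * ?d = 2 * ((\<kappa> / 2) * ?d)" "52 * B * real n = 52 * (B * real n)" "- B * real n + - (\<kappa> / 2) * ?d = - (B * real n) - (\<kappa> / 2) * ?d" by simp_all
      ultimately have "52 * B * real n - \<kappa> * ?d \<le> - B * real n + - (\<kappa> / 2) * ?d" using k1 by linarith
      then show ?thesis by simp
    qed
    finally show ?thesis by (simp only: exp_add mult.assoc)
  qed
  have "cmod (\<phi> m') \<le> (\<Sum>y = 0..<k. \<Sum>l\<in>W. cmod (G i0 y) * cmod (c (a + int y - l)) * cmod (\<phi> l))"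
  proof -
    have "cmod (\<phi> m') \<le> (\<Sum>y = 0..<k. cmod (G i0 y) * cmod (\<Sum>l\<in>W. c (a + int y - l) * \<phi> l))"
      unfolding rep using norm_sum[of "\<lambda>y. G i0 y * (- (\<Sum>l\<in>W. c (a + int y - l) * \<phi> l))" "{0..<k}"] by (simp add: norm_mult)
    also have "\<dots> \<le> (\<Sum>y = 0..<k. cmod (G i0 y) * (\<Sum>l\<in>W. cmod (c (a + int y - l) * \<phi> l)))"
      by (intro sum_mono mult_left_mono norm_sum) auto
    finally show ?thesis by (simp add: norm_mult sum_distrib_left mult.assoc)
  qed
  also have "\<dots> \<le> (\<Sum>y = 0..<k. \<Sum>l\<in>W. \<epsilon>1 * exp (51 * B * real n) * exp (- \<kappa> * of_int (cyn Q (m' - l))) * cmod (\<phi> l))"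
    by (intro sum_mono mult_right_mono ptw) auto
  also have "\<dots> = (\<Sum>l\<in>W. real k * (\<epsilon>1 * exp (51 * B * real n) * exp (- \<kappa> * of_int (cyn Q (m' - l)))) * cmod (\<phi> l))"
    by (simp add: sum_distrib_left mult.assoc)
  also have "\<dots> \<le> (\<Sum>l\<in>W. exp (- B * real n) * exp (- (\<kappa> / 2) * of_int (cyn Q (m' - l))) * cmod (\<phi> l))"
    by (intro sum_mono mult_right_mono small) auto
  also have "\<dots> \<le> (\<Sum>l\<in>{a..<a + int Q}. exp (- B * real n) * exp (- (\<kappa> / 2) * of_int (cyn Q (m' - l))) * cmod (\<phi> l))"
    unfolding W_def by (intro sum_mono2) auto
  also have "\<dots> = (\<Sum>l\<in>{0..<int Q}. exp (- B * real n) * exp (- (\<kappa> / 2) * of_int (cyn Q (m' - l))) * cmod (\<phi> l))"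
  proof (rule sum_period(1)[OF Q])
    fix l
    have "cyn Q (m' - (l + int Q)) = cyn Q (m' - l)"
    proof -
      have "(m' - (l + int Q)) mod int Q = (m' - l) mod int Q" by (metis diff_diff_eq minus_mod_self2)
      then show ?thesis by (simp only: cyn_def)
    qed
    then show "exp (- B * real n) * exp (- (\<kappa> / 2) * of_int (cyn Q (m' - (l + int Q)))) * cmod (\<phi> (l + int Q)) = exp (- B * real n) * exp (- (\<kappa> / 2) * of_int (cyn Q (m' - l))) * cmod (\<phi> l)"
      by (simp add: \<phi>)
  qed
  finally show thesis by (intro that[OF g(1)]) (simp add: sum_distrib_left mult.assoc)
qed

subsection \<open>Eigenbases of Hermitian matrices\<close>

text \<open>A zero row added to the \<open>Q\<close> equations makes the system square with
  vanishing determinant.\<close>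

lemma linear_dependence:
  fixes a :: "nat \<Rightarrow> nat \<Rightarrow> complex"
  obtains x :: "nat \<Rightarrow> complex" where "\<exists>l\<le>Q. x l \<noteq> 0" "\<And>i. i < Q \<Longrightarrow> (\<Sum>l\<le>Q. x l * a l i) = 0"
proof -
  let ?A = "mat (Suc Q) (Suc Q) (\<lambda>(i, l). if i < Q then a l i else 0)"
  have A: "?A \<in> carrier_mat (Suc Q) (Suc Q)" by simp
  have "fdet (Suc Q) (\<lambda>i l. if i < Q then a l i else 0) = 0"
    unfolding fdet_leibniz by (intro sum.neutral) (auto intro!: prod_zero bexI[of _ Q])
  then have "det ?A = 0" by (simp add: fdet_def)
  then obtain v where v: "v \<in> carrier_vec (Suc Q)" "v \<noteq> 0\<^sub>v (Suc Q)" "?A *\<^sub>v v = 0\<^sub>v (Suc Q)"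
    using det_0_iff_vec_prod_zero_field[OF A] by auto
  show thesis
  proof (rule that[of "\<lambda>l. vec_index v l"])
    show "\<exists>l\<le>Q. vec_index v l \<noteq> 0"
    proof (rule ccontr)
      assume "\<not> ?thesis"
      then have "v = 0\<^sub>v (Suc Q)" using v(1) by (intro eq_vecI) auto
      then show False using v(2) by simp
    qed
    fix i assume i: "i < Q"
    have "vec_index (?A *\<^sub>v v) i = 0" using v(3) i by simp
    then have "(\<Sum>l = 0..<Suc Q. a l i * vec_index v l) = 0" using i v(1) by (simp add: scalar_prod_def)
    moreover have "{0..<Suc Q} = {..Q}" by auto
    ultimately show "(\<Sum>l\<le>Q. vec_index v l * a l i) = 0" by (simp add: mult.commute)
  qed
qed

definition ip :: "nat \<Rightarrow> (nat \<Rightarrow> complex) \<Rightarrow> (nat \<Rightarrow> complex) \<Rightarrow> complex" where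
  "ip Q u v = (\<Sum>i<Q. cnj (u i) * v i)"

definition kop :: "nat \<Rightarrow> (nat \<Rightarrow> nat \<Rightarrow> complex) \<Rightarrow> (nat \<Rightarrow> complex) \<Rightarrow> nat \<Rightarrow> complex" where
  "kop Q K u i = (\<Sum>l<Q. K i l * u l)"

lemma ip_self: "ip Q u u = complex_of_real (\<Sum>i<Q. (cmod (u i))\<^sup>2)"
  by (simp add: ip_def complex_norm_square mult.commute del: of_real_power)

lemma ip_commute: "ip Q v u = cnj (ip Q u v)"
  by (simp add: ip_def mult.commute)

lemma ip_add: "ip Q u (\<lambda>i. a * v i + b * w i) = a * ip Q u v + b * ip Q u w"
  by (simp add: ip_def sum.distrib sum_distrib_left algebra_simps)

lemma ip_sum: "ip Q u (\<lambda>i. \<Sum>l\<in>A. x l * v l i) = (\<Sum>l\<in>A. x l * ip Q u (v l))"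
proof -
  have "ip Q u (\<lambda>i. \<Sum>l\<in>A. x l * v l i) = (\<Sum>i<Q. \<Sum>l\<in>A. x l * (cnj (u i) * v l i))"
    by (simp add: ip_def sum_distrib_left mult_ac)
  also have "\<dots> = (\<Sum>l\<in>A. \<Sum>i<Q. x l * (cnj (u i) * v l i))" by (rule sum.swap)
  finally show ?thesis by (simp add: ip_def sum_distrib_left)
qed

lemma ip_kop:
  assumes "\<And>i j. i < Q \<Longrightarrow> j < Q \<Longrightarrow> K j i = cnj (K i j)"
  shows "ip Q u (kop Q K v) = ip Q (kop Q K u) v"
proof -
  have "ip Q u (kop Q K v) = (\<Sum>i<Q. \<Sum>l<Q. cnj (u i) * K i l * v l)"
    by (simp add: ip_def kop_def sum_distrib_left mult.assoc)
  also have "\<dots> = (\<Sum>l<Q. \<Sum>i<Q. cnj (u i) * K i l * v l)" by (rule sum.swap)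
  also have "\<dots> = (\<Sum>l<Q. \<Sum>i<Q. cnj (K l i * u i) * v l)"
  proof (intro sum.cong refl)
    fix l i assume "l \<in> {..<Q}" "i \<in> {..<Q}"
    then have "K i l = cnj (K l i)" by (intro assms) auto
    then show "cnj (u i) * K i l * v l = cnj (K l i * u i) * v l" by (simp only: complex_cnj_mult mult.commute)
  qed
  finally show ?thesis by (simp add: ip_def kop_def sum_distrib_right)
qed

text \<open>Take a nonzero polynomial of least degree annihilating \<open>v\<close> under
  \<open>kop Q K\<close>, split off a linear factor and apply the quotient to \<open>v\<close>: by
  minimality the result is not zero. The predicate \<open>S\<close> keeps the eigenvector inside an
  invariant subspace.\<close>

lemma exists_eigenvector:
  fixes S :: "(nat \<Rightarrow> complex) \<Rightarrow> bool"
  assumes v: "S v" "\<exists>i<Q. v i \<noteq> 0"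
    and lin: "\<And>u w a b. S u \<Longrightarrow> S w \<Longrightarrow> S (\<lambda>i. a * u i + b * w i)" and K: "\<And>u. S u \<Longrightarrow> S (kop Q K u)"
  obtains u z where "S u" "\<exists>i<Q. u i \<noteq> 0" "\<And>i. i < Q \<Longrightarrow> kop Q K u i = z * u i"
proof -
  define pw where "pw l = ((kop Q K) ^^ l) v" for l
  have pwS: "pw (Suc l) = kop Q K (pw l)" for l by (simp add: pw_def)
  have Spw: "S (pw l)" for l by (induction l) (auto simp: pw_def v K)
  define ap where "ap p i = (\<Sum>l\<le>degree p. coeff p l * pw l i)" for p :: "complex poly" and i
  have apN: "ap p i = (\<Sum>l\<le>N. coeff p l * pw l i)" if "degree p \<le> N" for p N i
    unfolding ap_def by (rule sum.mono_neutral_left) (use that in \<open>auto simp: coeff_eq_0\<close>)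
  have Ssum: "S (\<lambda>i. \<Sum>l\<le>N. x l * pw l i)" for x :: "nat \<Rightarrow> complex" and N
  proof (induction N)
    case 0 then show ?case using lin[OF Spw[of 0] Spw[of 0], of "x 0" 0] by simp
  next
    case (Suc N) then show ?case using lin[OF Suc Spw[of "Suc N"], of 1 "x (Suc N)"] by simp
  qed
  have Sap: "S (ap p)" for p unfolding ap_def[abs_def] by (rule Ssum)
  have apmul: "ap ([:- z, 1:] * g) i = kop Q K (ap g) i - z * ap g i" for z g i
  proof -
    define N where "N = degree g"
    have "degree ([:- z, 1:] * g) \<le> Suc N" using degree_mult_le[of "[:- z, 1:]" g] by (simp add: N_def)
    then have "ap ([:- z, 1:] * g) i = (\<Sum>l\<le>Suc N. coeff ([:- z, 1:] * g) l * pw l i)" by (rule apN)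
    also have "\<dots> = (\<Sum>l\<le>Suc N. coeff (pCons 0 g) l * pw l i) - z * (\<Sum>l\<le>Suc N. coeff g l * pw l i)"
      by (simp add: algebra_simps sum_distrib_left flip: sum_subtractf) (simp add: sum.distrib sum_subtractf sum_distrib_left algebra_simps)
    also have "(\<Sum>l\<le>Suc N. coeff g l * pw l i) = ap g i" by (rule apN[symmetric]) (simp add: N_def)
    also have "(\<Sum>l\<le>Suc N. coeff (pCons 0 g) l * pw l i) = (\<Sum>l\<le>N. coeff g l * pw (Suc l) i)"
      by (subst sum.atMost_Suc_shift) simp
    also have "\<dots> = kop Q K (ap g) i"
    proof -
      have "kop Q K (ap g) i = (\<Sum>m<Q. \<Sum>l\<le>N. K i m * (coeff g l * pw l m))"
        by (simp add: kop_def ap_def N_def sum_distrib_left)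
      also have "\<dots> = (\<Sum>l\<le>N. \<Sum>m<Q. K i m * (coeff g l * pw l m))" by (rule sum.swap)
      also have "\<dots> = (\<Sum>l\<le>N. coeff g l * pw (Suc l) i)"
        by (simp add: pwS kop_def sum_distrib_left mult_ac)
      finally show ?thesis by simp
    qed
    finally show ?thesis .
  qed
  define good where "good p \<longleftrightarrow> p \<noteq> 0 \<and> (\<forall>i<Q. ap p i = 0)" for p
  have "\<exists>p. good p"
  proof -
    obtain x where x: "\<exists>l\<le>Q. x l \<noteq> 0" "\<And>i. i < Q \<Longrightarrow> (\<Sum>l\<le>Q. x l * pw l i) = 0"
      using linear_dependence[of Q pw] by blast
    define p where "p = (\<Sum>l\<le>Q. Polynomial.monom (x l) l)"
    have cp: "coeff p l = (if l \<le> Q then x l else 0)" for l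
      by (simp add: p_def coeff_sum)
    have "degree p \<le> Q" by (rule degree_le) (simp add: cp)
    then have "ap p i = 0" if "i < Q" for i using x(2)[OF that] by (simp add: apN cp)
    moreover have "p \<noteq> 0" using x(1) cp by (metis coeff_0)
    ultimately show ?thesis unfolding good_def by blast
  qed
  then obtain p where p: "good p" "\<And>p'. good p' \<Longrightarrow> degree p \<le> degree p'"
    using ex_has_least_nat[of good _ degree] by blast
  have "degree p \<noteq> 0"
  proof
    assume d0: "degree p = 0"
    then have "coeff p 0 \<noteq> 0" using p(1) by (metis good_def leading_coeff_0_iff)
    moreover obtain i where i: "i < Q" "v i \<noteq> 0" using v(2) by blast
    moreover have "ap p i = 0" using p(1) i by (simp add: good_def)
    ultimately show False using d0 by (simp add: ap_def pw_def)
  qed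
  then have "\<not> constant (poly p)" by (simp add: constant_degree)
  then obtain z where "poly p z = 0" using fundamental_theorem_of_algebra by blast
  then obtain g where g: "p = [:- z, 1:] * g" by (auto simp: poly_eq_0_iff_dvd dvd_def)
  have g0: "g \<noteq> 0" using g p(1) by (auto simp: good_def)
  have dg: "degree p = Suc (degree g)" unfolding g using g0 by (subst degree_mult_eq) auto
  have ng: "\<not> good g" using p(2)[of g] dg by auto
  show thesis
  proof (rule that[of "ap g" z])
    show "S (ap g)" by (rule Sap)
    show "\<exists>i<Q. ap g i \<noteq> 0" using ng g0 by (auto simp: good_def)
    fix i assume "i < Q"
    then have "ap p i = 0" using p(1) by (simp add: good_def)
    then show "kop Q K (ap g) i = z * ap g i" unfolding g apmul by simp
  qed
qed

text \<open>Each new eigenvector is found in the orthogonal complement of the earlier ones, which a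
  Hermitian matrix leaves invariant.\<close>

lemma orthonormal_eigenvectors:
  assumes herm: "\<And>i j. i < Q \<Longrightarrow> j < Q \<Longrightarrow> K j i = cnj (K i j)" and r: "r \<le> Q"
  shows "\<exists>(E::nat \<Rightarrow> real) \<phi>. (\<forall>j<r. \<forall>i<Q. kop Q K (\<phi> j) i = of_real (E j) * \<phi> j i) \<and>
     (\<forall>j<r. \<forall>j'<r. ip Q (\<phi> j) (\<phi> j') = (if j = j' then 1 else 0))"
  using r
proof (induction r)
  case 0 then show ?case by auto
next
  case (Suc r)
  obtain E :: "nat \<Rightarrow> real" and \<phi> where ev: "\<And>j i. j < r \<Longrightarrow> i < Q \<Longrightarrow> kop Q K (\<phi> j) i = of_real (E j) * \<phi> j i"
    and on: "\<And>j j'. j < r \<Longrightarrow> j' < r \<Longrightarrow> ip Q (\<phi> j) (\<phi> j') = (if j = j' then 1 else 0)"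
    using Suc.IH[OF Suc_leD[OF Suc.prems]] by blast
  define S where "S u \<longleftrightarrow> (\<forall>j<r. ip Q (\<phi> j) u = 0)" for u
  obtain v where v: "S v" "\<exists>i<Q. v i \<noteq> 0"
  proof -
    define w where "w i = (\<lambda>l. (if l = i then 1 else 0) - (\<Sum>j<r. cnj (\<phi> j i) * \<phi> j l))" for i
    have ipd: "ip Q (\<phi> j) (\<lambda>l. if l = i then 1 else 0) = cnj (\<phi> j i)" if "i < Q" for j i
      using that by (simp add: ip_def if_distrib[of "\<lambda>x. _ * x"] cong: if_cong)
    have Sw: "S (w i)" if "i < Q" for i
      unfolding S_def
    proof (intro allI impI)
      fix j assume j: "j < r"
      have "ip Q (\<phi> j) (w i) = ip Q (\<phi> j) (\<lambda>l. if l = i then 1 else 0) - ip Q (\<phi> j) (\<lambda>l. \<Sum>j'<r. cnj (\<phi> j' i) * \<phi> j' l)"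
        by (simp add: w_def ip_def algebra_simps sum_subtractf)
      also have "\<dots> = cnj (\<phi> j i) - (\<Sum>j'<r. cnj (\<phi> j' i) * ip Q (\<phi> j) (\<phi> j'))"
        unfolding ip_sum ipd[OF that] ..
      also have "\<dots> = 0" using j by (simp add: on if_distrib[of "\<lambda>x. _ * x"] cong: if_cong)
      finally show "ip Q (\<phi> j) (w i) = 0" .
    qed
    \<comment> \<open>These diagonal entries sum to \<open>Q - r\<close>, the trace of the
      projection onto the complement, so they cannot all vanish.\<close>
    have "\<exists>i<Q. w i i \<noteq> 0"
    proof (rule ccontr)
      assume "\<not> ?thesis"
      then have "(\<Sum>i<Q. w i i) = 0" by simp
      moreover have "(\<Sum>i<Q. w i i) = of_nat Q - (\<Sum>i<Q. \<Sum>j<r. cnj (\<phi> j i) * \<phi> j i)"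
        by (simp add: w_def sum_subtractf)
      moreover have "(\<Sum>i<Q. \<Sum>j<r. cnj (\<phi> j i) * \<phi> j i) = (\<Sum>j<r. ip Q (\<phi> j) (\<phi> j))"
        unfolding ip_def by (rule sum.swap)
      moreover have "\<dots> = of_nat r" by (simp add: on)
      ultimately have "(of_nat Q :: complex) = of_nat r" by simp
      then show False using Suc.prems by simp
    qed
    then show thesis using that Sw by blast
  qed
  have lin: "S (\<lambda>i. a * u i + b * w i)" if "S u" "S w" for u w a b
    using that by (simp add: S_def ip_add)
  have SK: "S (kop Q K u)" if "S u" for u
    unfolding S_def
  proof (intro allI impI)
    fix j assume j: "j < r"
    have "ip Q (\<phi> j) (kop Q K u) = ip Q (kop Q K (\<phi> j)) u" by (rule ip_kop[OF herm])
    also have "\<dots> = of_real (E j) * ip Q (\<phi> j) u"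
      using ev[OF j] by (simp add: ip_def sum_distrib_left mult.assoc)
    finally show "ip Q (\<phi> j) (kop Q K u) = 0" using that j by (simp add: S_def)
  qed
  obtain u z where u: "S u" "\<exists>i<Q. u i \<noteq> 0" "\<And>i. i < Q \<Longrightarrow> kop Q K u i = z * u i"
    using exists_eigenvector[of S v Q K] v lin SK by blast
  define t where "t = (\<Sum>i<Q. (cmod (u i))\<^sup>2)"
  have t: "0 < t"
  proof -
    obtain i where "i < Q" "u i \<noteq> 0" using u(2) by blast
    then show ?thesis unfolding t_def by (intro sum_pos2[of _ i]) auto
  qed
  have zr: "z \<in> \<real>"
  proof -
    have "z * ip Q u u = ip Q u (kop Q K u)" using u(3) by (simp add: ip_def sum_distrib_left mult_ac)
    also have "\<dots> = ip Q (kop Q K u) u" by (rule ip_kop[OF herm])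
    also have "\<dots> = cnj z * ip Q u u" using u(3) by (simp add: ip_def sum_distrib_left mult_ac)
    finally have "z = cnj z" using t unfolding ip_self t_def[symmetric] by simp
    then show ?thesis by (metis Reals_cnj_iff)
  qed
  then obtain e where e: "z = of_real e" by (auto elim: Reals_cases)
  define \<psi> where "\<psi> i = u i / of_real (sqrt t)" for i
  have \<psi>ip: "ip Q w \<psi> = ip Q w u / of_real (sqrt t)" for w
    by (simp add: ip_def \<psi>_def sum_divide_distrib)
  have \<psi>\<psi>: "ip Q \<psi> \<psi> = 1"
  proof -
    have "(\<Sum>i<Q. (cmod (\<psi> i))\<^sup>2) = (\<Sum>i<Q. (cmod (u i))\<^sup>2 / t)"
      using t by (intro sum.cong) (auto simp: \<psi>_def norm_divide power_divide)
    also have "\<dots> = 1" using t by (simp add: t_def sum_divide_distrib[symmetric])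
    finally show ?thesis unfolding ip_self by simp
  qed
  let ?\<phi> = "\<phi>(r := \<psi>)" and ?E = "E(r := e)"
  have "\<forall>j<Suc r. \<forall>i<Q. kop Q K (?\<phi> j) i = of_real (?E j) * ?\<phi> j i"
  proof (intro allI impI)
    fix j i assume ji: "j < Suc r" "i < Q"
    have "kop Q K \<psi> i = kop Q K u i / of_real (sqrt t)" by (simp add: kop_def \<psi>_def sum_divide_distrib)
    then show "kop Q K (?\<phi> j) i = of_real (?E j) * ?\<phi> j i"
      using ji ev u(3) e by (cases "j = r") (auto simp: \<psi>_def)
  qed
  moreover have "\<forall>j<Suc r. \<forall>j'<Suc r. ip Q (?\<phi> j) (?\<phi> j') = (if j = j' then 1 else 0)"
  proof (intro allI impI)
    fix j j' assume jj: "j < Suc r" "j' < Suc r"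
    have 1: "ip Q (\<phi> j) \<psi> = 0" if "j < r" for j using u(1) that unfolding \<psi>ip S_def by simp
    have 2: "ip Q \<psi> (\<phi> j) = 0" if "j < r" for j using 1[OF that] by (subst ip_commute) simp
    show "ip Q (?\<phi> j) (?\<phi> j') = (if j = j' then 1 else 0)"
      using jj on 1 2 \<psi>\<psi> by (cases "j = r"; cases "j' = r") auto
  qed
  ultimately show ?case by blast
qed

text \<open>Completeness follows from orthonormality, since a left inverse of a square matrix is
  also a right inverse.\<close>

lemma hermitian_eigenbasis:
  assumes herm: "\<And>i j. i < Q \<Longrightarrow> j < Q \<Longrightarrow> K j i = cnj (K i j)"
  obtains E :: "nat \<Rightarrow> real" and \<phi> where
    "\<And>j i. j < Q \<Longrightarrow> i < Q \<Longrightarrow> (\<Sum>l<Q. K i l * \<phi> j l) = of_real (E j) * \<phi> j i"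
    "\<And>j j'. j < Q \<Longrightarrow> j' < Q \<Longrightarrow> (\<Sum>i<Q. cnj (\<phi> j i) * \<phi> j' i) = (if j = j' then 1 else 0)"
    "\<And>i i'. i < Q \<Longrightarrow> i' < Q \<Longrightarrow> (\<Sum>j<Q. \<phi> j i * cnj (\<phi> j i')) = (if i = i' then 1 else 0)"
proof -
  obtain E :: "nat \<Rightarrow> real" and \<phi> where ev: "\<And>j i. j < Q \<Longrightarrow> i < Q \<Longrightarrow> kop Q K (\<phi> j) i = of_real (E j) * \<phi> j i"
    and on: "\<And>j j'. j < Q \<Longrightarrow> j' < Q \<Longrightarrow> ip Q (\<phi> j) (\<phi> j') = (if j = j' then 1 else 0)"
    using orthonormal_eigenvectors[of Q K Q, OF herm order_refl] by blast
  let ?A = "mat Q Q (\<lambda>(j, i). cnj (\<phi> j i))" and ?B = "mat Q Q (\<lambda>(i, j). \<phi> j i)"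
  have "?A * ?B = 1\<^sub>m Q"
    by (rule eq_matI) (use on in \<open>auto simp: scalar_prod_def ip_def atLeast0LessThan\<close>)
  then have BA: "?B * ?A = 1\<^sub>m Q" by (rule mat_mult_left_right_inverse[rotated 2]) auto
  have "(\<Sum>j<Q. \<phi> j i * cnj (\<phi> j i')) = (if i = i' then 1 else 0)" if "i < Q" "i' < Q" for i i'
  proof -
    have "(?B * ?A) $$ (i, i') = 1\<^sub>m Q $$ (i, i')" using BA by simp
    then show ?thesis using that by (simp add: scalar_prod_def atLeast0LessThan)
  qed
  then show thesis using that[of \<phi> E] ev on unfolding kop_def ip_def by blast
qed

subsection \<open>The dual model and its eigenfunction correlations\<close>

text \<open>The phase 1/(2Q) puts all points on the shifted grid (r + 1/2)/Q, whose elements keep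
  the distance 1/(2Q) from the integers. About 2 \<eta> Q grid points are near an integer, and each
  is hit at most twice because doubling is injective modulo \<open>Q\<close> on each half of the
  cycle.\<close>

lemma card_near_resonance:
  fixes P s :: int and Q :: nat and \<eta> :: real
  assumes Q: "Q > 0" and cop: "coprime P (int Q)" and \<eta>: "0 < \<eta>"
  shows "real (card {m\<in>{0..<int Q}. dz (2 * (1 / (4 * real Q)) + of_int (2 * m + s) * (of_int P / real Q)) < \<eta>}) \<le> 12 * \<eta> * real Q"
proof -
  define r where "r m = ((2 * m + s) * P) mod int Q" for m
  define R where "R = {r\<in>{0..<int Q}. dz ((of_int r + 1/2) / real Q) < \<eta>}"
  let ?S = "{m\<in>{0..<int Q}. dz (2 * (1 / (4 * real Q)) + of_int (2 * m + s) * (of_int P / real Q)) < \<eta>}"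
  have Qr: "0 < real Q" using Q by simp
  have rR: "r m \<in> R" if "m \<in> ?S" for m
  proof -
    define k where "k = ((2 * m + s) * P) div int Q"
    have "(2 * m + s) * P = int Q * k + r m" unfolding r_def k_def by simp
    from arg_cong[OF this, of real_of_int] have "of_int (2 * m + s) * of_int P = real Q * of_int k + of_int (r m)" by simp
    then have "2 * (1 / (4 * real Q)) + of_int (2 * m + s) * (of_int P / real Q) = (of_int (r m) + 1/2) / real Q + of_int k"
      using Qr by (simp add: field_simps)
    moreover have "dz ((of_int (r m) + 1/2) / real Q) \<le> dz (y + of_int k)" if "y = (of_int (r m) + 1/2) / real Q" for y
    proof -
      have "dz y \<le> \<bar>y - of_int (round (y + of_int k) - k)\<bar>" by (rule dz_le)
      also have "y - of_int (round (y + of_int k) - k) = y + of_int k - of_int (round (y + of_int k))" by simp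
      finally show ?thesis unfolding dz_def[of "y + of_int k"] using that by simp
    qed
    ultimately show ?thesis using that Q unfolding R_def r_def by (auto intro: order_le_less_trans)
  qed
  have cardR: "real (card R) \<le> 6 * \<eta> * real Q"
  proof (cases "\<eta> * real Q \<le> 1/2")
    case True
    have "R = {}"
    proof (rule ccontr)
      assume "R \<noteq> {}"
      then obtain r where r: "0 \<le> r" "r < int Q" "dz ((of_int r + 1/2) / real Q) < \<eta>" by (auto simp: R_def)
      define p where "p = round ((of_int r + 1/2) / real Q)"
      have "\<bar>(of_int r + 1/2) / real Q - of_int p\<bar> < \<eta>" using r(3) by (simp add: dz_def p_def)
      then have "\<bar>(of_int r + 1/2) / real Q - of_int p\<bar> * real Q < \<eta> * real Q" using Qr by (intro mult_strict_right_mono) auto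
      moreover have "\<bar>(of_int r + 1/2) / real Q - of_int p\<bar> * real Q = \<bar>of_int (r - p * int Q) + 1/2\<bar>"
      proof -
        have "\<bar>(of_int r + 1/2) / real Q - of_int p\<bar> * real Q = \<bar>((of_int r + 1/2) / real Q - of_int p) * real Q\<bar>" by (simp add: abs_mult)
        also have "((of_int r + 1/2) / real Q - of_int p) * real Q = of_int (r - p * int Q) + 1/2" using Qr by (simp add: field_simps)
        finally show ?thesis .
      qed
      ultimately have "\<bar>real_of_int (r - p * int Q) + 1/2\<bar> < 1/2" using True by linarith
      moreover have "\<not> \<bar>real_of_int z + 1/2\<bar> < 1/2" for z :: int
      proof -
        have "z \<ge> 0 \<or> z \<le> -1" by linarith
        then have "real_of_int z \<ge> 0 \<or> real_of_int z \<le> -1" by linarith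
        then show ?thesis by linarith
      qed
      ultimately show False by blast
    qed
    then show ?thesis using \<eta> by simp
  next
    case False
    define K where "K = \<lceil>\<eta> * real Q\<rceil>"
    have K: "0 < K" "of_int K < \<eta> * real Q + 1" "\<eta> * real Q \<le> of_int K" unfolding K_def using False by linarith+
    have "R \<subseteq> {0..<K} \<union> {int Q - K..<int Q}"
    proof
      fix r assume "r \<in> R"
      then have r: "0 \<le> r" "r < int Q" "dz ((of_int r + 1/2) / real Q) < \<eta>" by (auto simp: R_def)
      define p where "p = round ((of_int r + 1/2) / real Q)"
      have "\<bar>(of_int r + 1/2) / real Q - of_int p\<bar> < \<eta>" using r(3) by (simp add: dz_def p_def)
      then have lt: "\<bar>((of_int r + 1/2) / real Q - of_int p) * real Q\<bar> < \<eta> * real Q"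
        using Qr by (simp add: abs_mult)
      have "((of_int r + 1/2) / real Q - of_int p) * real Q = of_int (r - p * int Q) + 1/2" using Qr by (simp add: field_simps)
      then have lt2: "\<bar>real_of_int (r - p * int Q) + 1/2\<bar> < of_int K" using lt K by linarith
      have zK: "z < K \<and> - K \<le> z" if "\<bar>real_of_int z + 1/2\<bar> < of_int K" for z :: int using that by linarith
      have lt3: "r - p * int Q < K" "- K \<le> r - p * int Q" using zK[OF lt2] by auto
      consider "p \<le> 0" | "p \<ge> 1" by linarith
      then show "r \<in> {0..<K} \<union> {int Q - K..<int Q}"
      proof cases
        case 1
        then have "p * int Q \<le> 0" by (simp add: mult_nonpos_nonneg)
        then have "r < K" using lt3 by linarith
        then show ?thesis using r by auto
      next
        case 2
        then have "1 * int Q \<le> p * int Q" by (intro mult_right_mono) auto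
        then have "int Q - K \<le> r" using lt3 by linarith
        then show ?thesis using r by auto
      qed
    qed
    then have "card R \<le> card ({0..<K} \<union> {int Q - K..<int Q})" by (intro card_mono) auto
    also have "\<dots> \<le> card {0..<K} + card {int Q - K..<int Q}" by (rule card_Un_le)
    also have "\<dots> = nat (2 * K)" using K by simp
    finally have "real (card R) \<le> 2 * of_int K" using K by linarith
    moreover have "6 * \<eta> * real Q = 6 * (\<eta> * real Q)" by simp
    \<comment> \<open>Here \<eta> Q > 1/2, so rounding up is harmless: 2 (\<eta> Q + 1) is at most 6
      \<eta> Q.\<close>
    ultimately show ?thesis using K(2) False by linarith
  qed
  define h where "h = (int Q + 1) div 2"
  have h: "2 * h \<ge> int Q" "2 * h \<le> int Q + 1" unfolding h_def by linarith+
  have finR: "finite R" by (rule finite_subset[of _ "{0..<int Q}"]) (auto simp: R_def)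
  have inj: "inj_on r A" if A: "\<And>m m'. m \<in> A \<Longrightarrow> m' \<in> A \<Longrightarrow> 2 * \<bar>m - m'\<bar> < int Q" for A
  proof (rule inj_onI)
    fix m m' assume m: "m \<in> A" "m' \<in> A" "r m = r m'"
    then have "int Q dvd (2 * m + s) * P - (2 * m' + s) * P" by (simp add: r_def mod_eq_dvd_iff)
    moreover have "(2 * m + s) * P - (2 * m' + s) * P = 2 * (m - m') * P" by (simp add: algebra_simps)
    ultimately have "int Q dvd 2 * (m - m')" using cop by (simp add: coprime_commute coprime_dvd_mult_left_iff)
    have "2 * (m - m') = 0"
    proof (rule ccontr)
      assume "2 * (m - m') \<noteq> 0"
      then have "\<bar>int Q\<bar> \<le> \<bar>2 * (m - m')\<bar>" using \<open>int Q dvd 2 * (m - m')\<close> by (rule dvd_imp_le_int)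
      then show False using A[OF m(1,2)] by (simp add: abs_mult del: right_diff_distrib_numeral)
    qed
    then show "m = m'" by simp
  qed
  have split: "?S = (?S \<inter> {0..<h}) \<union> (?S \<inter> {h..<int Q})" by auto
  have "card (?S \<inter> {0..<h}) \<le> card R"
  proof (rule card_inj_on_le[OF inj _ finR])
    fix m m' assume "m \<in> ?S \<inter> {0..<h}" "m' \<in> ?S \<inter> {0..<h}"
    then have "\<bar>m - m'\<bar> \<le> h - 1" by auto
    then show "2 * \<bar>m - m'\<bar> < int Q" using h by (smt (verit))
  qed (use rR in auto)
  moreover have "card (?S \<inter> {h..<int Q}) \<le> card R"
  proof (rule card_inj_on_le[OF inj _ finR])
    fix m m' assume "m \<in> ?S \<inter> {h..<int Q}" "m' \<in> ?S \<inter> {h..<int Q}"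
    then have "\<bar>m - m'\<bar> \<le> int Q - h - 1" by auto
    then show "2 * \<bar>m - m'\<bar> < int Q" using h by (smt (verit))
  qed (use rR in auto)
  moreover have "card ?S \<le> card (?S \<inter> {0..<h}) + card (?S \<inter> {h..<int Q})"
    by (subst split) (rule card_Un_le)
  ultimately have "real (card ?S) \<le> 2 * real (card R)" by linarith
  then show ?thesis using cardR by linarith
qed

text \<open>Passing from \<alpha> to P/Q moves the multiple by \<open>d\<close> by at most 1/Q,
  while d P/Q with 0 < |d| < Q is itself at least 1/Q away from the integers. So the error is
  absorbed into the distance at the cost of a constant.\<close>

lemma diophantine_rational_approx:
  fixes \<alpha> c B :: real and P :: int and Q :: nat and d :: int
  assumes Q: "Q > 0" and cop: "coprime P (int Q)" and app: "\<bar>\<alpha> - of_int P / real Q\<bar> \<le> 1 / (real Q * real Q)"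
    and c: "0 < c" and dc: "\<And>(j::nat) (p::int). 1 \<le> j \<Longrightarrow> c * exp (- B * real j) \<le> \<bar>real j * \<alpha> - of_int p\<bar>"
    and d: "d \<noteq> 0" "\<bar>d\<bar> < int Q"
  shows "(c / 3) * exp (- B * real_of_int \<bar>d\<bar>) \<le> dz (of_int d * (of_int P / real Q))"
proof -
  let ?\<omega> = "of_int P / real Q"
  define j where "j = nat \<bar>d\<bar>"
  have j: "1 \<le> j" "real j = of_int \<bar>d\<bar>" "j < Q" using d by (auto simp: j_def)
  have Qr: "0 < real Q" using Q by simp
  define r where "r = round (of_int d * ?\<omega>)"
  have a: "c * exp (- B * real j) \<le> \<bar>of_int d * \<alpha> - of_int r\<bar>"
  proof (cases "d \<ge> 0")
    case True then show ?thesis using dc[OF j(1), of r] j(2) by simp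
  next
    case False
    have "\<bar>of_int d * \<alpha> - of_int r\<bar> = \<bar>real j * \<alpha> - of_int (- r)\<bar>" using False j(2) by simp
    then show ?thesis using dc[OF j(1), of "- r"] by simp
  qed
  have b: "\<bar>of_int d * \<alpha> - of_int d * ?\<omega>\<bar> \<le> 1 / real Q"
  proof -
    have "\<bar>of_int d * \<alpha> - of_int d * ?\<omega>\<bar> = real j * \<bar>\<alpha> - ?\<omega>\<bar>" unfolding j(2) right_diff_distrib[symmetric] by (simp only: abs_mult of_int_abs)
    also have "\<dots> \<le> real Q * (1 / (real Q * real Q))" using app j(3) by (intro mult_mono) auto
    finally show ?thesis using Qr by simp
  qed
  have e: "1 / real Q \<le> dz (of_int d * ?\<omega>)"
  proof -
    have "d * P - r * int Q \<noteq> 0"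
    proof
      assume "d * P - r * int Q = 0"
      then have "int Q dvd d * P" by (metis dvd_triv_right eq_iff_diff_eq_0)
      then have "int Q dvd d" using cop by (simp add: coprime_commute coprime_dvd_mult_left_iff)
      then show False using dvd_imp_le_int[OF d(1)] d(2) by fastforce
    qed
    then have "1 \<le> \<bar>real_of_int (d * P - r * int Q)\<bar>" by linarith
    moreover have "of_int d * ?\<omega> - of_int r = of_int (d * P - r * int Q) / real Q" using Qr by (simp add: field_simps)
    ultimately show ?thesis unfolding dz_def r_def[symmetric] using Qr by (simp add: divide_right_mono)
  qed
  have "\<bar>of_int d * \<alpha> - of_int r\<bar> \<le> dz (of_int d * ?\<omega>) + 1 / real Q"
  proof -
    have tri: "\<bar>u - v\<bar> \<le> w \<Longrightarrow> \<bar>u - z\<bar> \<le> \<bar>v - z\<bar> + w" for u v w z :: real by linarith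
    show ?thesis unfolding dz_def r_def[symmetric] by (rule tri[OF b])
  qed
  then have "c * exp (- B * real j) \<le> 2 * dz (of_int d * ?\<omega>)" using a e by linarith
  moreover have "0 \<le> dz (of_int d * ?\<omega>)" by simp
  ultimately show ?thesis unfolding j(2) by linarith
qed

lemma sum_swap3:
  fixes f :: "'a \<Rightarrow> 'b \<Rightarrow> 'c \<Rightarrow> 'd::comm_monoid_add"
  shows "(\<Sum>a\<in>A. \<Sum>b\<in>B. \<Sum>c\<in>C. f a b c) = (\<Sum>b\<in>B. \<Sum>c\<in>C. \<Sum>a\<in>A. f a b c)"
proof -
  have "(\<Sum>a\<in>A. \<Sum>b\<in>B. \<Sum>c\<in>C. f a b c) = (\<Sum>b\<in>B. \<Sum>a\<in>A. \<Sum>c\<in>C. f a b c)" by (rule sum.swap)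
  also have "\<dots> = (\<Sum>b\<in>B. \<Sum>c\<in>C. \<Sum>a\<in>A. f a b c)" by (intro sum.cong refl) (rule sum.swap)
  finally show ?thesis .
qed

section \<open>Aubry duality on the cycle\<close>

locale dual_model =
  fixes Q :: nat and P :: int and W :: "int \<Rightarrow> real"
  assumes Q: "Q > 0" and cop: "coprime P (int Q)" and W_per: "\<And>n. W (n + int Q) = W n"
begin

definition om :: real where "om = of_int P / real Q"

text \<open>This phase keeps \<open>2 xx + m om\<close> at distance at least \<open>1 / (2 Q)\<close> from the integers: no exact resonance occurs.\<close>

definition xx :: real where "xx = 1 / (4 * real Q)"

text \<open>Discrete Fourier coefficients with respect to the frequency P/Q instead of 1/Q: for a
  sampled potential W n = v(\<theta> + n P/Q) the harmonic s of v then lands at the index s modulo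
  \<open>Q\<close>, so that decay of harmonics becomes decay in \<open>cyn Q s\<close>.\<close>

definition cc :: "int \<Rightarrow> complex" where
  "cc s = (\<Sum>n\<in>{0..<int Q}. of_real (W n) * ee (- (of_int (n * s) * om))) / of_nat Q"

lemma om_Q: "of_int (a * int Q) * om = of_int (a * P)"
  using Q by (simp add: om_def)

lemma ee_om_period: "ee (of_int (d + a * int Q) * om) = ee (of_int d * om)"
proof -
  have "of_int (d + a * int Q) * om = of_int d * om + of_int (a * P)"
    unfolding om_Q[symmetric] by (simp add: distrib_right)
  then show ?thesis by (simp only: ee_add ee_int mult_1_right)
qed

lemma char_sum: "(\<Sum>s\<in>{0..<int Q}. ee (of_int (s * d) * om)) = (if int Q dvd d then of_nat Q else 0)"
proof -
  have img: "(\<Sum>s\<in>{0..<int Q}. ee (of_int (s * d) * om)) = (\<Sum>k<Q. ee (of_int d * om) ^ k)"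
    by (rule sum.reindex_bij_witness[of _ int nat]) (auto simp: ee_power mult_ac)
  show ?thesis
  proof (cases "int Q dvd d")
    case True
    then obtain a where "d = 0 + a * int Q" by (metis add_0 dvdE mult.commute)
    then have "ee (of_int d * om) = 1" using ee_om_period[of 0 a] by simp
    then show ?thesis unfolding img using True by simp
  next
    case False
    have "ee (of_int d * om) \<noteq> 1"
    proof
      assume "ee (of_int d * om) = 1"
      then obtain k :: int where "of_int d * om = of_int k" using ee_eq_1_imp_int by (auto elim: Ints_cases)
      then have "real_of_int (d * P) = of_int (k * int Q)" using Q by (simp add: om_def field_simps)
      then have "d * P = k * int Q" by (simp only: of_int_eq_iff)
      then have "int Q dvd d * P" by simp
      then have "int Q dvd d" using cop by (simp add: coprime_commute coprime_dvd_mult_left_iff)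
      then show False using False by simp
    qed
    moreover have "ee (of_int d * om) ^ Q = 1"
    proof -
      have "real Q * (of_int d * om) = of_int (d * P)" using om_Q[of d] by (simp add: mult_ac)
      then show ?thesis unfolding ee_power by (simp only: ee_int)
    qed
    ultimately show ?thesis unfolding img using False by (simp add: geometric_sum)
  qed
qed

lemma cc_per: "cc (s + int Q) = cc s"
proof -
  have "ee (- (of_int (n * (s + int Q)) * om)) = ee (- (of_int (n * s) * om))" for n
    unfolding ee_minus distrib_left[of n s] ee_om_period ..
  then show ?thesis by (simp only: cc_def)
qed

lemma cc_cnj: "cc (- s) = cnj (cc s)"
proof -
  have "ee (- (of_int (n * - s) * om)) = cnj (ee (- (of_int (n * s) * om)))" for n
    unfolding ee_minus[symmetric] by simp
  then show ?thesis unfolding cc_def complex_cnj_divide cnj_sum complex_cnj_mult complex_cnj_complex_of_real complex_cnj_of_nat by simp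
qed

lemma W_expand: "of_real (W n) = (\<Sum>s\<in>{0..<int Q}. cc s * ee (of_int (n * s) * om))"
proof -
  have *: "of_real (W n) = (\<Sum>s\<in>{0..<int Q}. cc s * ee (of_int (n * s) * om))" if n: "n \<in> {0..<int Q}" for n
  proof -
    have "(\<Sum>s\<in>{0..<int Q}. cc s * ee (of_int (n * s) * om))
       = (\<Sum>s\<in>{0..<int Q}. \<Sum>k\<in>{0..<int Q}. of_real (W k) * ee (of_int (s * (n - k)) * om) / of_nat Q)"
    proof (intro sum.cong refl)
      fix s
      have "ee (- (of_int (k * s) * om)) * ee (of_int (n * s) * om) = ee (of_int (s * (n - k)) * om)" for k
        unfolding ee_add[symmetric] by (simp add: algebra_simps)
      then show "cc s * ee (of_int (n * s) * om) = (\<Sum>k\<in>{0..<int Q}. of_real (W k) * ee (of_int (s * (n - k)) * om) / of_nat Q)"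
        unfolding cc_def by (simp add: sum_divide_distrib sum_distrib_right mult.assoc)
    qed
    also have "\<dots> = (\<Sum>k\<in>{0..<int Q}. \<Sum>s\<in>{0..<int Q}. of_real (W k) * ee (of_int (s * (n - k)) * om) / of_nat Q)" by (rule sum.swap)
    also have "\<dots> = (\<Sum>k\<in>{0..<int Q}. of_real (W k) * (\<Sum>s\<in>{0..<int Q}. ee (of_int (s * (n - k)) * om)) / of_nat Q)"
      by (simp only: sum_divide_distrib sum_distrib_left)
    also have "\<dots> = (\<Sum>k\<in>{0..<int Q}. if k = n then of_real (W k) else 0)"
    proof (intro sum.cong refl)
      fix k assume k: "k \<in> {0..<int Q}"
      have "int Q dvd n - k \<longleftrightarrow> k = n"
      proof
        assume dv: "int Q dvd n - k"
        show "k = n"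
        proof (rule ccontr)
          assume "k \<noteq> n"
          then have "\<bar>int Q\<bar> \<le> \<bar>n - k\<bar>" using dv by (intro dvd_imp_le_int) auto
          then show False using k n by auto
        qed
      qed simp
      then show "of_real (W k) * (\<Sum>s\<in>{0..<int Q}. ee (of_int (s * (n - k)) * om)) / of_nat Q = (if k = n then of_real (W k) else 0)"
        unfolding char_sum using Q by simp
    qed
    also have "\<dots> = of_real (W n)" using n by simp
    finally show ?thesis by simp
  qed
  have "W (n mod int Q) = W n" by (rule sum_period(2)[of Q W, OF Q W_per])
  moreover have "ee (of_int ((n mod int Q) * s) * om) = ee (of_int (n * s) * om)" for s
  proof -
    have "n * s = (n mod int Q) * s + ((n div int Q) * s) * int Q"
      by (metis div_mult_mod_eq distrib_right mult.assoc mult.commute add.commute)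
    then show ?thesis by (metis ee_om_period)
  qed
  ultimately show ?thesis using *[of "n mod int Q"] Q by simp
qed

lemma exists_dual_eigenbasis:
  obtains E :: "nat \<Rightarrow> real" and \<phi> :: "nat \<Rightarrow> int \<Rightarrow> complex" where
    "\<And>j l. \<phi> j (l + int Q) = \<phi> j l"
    "\<And>j i. j < Q \<Longrightarrow> of_real (2 * cos (2 * pi * (xx + of_int i * om))) * \<phi> j i + (\<Sum>l\<in>{0..<int Q}. cc (i - l) * \<phi> j l) = of_real (E j) * \<phi> j i"
    "\<And>j j'. j < Q \<Longrightarrow> j' < Q \<Longrightarrow> (\<Sum>i\<in>{0..<int Q}. cnj (\<phi> j i) * \<phi> j' i) = (if j = j' then 1 else 0)"
    "\<And>i i'. i \<in> {0..<int Q} \<Longrightarrow> i' \<in> {0..<int Q} \<Longrightarrow> (\<Sum>j<Q. \<phi> j i * cnj (\<phi> j i')) = (if i = i' then 1 else 0)"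
proof -
  define K where "K i l = (if i = l then of_real (2 * cos (2 * pi * (xx + real i * om))) else 0) + cc (int i - int l)" for i l :: nat
  have herm: "K j i = cnj (K i j)" for i j
  proof -
    have c: "cc (int j - int i) = cnj (cc (int i - int j))" using cc_cnj[of "int i - int j"] by simp
    show ?thesis
    proof (cases "i = j")
      case True then show ?thesis using c by (simp only: K_def if_True complex_cnj_add complex_cnj_complex_of_real simp_thms)
    next
      case False
      then have "j \<noteq> i" by simp
      then show ?thesis using False c by (simp only: K_def if_False complex_cnj_add complex_cnj_zero)
    qed
  qed
  obtain E :: "nat \<Rightarrow> real" and f where f:
    "\<And>j i. j < Q \<Longrightarrow> i < Q \<Longrightarrow> (\<Sum>l<Q. K i l * f j l) = of_real (E j) * f j i"
    "\<And>j j'. j < Q \<Longrightarrow> j' < Q \<Longrightarrow> (\<Sum>i<Q. cnj (f j i) * f j' i) = (if j = j' then 1 else 0)"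
    "\<And>i i'. i < Q \<Longrightarrow> i' < Q \<Longrightarrow> (\<Sum>j<Q. f j i * cnj (f j i')) = (if i = i' then 1 else 0)"
    by (rule hermitian_eigenbasis[of Q K, OF herm]) (assumption | (rule that; assumption))+
  define \<phi> where "\<phi> j l = f j (nat (l mod int Q))" for j l
  have fi: "\<phi> j (int l) = f j l" if "l < Q" for j l using that by (simp add: \<phi>_def)
  have re: "(\<Sum>l\<in>{0..<int Q}. h l) = (\<Sum>l<Q. h (int l))" for h :: "int \<Rightarrow> complex"
    by (rule sum.reindex_bij_witness[of _ int nat]) auto
  show thesis
  proof (rule that[of \<phi> E])
    show "\<phi> j (l + int Q) = \<phi> j l" for j l by (simp add: \<phi>_def)
    show "(\<Sum>i\<in>{0..<int Q}. cnj (\<phi> j i) * \<phi> j' i) = (if j = j' then 1 else 0)" if "j < Q" "j' < Q" for j j'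
      unfolding re using f(2)[OF that] by (simp add: fi)
    show "(\<Sum>j<Q. \<phi> j i * cnj (\<phi> j i')) = (if i = i' then 1 else 0)" if "i \<in> {0..<int Q}" "i' \<in> {0..<int Q}" for i i'
    proof -
      have a: "nat i < Q" "nat i' < Q" and b: "nat i = nat i' \<longleftrightarrow> i = i'" and c: "i mod int Q = i" "i' mod int Q = i'"
        using that by auto
      show ?thesis using f(3)[OF a] unfolding b by (simp only: \<phi>_def c)
    qed
  next
    fix j i assume j: "j < Q"
    define i0 where "i0 = nat (i mod int Q)"
    have i0: "i0 < Q" "int i0 = i mod int Q" using Q by (auto simp: i0_def nat_less_iff)
    have ii: "i = int i0 + (i div int Q) * int Q" unfolding i0(2) by simp
    have p1: "\<phi> j i = f j i0" by (simp add: \<phi>_def i0_def)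
    have p2: "cc (i - int l) = cc (int i0 - int l)" for l
    proof -
      have "cc ((i - int l) mod int Q) = cc (i - int l)" "cc ((int i0 - int l) mod int Q) = cc (int i0 - int l)"
        by (rule sum_period(2)[of Q cc, OF Q cc_per])+
      moreover have "(i - int l) mod int Q = (int i0 - int l) mod int Q" unfolding i0(2) by (simp add: mod_diff_left_eq)
      ultimately show ?thesis by simp
    qed
    have p3: "cos (2 * pi * (xx + of_int i * om)) = cos (2 * pi * (xx + real i0 * om))"
    proof -
      have "of_int i * om = real i0 * om + of_int ((i div int Q) * P)"
        using arg_cong[OF ii, of "\<lambda>t. of_int t * om"] om_Q[of "i div int Q"] by (simp add: distrib_right)
      then have "ee (xx + of_int i * om) = ee (xx + real i0 * om)"
        by (simp only: add.assoc[symmetric] ee_add ee_int mult_1_right)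
      then have "Re (ee (xx + of_int i * om)) = Re (ee (xx + real i0 * om))" by simp
      then show ?thesis by (simp add: ee_def)
    qed
    have "(\<Sum>l<Q. K i0 l * f j l) = of_real (2 * cos (2 * pi * (xx + real i0 * om))) * f j i0 + (\<Sum>l<Q. cc (int i0 - int l) * f j l)"
    proof -
      have "(\<Sum>l<Q. K i0 l * f j l) = (\<Sum>l<Q. (if i0 = l then of_real (2 * cos (2 * pi * (xx + real i0 * om))) * f j l else 0) + cc (int i0 - int l) * f j l)"
        by (intro sum.cong refl) (auto simp: K_def distrib_right)
      then show ?thesis using i0(1) by (simp add: sum.distrib)
    qed
    then show "of_real (2 * cos (2 * pi * (xx + of_int i * om))) * \<phi> j i + (\<Sum>l\<in>{0..<int Q}. cc (i - l) * \<phi> j l) = of_real (E j) * \<phi> j i"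
      unfolding re p1 p2 p3 using f(1)[OF j i0(1)] by (simp add: fi)
  qed
qed

end

locale dual_eig = dual_model +
  fixes E :: "nat \<Rightarrow> real" and \<phi> :: "nat \<Rightarrow> int \<Rightarrow> complex"
  assumes phi_per: "\<And>j l. \<phi> j (l + int Q) = \<phi> j l"
    and phi_ev: "\<And>j i. j < Q \<Longrightarrow> of_real (2 * cos (2 * pi * (xx + of_int i * om))) * \<phi> j i + (\<Sum>l\<in>{0..<int Q}. cc (i - l) * \<phi> j l) = of_real (E j) * \<phi> j i"
    and phi_on: "\<And>j j'. j < Q \<Longrightarrow> j' < Q \<Longrightarrow> (\<Sum>i\<in>{0..<int Q}. cnj (\<phi> j i) * \<phi> j' i) = (if j = j' then 1 else 0)"
    and phi_cp: "\<And>i i'. i \<in> {0..<int Q} \<Longrightarrow> i' \<in> {0..<int Q} \<Longrightarrow> (\<Sum>j<Q. \<phi> j i * cnj (\<phi> j i')) = (if i = i' then 1 else 0)"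
begin

text \<open>A Bloch wave of the periodic approximant: a translation by \<open>Q\<close> multiplies
  it by \<open>ee (1/4)\<close>, the imaginary unit, because Q xx = 1/4.\<close>

definition ww :: "nat \<Rightarrow> int \<Rightarrow> complex" where
  "ww j n = (\<Sum>m\<in>{0..<int Q}. \<phi> j m * ee (of_int n * (xx + of_int m * om)))"

lemma ee_site_period: "ee (of_int n * (xx + of_int (m + int Q) * om)) = ee (of_int n * (xx + of_int m * om))"
proof -
  have "of_int n * (xx + of_int (m + int Q) * om) = of_int n * (xx + of_int m * om) + of_int (n * P)"
    using om_Q[of n] by (simp add: algebra_simps)
  then show ?thesis by (simp only: ee_add ee_int mult_1_right)
qed

text \<open>The transform turns multiplication by 2 cos into the two shifts and convolution with
  \<open>cc\<close> into multiplication by \<open>W\<close>, so this is the dual eigenvalue equation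
  read on the other side.\<close>

lemma ww_eq:
  assumes j: "j < Q"
  shows "ww j (n + 1) + ww j (n - 1) + of_real (W n) * ww j n = of_real (E j) * ww j n"
proof -
  let ?e = "\<lambda>m. ee (of_int n * (xx + of_int m * om))"
  have hop: "ww j (n + 1) + ww j (n - 1) = (\<Sum>m\<in>{0..<int Q}. of_real (2 * cos (2 * pi * (xx + of_int m * om))) * \<phi> j m * ?e m)"
  proof -
    have H: "ee (of_int (n + 1) * y) + ee (of_int (n - 1) * y) = (ee y + ee (- y)) * ee (of_int n * y)" for y
      unfolding distrib_right ee_add[symmetric] by (simp add: algebra_simps)
    have "\<phi> j m * ee (of_int (n + 1) * (xx + of_int m * om)) + \<phi> j m * ee (of_int (n - 1) * (xx + of_int m * om))
       = of_real (2 * cos (2 * pi * (xx + of_int m * om))) * \<phi> j m * ?e m" for m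
    proof -
      have "\<phi> j m * ee (of_int (n + 1) * (xx + of_int m * om)) + \<phi> j m * ee (of_int (n - 1) * (xx + of_int m * om))
        = \<phi> j m * ((ee (xx + of_int m * om) + ee (- (xx + of_int m * om))) * ?e m)"
        unfolding H[symmetric] by (rule distrib_left[symmetric])
      also have "\<dots> = \<phi> j m * (of_real (2 * cos (2 * pi * (xx + of_int m * om))) * ?e m)"
        by (simp only: two_cos_ee)
      finally show ?thesis by (simp only: mult.assoc mult.left_commute)
    qed
    then show ?thesis unfolding ww_def sum.distrib[symmetric] by (simp only:)
  qed
  have pot: "of_real (W n) * ww j n = (\<Sum>m\<in>{0..<int Q}. (\<Sum>l\<in>{0..<int Q}. cc (m - l) * \<phi> j l) * ?e m)"
  proof -
    have sh: "cc s * ee (of_int (n * s) * om) * ?e l = cc ((s + l) - l) * ?e (s + l)" for s l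
    proof -
      have "of_int (n * s) * om + of_int n * (xx + of_int l * om) = of_int n * (xx + of_int (s + l) * om)" by (simp add: algebra_simps)
      then have "ee (of_int (n * s) * om) * ?e l = ?e (s + l)" unfolding ee_add[symmetric] by (simp only:)
      then show ?thesis by (simp add: mult.assoc)
    qed
    have "of_real (W n) * ww j n = (\<Sum>l\<in>{0..<int Q}. \<phi> j l * (\<Sum>s\<in>{0..<int Q}. cc ((s + l) - l) * ?e (s + l)))"
    proof -
      have A: "of_real (W n) * ?e l = (\<Sum>s\<in>{0..<int Q}. cc ((s + l) - l) * ?e (s + l))" for l
        unfolding W_expand sum_distrib_right sh ..
      have "of_real (W n) * (\<phi> j l * ?e l) = \<phi> j l * (\<Sum>s\<in>{0..<int Q}. cc ((s + l) - l) * ?e (s + l))" for l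
        unfolding A[symmetric] by (rule mult.left_commute)
      then show ?thesis unfolding ww_def sum_distrib_left[of "of_real (W n)"] by (intro sum.cong refl)
    qed
    also have "\<dots> = (\<Sum>l\<in>{0..<int Q}. \<phi> j l * (\<Sum>m\<in>{0..<int Q}. cc (m - l) * ?e m))"
    proof -
      have "(\<Sum>s\<in>{0..<int Q}. cc ((s + l) - l) * ?e (s + l)) = (\<Sum>m\<in>{0..<int Q}. cc (m - l) * ?e m)" for l
      proof -
      have "(\<Sum>s\<in>{0..<int Q}. cc ((s + l) - l) * ?e (s + l)) = (\<Sum>m\<in>{l..<l + int Q}. cc (m - l) * ?e m)"
        by (rule sum.reindex_bij_witness[of _ "\<lambda>m. m - l" "\<lambda>s. s + l"]) auto
      also have "\<dots> = (\<Sum>m\<in>{0..<int Q}. cc (m - l) * ?e m)"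
      proof (rule sum_period(1)[OF Q])
        fix m
        have "m + int Q - l = (m - l) + int Q" by simp
        then have "cc (m + int Q - l) = cc (m - l)" by (simp only: cc_per)
        then show "cc (m + int Q - l) * ?e (m + int Q) = cc (m - l) * ?e m" by (simp only: ee_site_period)
      qed
      finally show ?thesis .
      qed
      then show ?thesis by (simp only:)
    qed
    also have "\<dots> = (\<Sum>l\<in>{0..<int Q}. \<Sum>m\<in>{0..<int Q}. cc (m - l) * \<phi> j l * ?e m)"
      unfolding sum_distrib_left by (intro sum.cong refl) (simp only: mult.left_commute mult.assoc)
    also have "\<dots> = (\<Sum>m\<in>{0..<int Q}. \<Sum>l\<in>{0..<int Q}. cc (m - l) * \<phi> j l * ?e m)" by (rule sum.swap)
    finally show ?thesis by (simp only: sum_distrib_right)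
  qed
  have "ww j (n + 1) + ww j (n - 1) + of_real (W n) * ww j n
      = (\<Sum>m\<in>{0..<int Q}. (of_real (2 * cos (2 * pi * (xx + of_int m * om))) * \<phi> j m + (\<Sum>l\<in>{0..<int Q}. cc (m - l) * \<phi> j l)) * ?e m)"
    unfolding hop pot sum.distrib[symmetric] by (simp only: distrib_right)
  also have "\<dots> = of_real (E j) * ww j n"
    unfolding phi_ev[OF j] ww_def sum_distrib_left by (simp only: mult.assoc)
  finally show ?thesis .
qed

text \<open>Completeness of the dual eigenbasis, transported by the transform. Sites a full period
  apart carry proportional values, which is why |n - n'| stays below \<open>Q\<close>.\<close>

lemma ww_complete:
  assumes "\<bar>n - n'\<bar> < int Q"
  shows "(\<Sum>j<Q. ww j n * cnj (ww j n')) = (if n = n' then of_nat Q else 0)"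
proof -
  let ?e = "\<lambda>n m. ee (of_int n * (xx + of_int m * om))"
  have "(\<Sum>j<Q. ww j n * cnj (ww j n')) = (\<Sum>j<Q. \<Sum>m\<in>{0..<int Q}. \<Sum>m'\<in>{0..<int Q}. (\<phi> j m * cnj (\<phi> j m')) * (?e n m * cnj (?e n' m')))"
    unfolding ww_def cnj_sum sum_product complex_cnj_mult by (simp only: mult_ac)
  also have "\<dots> = (\<Sum>m\<in>{0..<int Q}. \<Sum>m'\<in>{0..<int Q}. \<Sum>j<Q. (\<phi> j m * cnj (\<phi> j m')) * (?e n m * cnj (?e n' m')))"
    by (rule sum_swap3)
  also have "\<dots> = (\<Sum>m\<in>{0..<int Q}. \<Sum>m'\<in>{0..<int Q}. if m = m' then ?e n m * cnj (?e n' m') else 0)"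
    unfolding sum_distrib_right[symmetric] by (intro sum.cong refl) (simp add: phi_cp)
  also have "\<dots> = (\<Sum>m\<in>{0..<int Q}. ?e n m * cnj (?e n' m))" by (intro sum.cong refl) simp
  also have "\<dots> = (\<Sum>m\<in>{0..<int Q}. ee (of_int (n - n') * xx) * ee (of_int (m * (n - n')) * om))"
  proof (intro sum.cong refl)
    fix m
    have "of_int n * (xx + of_int m * om) - of_int n' * (xx + of_int m * om) = of_int (n - n') * xx + of_int (m * (n - n')) * om"
      by (simp add: algebra_simps)
    then show "?e n m * cnj (?e n' m) = ee (of_int (n - n') * xx) * ee (of_int (m * (n - n')) * om)"
      unfolding ee_diff[symmetric] ee_add[symmetric] by (simp only:)
  qed
  also have "\<dots> = ee (of_int (n - n') * xx) * (if int Q dvd n - n' then of_nat Q else 0)"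
    unfolding sum_distrib_left[symmetric] char_sum ..
  also have "\<dots> = (if n = n' then of_nat Q else 0)"
  proof (cases "n = n'")
    case False
    then have "\<not> int Q dvd n - n'" using assms dvd_imp_le_int[of "n - n'" "int Q"] by auto
    then show ?thesis using False by simp
  qed simp
  finally show ?thesis .
qed

lemma ww_parseval:
  assumes "j < Q" "j' < Q"
  shows "(\<Sum>n\<in>{a..<a + int Q}. cnj (ww j n) * ww j' n) = (if j = j' then of_nat Q else 0)"
proof -
  let ?e = "\<lambda>n m. ee (of_int n * (xx + of_int m * om))"
  have cs: "(\<Sum>n\<in>{a..<a + int Q}. ee (of_int (n * d) * om)) = (if int Q dvd d then of_nat Q else 0)" for d
  proof -
    have "(\<Sum>n\<in>{a..<a + int Q}. ee (of_int (n * d) * om)) = (\<Sum>n\<in>{0..<int Q}. ee (of_int (n * d) * om))"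
    proof (rule sum_period(1)[OF Q])
      fix l show "ee (of_int ((l + int Q) * d) * om) = ee (of_int (l * d) * om)"
        using ee_om_period[of "l * d" d] by (simp add: algebra_simps)
    qed
    then show ?thesis by (simp only: char_sum)
  qed
  have "(\<Sum>n\<in>{a..<a + int Q}. cnj (ww j n) * ww j' n) = (\<Sum>n\<in>{a..<a + int Q}. \<Sum>m\<in>{0..<int Q}. \<Sum>m'\<in>{0..<int Q}. (cnj (\<phi> j m) * \<phi> j' m') * ee (of_int (n * (m' - m)) * om))"
  proof (intro sum.cong refl)
    fix n
    have "cnj (?e n m) * ?e n m' = ee (of_int (n * (m' - m)) * om)" for m m'
    proof -
      have "of_int n * (xx + of_int m' * om) - of_int n * (xx + of_int m * om) = of_int (n * (m' - m)) * om" by (simp add: algebra_simps)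
      then show ?thesis using ee_diff[of "of_int n * (xx + of_int m' * om)" "of_int n * (xx + of_int m * om)"] by (simp only: mult.commute)
    qed
    then have "(cnj (\<phi> j m) * cnj (?e n m)) * (\<phi> j' m' * ?e n m') = (cnj (\<phi> j m) * \<phi> j' m') * ee (of_int (n * (m' - m)) * om)" for m m'
      by (simp only: mult.assoc mult.left_commute)
    then show "cnj (ww j n) * ww j' n = (\<Sum>m\<in>{0..<int Q}. \<Sum>m'\<in>{0..<int Q}. (cnj (\<phi> j m) * \<phi> j' m') * ee (of_int (n * (m' - m)) * om))"
      unfolding ww_def cnj_sum sum_product complex_cnj_mult by (simp only:)
  qed
  also have "\<dots> = (\<Sum>m\<in>{0..<int Q}. \<Sum>m'\<in>{0..<int Q}. (cnj (\<phi> j m) * \<phi> j' m') * (\<Sum>n\<in>{a..<a + int Q}. ee (of_int (n * (m' - m)) * om)))"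
    unfolding sum_distrib_left by (rule sum_swap3)
  also have "\<dots> = (\<Sum>m\<in>{0..<int Q}. \<Sum>m'\<in>{0..<int Q}. if m = m' then (cnj (\<phi> j m) * \<phi> j' m') * of_nat Q else 0)"
  proof (intro sum.cong refl)
    fix m m' assume m: "m \<in> {0..<int Q}" "m' \<in> {0..<int Q}"
    have "int Q dvd m' - m \<longleftrightarrow> m = m'"
    proof
      assume dv: "int Q dvd m' - m"
      show "m = m'"
      proof (rule ccontr)
        assume "m \<noteq> m'"
        then have "\<bar>int Q\<bar> \<le> \<bar>m' - m\<bar>" using dv by (intro dvd_imp_le_int) auto
        then show False using m by auto
      qed
    qed simp
    then show "(cnj (\<phi> j m) * \<phi> j' m') * (\<Sum>n\<in>{a..<a + int Q}. ee (of_int (n * (m' - m)) * om)) = (if m = m' then (cnj (\<phi> j m) * \<phi> j' m') * of_nat Q else 0)"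
      unfolding cs by simp
  qed
  also have "\<dots> = (\<Sum>m\<in>{0..<int Q}. cnj (\<phi> j m) * \<phi> j' m) * of_nat Q"
    unfolding sum_distrib_right by (intro sum.cong refl) simp
  also have "\<dots> = (if j = j' then of_nat Q else 0)" unfolding phi_on[OF assms] by simp
  finally show ?thesis .
qed

lemma phi_norm_j: "(\<Sum>j<Q. (cmod (\<phi> j i))\<^sup>2) = 1"
proof -
  have "(\<Sum>j<Q. (cmod (\<phi> j i))\<^sup>2) = (\<Sum>j<Q. (cmod (\<phi> j (i mod int Q)))\<^sup>2)"
    by (simp only: sum_period(2)[of Q "\<phi> _", OF Q phi_per])
  also have "complex_of_real \<dots> = (\<Sum>j<Q. \<phi> j (i mod int Q) * cnj (\<phi> j (i mod int Q)))"
    by (simp add: complex_norm_square del: of_real_power)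
  also have "\<dots> = 1" using Q by (subst phi_cp) auto
  finally show ?thesis by (simp only: of_real_eq_1_iff)
qed

lemma phi_norm_i: "j < Q \<Longrightarrow> (\<Sum>i\<in>{0..<int Q}. (cmod (\<phi> j i))\<^sup>2) = 1"
proof -
  assume j: "j < Q"
  have "complex_of_real (\<Sum>i\<in>{0..<int Q}. (cmod (\<phi> j i))\<^sup>2) = (\<Sum>i\<in>{0..<int Q}. cnj (\<phi> j i) * \<phi> j i)"
    by (simp add: complex_norm_square mult.commute del: of_real_power)
  then show ?thesis unfolding phi_on[OF j j] by (simp only: if_True simp_thms of_real_eq_1_iff)
qed

lemma ww_norm: "j < Q \<Longrightarrow> (\<Sum>n\<in>{a..<a + int Q}. (cmod (ww j n))\<^sup>2) = real Q"
proof -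
  assume j: "j < Q"
  have "complex_of_real (\<Sum>n\<in>{a..<a + int Q}. (cmod (ww j n))\<^sup>2) = (\<Sum>n\<in>{a..<a + int Q}. cnj (ww j n) * ww j n)"
    by (simp add: complex_norm_square mult.commute del: of_real_power)
  also have "\<dots> = complex_of_real (real Q)" unfolding ww_parseval[OF j j] by simp
  finally show ?thesis by (simp only: of_real_eq_iff)
qed

end

section \<open>Decay of averaged correlations\<close>

lemma sum_shift_period:
  fixes f :: "int \<Rightarrow> 'a::comm_monoid_add"
  assumes Q: "Q > 0" and per: "\<And>l. f (l + int Q) = f l"
  shows "(\<Sum>m\<in>{0..<int Q}. f (m + d)) = (\<Sum>m\<in>{0..<int Q}. f m)"
proof -
  have "(\<Sum>m\<in>{0..<int Q}. f (m + d)) = (\<Sum>m\<in>{d..<d + int Q}. f m)"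
    by (rule sum.reindex_bij_witness[of _ "\<lambda>m. m - d" "\<lambda>m. m + d"]) auto
  also have "\<dots> = (\<Sum>m\<in>{0..<int Q}. f m)" by (rule sum_period(1)[of Q f, OF Q per])
  finally show ?thesis .
qed

context dual_eig
begin

text \<open>An eigenfunction correlator averaged over the sites: it measures localisation without
  reference to centres.\<close>

definition cor :: "int \<Rightarrow> real" where
  "cor d = (\<Sum>m\<in>{0..<int Q}. \<Sum>j<Q. cmod (\<phi> j m) * cmod (\<phi> j (m + d))) / real Q"

lemma sum_j_le_1: "(\<Sum>j<Q. cmod (\<phi> j a) * cmod (\<phi> j b)) \<le> 1"
proof -
  have "cmod (\<phi> j a) * cmod (\<phi> j b) \<le> ((cmod (\<phi> j a))\<^sup>2 + (cmod (\<phi> j b))\<^sup>2) / 2" for j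
    using sum_squares_bound[of "cmod (\<phi> j a)" "cmod (\<phi> j b)"] by simp
  then have "(\<Sum>j<Q. cmod (\<phi> j a) * cmod (\<phi> j b)) \<le> (\<Sum>j<Q. ((cmod (\<phi> j a))\<^sup>2 + (cmod (\<phi> j b))\<^sup>2) / 2)"
    by (intro sum_mono)
  also have "\<dots> = 1" by (simp add: sum_divide_distrib[symmetric] sum.distrib phi_norm_j)
  finally show ?thesis .
qed

lemma cor_le_1: "cor d \<le> 1"
proof -
  have "(\<Sum>m\<in>{0..<int Q}. \<Sum>j<Q. cmod (\<phi> j m) * cmod (\<phi> j (m + d))) \<le> (\<Sum>m\<in>{0..<int Q}. 1)"
    by (intro sum_mono sum_j_le_1)
  then show ?thesis unfolding cor_def using Q by simp
qed

lemma cor_minus: "cor (- d) = cor d"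
proof -
  have "(\<Sum>m\<in>{0..<int Q}. \<Sum>j<Q. cmod (\<phi> j (m + - d)) * cmod (\<phi> j ((m + - d) + d))) = (\<Sum>m\<in>{0..<int Q}. \<Sum>j<Q. cmod (\<phi> j m) * cmod (\<phi> j (m + d)))"
  proof (rule sum_shift_period[of Q "\<lambda>m. \<Sum>j<Q. cmod (\<phi> j m) * cmod (\<phi> j (m + d))", OF Q])
    fix l
    have "(l + int Q) + d = (l + d) + int Q" by simp
    then show "(\<Sum>j<Q. cmod (\<phi> j (l + int Q)) * cmod (\<phi> j ((l + int Q) + d))) = (\<Sum>j<Q. cmod (\<phi> j l) * cmod (\<phi> j (l + d)))"
      by (simp only: phi_per)
  qed
  then show ?thesis unfolding cor_def by (simp add: mult.commute)
qed

lemma cor_cyn: "cor (cyn Q d) = cor d"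
proof -
  have per: "cor (l + int Q) = cor l" for l
  proof -
    have "m + (l + int Q) = (m + l) + int Q" for m by simp
    then show ?thesis unfolding cor_def by (simp only: phi_per)
  qed
  obtain k where k: "cyn Q d = \<bar>d + k * int Q\<bar>" using cyn_attained[OF Q] by blast
  have "cor \<bar>d + k * int Q\<bar> = cor (d + k * int Q)" using cor_minus[of "d + k * int Q"] by (simp add: abs_if)
  also have "\<dots> = cor ((d + k * int Q) mod int Q)" by (rule sum_period(2)[of Q cor, OF Q per, symmetric])
  also have "\<dots> = cor (d mod int Q)" by simp
  also have "\<dots> = cor d" by (rule sum_period(2)[of Q cor, OF Q per])
  finally show ?thesis unfolding k .
qed

text \<open>Gershgorin's argument at a site where the eigenvector is largest.\<close>

lemma eigenvalue_bound:
  assumes j: "j < Q" and \<kappa>: "0 < \<kappa>" and \<epsilon>1: "\<epsilon>1 * (2 * (1 + 1 / \<kappa>)) \<le> \<epsilon>" "0 \<le> \<epsilon>1"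
    and c: "\<And>d. cmod (cc d) \<le> \<epsilon>1 * exp (- (2 * \<kappa>) * of_int (cyn Q d))"
  shows "\<bar>E j - Re (cc 0)\<bar> \<le> 2 + \<epsilon>" and "cc 0 = of_real (Re (cc 0))"
proof -
  have "cc 0 = cnj (cc 0)" using cc_cnj[of 0] by simp
  then have "cc 0 \<in> \<real>" by (metis Reals_cnj_iff)
  then show c0: "cc 0 = of_real (Re (cc 0))" by simp
  have fin: "finite ((\<lambda>i. cmod (\<phi> j i)) ` {0..<int Q})" "(\<lambda>i. cmod (\<phi> j i)) ` {0..<int Q} \<noteq> {}" using Q by auto
  obtain i where i: "i \<in> {0..<int Q}" "cmod (\<phi> j i) = Max ((\<lambda>i. cmod (\<phi> j i)) ` {0..<int Q})"
    using Max_in[OF fin] by auto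
  have mx: "cmod (\<phi> j l) \<le> cmod (\<phi> j i)" if "l \<in> {0..<int Q}" for l unfolding i(2) using that fin by simp
  have pos: "0 < cmod (\<phi> j i)"
  proof (rule ccontr)
    assume "\<not> ?thesis"
    then have "cmod (\<phi> j l) = 0" if "l \<in> {0..<int Q}" for l using mx[OF that] by simp
    then have "(\<Sum>l\<in>{0..<int Q}. (cmod (\<phi> j l))\<^sup>2) = 0" by simp
    then show False using phi_norm_i[OF j] by simp
  qed
  have "(\<Sum>l\<in>{0..<int Q}. cc (i - l) * \<phi> j l) = cc 0 * \<phi> j i + (\<Sum>l\<in>{0..<int Q} - {i}. cc (i - l) * \<phi> j l)"
    using i by (subst sum.remove[of _ i]) auto
  moreover have "C * f + S = e * f \<Longrightarrow> S = z * f + R \<Longrightarrow> (e - z) * f = C * f + R" for C S e f z R :: complex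
  proof -
    assume "C * f + S = e * f" "S = z * f + R"
    then have "e * f = C * f + (z * f + R)" by simp
    then show ?thesis by (simp add: left_diff_distrib)
  qed
  ultimately have eq: "(of_real (E j) - cc 0) * \<phi> j i = of_real (2 * cos (2 * pi * (xx + of_int i * om))) * \<phi> j i + (\<Sum>l\<in>{0..<int Q} - {i}. cc (i - l) * \<phi> j l)"
    using phi_ev[OF j, of i] by blast
  have "of_real (E j - Re (cc 0)) = of_real (E j) - cc 0" by (simp only: of_real_diff c0[symmetric])
  then have "cmod (of_real (E j - Re (cc 0)) * \<phi> j i) = cmod (of_real (2 * cos (2 * pi * (xx + of_int i * om))) * \<phi> j i + (\<Sum>l\<in>{0..<int Q} - {i}. cc (i - l) * \<phi> j l))"
    by (simp only: eq)
  also have "\<dots> \<le> cmod (of_real (2 * cos (2 * pi * (xx + of_int i * om))) * \<phi> j i) + cmod (\<Sum>l\<in>{0..<int Q} - {i}. cc (i - l) * \<phi> j l)"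
    by (rule norm_triangle_ineq)
  also have "cmod (\<Sum>l\<in>{0..<int Q} - {i}. cc (i - l) * \<phi> j l) \<le> (\<Sum>l\<in>{0..<int Q} - {i}. \<epsilon>1 * exp (- \<kappa> * of_int (cyn Q (i - l))) * cmod (\<phi> j i))"
  proof (rule order_trans[OF norm_sum], rule sum_mono)
    fix l assume l: "l \<in> {0..<int Q} - {i}"
    have "0 \<le> real_of_int (cyn Q (i - l))" using cyn_nonneg[OF Q] by simp
    then have "\<kappa> * real_of_int (cyn Q (i - l)) \<le> 2 * \<kappa> * of_int (cyn Q (i - l))" using \<kappa> by (intro mult_right_mono) auto
    then have "exp (- (2 * \<kappa>) * of_int (cyn Q (i - l))) \<le> exp (- \<kappa> * of_int (cyn Q (i - l)))" by simp
    then have "cmod (cc (i - l)) \<le> \<epsilon>1 * exp (- \<kappa> * of_int (cyn Q (i - l)))"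
      by (intro order_trans[OF c[of "i - l"]] mult_left_mono \<epsilon>1(2))
    then show "cmod (cc (i - l) * \<phi> j l) \<le> \<epsilon>1 * exp (- \<kappa> * of_int (cyn Q (i - l))) * cmod (\<phi> j i)"
      unfolding norm_mult using mx[of l] l by (intro mult_mono) (auto intro: mult_nonneg_nonneg \<epsilon>1)
  qed
  also have "\<dots> \<le> (\<Sum>l\<in>{0..<int Q}. \<epsilon>1 * exp (- \<kappa> * of_int (cyn Q (i - l))) * cmod (\<phi> j i))"
    using \<epsilon>1 by (intro sum_mono2) auto
  also have "\<dots> = \<epsilon>1 * (\<Sum>l\<in>{0..<int Q}. exp (- \<kappa> * of_int (cyn Q (i - l)))) * cmod (\<phi> j i)"
    by (simp add: sum_distrib_left sum_distrib_right)
  also have "\<dots> \<le> \<epsilon> * cmod (\<phi> j i)"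
  proof (rule mult_right_mono)
    have "\<epsilon>1 * (\<Sum>l\<in>{0..<int Q}. exp (- \<kappa> * of_int (cyn Q (i - l)))) \<le> \<epsilon>1 * (2 * (1 + 1 / \<kappa>))"
      by (intro mult_left_mono sum_exp_cyn_le[OF Q \<kappa>] \<epsilon>1)
    then show "\<epsilon>1 * (\<Sum>l\<in>{0..<int Q}. exp (- \<kappa> * of_int (cyn Q (i - l)))) \<le> \<epsilon>" using \<epsilon>1(1) by linarith
  qed simp
  finally have "cmod (of_real (E j - Re (cc 0)) * \<phi> j i) \<le> cmod (of_real (2 * cos (2 * pi * (xx + of_int i * om))) * \<phi> j i) + \<epsilon> * cmod (\<phi> j i)" by simp
  also have "cmod (of_real (2 * cos (2 * pi * (xx + of_int i * om))) * \<phi> j i) \<le> 2 * cmod (\<phi> j i)"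
    unfolding norm_mult norm_of_real by (intro mult_right_mono) (auto simp: abs_mult)
  finally have "\<bar>E j - Re (cc 0)\<bar> * cmod (\<phi> j i) \<le> (2 + \<epsilon>) * cmod (\<phi> j i)"
    unfolding norm_mult norm_of_real by (simp add: distrib_right)
  then show "\<bar>E j - Re (cc 0)\<bar> \<le> 2 + \<epsilon>" using pos by (simp only: mult_le_cancel_right_pos)
qed

text \<open>For a nonresonant \<open>m\<close> and each \<open>j\<close>, \<open>dual_decay\<close>
  makes the value at \<open>m\<close> or at \<open>m + n\<close> small, and summing over
  \<open>j\<close> with \<open>sum_j_le_1\<close> keeps the constants free of \<open>Q\<close>.
  Resonant sites arise from \<open>6 * n + 1\<close> shifts, each with proportion at most 12 exp(- B
  n), and contribute at most 1 apiece.\<close>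

lemma cor_decay:
  fixes B c0 \<epsilon> \<epsilon>1 \<kappa> L :: real and n :: nat
  assumes B: "0 < B" and c0: "0 < c0" "c0 \<le> 1" and \<epsilon>: "0 < \<epsilon>" "sqrt (2 * \<epsilon>) \<le> B"
    and L: "ln 2 + 2 * pi / sqrt (2 * \<epsilon>) \<le> L" "4 * ln 16 + 16 * ln (8 / (3 * c0)) \<le> L"
    and n: "1000 \<le> n" "40 * (exp L / c0 + 2) \<le> real n" "real n / (2 * \<epsilon>\<^sup>2 * c0 ^ 24) \<le> exp (B * real n)"
      "real n \<le> exp (B * real n)" "2 * n \<le> Q"
    and dc: "\<And>d::int. d \<noteq> 0 \<Longrightarrow> \<bar>d\<bar> < int Q \<Longrightarrow> c0 * exp (- B * real_of_int \<bar>d\<bar>) \<le> dz (of_int d * om)"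
    and \<kappa>: "\<kappa> = 22000 * B"
    and \<epsilon>1: "0 \<le> \<epsilon>1" "\<epsilon>1 \<le> 1" "\<epsilon>1 * (2 * (1 + 1 / \<kappa>)) \<le> \<epsilon>"
    and c: "\<And>d. cmod (cc d) \<le> \<epsilon>1 * exp (- (2 * \<kappa>) * of_int (cyn Q d))"
  shows "cor (int n) \<le> (4 * (1 + 2 / \<kappa>) + 12 * (6 * real n + 1)) * exp (- B * real n)"
proof -
  have \<kappa>0: "0 < \<kappa>" using \<kappa> B by simp
  define \<eta> where "\<eta> = exp (- B * real n)"
  define bad where "bad s' = {m\<in>{0..<int Q}. dz (2 * (1 / (4 * real Q)) + of_int (2 * m + s') * (of_int P / real Q)) < \<eta>}" for s'
  define Bd where "Bd = (\<Union>s'\<in>{- 3 * int n..3 * int n}. bad s')"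
  let ?f = "\<lambda>m. \<Sum>j<Q. cmod (\<phi> j m) * cmod (\<phi> j (m + int n))"
  have BdQ: "Bd \<subseteq> {0..<int Q}" unfolding Bd_def bad_def by auto
  have finB: "finite Bd" using BdQ finite_subset by blast
  have cB: "real (card Bd) \<le> (6 * real n + 1) * (12 * \<eta> * real Q)"
  proof -
    have "card Bd \<le> (\<Sum>s'\<in>{- 3 * int n..3 * int n}. card (bad s'))" unfolding Bd_def by (rule card_UN_le) simp
    then have "real (card Bd) \<le> (\<Sum>s'\<in>{- 3 * int n..3 * int n}. real (card (bad s')))" by (simp flip: of_nat_sum)
    also have "\<dots> \<le> (\<Sum>s'\<in>{- 3 * int n..3 * int n}. 12 * \<eta> * real Q)"
      unfolding bad_def by (intro sum_mono card_near_resonance[OF Q cop]) (simp add: \<eta>_def)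
    also have "\<dots> = (6 * real n + 1) * (12 * \<eta> * real Q)" by simp
    finally show ?thesis .
  qed
  have good: "?f m \<le> 4 * (1 + 2 / \<kappa>) * \<eta>" if m: "m \<in> {0..<int Q} - Bd" for m
  proof -
    have nr: "exp (- B * real n) \<le> dz (2 * xx + of_int (2 * m + s') * om)" if s': "\<bar>s'\<bar> \<le> 3 * int n" for s'
    proof -
      have "s' \<in> {- 3 * int n..3 * int n}" using s' by auto
      then have "m \<notin> bad s'" using m unfolding Bd_def by blast
      then show ?thesis using m unfolding bad_def \<eta>_def xx_def om_def by auto
    qed
    have dc': "c0 * exp (- B * real_of_int \<bar>d\<bar>) \<le> dz (of_int d * om)" if "d \<noteq> 0" "\<bar>d\<bar> < 2 * int n" for d :: int
      using that n(5) by (intro dc) auto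
    let ?w = "\<lambda>m' l. exp (- (\<kappa> / 2) * of_int (cyn Q (m' - l)))"
    \<comment> \<open>Which of the two sites is small depends on \<open>j\<close>, so both possible
      bounds are added.\<close>
    have each: "cmod (\<phi> j m) * cmod (\<phi> j (m + int n)) \<le> \<eta> * ((\<Sum>l\<in>{0..<int Q}. ?w m l * (cmod (\<phi> j l) * cmod (\<phi> j (m + int n)))) + (\<Sum>l\<in>{0..<int Q}. ?w (m + int n) l * (cmod (\<phi> j l) * cmod (\<phi> j m))))"
      if j: "j < Q" for j
    proof -
      note eb = eigenvalue_bound[OF j \<kappa>0 \<epsilon>1(3,1) c]
      have ev: "complex_of_real (2 * cos (2 * pi * (xx + of_int i * om)) - (E j - Re (cc 0))) * \<phi> j i + (\<Sum>l\<in>{0..<int Q}. cc (i - l) * \<phi> j l) = cc 0 * \<phi> j i" for i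
      proof -
        have "C * \<phi> j i + S = e * \<phi> j i \<Longrightarrow> (C - (e - z)) * \<phi> j i + S = z * \<phi> j i" for C S e z by (simp add: algebra_simps)
        from this[OF phi_ev[OF j, of i], of "of_real (Re (cc 0))"] show ?thesis
          unfolding eb(2)[symmetric] by (simp only: of_real_diff eb(2)[symmetric])
      qed
      obtain m' where m': "m' = m \<or> m' = m + int n" "cmod (\<phi> j m') \<le> exp (- B * real n) * (\<Sum>l\<in>{0..<int Q}. ?w m' l * cmod (\<phi> j l))"
        by (rule dual_decay[OF B c0 \<epsilon> L n dc' nr eb(1) \<kappa> \<epsilon>1 c cc_per phi_per ev]) (assumption | (rule that; assumption))+
      let ?S1 = "\<Sum>l\<in>{0..<int Q}. ?w m l * (cmod (\<phi> j l) * cmod (\<phi> j (m + int n)))"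
      let ?S2 = "\<Sum>l\<in>{0..<int Q}. ?w (m + int n) l * (cmod (\<phi> j l) * cmod (\<phi> j m))"
      have S: "0 \<le> ?S1" "0 \<le> ?S2" by (intro sum_nonneg; simp)+
      have e0: "0 < \<eta>" by (simp add: \<eta>_def)
      from m'(1) show ?thesis
      proof
        assume "m' = m"
        then have "cmod (\<phi> j m) * cmod (\<phi> j (m + int n)) \<le> (\<eta> * (\<Sum>l\<in>{0..<int Q}. ?w m l * cmod (\<phi> j l))) * cmod (\<phi> j (m + int n))"
          using m'(2) by (intro mult_right_mono) (auto simp: \<eta>_def)
        also have "\<dots> = \<eta> * ?S1" by (simp add: sum_distrib_right mult.assoc)
        also have "\<dots> \<le> \<eta> * (?S1 + ?S2)" using S e0 by (intro mult_left_mono) auto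
        finally show ?thesis .
      next
        assume "m' = m + int n"
        then have "cmod (\<phi> j (m + int n)) * cmod (\<phi> j m) \<le> (\<eta> * (\<Sum>l\<in>{0..<int Q}. ?w (m + int n) l * cmod (\<phi> j l))) * cmod (\<phi> j m)"
          using m'(2) by (intro mult_right_mono) (auto simp: \<eta>_def)
        also have "\<dots> = \<eta> * ?S2" by (simp add: sum_distrib_right mult.assoc)
        also have "\<dots> \<le> \<eta> * (?S1 + ?S2)" using S e0 by (intro mult_left_mono) auto
        finally show ?thesis by (simp only: mult.commute)
      qed
    qed
    have sw: "(\<Sum>j<Q. \<Sum>l\<in>{0..<int Q}. ?w a l * (cmod (\<phi> j l) * cmod (\<phi> j b))) \<le> 2 * (1 + 2 / \<kappa>)" for a b
    proof -
      have "(\<Sum>j<Q. \<Sum>l\<in>{0..<int Q}. ?w a l * (cmod (\<phi> j l) * cmod (\<phi> j b))) = (\<Sum>l\<in>{0..<int Q}. ?w a l * (\<Sum>j<Q. cmod (\<phi> j l) * cmod (\<phi> j b)))"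
        unfolding sum_distrib_left by (rule sum.swap)
      also have "\<dots> \<le> (\<Sum>l\<in>{0..<int Q}. ?w a l * 1)" by (intro sum_mono mult_left_mono sum_j_le_1) auto
      also have "\<dots> \<le> 2 * (1 + 1 / (\<kappa> / 2))" using sum_exp_cyn_le[OF Q, of "\<kappa> / 2" a] \<kappa>0 by simp
      finally show ?thesis by simp
    qed
    have "?f m \<le> (\<Sum>j<Q. \<eta> * ((\<Sum>l\<in>{0..<int Q}. ?w m l * (cmod (\<phi> j l) * cmod (\<phi> j (m + int n)))) + (\<Sum>l\<in>{0..<int Q}. ?w (m + int n) l * (cmod (\<phi> j l) * cmod (\<phi> j m)))))"
      by (intro sum_mono each) simp
    also have "\<dots> = \<eta> * ((\<Sum>j<Q. \<Sum>l\<in>{0..<int Q}. ?w m l * (cmod (\<phi> j l) * cmod (\<phi> j (m + int n)))) + (\<Sum>j<Q. \<Sum>l\<in>{0..<int Q}. ?w (m + int n) l * (cmod (\<phi> j l) * cmod (\<phi> j m))))"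
      by (simp only: sum_distrib_left[symmetric] sum.distrib)
    also have "\<dots> \<le> \<eta> * (2 * (1 + 2 / \<kappa>) + 2 * (1 + 2 / \<kappa>))" by (intro mult_left_mono add_mono sw) (simp add: \<eta>_def)
    finally show ?thesis by (simp add: mult.commute)
  qed
  have "(\<Sum>m\<in>{0..<int Q}. ?f m) = (\<Sum>m\<in>{0..<int Q} - Bd. ?f m) + (\<Sum>m\<in>Bd. ?f m)"
    using sum.subset_diff[OF BdQ, of ?f] by simp
  also have "(\<Sum>m\<in>{0..<int Q} - Bd. ?f m) \<le> (\<Sum>m\<in>{0..<int Q} - Bd. 4 * (1 + 2 / \<kappa>) * \<eta>)" by (intro sum_mono good)
  also have "\<dots> \<le> real Q * (4 * (1 + 2 / \<kappa>) * \<eta>)"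
  proof -
    have "card ({0..<int Q} - Bd) \<le> Q" using card_mono[of "{0..<int Q}" "{0..<int Q} - Bd"] by simp
    then show ?thesis using \<kappa>0 by (simp add: \<eta>_def mult_right_mono)
  qed
  also have "(\<Sum>m\<in>Bd. ?f m) \<le> (\<Sum>m\<in>Bd. 1)" by (intro sum_mono sum_j_le_1)
  also have "\<dots> \<le> (6 * real n + 1) * (12 * \<eta> * real Q)" using cB by simp
  finally have "(\<Sum>m\<in>{0..<int Q}. ?f m) \<le> real Q * (4 * (1 + 2 / \<kappa>) * \<eta>) + (6 * real n + 1) * (12 * \<eta> * real Q)" by simp
  also have "\<dots> = ((4 * (1 + 2 / \<kappa>) + 12 * (6 * real n + 1)) * \<eta>) * real Q" by (simp add: algebra_simps)
  finally show ?thesis unfolding cor_def \<eta>_def using Q by (simp add: divide_le_eq)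
qed

end

section \<open>Wronskians and the Green function near a good index\<close>

lemma int_step_const:
  fixes f :: "int \<Rightarrow> 'a"
  assumes "\<And>n. f (n + 1) = f n" shows "f n = f 0"
proof (induction n rule: int_induct[of _ 0])
  case base show ?case by simp
next
  case (step1 i) then show ?case using assms[of i] by simp
next
  case (step2 i) then show ?case using assms[of "i - 1"] by simp
qed

text \<open>The change of a discrete Wronskian in one step, for solutions at the energies
  \<open>E\<close> and \<open>z\<close>.\<close>

lemma cross_step:
  fixes E :: "'a::comm_ring_1"
  shows "G1 * ((E - W) * a - b) - (- (G0 + (W - z) * G1)) * a = (G0 * a - G1 * b) + (E - z) * (G1 * a)"
  by (simp add: algebra_simps)

context dual_eig
begin

text \<open>Up to the factor 2i this is the Wronskian of \<open>ww j\<close> and its complex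
  conjugate, which solve the same real equation.\<close>

definition wr :: "nat \<Rightarrow> int \<Rightarrow> real" where
  "wr j n = Im (cnj (ww j n) * ww j (n + 1))"

lemma ww_step: "j < Q \<Longrightarrow> ww j (n + 2) = of_real (E j - W (n + 1)) * ww j (n + 1) - ww j n"
  using ww_eq[of j "n + 1"] by (simp add: algebra_simps)

lemma wr_const: assumes j: "j < Q" shows "wr j n = wr j 0"
proof (rule int_step_const)
  fix n
  have "n + 1 + 1 = n + (2::int)" by simp
  then show "wr j (n + 1) = wr j n"
    unfolding wr_def by (simp only: ww_step[OF j]) (simp add: algebra_simps)
qed

text \<open>At \<open>z = E j + i/T\<close> the Green function is expressed through the bounded solution \<open>ww j\<close> and its
  conjugate, which are independent by the Wronskian bound; comparing \<open>Im G(n0, n0)\<close> with \<open>(1/T) \<Sum>|G|\<^sup>2\<close> bounds \<open>G(n0, n0)\<close>.\<close>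

lemma good_cell:
  fixes T K \<eta> :: real and n0 :: int
  assumes j: "j < Q" and K: "1 \<le> K" "\<And>n. cmod (ww j n) \<le> K" and \<eta>: "0 < \<eta>" "\<eta> \<le> 1" "\<eta> \<le> \<bar>wr j 0\<bar>"
    and T: "0 < T" "T + 3 \<le> real Q"
  shows "(\<Sum>i\<in>{i\<in>{..<Q}. \<bar>E i - E j\<bar> \<le> 1 / T}. (cmod (ww i n0))\<^sup>2) / real Q \<le> 64 * K ^ 6 / (\<eta> ^ 3 * T)"
proof -
  define z where "z = Complex (E j) (1 / T)"
  have Qr: "0 < real Q" using Q by simp
  have nz: "of_real (E i) - z \<noteq> 0" for i using T by (auto simp: z_def complex_eq_iff)
  have norm2: "(cmod (of_real (E i) - z))\<^sup>2 = (E i - E j)\<^sup>2 + (1 / T)\<^sup>2" for i by (simp add: z_def cmod_power2)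
  \<comment> \<open>The coefficients of the resolvent at \<open>z\<close>, with source at
    \<open>n0\<close> and Bloch boundary conditions, in the eigenbasis \<open>ww\<close>.\<close>
  define a where "a i = cnj (ww i n0) / ((of_real (E i) - z) * of_nat Q)" for i
  define G where "G n = (\<Sum>i<Q. a i * ww i n)" for n
  have Geq: "G (n + 1) + G (n - 1) + (of_real (W n) - z) * G n = (if n = n0 then 1 else 0)" if "\<bar>n - n0\<bar> < int Q" for n
  proof -
    have "G (n + 1) + G (n - 1) + (of_real (W n) - z) * G n = (\<Sum>i<Q. a i * (ww i (n + 1) + ww i (n - 1) + (of_real (W n) - z) * ww i n))"
      unfolding G_def sum_distrib_left sum.distrib[symmetric] by (simp add: algebra_simps)
    also have "\<dots> = (\<Sum>i<Q. ww i n * cnj (ww i n0) / of_nat Q)"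
    proof (rule sum.cong[OF refl])
      fix i assume "i \<in> {..<Q}"
      then have "ww i (n + 1) + ww i (n - 1) + (of_real (W n) - z) * ww i n = (of_real (E i) - z) * ww i n"
        by (simp only: left_diff_distrib add_diff_eq ww_eq lessThan_iff)
      then show "a i * (ww i (n + 1) + ww i (n - 1) + (of_real (W n) - z) * ww i n) = ww i n * cnj (ww i n0) / of_nat Q"
        using nz[of i] by (simp add: a_def)
    qed
    also have "\<dots> = (if n = n0 then of_nat Q else 0) / of_nat Q"
      unfolding sum_divide_distrib[symmetric] ww_complete[OF that] ..
    finally show ?thesis using Q by simp
  qed
  define N2 where "N2 = (\<Sum>n\<in>{n0..<n0 + int Q}. (cmod (G n))\<^sup>2)"
  have N2: "N2 = (\<Sum>i<Q. (cmod (ww i n0))\<^sup>2 / (cmod (of_real (E i) - z))\<^sup>2) / real Q"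
  proof -
    have "complex_of_real N2 = (\<Sum>n\<in>{n0..<n0 + int Q}. cnj (G n) * G n)"
      unfolding N2_def by (simp add: complex_norm_square mult.commute del: of_real_power)
    also have "\<dots> = (\<Sum>n\<in>{n0..<n0 + int Q}. \<Sum>i<Q. \<Sum>i'<Q. (cnj (a i) * a i') * (cnj (ww i n) * ww i' n))"
      unfolding G_def cnj_sum sum_product complex_cnj_mult by (simp only: mult_ac)
    also have "\<dots> = (\<Sum>i<Q. \<Sum>i'<Q. (cnj (a i) * a i') * (\<Sum>n\<in>{n0..<n0 + int Q}. cnj (ww i n) * ww i' n))"
      unfolding sum_distrib_left by (rule sum_swap3)
    also have "\<dots> = (\<Sum>i<Q. \<Sum>i'<Q. if i = i' then (cnj (a i) * a i') * of_nat Q else 0)"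
      by (intro sum.cong refl) (simp add: ww_parseval)
    also have "\<dots> = (\<Sum>i<Q. (cnj (a i) * a i) * of_nat Q)" by (intro sum.cong refl) simp
    also have "\<dots> = (\<Sum>i<Q. complex_of_real ((cmod (ww i n0))\<^sup>2 / (cmod (of_real (E i) - z))\<^sup>2 / real Q))"
    proof (rule sum.cong[OF refl])
      fix i
      have "cnj (a i) * a i = complex_of_real ((cmod (a i))\<^sup>2)" by (simp add: complex_norm_square mult.commute del: of_real_power)
      also have "(cmod (a i))\<^sup>2 = (cmod (ww i n0))\<^sup>2 / (cmod (of_real (E i) - z))\<^sup>2 / (real Q)\<^sup>2"
        by (simp add: a_def norm_divide norm_mult power_divide power_mult_distrib)
      finally show "(cnj (a i) * a i) * of_nat Q = complex_of_real ((cmod (ww i n0))\<^sup>2 / (cmod (of_real (E i) - z))\<^sup>2 / real Q)"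
        using Qr by (simp add: power2_eq_square)
    qed
    also have "\<dots> = complex_of_real ((\<Sum>i<Q. (cmod (ww i n0))\<^sup>2 / (cmod (of_real (E i) - z))\<^sup>2) / real Q)"
      by (simp only: of_real_sum[symmetric] sum_divide_distrib)
    finally show ?thesis by (simp only: of_real_eq_iff)
  qed
  \<comment> \<open>The resolvent identity: Im z times the sum of |G|^2 over one period equals Im
    G(n0, n0), here with Im z = 1/T.\<close>
  have ImG: "Im (G n0) = N2 / T"
  proof -
    have "Im (a i * ww i n0) = (cmod (ww i n0))\<^sup>2 / (cmod (of_real (E i) - z))\<^sup>2 / real Q / T" for i
    proof -
      have e1: "a i * ww i n0 = of_real ((cmod (ww i n0))\<^sup>2 / real Q) * inverse (of_real (E i) - z)"
        unfolding a_def by (simp add: complex_norm_square divide_inverse mult_ac del: of_real_power)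
      have e2: "Im (inverse (of_real (E i) - z)) = (1 / T) / (cmod (of_real (E i) - z))\<^sup>2"
        unfolding cmod_power2 by (simp add: z_def)
      have e3: "Im (complex_of_real r * u) = r * Im u" for r u by simp
      show ?thesis unfolding e1 e3 e2 by (simp add: field_simps)
    qed
    then have "Im (G n0) = (\<Sum>i<Q. (cmod (ww i n0))\<^sup>2 / (cmod (of_real (E i) - z))\<^sup>2 / real Q / T)"
      unfolding G_def Im_sum by (simp only:)
    then show ?thesis unfolding N2 by (simp only: sum_divide_distrib)
  qed
  define w where "w = ww j"
  have wK: "cmod (w n) \<le> K" for n using K(2) by (simp add: w_def)
  \<comment> \<open>Wronskians of \<open>G\<close> with the two independent solutions; away from the
    source they change only through the energy defect of modulus 1/T.\<close>
  define \<alpha> where "\<alpha> n = G n * cnj (w (n + 1)) - G (n + 1) * cnj (w n)" for n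
  define \<beta> where "\<beta> n = G n * w (n + 1) - G (n + 1) * w n" for n
  define X where "X l = cmod (\<alpha> (n0 + int l)) + cmod (\<beta> (n0 + int l))" for l :: nat
  have eta: "\<eta> \<le> \<bar>Im (cnj (w n) * w (n + 1))\<bar>" for n
    using \<eta>(3) wr_const[OF j, of n] unfolding wr_def w_def by simp
  have step: "\<alpha> (n + 1) = \<alpha> n + (of_real (E j) - z) * (G (n + 1) * cnj (w (n + 1)))"
    "\<beta> (n + 1) = \<beta> n + (of_real (E j) - z) * (G (n + 1) * w (n + 1))" if n: "n0 \<le> n" "n + 1 - n0 < int Q" for n
  proof -
    have "G (n + 1 + 1) + G n + (of_real (W (n + 1)) - z) * G (n + 1) = 0" using Geq[of "n + 1"] n by simp
    then have g: "G (n + 1 + 1) = - (G n + (of_real (W (n + 1)) - z) * G (n + 1))" by (simp only: add.assoc eq_neg_iff_add_eq_0)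
    have w2: "w (n + 1 + 1) = of_real (E j - W (n + 1)) * w (n + 1) - w n"
    proof -
      have "n + 1 + 1 = n + 2" by simp
      then show ?thesis unfolding w_def by (simp only: ww_step[OF j])
    qed
    have w2': "w (n + 1 + 1) = (of_real (E j) - of_real (W (n + 1))) * w (n + 1) - w n" unfolding w2 by simp
    have c2: "cnj (w (n + 1 + 1)) = (of_real (E j) - of_real (W (n + 1))) * cnj (w (n + 1)) - cnj (w n)" unfolding w2' by simp
    show "\<alpha> (n + 1) = \<alpha> n + (of_real (E j) - z) * (G (n + 1) * cnj (w (n + 1)))"
      unfolding \<alpha>_def g c2 by (rule cross_step)
    show "\<beta> (n + 1) = \<beta> n + (of_real (E j) - z) * (G (n + 1) * w (n + 1))"
      unfolding \<beta>_def g w2' by (rule cross_step)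
  qed
  have Gz: "cmod (of_real (E j) - z) = 1 / T"
  proof -
    have "(cmod (of_real (E j) - z))\<^sup>2 = (1 / T)\<^sup>2" unfolding norm2 by simp
    then show ?thesis by (rule power2_eq_imp_eq) (use T(1) in auto)
  qed
  \<comment> \<open>Conversely \<open>G\<close> is recovered from both Wronskians, at the price of
    dividing by the Wronskian of the two solutions.\<close>
  have GX: "2 * \<eta> * cmod (G n) \<le> K * (cmod (\<alpha> n) + cmod (\<beta> n))" "2 * \<eta> * cmod (G (n + 1)) \<le> K * (cmod (\<alpha> n) + cmod (\<beta> n))" for n
  proof -
    let ?I = "Im (cnj (w n) * w (n + 1))"
    have I: "cnj (w n) * w (n + 1) - w n * cnj (w (n + 1)) = 2 * \<i> * of_real ?I" by (simp add: complex_eq_iff)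
    have main: "2 * \<eta> * cmod g \<le> K * (cmod (\<alpha> n) + cmod (\<beta> n))" if "\<beta> n * cnj y - \<alpha> n * y = g * (2 * \<i> * of_real ?I)" "cmod y \<le> K" for g y
    proof -
      have "2 * \<eta> * cmod g \<le> 2 * \<bar>?I\<bar> * cmod g" using eta[of n] by (intro mult_right_mono) auto
      also have "\<dots> = cmod (g * (2 * \<i> * of_real ?I))"
      proof -
        have "2 * \<bar>r\<bar> * cmod g = cmod (g * (2 * \<i> * of_real r))" for r by (simp add: norm_mult)
        then show ?thesis .
      qed
      also have "\<dots> \<le> cmod (\<beta> n * cnj y) + cmod (\<alpha> n * y)" unfolding that(1)[symmetric] by (rule norm_triangle_ineq4)
      also have "\<dots> = cmod y * (cmod (\<alpha> n) + cmod (\<beta> n))" by (simp add: norm_mult algebra_simps)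
      also have "\<dots> \<le> K * (cmod (\<alpha> n) + cmod (\<beta> n))" using that(2) by (intro mult_right_mono) auto
      finally show ?thesis .
    qed
    show "2 * \<eta> * cmod (G n) \<le> K * (cmod (\<alpha> n) + cmod (\<beta> n))"
      by (rule main[of "w n", OF _ wK]) (unfold I[symmetric] \<alpha>_def \<beta>_def, simp add: algebra_simps)
    show "2 * \<eta> * cmod (G (n + 1)) \<le> K * (cmod (\<alpha> n) + cmod (\<beta> n))"
      by (rule main[of "w (n + 1)", OF _ wK]) (unfold I[symmetric] \<alpha>_def \<beta>_def, simp add: algebra_simps)
  qed
  have XG: "cmod (\<alpha> n) + cmod (\<beta> n) \<le> 2 * K * (cmod (G n) + cmod (G (n + 1)))" for n
  proof -
    have b: "cmod (G n * u - G (n + 1) * v) \<le> K * (cmod (G n) + cmod (G (n + 1)))" if "cmod u \<le> K" "cmod v \<le> K" for u v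
    proof -
      have "cmod (G n * u - G (n + 1) * v) \<le> cmod (G n) * cmod u + cmod (G (n + 1)) * cmod v"
        using norm_triangle_ineq4[of "G n * u" "G (n + 1) * v"] by (simp add: norm_mult)
      also have "\<dots> \<le> cmod (G n) * K + cmod (G (n + 1)) * K" using that by (intro add_mono mult_left_mono) auto
      finally show ?thesis by (simp add: algebra_simps)
    qed
    have "cmod (\<alpha> n) \<le> K * (cmod (G n) + cmod (G (n + 1)))" unfolding \<alpha>_def by (rule b) (auto simp: wK)
    moreover have "cmod (\<beta> n) \<le> K * (cmod (G n) + cmod (G (n + 1)))" unfolding \<beta>_def by (rule b) (auto simp: wK)
    ultimately show ?thesis by simp
  qed
  \<comment> \<open>\<open>\<rho>\<close> bounds the relative loss of \<open>X\<close> in one step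
    and \<open>L\<close> is 1/(2 \<rho>) rounded down, so that half of \<open>X 0\<close> survives
    \<open>L\<close> steps.\<close>
  define \<rho> where "\<rho> = K\<^sup>2 / (\<eta> * T)"
  define L where "L = nat \<lfloor>\<eta> * T / (2 * K\<^sup>2)\<rfloor>"
  have K2: "1 \<le> K\<^sup>2" using K(1) by (simp add: one_le_power)
  have \<rho>0: "0 < \<rho>" unfolding \<rho>_def using \<eta> T K2 by (intro divide_pos_pos mult_pos_pos) auto
  have yT: "0 \<le> \<eta> * T / (2 * K\<^sup>2)" using \<eta> T by simp
  have L: "real L \<le> \<eta> * T / (2 * K\<^sup>2)" "\<eta> * T / (2 * K\<^sup>2) \<le> real L + 1"
    unfolding L_def using yT by linarith+
  have L\<rho>: "real L * \<rho> \<le> 1/2"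
  proof -
    have "real L * \<rho> \<le> (\<eta> * T / (2 * K\<^sup>2)) * \<rho>" using L(1) \<rho>0 by (intro mult_right_mono) auto
    also have "\<dots> = 1/2" unfolding \<rho>_def using \<eta> T K(1) by (simp add: field_simps)
    finally show ?thesis .
  qed
  have LQ: "L + 3 \<le> Q"
  proof -
    have "\<eta> * T / (2 * K\<^sup>2) \<le> 1 * T / 1" using \<eta> T K2 by (intro frac_le mult_right_mono) auto
    then have "real L \<le> T" using L(1) by simp
    then have "real (L + 3) \<le> real Q" using T(2) by simp
    then show ?thesis by (simp only: of_nat_le_iff)
  qed
  have Xs: "X l * (1 - \<rho>) \<le> X (Suc l)" if l: "Suc l < Q" for l
  proof -
    let ?n = "n0 + int l"
    have nn: "n0 + int (Suc l) = ?n + 1" by simp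
    have st: "\<alpha> (?n + 1) = \<alpha> ?n + (of_real (E j) - z) * (G (?n + 1) * cnj (w (?n + 1)))" "\<beta> (?n + 1) = \<beta> ?n + (of_real (E j) - z) * (G (?n + 1) * w (?n + 1))"
      by (rule step; use l in linarith)+
    have d: "cmod ((of_real (E j) - z) * (G (?n + 1) * u)) \<le> (1 / T) * (cmod (G (?n + 1)) * K)" if "cmod u \<le> K" for u
      unfolding norm_mult Gz using that T(1) by (intro mult_left_mono) auto
    have "cmod (\<alpha> ?n) \<le> cmod (\<alpha> (?n + 1)) + (1 / T) * (cmod (G (?n + 1)) * K)"
      using d[of "cnj (w (?n + 1))"] wK[of "?n + 1"] norm_triangle_ineq4[of "\<alpha> (?n + 1)" "(of_real (E j) - z) * (G (?n + 1) * cnj (w (?n + 1)))"] st(1) by simp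
    moreover have "cmod (\<beta> ?n) \<le> cmod (\<beta> (?n + 1)) + (1 / T) * (cmod (G (?n + 1)) * K)"
      using d[of "w (?n + 1)"] wK[of "?n + 1"] norm_triangle_ineq4[of "\<beta> (?n + 1)" "(of_real (E j) - z) * (G (?n + 1) * w (?n + 1))"] st(2) by simp
    ultimately have "X l \<le> X (Suc l) + 2 * ((1 / T) * (cmod (G (?n + 1)) * K))" unfolding X_def nn by argo
    moreover have "2 * ((1 / T) * (cmod (G (?n + 1)) * K)) \<le> X l * \<rho>"
    proof -
      have "(K / (\<eta> * T)) * (2 * \<eta> * cmod (G (?n + 1))) \<le> (K / (\<eta> * T)) * (K * X l)"
        unfolding X_def using GX(2)[of ?n] K(1) \<eta> T(1) by (intro mult_left_mono divide_nonneg_nonneg mult_nonneg_nonneg) auto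
      moreover have "(K / (\<eta> * T)) * (2 * \<eta> * cmod (G (?n + 1))) = 2 * ((1 / T) * (cmod (G (?n + 1)) * K))" using \<eta> T(1) by (simp add: field_simps)
      moreover have "(K / (\<eta> * T)) * (K * X l) = X l * \<rho>" unfolding \<rho>_def by (simp add: power2_eq_square)
      ultimately show ?thesis by simp
    qed
    ultimately show ?thesis by (simp add: right_diff_distrib)
  qed
  have X0: "0 \<le> X l" for l unfolding X_def by simp
  have XL: "X 0 * (1 - real l * \<rho>) \<le> X l" if "l \<le> L" for l
    using that
  proof (induction l)
    case 0 then show ?case by simp
  next
    case (Suc l)
    have r1: "\<rho> \<le> 1"
    proof -
      have "1 * \<rho> \<le> real L * \<rho>" using Suc.prems \<rho>0 by (intro mult_right_mono) auto
      then show ?thesis using L\<rho> by simp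
    qed
    have "X 0 * (1 - real (Suc l) * \<rho>) \<le> X 0 * ((1 - real l * \<rho>) * (1 - \<rho>))"
    proof (rule mult_left_mono[OF _ X0])
      have "0 \<le> real l * \<rho> * \<rho>" using \<rho>0 by simp
      then show "1 - real (Suc l) * \<rho> \<le> (1 - real l * \<rho>) * (1 - \<rho>)" by (simp add: algebra_simps)
    qed
    also have "\<dots> \<le> X l * (1 - \<rho>)" using Suc r1 by (simp add: mult.assoc[symmetric] mult_right_mono)
    also have "\<dots> \<le> X (Suc l)" using Suc.prems LQ by (intro Xs) linarith
    finally show ?case .
  qed
  define \<sigma> where "\<sigma> = \<eta> / (2 * K\<^sup>2)"
  have \<sigma>0: "0 < \<sigma>" unfolding \<sigma>_def using \<eta> K(1) by simp
  have GG: "\<sigma> * cmod (G n0) \<le> cmod (G (n0 + int l)) + cmod (G (n0 + int l + 1))" if l: "l \<le> L" for l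
  proof -
    have "real l * \<rho> \<le> real L * \<rho>" using l \<rho>0 by (intro mult_right_mono) auto
    then have "X 0 * (1/2) \<le> X 0 * (1 - real l * \<rho>)" using L\<rho> X0[of 0] by (intro mult_left_mono) auto
    then have "X 0 / 2 \<le> X l" using XL[OF l] by simp
    also have "X l \<le> 2 * K * (cmod (G (n0 + int l)) + cmod (G (n0 + int l + 1)))" unfolding X_def by (rule XG)
    finally have 1: "X 0 / (4 * K) \<le> cmod (G (n0 + int l)) + cmod (G (n0 + int l + 1))" using K(1) by (simp add: field_simps)
    have "2 * \<eta> * cmod (G n0) \<le> K * X 0" unfolding X_def using GX(1)[of n0] by simp
    then have "\<sigma> * cmod (G n0) \<le> X 0 / (4 * K)" unfolding \<sigma>_def using K(1) by (simp add: field_simps power2_eq_square)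
    then show ?thesis using 1 by linarith
  qed
  \<comment> \<open>So |G| stays comparable with |G(n0)| on adjacent pairs along a stretch of length
    proportional to \<open>T\<close>; every site belongs to at most two pairs, hence twice
    \<open>N2\<close>.\<close>
  have low: "(real L + 1) * (\<sigma>\<^sup>2 * (cmod (G n0))\<^sup>2 / 2) \<le> 2 * N2"
  proof -
    let ?s = "\<lambda>n. (cmod (G n))\<^sup>2"
    have "(\<Sum>l\<le>L. \<sigma>\<^sup>2 * (cmod (G n0))\<^sup>2 / 2) \<le> (\<Sum>l\<le>L. ?s (n0 + int l) + ?s (n0 + int l + 1))"
    proof (rule sum_mono)
      fix l assume "l \<in> {..L}"
      then have "(\<sigma> * cmod (G n0))\<^sup>2 \<le> (cmod (G (n0 + int l)) + cmod (G (n0 + int l + 1)))\<^sup>2"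
        using GG[of l] \<sigma>0 by (intro power_mono) auto
      also have "\<dots> \<le> 2 * (?s (n0 + int l) + ?s (n0 + int l + 1))"
        using sum_squares_bound[of "cmod (G (n0 + int l))" "cmod (G (n0 + int l + 1))"] by (simp add: power2_sum)
      finally show "\<sigma>\<^sup>2 * (cmod (G n0))\<^sup>2 / 2 \<le> ?s (n0 + int l) + ?s (n0 + int l + 1)" by (simp add: power_mult_distrib)
    qed
    also have "\<dots> = (\<Sum>l\<le>L. ?s (n0 + int l)) + (\<Sum>l\<le>L. ?s (n0 + int l + 1))" by (rule sum.distrib)
    also have "(\<Sum>l\<le>L. ?s (n0 + int l)) \<le> N2"
    proof -
      have "(\<Sum>l\<le>L. ?s (n0 + int l)) = (\<Sum>n\<in>(\<lambda>l. n0 + int l) ` {..L}. ?s n)" by (subst sum.reindex) (auto simp: inj_on_def)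
      also have "\<dots> \<le> N2" unfolding N2_def using LQ by (intro sum_mono2) auto
      finally show ?thesis .
    qed
    also have "(\<Sum>l\<le>L. ?s (n0 + int l + 1)) \<le> N2"
    proof -
      have "(\<Sum>l\<le>L. ?s (n0 + int l + 1)) = (\<Sum>n\<in>(\<lambda>l. n0 + int l + 1) ` {..L}. ?s n)" by (subst sum.reindex) (auto simp: inj_on_def)
      also have "\<dots> \<le> N2" unfolding N2_def using LQ by (intro sum_mono2) auto
      finally show ?thesis .
    qed
    finally show ?thesis by (simp add: algebra_simps)
  qed
  define c2 where "c2 = \<eta> ^ 3 / (32 * K ^ 6)"
  have c20: "0 < c2" unfolding c2_def using \<eta> K(1) by simp
  have "c2 * T * (cmod (G n0))\<^sup>2 \<le> N2"
  proof -
    have "(\<eta> * T / (2 * K\<^sup>2)) * (\<sigma>\<^sup>2 * (cmod (G n0))\<^sup>2 / 2) \<le> (real L + 1) * (\<sigma>\<^sup>2 * (cmod (G n0))\<^sup>2 / 2)"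
      using L(2) by (intro mult_right_mono) auto
    also have "\<dots> \<le> 2 * N2" by (rule low)
    finally have "(\<eta> * T / (2 * K\<^sup>2)) * (\<sigma>\<^sup>2 * (cmod (G n0))\<^sup>2 / 2) / 2 \<le> N2" by simp
    moreover have "(\<eta> * T / (2 * K\<^sup>2)) * (\<sigma>\<^sup>2 * (cmod (G n0))\<^sup>2 / 2) / 2 = c2 * T * (cmod (G n0))\<^sup>2"
      unfolding \<sigma>_def c2_def using K(1) by (simp add: field_simps eval_nat_numeral)
    ultimately show ?thesis by simp
  qed
  moreover have "N2 = T * Im (G n0)" unfolding ImG using T(1) by simp
  \<comment> \<open>A lower bound quadratic in |G(n0)| meets an upper bound that is linear, so
    |G(n0)| is bounded by a constant independent of \<open>T\<close>.\<close>
  ultimately have "c2 * T * (cmod (G n0))\<^sup>2 \<le> T * cmod (G n0)"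
    using mult_left_mono[OF abs_Im_le_cmod[of "G n0"], of T] T(1) by (smt (verit) abs_ge_self mult_left_mono)
  then have "T * (c2 * (cmod (G n0))\<^sup>2) \<le> T * cmod (G n0)" by (simp add: mult_ac)
  then have "c2 * (cmod (G n0))\<^sup>2 \<le> cmod (G n0)" using T(1) by (simp only: mult_le_cancel_left_pos)
  then have Gb: "cmod (G n0) \<le> 1 / c2"
  proof (cases "G n0 = 0")
    case False
    assume "c2 * (cmod (G n0))\<^sup>2 \<le> cmod (G n0)"
    then have "(c2 * cmod (G n0)) * cmod (G n0) \<le> 1 * cmod (G n0)" by (simp add: power2_eq_square mult_ac)
    then have "c2 * cmod (G n0) \<le> 1" by (rule mult_right_le_imp_le) (use False in simp)
    then show ?thesis using c20 by (simp add: field_simps)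
  qed (use c20 in simp)
  \<comment> \<open>Energies within 1/T of \<open>E j\<close> satisfy |E i - z|^2 \<le> 2/T^2, so
    their weights are dominated by terms of the spectral sum for \<open>N2\<close>.\<close>
  have "(\<Sum>i\<in>{i\<in>{..<Q}. \<bar>E i - E j\<bar> \<le> 1 / T}. (cmod (ww i n0))\<^sup>2) \<le> (\<Sum>i\<in>{i\<in>{..<Q}. \<bar>E i - E j\<bar> \<le> 1 / T}. (2 / T\<^sup>2) * ((cmod (ww i n0))\<^sup>2 / (cmod (of_real (E i) - z))\<^sup>2))"
  proof (rule sum_mono)
    fix i assume "i \<in> {i\<in>{..<Q}. \<bar>E i - E j\<bar> \<le> 1 / T}"
    then have "\<bar>E i - E j\<bar>\<^sup>2 \<le> (1 / T)\<^sup>2" by (intro power_mono) auto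
    then have le: "(cmod (of_real (E i) - z))\<^sup>2 \<le> 2 / T\<^sup>2" unfolding norm2 by (simp add: power_divide)
    have p: "0 < (cmod (of_real (E i) - z))\<^sup>2" using nz[of i] by simp
    have "1 \<le> (2 / T\<^sup>2) / (cmod (of_real (E i) - z))\<^sup>2" using le p by (simp only: le_divide_eq_1_pos)
    then have "(cmod (ww i n0))\<^sup>2 * 1 \<le> (cmod (ww i n0))\<^sup>2 * ((2 / T\<^sup>2) / (cmod (of_real (E i) - z))\<^sup>2)" by (intro mult_left_mono) auto
    then show "(cmod (ww i n0))\<^sup>2 \<le> (2 / T\<^sup>2) * ((cmod (ww i n0))\<^sup>2 / (cmod (of_real (E i) - z))\<^sup>2)" by (simp add: mult_ac)
  qed
  also have "\<dots> \<le> (\<Sum>i<Q. (2 / T\<^sup>2) * ((cmod (ww i n0))\<^sup>2 / (cmod (of_real (E i) - z))\<^sup>2))" by (intro sum_mono2) auto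
  also have "\<dots> = (2 / T\<^sup>2) * (N2 * real Q)" unfolding N2 sum_distrib_left[symmetric] using Qr by simp
  also have "N2 = T * Im (G n0)" unfolding ImG using T(1) by simp
  also have "(2 / T\<^sup>2) * (T * Im (G n0) * real Q) = (2 / T) * Im (G n0) * real Q" using T(1) by (simp add: power2_eq_square)
  also have "\<dots> \<le> (2 / T) * (1 / c2) * real Q"
    using Gb abs_Im_le_cmod[of "G n0"] T(1) by (intro mult_right_mono mult_left_mono) auto
  also have "(2 / T) * (1 / c2) = 64 * K ^ 6 / (\<eta> ^ 3 * T)" unfolding c2_def by (simp add: field_simps)
  finally show ?thesis using Qr by (simp add: divide_le_eq)
qed

end

section \<open>Exceptional indices and the mass of energy cells\<close>

lemma dz_add_int: "dz (y + of_int k) = dz y"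
proof -
  have le: "dz y \<le> dz (y + of_int k)" for y k
  proof -
    have "dz y \<le> \<bar>y - of_int (round (y + of_int k) - k)\<bar>" by (rule dz_le)
    also have "y - of_int (round (y + of_int k) - k) = y + of_int k - of_int (round (y + of_int k))" by simp
    finally show ?thesis unfolding dz_def[of "y + of_int k"] .
  qed
  have "dz (y + of_int k) \<le> dz (y + of_int k + of_int (- k))" by (rule le)
  then show ?thesis using le[of y k] by simp
qed

text \<open>The first \<open>N\<close> distances use the cap \<open>b\<close>, the others the tail
  of \<open>g\<close>; the factor 2 stands for the two arcs of the cycle.\<close>

lemma sum_cyn_min_le:
  fixes g :: "nat \<Rightarrow> real"
  assumes Q: "Q > 0" and g: "summable g" "\<And>n. 0 \<le> g n" and b: "0 \<le> b"
  shows "(\<Sum>d\<in>{0..<int Q}. min (g (nat (cyn Q d))) b) \<le> 2 * (real N * b + (\<Sum>n. g (n + N)))"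
proof -
  define h where "h n = min (g n) b" for n
  have h0: "0 \<le> h n" for n using g(2) b by (simp add: h_def)
  have "(\<Sum>d\<in>{0..<int Q}. h (nat (cyn Q d))) \<le> (\<Sum>d\<in>{0..<int Q}. h (nat d) + h (nat (int Q - d)))"
  proof (rule sum_mono)
    fix d assume "d \<in> {0..<int Q}"
    then have "cyn Q d = d \<or> cyn Q d = int Q - d" using cyn_between[of d Q] by (auto simp: min_def)
    then show "h (nat (cyn Q d)) \<le> h (nat d) + h (nat (int Q - d))" using h0 by auto
  qed
  also have "\<dots> = (\<Sum>d\<in>{0..<int Q}. h (nat d)) + (\<Sum>d\<in>{0..<int Q}. h (nat (int Q - d)))" by (rule sum.distrib)
  also have "(\<Sum>d\<in>{0..<int Q}. h (nat d)) = (\<Sum>n<Q. h n)"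
    by (rule sum.reindex_bij_witness[of _ int nat]) auto
  also have "\<dots> \<le> (\<Sum>n<Suc Q. h n)" using h0 by simp
  also have "(\<Sum>d\<in>{0..<int Q}. h (nat (int Q - d))) = (\<Sum>n\<in>{1..Q}. h n)"
    by (rule sum.reindex_bij_witness[of _ "\<lambda>n. int Q - int n" "\<lambda>d. nat (int Q - d)"]) auto
  also have "\<dots> \<le> (\<Sum>n<Suc Q. h n)" using h0 by (intro sum_mono2) auto
  finally have 1: "(\<Sum>d\<in>{0..<int Q}. h (nat (cyn Q d))) \<le> 2 * (\<Sum>n<Suc Q. h n)" by simp
  have "(\<Sum>n<Suc Q. h n) \<le> (\<Sum>n<N + Suc Q. h n)" using h0 by (intro sum_mono2) auto
  also have "\<dots> = (\<Sum>n<N. h n) + (\<Sum>n<Suc Q. h (N + n))"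
  proof -
    have "(\<Sum>n<a + k. h n) = (\<Sum>n<a. h n) + (\<Sum>n<k. h (a + n))" for a k by (induction k) auto
    then show ?thesis .
  qed
  also have "(\<Sum>n<N. h n) \<le> (\<Sum>n<N. b)" by (intro sum_mono) (simp add: h_def)
  also have "(\<Sum>n<Suc Q. h (N + n)) \<le> (\<Sum>n<Suc Q. g (n + N))" by (intro sum_mono) (simp add: h_def add.commute)
  also have "\<dots> \<le> (\<Sum>n. g (n + N))"
    by (rule sum_le_suminf) (use g in \<open>auto simp: summable_iff_shift\<close>)
  finally have "(\<Sum>n<Suc Q. h n) \<le> real N * b + (\<Sum>n. g (n + N))" by simp
  then show ?thesis using 1 unfolding h_def by argo
qed

context dual_eig
begin

text \<open>This norm dominates \<open>ww j\<close> at every site, so decay on the dual side becomes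
  boundedness of solutions.\<close>

definition l1 :: "nat \<Rightarrow> real" where "l1 j = (\<Sum>m\<in>{0..<int Q}. cmod (\<phi> j m))"

lemma ww_le_l1: "cmod (ww j n) \<le> l1 j"
  unfolding ww_def l1_def by (rule order_trans[OF norm_sum]) (simp add: norm_mult)

lemma phi_double_sum:
  fixes t :: "int \<Rightarrow> int \<Rightarrow> real"
  assumes "\<And>m l. t m (l + int Q) = t m l"
  shows "(\<Sum>m\<in>{0..<int Q}. \<Sum>l\<in>{0..<int Q}. cmod (\<phi> j m) * cmod (\<phi> j l) * t m l)
    = (\<Sum>d\<in>{0..<int Q}. \<Sum>m\<in>{0..<int Q}. cmod (\<phi> j m) * cmod (\<phi> j (m + d)) * t m (m + d))"
proof -
  have "(\<Sum>l\<in>{0..<int Q}. cmod (\<phi> j m) * cmod (\<phi> j l) * t m l) = (\<Sum>d\<in>{0..<int Q}. cmod (\<phi> j m) * cmod (\<phi> j (d + m)) * t m (d + m))" for m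
    by (rule sum_shift_period[of Q "\<lambda>l. cmod (\<phi> j m) * cmod (\<phi> j l) * t m l", OF Q, symmetric]) (simp only: phi_per assms)
  then have "(\<Sum>m\<in>{0..<int Q}. \<Sum>l\<in>{0..<int Q}. cmod (\<phi> j m) * cmod (\<phi> j l) * t m l)
     = (\<Sum>m\<in>{0..<int Q}. \<Sum>d\<in>{0..<int Q}. cmod (\<phi> j m) * cmod (\<phi> j (d + m)) * t m (d + m))" by (simp only:)
  also have "\<dots> = (\<Sum>d\<in>{0..<int Q}. \<Sum>m\<in>{0..<int Q}. cmod (\<phi> j m) * cmod (\<phi> j (d + m)) * t m (d + m))" by (rule sum.swap)
  finally show ?thesis by (simp only: add.commute)
qed

lemma sum_m_le_1: "j < Q \<Longrightarrow> (\<Sum>m\<in>{0..<int Q}. cmod (\<phi> j m) * cmod (\<phi> j (m + d))) \<le> 1"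
proof -
  assume j: "j < Q"
  have "cmod (\<phi> j m) * cmod (\<phi> j (m + d)) \<le> ((cmod (\<phi> j m))\<^sup>2 + (cmod (\<phi> j (m + d)))\<^sup>2) / 2" for m
    using sum_squares_bound[of "cmod (\<phi> j m)" "cmod (\<phi> j (m + d))"] by simp
  then have "(\<Sum>m\<in>{0..<int Q}. cmod (\<phi> j m) * cmod (\<phi> j (m + d))) \<le> (\<Sum>m\<in>{0..<int Q}. ((cmod (\<phi> j m))\<^sup>2 + (cmod (\<phi> j (m + d)))\<^sup>2) / 2)"
    by (intro sum_mono)
  also have "\<dots> = ((\<Sum>m\<in>{0..<int Q}. (cmod (\<phi> j m))\<^sup>2) + (\<Sum>m\<in>{0..<int Q}. (cmod (\<phi> j (m + d)))\<^sup>2)) / 2"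
    by (simp only: sum_divide_distrib[symmetric] sum.distrib)
  also have "(\<Sum>m\<in>{0..<int Q}. (cmod (\<phi> j (m + d)))\<^sup>2) = (\<Sum>m\<in>{0..<int Q}. (cmod (\<phi> j m))\<^sup>2)"
    by (rule sum_shift_period[of Q "\<lambda>m. (cmod (\<phi> j m))\<^sup>2", OF Q]) (simp only: phi_per)
  finally show ?thesis unfolding phi_norm_i[OF j] by simp
qed

text \<open>The squared norms expand into correlations at all shifts \<open>d\<close>. For each
  \<open>d\<close> there are two bounds: the total over \<open>j\<close>, which is
  \<open>cor d\<close>, and one unit per index of \<open>Bd\<close>. Taking the smaller for each
  \<open>d\<close> shows that a small proportion of indices carries a small mass.\<close>

lemma bad_mass:
  assumes g: "summable g" "\<And>n. 0 \<le> g n" "\<And>d. cor d \<le> g (nat (cyn Q d))"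
    and Bd: "Bd \<subseteq> {..<Q}" and b: "real (card Bd) \<le> b * real Q" "0 \<le> b"
  shows "(\<Sum>j\<in>Bd. (l1 j)\<^sup>2) / real Q \<le> 2 * (real N * b + (\<Sum>n. g (n + N)))"
proof -
  have Qr: "0 < real Q" using Q by simp
  have finB: "finite Bd" using Bd finite_subset by blast
  let ?p = "\<lambda>d j. \<Sum>m\<in>{0..<int Q}. cmod (\<phi> j m) * cmod (\<phi> j (m + d))"
  have "(l1 j)\<^sup>2 = (\<Sum>d\<in>{0..<int Q}. ?p d j)" for j
  proof -
    have "(l1 j)\<^sup>2 = (\<Sum>m\<in>{0..<int Q}. \<Sum>l\<in>{0..<int Q}. cmod (\<phi> j m) * cmod (\<phi> j l) * 1)"
      by (simp add: l1_def power2_eq_square sum_product)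
    also have "\<dots> = (\<Sum>d\<in>{0..<int Q}. ?p d j)" using phi_double_sum[of "\<lambda>_ _. 1" j] by simp
    finally show ?thesis .
  qed
  then have "(\<Sum>j\<in>Bd. (l1 j)\<^sup>2) / real Q = (\<Sum>j\<in>Bd. \<Sum>d\<in>{0..<int Q}. ?p d j) / real Q" by (simp only:)
  also have "\<dots> = (\<Sum>d\<in>{0..<int Q}. (\<Sum>j\<in>Bd. ?p d j) / real Q)"
    by (subst sum.swap) (simp only: sum_divide_distrib)
  also have "\<dots> \<le> (\<Sum>d\<in>{0..<int Q}. min (g (nat (cyn Q d))) b)"
  proof (rule sum_mono, rule min.boundedI)
    fix d
    have "(\<Sum>j\<in>Bd. ?p d j) \<le> (\<Sum>j<Q. ?p d j)" using Bd by (intro sum_mono2) (auto intro: sum_nonneg)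
    also have "\<dots> = cor d * real Q" unfolding cor_def using Qr by (subst sum.swap) simp
    finally have "(\<Sum>j\<in>Bd. ?p d j) / real Q \<le> cor d" using Qr by (simp add: divide_le_eq)
    then show "(\<Sum>j\<in>Bd. ?p d j) / real Q \<le> g (nat (cyn Q d))" using g(3)[of d] by linarith
    have "(\<Sum>j\<in>Bd. ?p d j) \<le> (\<Sum>j\<in>Bd. 1)" using Bd by (intro sum_mono sum_m_le_1) auto
    then show "(\<Sum>j\<in>Bd. ?p d j) / real Q \<le> b" using b(1) Qr by (simp add: divide_le_eq)
  qed
  also have "\<dots> \<le> 2 * (real N * b + (\<Sum>n. g (n + N)))" by (rule sum_cyn_min_le[OF Q g(1,2) b(2)])
  finally show ?thesis .
qed

text \<open>A small Wronskian makes \<open>ww j\<close> real up to a constant phase on long windows, so \<open>(ww j)\<^sup>2\<close> and \<open>|ww j|\<^sup>2\<close> have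
  comparable averages; the averages of the former only see near-resonant pairs \<open>m + l\<close>.\<close>

lemma small_wronskian:
  fixes T :: nat and \<Lambda> \<delta> :: real
  assumes j: "j < Q" and T: "0 < T" and \<Lambda>: "0 \<le> \<Lambda>" "\<And>n. \<bar>E j - W n\<bar> \<le> \<Lambda>" and sm: "(\<Lambda> + 1) ^ T * \<bar>wr j 0\<bar> \<le> 1/2"
    and \<delta>: "0 < \<delta>"
  shows "1/2 \<le> (\<Sum>m\<in>{0..<int Q}. \<Sum>l\<in>{0..<int Q}. cmod (\<phi> j m) * cmod (\<phi> j l) *
      (if dz (2 * xx + of_int (m + l) * om) < \<delta> then 1 else 2 / (real T * \<delta>)))" (is "_ \<le> ?D")
proof -
  have Tr: "0 < real T" using T by simp
  \<comment> \<open>As a function of \<open>b\<close> this quantity obeys the recursion of the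
    solution with initial values 0 and \<open>wr j n\<close>, so its bound grows by the factor
    \<open>\<Lambda> + 1\<close> per step.\<close>
  have im: "\<bar>Im (cnj (ww j n) * ww j (n + int b))\<bar> \<le> (\<Lambda> + 1) ^ b * \<bar>wr j 0\<bar>" for n b
  proof (induction b rule: induct_nat_012)
    case 0 then show ?case by (simp add: complex_mult_cnj mult.commute[of "cnj _"])
  next
    case 1
    have "\<bar>Im (cnj (ww j n) * ww j (n + 1))\<bar> = \<bar>wr j 0\<bar>" using wr_const[OF j, of n] by (simp only: wr_def)
    then show ?case using \<Lambda>(1) mult_right_mono[of 1 "\<Lambda> + 1" "\<bar>wr j 0\<bar>"] by simp
  next
    case (ge2 b)
    let ?Y = "\<lambda>b. Im (cnj (ww j n) * ww j (n + int b))"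
    have "n + int (Suc (Suc b)) = (n + int b) + 2" "n + int (Suc b) = (n + int b) + 1" by simp_all
    then have "?Y (Suc (Suc b)) = (E j - W (n + int b + 1)) * ?Y (Suc b) - ?Y b"
      by (simp only: ww_step[OF j]) (simp add: algebra_simps)
    then have "\<bar>?Y (Suc (Suc b))\<bar> \<le> \<bar>E j - W (n + int b + 1)\<bar> * \<bar>?Y (Suc b)\<bar> + \<bar>?Y b\<bar>"
      using abs_triangle_ineq4[of "(E j - W (n + int b + 1)) * ?Y (Suc b)" "?Y b"] by (simp only: abs_mult)
    also have "\<dots> \<le> \<Lambda> * ((\<Lambda> + 1) ^ Suc b * \<bar>wr j 0\<bar>) + (\<Lambda> + 1) ^ Suc b * \<bar>wr j 0\<bar>"
    proof (intro add_mono mult_mono \<Lambda> ge2)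
      have "(\<Lambda> + 1) ^ b * \<bar>wr j 0\<bar> \<le> (\<Lambda> + 1) ^ Suc b * \<bar>wr j 0\<bar>" using \<Lambda>(1) by (intro mult_right_mono power_increasing) auto
      then show "\<bar>?Y b\<bar> \<le> (\<Lambda> + 1) ^ Suc b * \<bar>wr j 0\<bar>" using ge2(1) by linarith
    qed auto
    also have "\<dots> = (\<Lambda> + 1) ^ Suc (Suc b) * \<bar>wr j 0\<bar>" by (simp add: algebra_simps)
    finally show ?case .
  qed
  have imb: "\<bar>Im (cnj (ww j (l + int a)) * ww j (l + int b))\<bar> \<le> 1/2" if ab: "a < T" "b < T" for l a b
  proof -
    have main: "\<bar>Im (cnj (ww j (l + int a)) * ww j (l + int b))\<bar> \<le> 1/2" if "a \<le> b" "b < T" for a b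
    proof -
      have "l + int b = (l + int a) + int (b - a)" using that by simp
      then have "\<bar>Im (cnj (ww j (l + int a)) * ww j (l + int b))\<bar> \<le> (\<Lambda> + 1) ^ (b - a) * \<bar>wr j 0\<bar>" using im[of "l + int a" "b - a"] by (simp only:)
      also have "\<dots> \<le> (\<Lambda> + 1) ^ T * \<bar>wr j 0\<bar>" using \<Lambda>(1) that by (intro mult_right_mono power_increasing) auto
      finally show ?thesis using sm by linarith
    qed
    have "Im (cnj (ww j (l + int b)) * ww j (l + int a)) = - Im (cnj (ww j (l + int a)) * ww j (l + int b))" by simp
    then have e: "\<bar>Im (cnj (ww j (l + int a)) * ww j (l + int b))\<bar> = \<bar>Im (cnj (ww j (l + int b)) * ww j (l + int a))\<bar>" by (simp only: abs_minus_cancel)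
    show ?thesis
    proof (cases "a \<le> b")
      case True then show ?thesis by (rule main[OF _ ab(2)])
    next
      case False
      then have "b \<le> a" by simp
      then show ?thesis unfolding e by (rule main[OF _ ab(1)])
    qed
  qed
  define S where "S l = (\<Sum>a<T. (cmod (ww j (l + int a)))\<^sup>2)" for l
  \<comment> \<open>The mean of |ww j|^2 over a period is 1, so some window of length
    \<open>T\<close> has at least the average mass \<open>T\<close>.\<close>
  have "\<exists>l\<in>{0..<int Q}. real T \<le> S l"
  proof (rule ccontr)
    assume "\<not> ?thesis"
    then have "(\<Sum>l\<in>{0..<int Q}. S l) < (\<Sum>l\<in>{0..<int Q}. real T)" using Q by (intro sum_strict_mono) (auto simp: not_le)
    moreover have "(\<Sum>l\<in>{0..<int Q}. S l) = (\<Sum>a<T. \<Sum>l\<in>{0..<int Q}. (cmod (ww j (l + int a)))\<^sup>2)" unfolding S_def by (rule sum.swap)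
    moreover have "(\<Sum>l\<in>{0..<int Q}. (cmod (ww j (l + int a)))\<^sup>2) = real Q" for a
    proof -
      have "(\<Sum>l\<in>{0..<int Q}. (cmod (ww j (l + int a)))\<^sup>2) = (\<Sum>n\<in>{int a..<int a + int Q}. (cmod (ww j n))\<^sup>2)"
        by (rule sum.reindex_bij_witness[of _ "\<lambda>n. n - int a" "\<lambda>l. l + int a"]) auto
      then show ?thesis using ww_norm[OF j, of "int a"] by simp
    qed
    ultimately show False by (simp add: mult.commute)
  qed
  then obtain l where l: "real T \<le> S l" by blast
  define A where "A = (\<Sum>a<T. (ww j (l + int a))\<^sup>2)"
  have lowA: "(real T)\<^sup>2 / 2 \<le> (cmod A)\<^sup>2"
  proof -
    have "complex_of_real ((cmod A)\<^sup>2) = cnj A * A" by (simp add: complex_norm_square mult.commute del: of_real_power)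
    also have "\<dots> = (\<Sum>a<T. \<Sum>b<T. (cnj (ww j (l + int a)) * ww j (l + int b))\<^sup>2)"
      unfolding A_def cnj_sum sum_product by (simp add: power_mult_distrib)
    finally have "(cmod A)\<^sup>2 = (\<Sum>a<T. \<Sum>b<T. Re ((cnj (ww j (l + int a)) * ww j (l + int b))\<^sup>2))"
      by (metis (no_types, lifting) Re_complex_of_real Re_sum sum.cong)
    also have "\<dots> \<ge> (\<Sum>a<T. \<Sum>b<T. (cmod (ww j (l + int a)))\<^sup>2 * (cmod (ww j (l + int b)))\<^sup>2 - 1/2)"
    proof (intro sum_mono)
      fix a b assume ab: "a \<in> {..<T}" "b \<in> {..<T}"
      let ?z = "cnj (ww j (l + int a)) * ww j (l + int b)"
      \<comment> \<open>For nearly real products squaring causes no cancellation: the real part of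
        the square is the squared modulus up to 1/2.\<close>
      have rz: "Re (?z\<^sup>2) = (cmod ?z)\<^sup>2 - 2 * (Im ?z)\<^sup>2" unfolding cmod_power2 by (simp only: Re_power2)
      have "\<bar>Im ?z\<bar>\<^sup>2 \<le> (1/2)\<^sup>2" using imb[of a b l] ab by (intro power_mono) auto
      then have "2 * (Im ?z)\<^sup>2 \<le> 1/2" by (simp add: power2_eq_square)
      moreover have "(cmod ?z)\<^sup>2 = (cmod (ww j (l + int a)))\<^sup>2 * (cmod (ww j (l + int b)))\<^sup>2" by (simp add: norm_mult power_mult_distrib)
      ultimately show "(cmod (ww j (l + int a)))\<^sup>2 * (cmod (ww j (l + int b)))\<^sup>2 - 1/2 \<le> Re (?z\<^sup>2)" unfolding rz by linarith
    qed
    also have "(\<Sum>a<T. \<Sum>b<T. (cmod (ww j (l + int a)))\<^sup>2 * (cmod (ww j (l + int b)))\<^sup>2 - 1/2) = (S l)\<^sup>2 - (real T)\<^sup>2 / 2"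
      by (simp add: S_def power2_eq_square sum_product sum_subtractf)
    finally have "(S l)\<^sup>2 - (real T)\<^sup>2 / 2 \<le> (cmod A)\<^sup>2" .
    moreover have "(real T)\<^sup>2 \<le> (S l)\<^sup>2" using l by (intro power_mono) auto
    ultimately show ?thesis by linarith
  qed
  have "real T / 2 \<le> cmod A"
  proof -
    have "(real T / 2)\<^sup>2 \<le> (cmod A)\<^sup>2" using lowA by (simp add: power_divide) (smt (verit) zero_le_power2)
    then show ?thesis by (rule power2_le_imp_le) simp
  qed
  moreover have "cmod A \<le> real T * ?D"
  proof -
    let ?e = "\<lambda>m m' n. ee (of_int n * (2 * xx + of_int (m + m') * om))"
    have sq: "(ww j n)\<^sup>2 = (\<Sum>m\<in>{0..<int Q}. \<Sum>m'\<in>{0..<int Q}. \<phi> j m * \<phi> j m' * ?e m m' n)" for n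
    proof -
      have "ee (of_int n * (xx + of_int m * om)) * ee (of_int n * (xx + of_int m' * om)) = ?e m m' n" for m m'
        unfolding ee_add[symmetric] by (simp add: algebra_simps)
      then have "(\<phi> j m * ee (of_int n * (xx + of_int m * om))) * (\<phi> j m' * ee (of_int n * (xx + of_int m' * om))) = \<phi> j m * \<phi> j m' * ?e m m' n" for m m'
        by (simp only: mult.assoc mult.left_commute)
      then show ?thesis unfolding ww_def power2_eq_square sum_product by (simp only:)
    qed
    \<comment> \<open>A geometric sum over the window: at most \<open>T\<close> near a resonance and
      at most 2/\<delta> away from it.\<close>
    have gs: "cmod (\<Sum>a<T. ?e m m' (l + int a)) \<le> real T * (if dz (2 * xx + of_int (m + m') * om) < \<delta> then 1 else 2 / (real T * \<delta>))" for m m'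
    proof -
      define y where "y = 2 * xx + of_int (m + m') * om"
      show ?thesis
      proof (cases "dz y < \<delta>")
        case True
        have "cmod (\<Sum>a<T. ee (of_int (l + int a) * y)) \<le> (\<Sum>a<T. cmod (ee (of_int (l + int a) * y)))" by (rule norm_sum)
        also have "\<dots> = real T" by simp
        finally show ?thesis using True unfolding y_def by simp
      next
        case False
        have dy: "\<delta> \<le> cmod (ee y - 1)"
          using False abs_sin_pi_ge_dz[of y] cmod_ee_diff[of y 0] by simp
        then have ne: "ee y \<noteq> 1" using \<delta> by auto
        have "(\<Sum>a<T. ee (of_int (l + int a) * y)) = ee (of_int l * y) * (\<Sum>a<T. ee y ^ a)"
          unfolding sum_distrib_left ee_power ee_add[symmetric] by (simp add: distrib_right)
        also have "(\<Sum>a<T. ee y ^ a) = (ee y ^ T - 1) / (ee y - 1)" using ne by (rule geometric_sum)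
        finally have "cmod (\<Sum>a<T. ee (of_int (l + int a) * y)) = cmod (ee y ^ T - 1) / cmod (ee y - 1)"
          by (simp add: norm_mult norm_divide)
        also have "\<dots> \<le> 2 / \<delta>"
        proof (rule frac_le)
          show "cmod (ee y ^ T - 1) \<le> 2" using norm_triangle_ineq4[of "ee y ^ T" 1] by (simp add: norm_power)
        qed (use dy \<delta> in auto)
        finally show ?thesis using False Tr unfolding y_def by simp
      qed
    qed
    have "A = (\<Sum>m\<in>{0..<int Q}. \<Sum>m'\<in>{0..<int Q}. \<phi> j m * \<phi> j m' * (\<Sum>a<T. ?e m m' (l + int a)))"
      unfolding A_def sq sum_distrib_left by (rule sum_swap3)
    then have "cmod A \<le> (\<Sum>m\<in>{0..<int Q}. \<Sum>m'\<in>{0..<int Q}. cmod (\<phi> j m * \<phi> j m' * (\<Sum>a<T. ?e m m' (l + int a))))"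
      by (simp only:) (rule order_trans[OF norm_sum], rule sum_mono, rule norm_sum)
    also have "\<dots> \<le> (\<Sum>m\<in>{0..<int Q}. \<Sum>m'\<in>{0..<int Q}. cmod (\<phi> j m) * cmod (\<phi> j m') * (real T * (if dz (2 * xx + of_int (m + m') * om) < \<delta> then 1 else 2 / (real T * \<delta>))))"
      unfolding norm_mult by (intro sum_mono mult_left_mono gs) auto
    also have "\<dots> = real T * ?D" by (simp only: sum_distrib_left mult.left_commute)
    finally show ?thesis .
  qed
  ultimately have "real T * (1/2) \<le> real T * ?D" by simp
  then show ?thesis using Tr by (simp only: mult_le_cancel_left_pos)
qed

text \<open>Every index with small Wronskian contributes at least 1/2 to a sum whose part at shift
  \<open>d\<close> is bounded both by \<open>cor d\<close> and by the resonance weight. With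
  \<delta> = 1/t and windows of length t^2, resonant sites have proportion at most 12/t and the rest
  weight 2/t, together 14/t.\<close>

lemma card_small_wronskian:
  fixes t N :: nat and \<Lambda> :: real
  assumes g: "summable g" "\<And>n. 0 \<le> g n" "\<And>d. cor d \<le> g (nat (cyn Q d))"
    and \<Lambda>: "0 \<le> \<Lambda>" "\<And>j n. j < Q \<Longrightarrow> \<bar>E j - W n\<bar> \<le> \<Lambda>" and t: "2 \<le> t"
  shows "real (card {j\<in>{..<Q}. (\<Lambda> + 1) ^ (t\<^sup>2) * \<bar>wr j 0\<bar> \<le> 1/2}) \<le> 4 * (real N * (14 / real t) + (\<Sum>n. g (n + N))) * real Q"
proof -
  have Qr: "0 < real Q" using Q by simp
  have tr: "0 < real t" "2 \<le> real t" using t by auto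
  define \<delta> where "\<delta> = 1 / real t"
  have \<delta>: "0 < \<delta>" unfolding \<delta>_def using tr by simp
  have T\<delta>: "2 / (real (t\<^sup>2) * \<delta>) = 2 / real t" unfolding \<delta>_def using tr by (simp add: power2_eq_square)
  define wt where "wt y = (if dz (2 * xx + of_int y * om) < \<delta> then 1 else 2 / real t)" for y :: int
  have wt0: "0 \<le> wt y" for y unfolding wt_def using tr by simp
  have wt1: "wt y \<le> 1" for y unfolding wt_def using tr by simp
  have wtper: "wt (y + int Q) = wt y" for y
  proof -
    have "2 * xx + of_int (y + int Q) * om = (2 * xx + of_int y * om) + of_int P" unfolding om_def using Qr by (simp add: field_simps)
    then show ?thesis unfolding wt_def by (simp only: dz_add_int)
  qed
  define Bd where "Bd = {j\<in>{..<Q}. (\<Lambda> + 1) ^ (t\<^sup>2) * \<bar>wr j 0\<bar> \<le> 1/2}"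
  let ?p = "\<lambda>j d m. cmod (\<phi> j m) * cmod (\<phi> j (m + d))"
  define D where "D j = (\<Sum>d\<in>{0..<int Q}. \<Sum>m\<in>{0..<int Q}. ?p j d m * wt (m + (m + d)))" for j
  have D0: "0 \<le> D j" for j unfolding D_def by (intro sum_nonneg mult_nonneg_nonneg wt0) auto
  have half: "1/2 \<le> D j" if j: "j \<in> Bd" for j
  proof -
    have "1/2 \<le> (\<Sum>m\<in>{0..<int Q}. \<Sum>l\<in>{0..<int Q}. cmod (\<phi> j m) * cmod (\<phi> j l) * wt (m + l))"
      unfolding wt_def T\<delta>[symmetric] by (rule small_wronskian[of j "t\<^sup>2" \<Lambda> \<delta>]) (use j \<Lambda> \<delta> tr in \<open>auto simp: Bd_def\<close>)
    also have "\<dots> = D j" unfolding D_def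
      by (rule phi_double_sum[of "\<lambda>m l. wt (m + l)" j]) (simp only: add.assoc[symmetric] wtper)
    finally show ?thesis .
  qed
  define b where "b = 14 / real t"
  have b0: "0 \<le> b" unfolding b_def by simp
  have dterm: "(\<Sum>m\<in>{0..<int Q}. \<Sum>j<Q. ?p j d m * wt (m + (m + d))) / real Q \<le> min (g (nat (cyn Q d))) b" for d
  proof (rule min.boundedI)
    have "(\<Sum>m\<in>{0..<int Q}. \<Sum>j<Q. ?p j d m * wt (m + (m + d))) \<le> (\<Sum>m\<in>{0..<int Q}. \<Sum>j<Q. ?p j d m)"
      by (intro sum_mono mult_left_le wt1) auto
    then have "(\<Sum>m\<in>{0..<int Q}. \<Sum>j<Q. ?p j d m * wt (m + (m + d))) / real Q \<le> cor d"
      unfolding cor_def using Qr by (intro divide_right_mono) auto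
    then show "(\<Sum>m\<in>{0..<int Q}. \<Sum>j<Q. ?p j d m * wt (m + (m + d))) / real Q \<le> g (nat (cyn Q d))" using g(3)[of d] by linarith
    have "(\<Sum>m\<in>{0..<int Q}. \<Sum>j<Q. ?p j d m * wt (m + (m + d))) \<le> (\<Sum>m\<in>{0..<int Q}. (if dz (2 * xx + of_int (2 * m + d) * om) < \<delta> then 1 else 0) + 2 / real t)"
    proof (rule sum_mono)
      fix m
      have "(\<Sum>j<Q. ?p j d m * wt (m + (m + d))) = (\<Sum>j<Q. ?p j d m) * wt (m + (m + d))" by (rule sum_distrib_right[symmetric])
      also have "\<dots> \<le> 1 * wt (m + (m + d))" by (intro mult_right_mono sum_j_le_1 wt0)
      also have "\<dots> \<le> (if dz (2 * xx + of_int (2 * m + d) * om) < \<delta> then 1 else 0) + 2 / real t"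
      proof -
        have "m + (m + d) = 2 * m + d" by simp
        then show ?thesis unfolding wt_def using tr by simp
      qed
      finally show "(\<Sum>j<Q. ?p j d m * wt (m + (m + d))) \<le> (if dz (2 * xx + of_int (2 * m + d) * om) < \<delta> then 1 else 0) + 2 / real t" .
    qed
    also have "\<dots> = real (card {m\<in>{0..<int Q}. dz (2 * xx + of_int (2 * m + d) * om) < \<delta>}) + real Q * (2 / real t)"
    proof -
      have "(\<Sum>m\<in>{0..<int Q}. if dz (2 * xx + of_int (2 * m + d) * om) < \<delta> then 1 else (0::real)) = real (card {m\<in>{0..<int Q}. dz (2 * xx + of_int (2 * m + d) * om) < \<delta>})"
        by (subst sum.inter_filter[symmetric]) auto
      then show ?thesis by (simp only: sum.distrib sum_constant) simp
    qed
    also have "\<dots> \<le> 12 * \<delta> * real Q + real Q * (2 / real t)"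
      unfolding xx_def om_def using card_near_resonance[OF Q cop \<delta>, of d] by simp
    also have "\<dots> = b * real Q" unfolding b_def \<delta>_def by (simp add: field_simps)
    finally show "(\<Sum>m\<in>{0..<int Q}. \<Sum>j<Q. ?p j d m * wt (m + (m + d))) / real Q \<le> b" using Qr by (simp add: divide_le_eq)
  qed
  have "real (card Bd) * (1/2) = (\<Sum>j\<in>Bd. 1/2)" by simp
  also have "\<dots> \<le> (\<Sum>j\<in>Bd. D j)" by (intro sum_mono half)
  also have "\<dots> \<le> (\<Sum>j<Q. D j)" using D0 by (intro sum_mono2) (auto simp: Bd_def)
  also have "\<dots> = (\<Sum>d\<in>{0..<int Q}. \<Sum>m\<in>{0..<int Q}. \<Sum>j<Q. ?p j d m * wt (m + (m + d)))" unfolding D_def by (rule sum_swap3)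
  finally have "real (card Bd) * (1/2) / real Q \<le> (\<Sum>d\<in>{0..<int Q}. (\<Sum>m\<in>{0..<int Q}. \<Sum>j<Q. ?p j d m * wt (m + (m + d))) / real Q)"
    unfolding sum_divide_distrib[symmetric] by (rule divide_right_mono) simp
  also have "\<dots> \<le> (\<Sum>d\<in>{0..<int Q}. min (g (nat (cyn Q d))) b)" by (intro sum_mono dterm)
  also have "\<dots> \<le> 2 * (real N * b + (\<Sum>n. g (n + N)))" by (rule sum_cyn_min_le[OF Q g(1,2) b0])
  finally have "real (card Bd) * (1/2) \<le> 2 * (real N * b + (\<Sum>n. g (n + N))) * real Q" using Qr by (simp only: pos_divide_le_eq)
  moreover have "c \<le> 4 * s * q" if "c * (1/2) \<le> 2 * s * q" for c s q :: real using that by simp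
  ultimately have "real (card Bd) \<le> 4 * (real N * b + (\<Sum>n. g (n + N))) * real Q" by blast
  then show ?thesis unfolding Bd_def b_def .
qed

text \<open>An index is bad if its l1 norm is large, which Chebyshev's inequality makes rare, or if
  its Wronskian is small. Bad indices carry little mass by \<open>bad_mass\<close>; a cell of length
  1/T that contains a good index is controlled by \<open>good_cell\<close>, and all other cells
  consist of bad indices.\<close>

lemma cell_mass_bound:
  fixes t N N2 :: nat and \<Lambda> K T b :: real and Z :: "int set"
  assumes g: "summable g" "\<And>n. 0 \<le> g n" "\<And>d. cor d \<le> g (nat (cyn Q d))"
    and \<Lambda>: "0 \<le> \<Lambda>" "\<And>j n. j < Q \<Longrightarrow> \<bar>E j - W n\<bar> \<le> \<Lambda>" and t: "2 \<le> t" and K: "1 \<le> K"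
    and b: "2 * (\<Sum>n. g n) / K\<^sup>2 + 4 * (real N2 * (14 / real t) + (\<Sum>n. g (n + N2))) \<le> b"
    and T: "0 < T" "T + 3 \<le> real Q" and Z: "finite Z"
  shows "(\<Sum>j\<in>{j\<in>{..<Q}. \<lfloor>T * E j\<rfloor> \<in> Z}. (cmod (ww j n0))\<^sup>2) / real Q
    \<le> 2 * (real N * b + (\<Sum>n. g (n + N))) + 64 * K ^ 6 * (2 * (\<Lambda> + 1) ^ (t\<^sup>2)) ^ 3 * (real (card Z) / T)"
proof -
  have Qr: "0 < real Q" using Q by simp
  define Bd1 where "Bd1 = {j\<in>{..<Q}. K < l1 j}"
  define Bd2 where "Bd2 = {j\<in>{..<Q}. (\<Lambda> + 1) ^ (t\<^sup>2) * \<bar>wr j 0\<bar> \<le> 1/2}"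
  have l10: "0 \<le> l1 j" for j unfolding l1_def by (intro sum_nonneg) auto
  have K2: "0 < K\<^sup>2" using K by simp
  have c1: "real (card Bd1) \<le> 2 * (\<Sum>n. g n) / K\<^sup>2 * real Q"
  proof -
    have "real (card Bd1) * K\<^sup>2 = (\<Sum>j\<in>Bd1. K\<^sup>2)" by simp
    also have "\<dots> \<le> (\<Sum>j\<in>Bd1. (l1 j)\<^sup>2)" using K by (intro sum_mono power_mono) (auto simp: Bd1_def)
    also have "\<dots> \<le> (\<Sum>j<Q. (l1 j)\<^sup>2)" by (intro sum_mono2) (auto simp: Bd1_def)
    also have "\<dots> \<le> 2 * (\<Sum>n. g n) * real Q"
    proof -
      have "(\<Sum>j<Q. (l1 j)\<^sup>2) / real Q \<le> 2 * (real 0 * 1 + (\<Sum>n. g (n + 0)))" by (rule bad_mass[OF g]) auto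
      then show ?thesis using Qr by (simp add: divide_le_eq)
    qed
    finally have "real (card Bd1) * K\<^sup>2 \<le> 2 * (\<Sum>n. g n) * real Q" .
    then have "real (card Bd1) \<le> 2 * (\<Sum>n. g n) * real Q / K\<^sup>2" using K2 by (simp only: pos_le_divide_eq)
    then show ?thesis by simp
  qed
  have c2: "real (card Bd2) \<le> 4 * (real N2 * (14 / real t) + (\<Sum>n. g (n + N2))) * real Q"
    unfolding Bd2_def by (rule card_small_wronskian[OF g \<Lambda> t])
  define Bd where "Bd = Bd1 \<union> Bd2"
  have Bsub: "Bd \<subseteq> {..<Q}" unfolding Bd_def Bd1_def Bd2_def by auto
  have cB: "real (card Bd) \<le> b * real Q"
  proof -
    have "card Bd \<le> card Bd1 + card Bd2" unfolding Bd_def by (rule card_Un_le)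
    then have "real (card Bd) \<le> real (card Bd1) + real (card Bd2)" by (simp only: of_nat_add[symmetric] of_nat_le_iff)
    also have "\<dots> \<le> (2 * (\<Sum>n. g n) / K\<^sup>2 + 4 * (real N2 * (14 / real t) + (\<Sum>n. g (n + N2)))) * real Q"
      unfolding distrib_right[of _ _ "real Q"] by (rule add_mono[OF c1 c2])
    also have "\<dots> \<le> b * real Q" using b Qr by (intro mult_right_mono) auto
    finally show ?thesis .
  qed
  have b0: "0 \<le> b"
  proof -
    have "0 \<le> (\<Sum>n. g n)" "0 \<le> (\<Sum>n. g (n + N2))" using g(1,2) by (auto intro!: suminf_nonneg simp: summable_iff_shift)
    then have "0 \<le> 2 * (\<Sum>n. g n) / K\<^sup>2 + 4 * (real N2 * (14 / real t) + (\<Sum>n. g (n + N2)))" by simp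
    then show ?thesis using b by linarith
  qed
  let ?s = "\<lambda>j. (cmod (ww j n0))\<^sup>2"
  have bad: "(\<Sum>j\<in>Bd. ?s j) / real Q \<le> 2 * (real N * b + (\<Sum>n. g (n + N)))"
  proof -
    have "(\<Sum>j\<in>Bd. ?s j) \<le> (\<Sum>j\<in>Bd. (l1 j)\<^sup>2)" by (intro sum_mono power_mono ww_le_l1) auto
    then have "(\<Sum>j\<in>Bd. ?s j) / real Q \<le> (\<Sum>j\<in>Bd. (l1 j)\<^sup>2) / real Q" by (rule divide_right_mono) simp
    also have "\<dots> \<le> 2 * (real N * b + (\<Sum>n. g (n + N)))" by (rule bad_mass[OF g Bsub cB b0])
    finally show ?thesis .
  qed
  define \<eta> where "\<eta> = 1 / (2 * (\<Lambda> + 1) ^ (t\<^sup>2))"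
  have p1: "1 \<le> (\<Lambda> + 1) ^ (t\<^sup>2)" using \<Lambda>(1) by (simp add: one_le_power)
  have \<eta>: "0 < \<eta>" "\<eta> \<le> 1" unfolding \<eta>_def using p1 by auto
  define cell where "cell k = {i\<in>{..<Q}. \<lfloor>T * E i\<rfloor> = k} - Bd" for k
  have cell: "(\<Sum>i\<in>cell k. ?s i) / real Q \<le> 64 * K ^ 6 / (\<eta> ^ 3 * T)" for k
  proof (cases "cell k = {}")
    case True
    have "0 \<le> 64 * K ^ 6 / (\<eta> ^ 3 * T)" using K \<eta> T by simp
    then show ?thesis using True by simp
  next
    case False
    then obtain j where j: "j \<in> cell k" by blast
    have jQ: "j < Q" and jk: "\<lfloor>T * E j\<rfloor> = k" and jB: "j \<notin> Bd" using j by (auto simp: cell_def)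
    have lK: "l1 j \<le> K" using jB jQ by (auto simp: Bd_def Bd1_def)
    have wj: "\<eta> \<le> \<bar>wr j 0\<bar>"
    proof -
      have "1/2 < (\<Lambda> + 1) ^ (t\<^sup>2) * \<bar>wr j 0\<bar>" using jB jQ by (auto simp: Bd_def Bd2_def)
      then show ?thesis unfolding \<eta>_def using p1 by (simp add: field_simps)
    qed
    have "cell k \<subseteq> {i\<in>{..<Q}. \<bar>E i - E j\<bar> \<le> 1 / T}"
    proof
      fix i assume "i \<in> cell k"
      then have i: "i < Q" "\<lfloor>T * E i\<rfloor> = k" by (auto simp: cell_def)
      have "\<bar>T * E i - T * E j\<bar> \<le> 1" using i(2) jk by linarith
      then have "T * \<bar>E i - E j\<bar> \<le> 1" using T(1) by (simp add: abs_mult flip: right_diff_distrib)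
      then show "i \<in> {i\<in>{..<Q}. \<bar>E i - E j\<bar> \<le> 1 / T}" using i(1) T(1) by (simp add: pos_le_divide_eq mult.commute)
    qed
    then have "(\<Sum>i\<in>cell k. ?s i) \<le> (\<Sum>i\<in>{i\<in>{..<Q}. \<bar>E i - E j\<bar> \<le> 1 / T}. ?s i)" by (intro sum_mono2) auto
    then have "(\<Sum>i\<in>cell k. ?s i) / real Q \<le> (\<Sum>i\<in>{i\<in>{..<Q}. \<bar>E i - E j\<bar> \<le> 1 / T}. ?s i) / real Q" by (rule divide_right_mono) simp
    also have "\<dots> \<le> 64 * K ^ 6 / (\<eta> ^ 3 * T)"
      by (rule good_cell[OF jQ K _ \<eta> wj T]) (use ww_le_l1[of j] lK order_trans in blast)
    finally show ?thesis .
  qed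
  have "(\<Sum>j\<in>{j\<in>{..<Q}. \<lfloor>T * E j\<rfloor> \<in> Z}. ?s j) \<le> (\<Sum>j\<in>Bd \<union> (\<Union>k\<in>Z. cell k). ?s j)"
    using Z Bsub by (intro sum_mono2) (auto simp: cell_def intro: finite_subset)
  also have "\<dots> = (\<Sum>j\<in>Bd. ?s j) + (\<Sum>j\<in>(\<Union>k\<in>Z. cell k). ?s j)"
    using Z Bsub by (intro sum.union_disjoint) (auto simp: cell_def intro: finite_subset)
  also have "(\<Sum>j\<in>(\<Union>k\<in>Z. cell k). ?s j) = (\<Sum>k\<in>Z. \<Sum>j\<in>cell k. ?s j)"
    using Z by (intro sum.UNION_disjoint) (auto simp: cell_def)
  finally have "(\<Sum>j\<in>{j\<in>{..<Q}. \<lfloor>T * E j\<rfloor> \<in> Z}. ?s j) / real Q \<le> (\<Sum>j\<in>Bd. ?s j) / real Q + (\<Sum>k\<in>Z. (\<Sum>j\<in>cell k. ?s j) / real Q)"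
    unfolding sum_divide_distrib[symmetric] add_divide_distrib[symmetric] by (rule divide_right_mono) simp
  also have "\<dots> \<le> 2 * (real N * b + (\<Sum>n. g (n + N))) + (\<Sum>k\<in>Z. 64 * K ^ 6 / (\<eta> ^ 3 * T))"
    by (intro add_mono bad sum_mono cell)
  also have "(\<Sum>k\<in>Z. 64 * K ^ 6 / (\<eta> ^ 3 * T)) = 64 * K ^ 6 * (2 * (\<Lambda> + 1) ^ (t\<^sup>2)) ^ 3 * (real (card Z) / T)"
    unfolding \<eta>_def by (simp add: power_divide)
  finally show ?thesis .
qed

end

section \<open>Parameters uniform in the period\<close>

text \<open>The order of choice matters: \<open>N\<close> from \<open>\<epsilon>\<close>, then
  \<open>b\<close>, and from \<open>b\<close> the numbers \<open>N2\<close>, \<open>K\<close> and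
  \<open>t\<close>. None of them sees the period \<open>Q\<close>.\<close>

lemma cell_mass_parameters:
  fixes \<epsilon> :: real
  assumes g: "summable g" "\<And>n::nat. 0 \<le> g n" and \<epsilon>: "0 < \<epsilon>"
  obtains t N N2 :: nat and K b :: real where "2 \<le> t" "1 \<le> K"
    "2 * (\<Sum>n. g n) / K\<^sup>2 + 4 * (real N2 * (14 / real t) + (\<Sum>n. g (n + N2))) \<le> b"
    "2 * (real N * b + (\<Sum>n. g (n + N))) \<le> \<epsilon>"
proof -
  have tail: "\<exists>N. (\<Sum>n. g (n + N)) < r" if r0: "0 < r" for r
  proof -
    obtain N where "\<forall>n\<ge>N. norm (\<Sum>i. g (i + n)) < r" using suminf_exist_split[OF r0 g(1)] by blast
    then have "norm (\<Sum>i. g (i + N)) < r" by blast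
    then show ?thesis by (intro exI[of _ N]) simp
  qed
  obtain N where N: "(\<Sum>n. g (n + N)) < \<epsilon> / 8" using tail[of "\<epsilon> / 8"] \<epsilon> by auto
  define b where "b = \<epsilon> / (4 * (real N + 1))"
  have b0: "0 < b" unfolding b_def using \<epsilon> by simp
  have Nb: "real N * b \<le> \<epsilon> / 4" unfolding b_def using \<epsilon> by (simp add: field_simps)
  obtain N2 where N2: "(\<Sum>n. g (n + N2)) < b / 16" using tail[of "b / 16"] b0 by auto
  define G where "G = (\<Sum>n. g n)"
  have G0: "0 \<le> G" unfolding G_def using g by (intro suminf_nonneg) auto
  define K where "K = 1 + 4 * G / b"
  have K1: "1 \<le> K" unfolding K_def using G0 b0 by simp
  have GK: "2 * G / K\<^sup>2 \<le> b / 2"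
  proof -
    have "4 * G / b \<le> K" unfolding K_def by simp
    also have "K \<le> K\<^sup>2" using K1 by (simp add: power2_eq_square)
    finally have "4 * G \<le> K\<^sup>2 * b" using b0 by (simp only: pos_divide_le_eq)
    then show ?thesis using K1 by (simp add: divide_le_eq) (simp add: mult.commute)
  qed
  obtain t where t: "real 2 + 224 * real N2 / b \<le> real t" using real_arch_simple by blast
  have t2: "2 \<le> t"
  proof -
    have "0 \<le> 224 * real N2 / b" using b0 by simp
    then have "real 2 \<le> real t" using t by linarith
    then show ?thesis by (simp only: of_nat_le_iff)
  qed
  have Nt: "real N2 * (14 / real t) \<le> b / 16"
  proof -
    have "224 * real N2 / b \<le> real t" using t by simp
    then have "224 * real N2 \<le> real t * b" using b0 by (simp only: pos_divide_le_eq)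
    then show ?thesis using t2 by (simp add: field_simps)
  qed
  show thesis
  proof (rule that[OF t2 K1])
    have "4 * (real N2 * (14 / real t) + (\<Sum>n. g (n + N2))) \<le> 4 * (b / 16 + b / 16)" using Nt N2 by (intro mult_left_mono add_mono) auto
    then show "2 * (\<Sum>n. g n) / K\<^sup>2 + 4 * (real N2 * (14 / real t) + (\<Sum>n. g (n + N2))) \<le> b" using GK unfolding G_def by argo
    show "2 * (real N * b + (\<Sum>n. g (n + N))) \<le> \<epsilon>" using Nb N \<epsilon> by argo
  qed
qed

text \<open>A majorant of the correlations common to all approximants: the trivial bound below the
  threshold \<open>n0\<close>, the bound of \<open>cor_decay\<close> beyond it.\<close>

definition cor_profile :: "real \<Rightarrow> nat \<Rightarrow> nat \<Rightarrow> real" where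
  "cor_profile B n0 n = (if n < n0 then 1 else (4 * (1 + 2 / (22000 * B)) + 12 * (6 * real n + 1)) * exp (- B * real n))"

lemma cor_profile_nonneg: "0 < B \<Longrightarrow> 0 \<le> cor_profile B n0 n"
  unfolding cor_profile_def by (auto intro!: mult_nonneg_nonneg add_nonneg_nonneg)

lemma summable_cor_profile:
  assumes B: "0 < B" shows "summable (cor_profile B n0)"
proof -
  define a where "a = 4 * (1 + 2 / (22000 * B)) + 72"
  have "norm (exp (- B)) < 1" using B by simp
  then have "summable (\<lambda>n. of_nat (Suc n) * exp (- B) ^ n)" by (rule sums_summable[OF geometric_deriv_sums])
  then have s: "summable (\<lambda>n. a * (of_nat (Suc n) * exp (- B) ^ n))" by (rule summable_mult)
  show ?thesis
  proof (rule summable_comparison_test'[OF s, of n0])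
    fix n assume n: "n0 \<le> n"
    have a0: "0 < 2 / (22000 * B)" using B by simp
    have "4 * (1 + x) + 12 * (6 * real n + 1) \<le> (4 * (1 + x) + 72) * real (Suc n)" if "0 < x" for x :: real
    proof -
      have "0 \<le> x * real n" using that by simp
      then show ?thesis by (simp add: algebra_simps)
    qed
    from this[OF a0] have "4 * (1 + 2 / (22000 * B)) + 12 * (6 * real n + 1) \<le> a * real (Suc n)" unfolding a_def .
    then have "(4 * (1 + 2 / (22000 * B)) + 12 * (6 * real n + 1)) * exp (- B * real n) \<le> a * real (Suc n) * exp (- B * real n)"
      by (rule mult_right_mono) simp
    moreover have "exp (- B * real n) = exp (- B) ^ n" by (simp add: exp_of_nat_mult[symmetric] mult.commute)
    ultimately have "cor_profile B n0 n \<le> a * (of_nat (Suc n) * exp (- B) ^ n)" unfolding cor_profile_def using n by (simp add: mult.assoc)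
    then show "norm (cor_profile B n0 n) \<le> a * (of_nat (Suc n) * exp (- B) ^ n)" using cor_profile_nonneg[OF B, of n0 n] by simp
  qed
qed

lemma decay_threshold:
  fixes B c0 \<epsilon> L :: real
  assumes B: "0 < B" and c0: "0 < c0" and \<epsilon>: "0 < \<epsilon>"
  obtains n0 :: nat where "\<And>n. n0 \<le> n \<Longrightarrow> 1000 \<le> n \<and> 40 * (exp L / c0 + 2) \<le> real n \<and> real n / (2 * \<epsilon>\<^sup>2 * c0 ^ 24) \<le> exp (B * real n) \<and> real n \<le> exp (B * real n)"
proof -
  define D where "D = 2 * \<epsilon>\<^sup>2 * c0 ^ 24"
  have D0: "0 < D" unfolding D_def using c0 \<epsilon> by simp
  obtain n0 :: nat where n0: "max 1000 (max (40 * (exp L / c0 + 2)) (max (2 / (D * B\<^sup>2)) (2 / B\<^sup>2))) \<le> real n0" using real_arch_simple by blast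
  show thesis
  proof (rule that)
    fix n assume "n0 \<le> n"
    then have "max 1000 (max (40 * (exp L / c0 + 2)) (max (2 / (D * B\<^sup>2)) (2 / B\<^sup>2))) \<le> real n" using n0 by (meson of_nat_le_iff order_trans)
    then have n: "1000 \<le> real n" "40 * (exp L / c0 + 2) \<le> real n" "2 / (D * B\<^sup>2) \<le> real n" "2 / B\<^sup>2 \<le> real n" by (simp_all only: max.bounded_iff)
    have e: "(B * real n)\<^sup>2 / 2 \<le> exp (B * real n)" 
    proof -
      have "0 \<le> B * real n" using B by simp
      then show ?thesis using exp_lower_Taylor_quadratic[of "B * real n"] by linarith
    qed
    have gen: "x * real n \<le> exp (B * real n)" if "2 * x / B\<^sup>2 \<le> real n" for x
    proof -
      have "2 * x \<le> real n * B\<^sup>2" using that B by (simp add: pos_divide_le_eq)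
      then have "x * real n \<le> (real n * B\<^sup>2 / 2) * real n" by (intro mult_right_mono) auto
      also have "\<dots> = (B * real n)\<^sup>2 / 2" by (simp add: power2_eq_square)
      finally show ?thesis using e by linarith
    qed
    have "real n / D \<le> exp (B * real n)" using gen[of "1 / D"] n(3) by simp
    moreover have "real n \<le> exp (B * real n)" using gen[of 1] n(4) by simp
    moreover have "1000 \<le> n" using n(1) by linarith
    ultimately show "1000 \<le> n \<and> 40 * (exp L / c0 + 2) \<le> real n \<and> real n / (2 * \<epsilon>\<^sup>2 * c0 ^ 24) \<le> exp (B * real n) \<and> real n \<le> exp (B * real n)"
      using n(2) unfolding D_def by blast
  qed
qed

lemma (in dual_eig) cor_le_profile:
  fixes B c0 \<epsilon> \<epsilon>1 L :: real and n0 :: nat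
  assumes B: "0 < B" and c0: "0 < c0" "c0 \<le> 1" and \<epsilon>: "0 < \<epsilon>" "sqrt (2 * \<epsilon>) \<le> B"
    and L: "ln 2 + 2 * pi / sqrt (2 * \<epsilon>) \<le> L" "4 * ln 16 + 16 * ln (8 / (3 * c0)) \<le> L"
    and n0: "\<And>n. n0 \<le> n \<Longrightarrow> 1000 \<le> n \<and> 40 * (exp L / c0 + 2) \<le> real n \<and> real n / (2 * \<epsilon>\<^sup>2 * c0 ^ 24) \<le> exp (B * real n) \<and> real n \<le> exp (B * real n)"
    and dc: "\<And>d::int. d \<noteq> 0 \<Longrightarrow> \<bar>d\<bar> < int Q \<Longrightarrow> c0 * exp (- B * real_of_int \<bar>d\<bar>) \<le> dz (of_int d * om)"
    and \<epsilon>1: "0 \<le> \<epsilon>1" "\<epsilon>1 \<le> 1" "\<epsilon>1 * (2 * (1 + 1 / (22000 * B))) \<le> \<epsilon>"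
    and c: "\<And>d. cmod (cc d) \<le> \<epsilon>1 * exp (- (2 * (22000 * B)) * of_int (cyn Q d))"
  shows "cor d \<le> cor_profile B n0 (nat (cyn Q d))"
proof (cases "nat (cyn Q d) < n0")
  case True
  then show ?thesis using cor_le_1[of d] by (simp add: cor_profile_def)
next
  case False
  define n where "n = nat (cyn Q d)"
  have n: "int n = cyn Q d" unfolding n_def using cyn_nonneg[OF Q, of d] by simp
  have nn: "n0 \<le> n" using False by (simp add: n_def)
  have "2 * n \<le> Q"
  proof -
    have "cyn Q d = min (d mod int Q) (int Q - d mod int Q)" by (simp add: cyn_def)
    then show ?thesis using n by linarith
  qed
  then have "cor (int n) \<le> (4 * (1 + 2 / (22000 * B)) + 12 * (6 * real n + 1)) * exp (- B * real n)"
    using n0[OF nn] by (intro cor_decay[OF B c0 \<epsilon> L _ _ _ _ _ dc refl \<epsilon>1 c]) auto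
  then show ?thesis unfolding n cor_cyn using nn unfolding cor_profile_def n_def[symmetric] by simp
qed

subsection \<open>Fourier coefficients of sampled analytic functions\<close>

definition fdiff :: "real \<Rightarrow> (complex \<Rightarrow> complex) \<Rightarrow> complex \<Rightarrow> complex" where
  "fdiff \<delta> f z = f (z + of_real \<delta>) - f z"

text \<open>Differences of a function and of its derivatives again form such a family, with bounds
  multiplied by \<delta> and shifted by one; hence the induction over the whole family. Derivatives
  are taken within the real axis since all shifts are real.\<close>

lemma fdiff_pow_bound:
  fixes f :: "nat \<Rightarrow> complex \<Rightarrow> complex" and M :: "nat \<Rightarrow> real"
  assumes d: "\<And>m z. z \<in> \<real> \<Longrightarrow> (f m has_field_derivative f (Suc m) z) (at z within \<real>)"
    and b: "\<And>m z. z \<in> \<real> \<Longrightarrow> cmod (f m z) \<le> M m" and \<delta>: "0 \<le> \<delta>" and z: "z \<in> \<real>"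
  shows "cmod ((fdiff \<delta> ^^ k) (f 0) z) \<le> \<delta> ^ k * M k"
  using d b z
proof (induction k arbitrary: f M z)
  case 0 then show ?case by simp
next
  case (Suc k)
  define g where "g m = fdiff \<delta> (f m)" for m
  have "cmod ((fdiff \<delta> ^^ k) (g 0) z) \<le> \<delta> ^ k * (\<delta> * M (Suc k))"
  proof (rule Suc.IH[of g "\<lambda>m. \<delta> * M (Suc m)"])
    fix m and z :: complex assume z: "z \<in> \<real>"
    have zd: "z + of_real \<delta> \<in> \<real>" using z by simp
    have sh: "((\<lambda>z. f m (z + of_real \<delta>)) has_field_derivative f (Suc m) (z + of_real \<delta>)) (at z within \<real>)"
    proof -
      have "(\<lambda>z. z + of_real \<delta>) ` \<real> \<subseteq> (\<real> :: complex set)" by auto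
      then have "(f m has_field_derivative f (Suc m) (z + of_real \<delta>)) (at (z + of_real \<delta>) within (\<lambda>z. z + of_real \<delta>) ` \<real>)"
        by (rule has_field_derivative_subset[OF Suc.prems(1)[OF zd]])
      moreover have "((\<lambda>z. z + of_real \<delta>) has_field_derivative 1) (at z within \<real>)" by (auto intro!: derivative_eq_intros)
      ultimately show ?thesis using DERIV_image_chain[of "f m" "f (Suc m) (z + of_real \<delta>)" "\<lambda>z. z + of_real \<delta>" z \<real> 1] by (simp add: o_def)
    qed
    show "(g m has_field_derivative g (Suc m) z) (at z within \<real>)"
      unfolding g_def fdiff_def by (intro DERIV_diff sh Suc.prems(1) z)
    have "cmod (f m (z + of_real \<delta>) - f m z) \<le> M (Suc m) * cmod ((z + of_real \<delta>) - z)"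
    proof (rule field_differentiable_bound[of \<real> "f m" "f (Suc m)"])
      show "convex (\<real> :: complex set)" by (rule convex_Reals)
    qed (use Suc.prems(1,2) zd z in auto)
    then show "cmod (g m z) \<le> \<delta> * M (Suc m)" unfolding g_def fdiff_def using \<delta> by (simp add: mult.commute)
  qed (fact Suc.prems(3))
  then show ?case by (simp add: g_def funpow_swap1 mult_ac)
qed

lemma fdiff_periodic:
  assumes "\<And>x. x \<in> \<real> \<Longrightarrow> f (x + 1) = f x" "x \<in> \<real>"
  shows "(fdiff \<delta> ^^ k) f (x + 1) = (fdiff \<delta> ^^ k) f x"
  using assms(2)
proof (induction k arbitrary: x)
  case 0 then show ?case using assms(1) by simp
next
  case (Suc k)
  have "x + 1 + of_real \<delta> = (x + of_real \<delta>) + 1" by simp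
  then have "(fdiff \<delta> ^^ k) f (x + 1 + of_real \<delta>) = (fdiff \<delta> ^^ k) f (x + of_real \<delta>)"
    using Suc.IH[of "x + of_real \<delta>"] Suc.prems by (simp only: Reals_add Reals_of_real)
  then show ?case using Suc.IH[OF Suc.prems] by (simp only: funpow.simps o_apply fdiff_def[of \<delta> "(fdiff \<delta> ^^ k) f"])
qed

lemma periodic_int:
  fixes f :: "complex \<Rightarrow> complex"
  assumes "\<And>x. x \<in> \<real> \<Longrightarrow> f (x + 1) = f x" "x \<in> \<real>"
  shows "f (x + of_int k) = f x"
proof (induction k rule: int_induct[of _ 0])
  case base show ?case by simp
next
  case (step1 i)
  have "x + of_int (i + 1) = (x + of_int i) + 1" by simp
  then have "f (x + of_int (i + 1)) = f (x + of_int i)" using assms(1)[of "x + of_int i"] assms(2) by (simp only: Reals_add Reals_of_int)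
  then show ?case using step1 by simp
next
  case (step2 i)
  have "x + of_int i = (x + of_int (i - 1)) + 1" by simp
  then have "f (x + of_int i) = f (x + of_int (i - 1))" using assms(1)[of "x + of_int (i - 1)"] assms(2) by (simp only: Reals_add Reals_of_int)
  then show ?case using step2 by simp
qed

text \<open>Summation by parts: with \<open>P' P \<equiv> 1 (mod Q)\<close>, shifting the index by \<open>P'\<close> moves the
  sampling point by \<open>1/Q\<close>, so a difference in the function is a factor on the coefficient.\<close>

lemma coeff_fdiff:
  fixes P s :: int and Q :: nat and \<theta> :: real
  assumes Q: "Q > 0" and cop: "coprime P (int Q)" and per: "\<And>x. x \<in> \<real> \<Longrightarrow> f (x + 1) = f x"
  defines "\<omega> \<equiv> of_int P / real Q"
  shows "(\<Sum>n\<in>{0..<int Q}. fdiff (1 / real Q) f (of_real (\<theta> + of_int n * \<omega>)) * ee (- (of_int (n * s) * \<omega>)))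
    = (ee (of_int s / real Q) - 1) * (\<Sum>n\<in>{0..<int Q}. f (of_real (\<theta> + of_int n * \<omega>)) * ee (- (of_int (n * s) * \<omega>)))"
proof -
  have Qr: "real Q \<noteq> 0" using Q by simp
  obtain P' k where Pk: "P' * P = 1 + k * int Q"
  proof -
    obtain u w where "u * P + w * int Q = gcd P (int Q)" using bezout_int by blast
    then have "u * P = 1 + (- w) * int Q" using cop by simp
    then show thesis by (rule that)
  qed
  have P'\<omega>: "of_int P' * \<omega> = 1 / real Q + of_int k"
  proof -
    have "of_int P' * of_int P = 1 + of_int k * real Q" using arg_cong[OF Pk, of real_of_int] by simp
    then show ?thesis unfolding \<omega>_def using Qr by (simp add: add_divide_distrib)
  qed
  have Q\<omega>: "of_int (int Q) * \<omega> = of_int P" unfolding \<omega>_def using Qr by simp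
  define F where "F n = f (of_real (\<theta> + of_int n * \<omega>))" for n :: int
  define e where "e n = ee (- (of_int (n * s) * \<omega>))" for n :: int
  have Fper: "F (n + int Q) = F n" for n
  proof -
    have "\<theta> + of_int (n + int Q) * \<omega> = (\<theta> + of_int n * \<omega>) + of_int P" using Q\<omega> by (simp add: distrib_right)
    then have "complex_of_real (\<theta> + of_int (n + int Q) * \<omega>) = of_real (\<theta> + of_int n * \<omega>) + of_int P" by simp
    then show ?thesis unfolding F_def using periodic_int[of f "of_real (\<theta> + of_int n * \<omega>)" P, OF per Reals_of_real] by (simp only:)
  qed
  have eper: "e (n + int Q) = e n" for n
  proof -
    have "- (of_int ((n + int Q) * s) * \<omega>) = - (of_int (n * s) * \<omega>) + of_int (- (s * P))"
      using Q\<omega> by (simp add: algebra_simps)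
    then show ?thesis unfolding e_def by (simp only: ee_add ee_int mult_1_right)
  qed
  have Fs: "fdiff (1 / real Q) f (of_real (\<theta> + of_int n * \<omega>)) = F (n + P') - F n" for n
  proof -
    have "\<theta> + of_int (n + P') * \<omega> = (\<theta> + of_int n * \<omega> + 1 / real Q) + of_int k" using P'\<omega> by (simp add: distrib_right)
    then have "complex_of_real (\<theta> + of_int (n + P') * \<omega>) = of_real (\<theta> + of_int n * \<omega> + 1 / real Q) + of_int k" by simp
    then have "F (n + P') = f (of_real (\<theta> + of_int n * \<omega> + 1 / real Q))"
      unfolding F_def using periodic_int[of f "of_real (\<theta> + of_int n * \<omega> + 1 / real Q)" k, OF per Reals_of_real] by (simp only:)
    then show ?thesis by (simp add: fdiff_def F_def)
  qed
  have es: "e n = ee (of_int s / real Q) * e (n + P')" for n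
  proof -
    have "- (of_int (n * s) * \<omega>) = of_int s / real Q + - (of_int ((n + P') * s) * \<omega>) + of_int (k * s)"
    proof -
      have "of_int ((n + P') * s) * \<omega> = of_int (n * s) * \<omega> + of_int s * (of_int P' * \<omega>)" by (simp add: algebra_simps)
      also have "of_int s * (of_int P' * \<omega>) = of_int s / real Q + of_int (k * s)" unfolding P'\<omega> by (simp add: distrib_left mult.commute)
      finally show ?thesis by simp
    qed
    then show ?thesis unfolding e_def by (simp only: ee_add ee_int mult_1_right)
  qed
  have "(\<Sum>n\<in>{0..<int Q}. F (n + P') * e n) = ee (of_int s / real Q) * (\<Sum>n\<in>{0..<int Q}. F (n + P') * e (n + P'))"
    unfolding sum_distrib_left
  proof (rule sum.cong[OF refl])
    fix n
    show "F (n + P') * e n = ee (of_int s / real Q) * (F (n + P') * e (n + P'))"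
      unfolding es[of n] by (simp only: mult_ac)
  qed
  also have "(\<Sum>n\<in>{0..<int Q}. F (n + P') * e (n + P')) = (\<Sum>n\<in>{0..<int Q}. F n * e n)"
    by (rule sum_shift_period[of Q "\<lambda>n. F n * e n", OF Q]) (simp only: Fper eper)
  finally have "(\<Sum>n\<in>{0..<int Q}. (F (n + P') - F n) * e n) = (ee (of_int s / real Q) - 1) * (\<Sum>n\<in>{0..<int Q}. F n * e n)"
    by (simp add: left_diff_distrib sum_subtractf)
  then show ?thesis by (simp only: Fs F_def[symmetric] e_def[symmetric])
qed

text \<open>A period rectangle of the smaller strip is compact, and periodicity carries its bound
  along the strip.\<close>

lemma periodic_strip_bounded:
  assumes V: "V holomorphic_on {z. \<bar>Im z\<bar> < R}" and per: "\<And>z. \<bar>Im z\<bar> < R \<Longrightarrow> V (z + 1) = V z" and h: "h < R"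
  obtains A where "0 < A" "\<And>z. \<bar>Im z\<bar> \<le> h \<Longrightarrow> cmod (V z) \<le> A"
proof -
  have "compact (cbox (Complex 0 (- h)) (Complex 1 h))" by (rule compact_cbox)
  moreover have sub: "cbox (Complex 0 (- h)) (Complex 1 h) \<subseteq> {z. \<bar>Im z\<bar> < R}" using h by (auto simp: in_cbox_complex_iff)
  ultimately have "compact (V ` cbox (Complex 0 (- h)) (Complex 1 h))"
    using holomorphic_on_imp_continuous_on[OF V] by (intro compact_continuous_image) (auto intro: continuous_on_subset)
  then have "bounded (V ` cbox (Complex 0 (- h)) (Complex 1 h))" by (rule compact_imp_bounded)
  then obtain A where A: "0 < A" "\<And>w. w \<in> V ` cbox (Complex 0 (- h)) (Complex 1 h) \<Longrightarrow> norm w \<le> A" by (auto simp: bounded_pos)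
  have im: "\<bar>Im (z + of_int i)\<bar> < R" if "\<bar>Im z\<bar> < R" for z i using that by simp
  have pi': "V (z + of_int k) = V z" if z: "\<bar>Im z\<bar> < R" for z k
  proof (induction k rule: int_induct[of _ 0])
    case base show ?case by simp
  next
    case (step1 i)
    have "z + of_int (i + 1) = (z + of_int i) + 1" by simp
    then have "V (z + of_int (i + 1)) = V (z + of_int i)" using per[of "z + of_int i", OF im[OF z]] by (simp only:)
    then show ?case using step1 by simp
  next
    case (step2 i)
    have "z + of_int i = (z + of_int (i - 1)) + 1" by simp
    then have "V (z + of_int i) = V (z + of_int (i - 1))" using per[of "z + of_int (i - 1)", OF im[OF z]] by (simp only:)
    then show ?case using step2 by simp
  qed
  have "cmod (V z) \<le> A" if z: "\<bar>Im z\<bar> \<le> h" for z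
  proof -
    define w where "w = z + of_int (- \<lfloor>Re z\<rfloor>)"
    have "w \<in> cbox (Complex 0 (- h)) (Complex 1 h)" unfolding in_cbox_complex_iff w_def using z by (auto; linarith)
    then have "cmod (V w) \<le> A" using A(2) by blast
    moreover have "V w = V z" unfolding w_def using z h by (intro pi') simp
    ultimately show ?thesis by simp
  qed
  then show thesis using A(1) that by blast
qed

lemma cyn_le_cmod_ee:
  assumes Q: "Q > 0" shows "of_int (cyn Q s) / real Q \<le> cmod (ee (of_int s / real Q) - 1)"
proof -
  let ?y = "of_int s / real Q"
  have "real_of_int (cyn Q s) \<le> of_int \<bar>s + (- round ?y) * int Q\<bar>" using cyn_le[OF Q] by (simp only: of_int_le_iff)
  also have "\<dots> = \<bar>?y - of_int (round ?y)\<bar> * real Q"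
  proof -
    have "?y - of_int (round ?y) = (of_int s - of_int (round ?y) * real Q) / real Q" using Q by (simp add: field_simps)
    then show ?thesis using Q by (simp add: abs_mult)
  qed
  finally have "of_int (cyn Q s) / real Q \<le> dz ?y" unfolding dz_def using Q by (simp add: divide_le_eq)
  also have "\<dots> \<le> cmod (ee ?y - 1)" using abs_sin_pi_ge_dz[of ?y] cmod_ee_diff[of ?y 0] by simp
  finally show ?thesis .
qed

lemma divide_cancel_power:
  fixes q :: real
  assumes q: "0 < q" and le: "(N / q) ^ k * S \<le> q * ((1 / q) ^ k * M)"
  shows "N ^ k * (S / q) \<le> M"
proof -
  have "((N / q) ^ k * S) * (q ^ k / q) \<le> (q * ((1 / q) ^ k * M)) * (q ^ k / q)"
    using le q by (intro mult_right_mono) auto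
  moreover have "((N / q) ^ k * S) * (q ^ k / q) = N ^ k * (S / q)" using q by (simp add: power_divide)
  moreover have "(q * ((1 / q) ^ k * M)) * (q ^ k / q) = M" using q by (simp add: power_divide)
  ultimately show ?thesis by (simp only:)
qed

text \<open>Each difference with step 1/Q multiplies the coefficient by a number of modulus at least
  \<open>cyn Q s / Q\<close>, while Cauchy's estimates bound the \<open>k\<close>-th difference by
  Q^(-k) k! A / h^k. The powers of \<open>Q\<close> cancel, so the decay is uniform in
  \<open>Q\<close>.\<close>

lemma sampled_coefficient_decay:
  fixes v :: "real \<Rightarrow> real"
  assumes V: "V holomorphic_on {z. \<bar>Im z\<bar> < R}" and per: "\<And>z. \<bar>Im z\<bar> < R \<Longrightarrow> V (z + 1) = V z"
    and ext: "\<And>x. V (complex_of_real x) = complex_of_real (v x)" and h: "0 < h" "h < R"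
  obtains A where "0 < A" "\<And>x. \<bar>v x\<bar> \<le> A"
    "\<And>lam \<theta> (Q::nat) (P::int) (s::int). Q > 0 \<Longrightarrow> coprime P (int Q) \<Longrightarrow>
      cmod ((\<Sum>n\<in>{0..<int Q}. of_real (lam * v (\<theta> + of_int n * (of_int P / real Q))) * ee (- (of_int (n * s) * (of_int P / real Q)))) / of_nat Q)
        \<le> \<bar>lam\<bar> * (2 * A) * exp (- (h / 2) * of_int (cyn Q s))"
proof -
  obtain A where A: "0 < A" "\<And>z. \<bar>Im z\<bar> \<le> h \<Longrightarrow> cmod (V z) \<le> A" by (rule periodic_strip_bounded[OF V per h(2)]) blast+
  have vA: "\<bar>v x\<bar> \<le> A" for x using A(2)[of "of_real x"] h(1) ext[of x] by simp
  have op: "open {z. \<bar>Im z\<bar> < R}"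
  proof -
    have "{z. \<bar>Im z\<bar> < R} = {z. Im z < R} \<inter> {z. - R < Im z}" by auto
    then show ?thesis by (simp add: open_halfspace_Im_lt open_halfspace_Im_gt open_Int)
  qed
  have Rsub: "z \<in> {z. \<bar>Im z\<bar> < R}" if "z \<in> \<real>" for z using that h by (auto elim: Reals_cases)
  define f where "f m = (deriv ^^ m) V" for m
  have fd: "(f m has_field_derivative f (Suc m) z) (at z within \<real>)" if z: "z \<in> \<real>" for m z
  proof -
    have "f m holomorphic_on {z. \<bar>Im z\<bar> < R}" unfolding f_def by (rule holomorphic_higher_deriv[OF V op])
    from holomorphic_derivI[OF this op Rsub[OF z]] show ?thesis by (simp add: f_def)
  qed
  have fb: "cmod (f m z) \<le> fact m * A / h ^ m" if z: "z \<in> \<real>" for m z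
  proof -
    have sub: "cball z h \<subseteq> {z. \<bar>Im z\<bar> \<le> h}"
    proof
      fix y assume "y \<in> cball z h"
      then have "cmod (z - y) \<le> h" by (simp add: dist_norm)
      moreover have "\<bar>Im (z - y)\<bar> \<le> cmod (z - y)" by (rule abs_Im_le_cmod)
      moreover have "Im z = 0" using z by (simp add: complex_is_Real_iff)
      ultimately show "y \<in> {z. \<bar>Im z\<bar> \<le> h}" by simp
    qed
    have hol: "V holomorphic_on cball z h" by (rule holomorphic_on_subset[OF V]) (use sub h in auto)
    show ?thesis unfolding f_def
    proof (rule Cauchy_inequality)
      show "V holomorphic_on ball z h" using hol by (rule holomorphic_on_subset) (rule ball_subset_cball)
      show "continuous_on (cball z h) V" using hol by (rule holomorphic_on_imp_continuous_on)
      fix x assume "cmod (z - x) = h"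
      then show "cmod (V x) \<le> A" using sub by (intro A(2)) (auto simp: dist_norm)
    qed (rule h(1))
  qed
  have Vper: "V (x + 1) = V x" if "x \<in> \<real>" for x using per Rsub[OF that] by simp
  show thesis
  proof (rule that[OF A(1) vA])
    fix lam \<theta> :: real and Q :: nat and P s :: int assume Q: "Q > 0" and cop: "coprime P (int Q)"
    have Qr: "0 < real Q" using Q by simp
    define \<omega> where "\<omega> = of_int P / real Q"
    define S where "S u = (\<Sum>n\<in>{0..<int Q}. u (complex_of_real (\<theta> + of_int n * \<omega>)) * ee (- (of_int (n * s) * \<omega>)))" for u
    define \<zeta> where "\<zeta> = ee (of_int s / real Q) - 1"
    have Sk: "S ((fdiff (1 / real Q) ^^ k) V) = \<zeta> ^ k * S V" for k
    proof (induction k)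
      case (Suc k)
      have "S (fdiff (1 / real Q) ((fdiff (1 / real Q) ^^ k) V)) = \<zeta> * S ((fdiff (1 / real Q) ^^ k) V)"
        unfolding S_def \<zeta>_def \<omega>_def by (rule coeff_fdiff[OF Q cop]) (rule fdiff_periodic, rule Vper)
      then show ?case using Suc by (simp add: mult.assoc)
    qed simp
    define N where "N = real_of_int (cyn Q s)"
    have N0: "0 \<le> N" unfolding N_def using cyn_nonneg[OF Q] by simp
    define X where "X = cmod (S V) / real Q"
    have X0: "0 \<le> X" unfolding X_def by simp
    \<comment> \<open>Giving up half of \<open>h\<close> turns the bounds for all \<open>k\<close>
      into a geometric series; summed against the exponential series they yield the rate h/2 and the
      factor 2.\<close>
    have k: "X * ((h / 2 * N) ^ k / fact k) \<le> A * (1 / 2) ^ k" for k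
    proof -
      have "cmod (S ((fdiff (1 / real Q) ^^ k) V)) \<le> (\<Sum>n\<in>{0..<int Q}. (1 / real Q) ^ k * (fact k * A / h ^ k))"
        unfolding S_def
      proof (rule order_trans[OF norm_sum], rule sum_mono)
        fix n
        have "cmod ((fdiff (1 / real Q) ^^ k) (f 0) (of_real (\<theta> + of_int n * \<omega>))) \<le> (1 / real Q) ^ k * (fact k * A / h ^ k)"
          by (rule fdiff_pow_bound[of f "\<lambda>m. fact m * A / h ^ m"]) (use fd fb in auto)
        then show "cmod ((fdiff (1 / real Q) ^^ k) V (of_real (\<theta> + of_int n * \<omega>)) * ee (- (of_int (n * s) * \<omega>))) \<le> (1 / real Q) ^ k * (fact k * A / h ^ k)"
          by (simp add: norm_mult f_def)
      qed
      then have 1: "cmod \<zeta> ^ k * cmod (S V) \<le> real Q * ((1 / real Q) ^ k * (fact k * A / h ^ k))"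
        unfolding Sk by (simp add: norm_mult norm_power)
      have "(N / real Q) ^ k \<le> cmod \<zeta> ^ k" unfolding N_def \<zeta>_def
        by (rule power_mono[OF cyn_le_cmod_ee[OF Q]]) (use cyn_nonneg[OF Q] in simp)
      then have "(N / real Q) ^ k * cmod (S V) \<le> cmod \<zeta> ^ k * cmod (S V)" by (rule mult_right_mono) simp
      with 1 have "(N / real Q) ^ k * cmod (S V) \<le> real Q * ((1 / real Q) ^ k * (fact k * A / h ^ k))" by linarith
      then have "N ^ k * X \<le> fact k * A / h ^ k"
        unfolding X_def by (rule divide_cancel_power[OF Qr])
      then have "N ^ k * X * h ^ k \<le> fact k * A" using h(1) by (simp add: pos_le_divide_eq)
      then show ?thesis by (simp add: power_mult_distrib power_divide divide_simps mult_ac)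
    qed
    have "(\<lambda>k. (h / 2 * N) ^ k / fact k) sums exp (h / 2 * N)"
      using exp_converges[of "h / 2 * N"] by (simp only: real_scaleR_def divide_inverse mult.commute)
    then have e: "(\<lambda>k. X * ((h / 2 * N) ^ k / fact k)) sums (X * exp (h / 2 * N))" by (rule sums_mult)
    have "(\<lambda>k. (1 / 2 :: real) ^ k) sums 2" using geometric_sums[of "1/2 :: real"] by simp
    then have g: "(\<lambda>k. A * (1 / 2) ^ k) sums (A * 2)" by (rule sums_mult)
    have "X * exp (h / 2 * N) \<le> A * 2" by (rule sums_le[OF k e g])
    then have "X * exp (h / 2 * N) * exp (- (h / 2) * N) \<le> A * 2 * exp (- (h / 2) * N)" by (rule mult_right_mono) simp
    moreover have "X * exp (h / 2 * N) * exp (- (h / 2) * N) = X" by (simp only: mult.assoc exp_add[symmetric]) simp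
    ultimately have X: "X \<le> 2 * A * exp (- (h / 2) * N)" by (simp only: mult.commute)
    have "(\<Sum>n\<in>{0..<int Q}. of_real (lam * v (\<theta> + of_int n * \<omega>)) * ee (- (of_int (n * s) * \<omega>))) = of_real lam * S V"
      unfolding S_def sum_distrib_left ext by (simp add: mult.assoc)
    then have "cmod ((\<Sum>n\<in>{0..<int Q}. of_real (lam * v (\<theta> + of_int n * \<omega>)) * ee (- (of_int (n * s) * \<omega>))) / of_nat Q) = \<bar>lam\<bar> * X"
      unfolding X_def by (simp add: norm_mult norm_divide)
    also have "\<dots> \<le> \<bar>lam\<bar> * (2 * A * exp (- (h / 2) * N))" using X by (rule mult_left_mono) simp
    finally show "cmod ((\<Sum>n\<in>{0..<int Q}. of_real (lam * v (\<theta> + of_int n * (of_int P / real Q))) * ee (- (of_int (n * s) * (of_int P / real Q)))) / of_nat Q)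
        \<le> \<bar>lam\<bar> * (2 * A) * exp (- (h / 2) * of_int (cyn Q s))" unfolding \<omega>_def N_def by (simp only: mult.assoc)
  qed
qed

subsection \<open>Moments and the weak limit\<close>

text \<open>\<open>schr_op\<close> for an arbitrary potential, so that the periodic approximants and
  the limit share one operator.\<close>

definition hop :: "(int \<Rightarrow> real) \<Rightarrow> (int \<Rightarrow> complex) \<Rightarrow> int \<Rightarrow> complex" where
  "hop U u = (\<lambda>n. u (n + 1) + u (n - 1) + of_real (U n) * u n)"

lemma schr_op_eq_hop: "schr_op lam v \<alpha> \<theta> = hop (\<lambda>n. lam * v (\<theta> + of_int n * \<alpha>))"
  by (intro ext) (simp add: schr_op_def hop_def)

lemma hop_Suc: "(hop U ^^ Suc k) u n = (hop U ^^ k) u (n + 1) + (hop U ^^ k) u (n - 1) + of_real (U n) * (hop U ^^ k) u n"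
  by (simp add: hop_def[of U "(hop U ^^ k) u"])

definition dlt :: "int \<Rightarrow> int \<Rightarrow> complex" where
  "dlt m n = (if n = m then 1 else 0)"

lemma hop_pow_sum:
  assumes S: "finite S"
  shows "(hop U ^^ k) (\<lambda>n. if n \<in> S then \<psi> n else 0) n = (\<Sum>m\<in>S. \<psi> m * (hop U ^^ k) (dlt m) n)"
proof (induction k arbitrary: n)
  case 0
  have "(\<Sum>m\<in>S. \<psi> m * dlt m n) = (\<Sum>m\<in>S. if n = m then \<psi> m else 0)" by (rule sum.cong) (auto simp: dlt_def)
  then show ?case using S by simp
next
  case (Suc k)
  show ?case unfolding hop_Suc Suc.IH sum_distrib_left sum.distrib[symmetric]
    by (rule sum.cong[OF refl]) (simp add: algebra_simps)
qed

lemma hop_pow_eigen: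
  assumes "\<And>n. hop U u n = of_real e * u n"
  shows "(hop U ^^ k) u n = of_real e ^ k * u n"
proof (induction k arbitrary: n)
  case (Suc k)
  have "(hop U ^^ Suc k) u n = of_real e ^ k * hop U u n"
    unfolding hop_Suc Suc.IH by (simp add: hop_def algebra_simps)
  then show ?case unfolding assms by (simp add: mult_ac)
qed simp

text \<open>The \<open>k\<close>-th power reaches only sites at distance at most \<open>k\<close>,
  so completeness is used below one period only.\<close>

lemma moment_identity_site:
  fixes w :: "nat \<Rightarrow> int \<Rightarrow> complex"
  assumes cp: "\<And>n n'. \<bar>n - n'\<bar> < int Q \<Longrightarrow> (\<Sum>j<Q. w j n * cnj (w j n')) = (if n = n' then of_nat Q else 0)"
  shows "\<bar>n - n'\<bar> + int k < int Q \<Longrightarrow> (\<Sum>j<Q. (hop U ^^ k) (w j) n * cnj (w j n')) = of_nat Q * (hop U ^^ k) (dlt n') n"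
proof (induction k arbitrary: n)
  case 0 then show ?case using cp[of n n'] by (simp add: dlt_def)
next
  case (Suc k)
  have "(\<Sum>j<Q. (hop U ^^ Suc k) (w j) n * cnj (w j n')) = (\<Sum>j<Q. (hop U ^^ k) (w j) (n + 1) * cnj (w j n'))
     + (\<Sum>j<Q. (hop U ^^ k) (w j) (n - 1) * cnj (w j n')) + of_real (U n) * (\<Sum>j<Q. (hop U ^^ k) (w j) n * cnj (w j n'))"
    unfolding hop_Suc distrib_right sum.distrib sum_distrib_left mult.assoc ..
  also have "\<dots> = of_nat Q * (hop U ^^ Suc k) (dlt n') n"
  proof -
    have "\<bar>n + 1 - n'\<bar> + int k < int Q" "\<bar>n - 1 - n'\<bar> + int k < int Q" "\<bar>n - n'\<bar> + int k < int Q" using Suc.prems by auto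
    note i = this[THEN Suc.IH]
    show ?thesis unfolding i hop_Suc by (simp only: distrib_left mult.left_commute)
  qed
  finally show ?case .
qed

lemma moment_identity:
  fixes w :: "nat \<Rightarrow> int \<Rightarrow> complex"
  assumes cp: "\<And>n n'. \<bar>n - n'\<bar> < int Q \<Longrightarrow> (\<Sum>j<Q. w j n * cnj (w j n')) = (if n = n' then of_nat Q else 0)"
    and ev: "\<And>j n. j < Q \<Longrightarrow> hop U (w j) n = of_real (E j) * w j n"
    and S: "finite S" "\<And>n n'. n \<in> S \<Longrightarrow> n' \<in> S \<Longrightarrow> \<bar>n - n'\<bar> + int k < int Q"
  shows "complex_of_real (\<Sum>j<Q. (cmod (\<Sum>n\<in>S. cnj (w j n) * \<psi> n))\<^sup>2 * E j ^ k)
    = of_nat Q * (\<Sum>n\<in>S. cnj (\<psi> n) * (hop U ^^ k) (\<lambda>n. if n \<in> S then \<psi> n else 0) n)"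
proof -
  have "complex_of_real ((cmod (\<Sum>n\<in>S. cnj (w j n) * \<psi> n))\<^sup>2 * E j ^ k)
      = (\<Sum>n\<in>S. \<Sum>n'\<in>S. (cnj (\<psi> n) * \<psi> n') * ((hop U ^^ k) (w j) n * cnj (w j n')))" if j: "j < Q" for j
  proof -
    let ?z = "\<Sum>n\<in>S. cnj (w j n) * \<psi> n"
    have "complex_of_real ((cmod ?z)\<^sup>2 * E j ^ k) = of_real (E j) ^ k * (cnj ?z * ?z)"
    proof -
      have a: "complex_of_real ((cmod ?z)\<^sup>2) = cnj ?z * ?z" by (simp only: complex_norm_square mult.commute)
      show ?thesis unfolding of_real_mult a unfolding of_real_power by (rule mult.commute)
    qed
    also have "\<dots> = (\<Sum>n\<in>S. \<Sum>n'\<in>S. of_real (E j) ^ k * ((w j n * cnj (\<psi> n)) * (cnj (w j n') * \<psi> n')))"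
      unfolding cnj_sum complex_cnj_mult complex_cnj_cnj sum_product unfolding sum_distrib_left ..
    also have "\<dots> = (\<Sum>n\<in>S. \<Sum>n'\<in>S. (cnj (\<psi> n) * \<psi> n') * ((hop U ^^ k) (w j) n * cnj (w j n')))"
      unfolding hop_pow_eigen[of U "w j", OF ev[OF j]] by (simp only: mult_ac)
    finally show ?thesis .
  qed
  then have "complex_of_real (\<Sum>j<Q. (cmod (\<Sum>n\<in>S. cnj (w j n) * \<psi> n))\<^sup>2 * E j ^ k)
     = (\<Sum>j<Q. \<Sum>n\<in>S. \<Sum>n'\<in>S. (cnj (\<psi> n) * \<psi> n') * ((hop U ^^ k) (w j) n * cnj (w j n')))"
    unfolding of_real_sum by (intro sum.cong[OF refl]) auto
  also have "\<dots> = (\<Sum>n\<in>S. \<Sum>n'\<in>S. (cnj (\<psi> n) * \<psi> n') * (\<Sum>j<Q. (hop U ^^ k) (w j) n * cnj (w j n')))"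
    unfolding sum_distrib_left by (rule sum_swap3)
  also have "\<dots> = (\<Sum>n\<in>S. \<Sum>n'\<in>S. (cnj (\<psi> n) * \<psi> n') * (of_nat Q * (hop U ^^ k) (dlt n') n))"
  proof (rule sum.cong[OF refl], rule sum.cong[OF refl])
    fix n n' assume "n \<in> S" "n' \<in> S"
    then have "(\<Sum>j<Q. (hop U ^^ k) (w j) n * cnj (w j n')) = of_nat Q * (hop U ^^ k) (dlt n') n"
      using S(2) by (intro moment_identity_site[OF cp])
    then show "(cnj (\<psi> n) * \<psi> n') * (\<Sum>j<Q. (hop U ^^ k) (w j) n * cnj (w j n')) = (cnj (\<psi> n) * \<psi> n') * (of_nat Q * (hop U ^^ k) (dlt n') n)" by (simp only:)
  qed
  also have "\<dots> = of_nat Q * (\<Sum>n\<in>S. cnj (\<psi> n) * (hop U ^^ k) (\<lambda>n. if n \<in> S then \<psi> n else 0) n)"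
    unfolding hop_pow_sum[OF S(1)] sum_distrib_left by (simp only: mult_ac)
  finally show ?thesis .
qed

text \<open>A positive operator dominating every \<open>hop U\<close> with |U| \<le> R, which
  provides one square-summable majorant for all approximants.\<close>

definition hopp :: "real \<Rightarrow> (int \<Rightarrow> real) \<Rightarrow> int \<Rightarrow> real" where
  "hopp R f = (\<lambda>n. f (n + 1) + f (n - 1) + R * f n)"

lemma hop_pow_bound:
  assumes U: "\<And>n. \<bar>U n\<bar> \<le> R" and u: "\<And>n. cmod (u n) \<le> f n"
  shows "cmod ((hop U ^^ k) u n) \<le> (hopp R ^^ k) f n"
proof (induction k arbitrary: n)
  case 0 then show ?case using u by simp
next
  case (Suc k)
  let ?h = "(hop U ^^ k) u"
  have "cmod ((hop U ^^ Suc k) u n) \<le> cmod (?h (n + 1)) + cmod (?h (n - 1)) + \<bar>U n\<bar> * cmod (?h n)"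
    unfolding hop_Suc by (rule order_trans[OF norm_triangle_ineq add_mono[OF norm_triangle_ineq]]) (simp add: norm_mult)
  also have "\<dots> \<le> (hopp R ^^ k) f (n + 1) + (hopp R ^^ k) f (n - 1) + R * (hopp R ^^ k) f n"
    using U[of n] by (intro add_mono mult_mono Suc.IH) auto
  also have "\<dots> = (hopp R ^^ Suc k) f n" by (simp add: hopp_def)
  finally show ?case .
qed

lemma summable_shift_int:
  fixes f :: "int \<Rightarrow> real"
  assumes "f summable_on UNIV" shows "(\<lambda>n. f (n + a)) summable_on UNIV"
proof -
  have "bij_betw (\<lambda>n::int. n + a) UNIV UNIV" by (rule bij_betwI[of _ _ _ "\<lambda>n. n - a"]) auto
  from summable_on_reindex_bij_betw[OF this, of f] show ?thesis using assms by simp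
qed

lemma hopp_sq_summable:
  assumes "(\<lambda>n. (f n)\<^sup>2) summable_on UNIV" shows "(\<lambda>n. (hopp R f n)\<^sup>2) summable_on UNIV"
proof -
  have a: "(\<lambda>n. (f (n + 1))\<^sup>2) summable_on UNIV" using summable_shift_int[OF assms, of 1] .
  have b: "(\<lambda>n. (f (n - 1))\<^sup>2) summable_on UNIV" using summable_shift_int[OF assms, of "- 1"] by simp
  have "(\<lambda>n. 3 * ((f (n + 1))\<^sup>2 + (f (n - 1))\<^sup>2 + R\<^sup>2 * (f n)\<^sup>2)) summable_on UNIV"
    by (intro summable_on_cmult_right summable_on_add a b assms)
  then show ?thesis
  proof (rule summable_on_comparison_test)
    fix n :: int
    have "(x + y + z)\<^sup>2 \<le> 3 * (x\<^sup>2 + y\<^sup>2 + z\<^sup>2)" for x y z :: real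
    proof -
      have "0 \<le> (x - y)\<^sup>2 + (y - z)\<^sup>2 + (x - z)\<^sup>2" by simp
      then show ?thesis by (simp add: power2_eq_square algebra_simps)
    qed
    from this[of "f (n + 1)" "f (n - 1)" "R * f n"]
    show "(hopp R f n)\<^sup>2 \<le> 3 * ((f (n + 1))\<^sup>2 + (f (n - 1))\<^sup>2 + R\<^sup>2 * (f n)\<^sup>2)"
      unfolding hopp_def power_mult_distrib .
  qed simp
qed

lemma hopp_pow_sq_summable:
  assumes "(\<lambda>n. (f n)\<^sup>2) summable_on UNIV" shows "(\<lambda>n. ((hopp R ^^ k) f n)\<^sup>2) summable_on UNIV"
  by (induction k) (use assms hopp_sq_summable in auto)

lemma summable_mult_l2:
  fixes f h :: "int \<Rightarrow> real"
  assumes "(\<lambda>n. (f n)\<^sup>2) summable_on UNIV" "(\<lambda>n. (h n)\<^sup>2) summable_on UNIV" "\<And>n. 0 \<le> f n" "\<And>n. 0 \<le> h n"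
  shows "(\<lambda>n. f n * h n) summable_on UNIV"
proof (rule summable_on_comparison_test)
  show "(\<lambda>n. (f n)\<^sup>2 + (h n)\<^sup>2) summable_on UNIV" using assms(1,2) by (rule summable_on_add)
  show "f n * h n \<le> (f n)\<^sup>2 + (h n)\<^sup>2" for n
    using sum_squares_bound[of "f n" "h n"] assms(3,4)[of n] mult_nonneg_nonneg[OF assms(3,4), of n n] by linarith
qed (use assms(3,4) in auto)

lemma tendsto_hop_pow:
  assumes "\<And>n. (\<lambda>i. W i n) \<longlonglongrightarrow> V n" "\<And>n. (\<lambda>i. u i n) \<longlonglongrightarrow> \<psi> n"
  shows "(\<lambda>i. (hop (W i) ^^ k) (u i) n) \<longlonglongrightarrow> (hop V ^^ k) \<psi> n"
proof (induction k arbitrary: n)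
  case 0 then show ?case using assms(2) by simp
next
  case (Suc k)
  show ?case unfolding hop_Suc by (intro tendsto_add tendsto_mult tendsto_of_real assms(1) Suc)
qed

lemma tendsto_sum_dominated:
  fixes s :: "nat \<Rightarrow> int \<Rightarrow> complex"
  assumes D: "D summable_on UNIV" "\<And>i n. cmod (s i n) \<le> D n" and lim: "\<And>n. (\<lambda>i. s i n) \<longlonglongrightarrow> l n"
    and A: "\<And>i. finite (A i)" "\<And>i n. n \<notin> A i \<Longrightarrow> s i n = 0"
  shows "(\<lambda>i. \<Sum>n\<in>A i. s i n) \<longlonglongrightarrow> infsum l UNIV"
proof -
  have D0: "0 \<le> D n" for n by (rule order_trans[OF norm_ge_zero D(2)[of 0 n]])
  have intD: "integrable (count_space UNIV) D"
  proof -
    have "(\<lambda>n. norm (D n)) summable_on UNIV" using D(1) D0 by simp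
    then show ?thesis using abs_summable_equivalent[of D UNIV] by (simp add: abs_summable_on_def)
  qed
  have conv: "(\<lambda>i. integral\<^sup>L (count_space UNIV) (s i)) \<longlonglongrightarrow> integral\<^sup>L (count_space UNIV) l"
    and intl: "integrable (count_space UNIV) l"
    by (rule integral_dominated_convergence[of l "count_space UNIV" s D] integrable_dominated_convergence[of l "count_space UNIV" s D]; use intD D(2) lim in simp)+
  have "integral\<^sup>L (count_space UNIV) (s i) = (\<Sum>n\<in>A i. s i n)" for i
  proof -
    have fin: "{n. s i n \<noteq> 0} \<subseteq> A i" using A(2) by blast
    have "integral\<^sup>L (count_space UNIV) (s i) = (\<Sum>n | n \<in> UNIV \<and> s i n \<noteq> 0. s i n)"
      by (rule lebesgue_integral_count_space_finite_support) (use fin A(1) in \<open>auto intro: finite_subset\<close>)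
    also have "\<dots> = (\<Sum>n\<in>A i. s i n)" using fin A(1) by (intro sum.mono_neutral_left) auto
    finally show ?thesis .
  qed
  moreover have "integral\<^sup>L (count_space UNIV) l = infsum l UNIV"
    using infsetsum_infsum[of l UNIV] intl by (simp add: infsetsum_def abs_summable_on_def)
  ultimately show ?thesis using conv by simp
qed

text \<open>Dominated convergence: |\<psi>| times the \<open>k\<close>-th power of
  \<open>hopp R\<close> applied to |\<psi>| is summable and independent of \<open>i\<close>.\<close>

lemma moment_limit:
  fixes m :: "nat \<Rightarrow> nat" and W :: "nat \<Rightarrow> int \<Rightarrow> real"
  assumes Wl: "\<And>n. (\<lambda>i. W i n) \<longlonglongrightarrow> V n" and Wb: "\<And>i n. \<bar>W i n\<bar> \<le> R" and \<psi>: "\<psi> \<in> ell2" and m: "filterlim m at_top sequentially"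
  shows "(\<lambda>i. \<Sum>n\<in>{- int (m i)..int (m i)}. cnj (\<psi> n) * (hop (W i) ^^ k) (\<lambda>n. if n \<in> {- int (m i)..int (m i)} then \<psi> n else 0) n)
    \<longlonglongrightarrow> inner_l2 \<psi> ((hop V ^^ k) \<psi>)"
proof -
  define u where "u i = (\<lambda>n. if n \<in> {- int (m i)..int (m i)} then \<psi> n else 0)" for i
  define s where "s i n = cnj (u i n) * (hop (W i) ^^ k) (u i) n" for i n
  have sq: "(\<lambda>n. (cmod (\<psi> n))\<^sup>2) summable_on UNIV" using \<psi> by (simp add: ell2_def)
  have R0: "0 \<le> R" using Wb[of 0 0] by linarith
  have ub: "cmod (u i n) \<le> cmod (\<psi> n)" for i n by (simp add: u_def)
  have h0: "0 \<le> (hopp R ^^ k) (\<lambda>n. cmod (\<psi> n)) n" for n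
    by (rule order_trans[OF norm_ge_zero hop_pow_bound[of "\<lambda>_. 0" R "\<lambda>_. 0"]]) (use R0 in auto)
  have ul: "(\<lambda>i. u i n) \<longlonglongrightarrow> \<psi> n" for n
  proof (rule tendsto_eventually)
    have "\<forall>\<^sub>F i in sequentially. nat \<bar>n\<bar> \<le> m i" using m by (simp add: filterlim_at_top)
    then show "\<forall>\<^sub>F i in sequentially. u i n = \<psi> n" by eventually_elim (auto simp: u_def)
  qed
  have "(\<lambda>i. \<Sum>n\<in>{- int (m i)..int (m i)}. s i n) \<longlonglongrightarrow> infsum (\<lambda>n. cnj (\<psi> n) * (hop V ^^ k) \<psi> n) UNIV"
  proof (rule tendsto_sum_dominated)
    show "(\<lambda>n. cmod (\<psi> n) * (hopp R ^^ k) (\<lambda>n. cmod (\<psi> n)) n) summable_on UNIV"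
      by (rule summable_mult_l2[OF sq hopp_pow_sq_summable[OF sq] norm_ge_zero h0])
    show "cmod (s i n) \<le> cmod (\<psi> n) * (hopp R ^^ k) (\<lambda>n. cmod (\<psi> n)) n" for i n
      unfolding s_def norm_mult complex_mod_cnj by (intro mult_mono ub hop_pow_bound Wb) auto
    show "(\<lambda>i. s i n) \<longlonglongrightarrow> cnj (\<psi> n) * (hop V ^^ k) \<psi> n" for n
      unfolding s_def by (intro tendsto_mult tendsto_cnj ul tendsto_hop_pow Wl)
  qed (auto simp: s_def u_def)
  moreover have "(\<Sum>n\<in>{- int (m i)..int (m i)}. s i n) = (\<Sum>n\<in>{- int (m i)..int (m i)}. cnj (\<psi> n) * (hop (W i) ^^ k) (u i) n)" for i
    by (rule sum.cong[OF refl]) (simp add: s_def, simp add: u_def)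
  ultimately show ?thesis unfolding u_def[symmetric] inner_l2_def by simp
qed

lemma cmod_sum_sq_le:
  assumes "finite S" shows "(cmod (\<Sum>n\<in>S. x n))\<^sup>2 \<le> real (card S) * (\<Sum>n\<in>S. (cmod (x n))\<^sup>2)"
proof -
  have "(cmod (\<Sum>n\<in>S. x n))\<^sup>2 \<le> (\<Sum>n\<in>S. cmod (x n))\<^sup>2" by (intro power_mono norm_sum) auto
  also have "\<dots> \<le> (\<Sum>n\<in>S. (cmod (x n))\<^sup>2) * real (card S)" by (rule sum_squared_le_sum_of_squares)
  finally show ?thesis by (simp only: mult.commute)
qed

lemma summable_on_int_tail:
  fixes f :: "int \<Rightarrow> real"
  assumes f: "f summable_on UNIV" and e: "0 < e"
  obtains M :: nat where "\<And>S. finite S \<Longrightarrow> S \<inter> {- int M..int M} = {} \<Longrightarrow> sum f S \<le> e"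
proof -
  have "(sum f \<longlongrightarrow> infsum f UNIV) (finite_subsets_at_top UNIV)" using has_sum_infsum[OF f] by (simp add: has_sum_def)
  then have "\<forall>\<^sub>F F in finite_subsets_at_top UNIV. dist (sum f F) (infsum f UNIV) < e / 2" by (rule tendstoD) (use e in simp)
  then obtain X where X: "finite X" "\<And>Y. finite Y \<Longrightarrow> X \<subseteq> Y \<Longrightarrow> dist (sum f Y) (infsum f UNIV) < e / 2"
    unfolding eventually_finite_subsets_at_top by auto
  define b where "b = Max (insert 0 (abs ` X))"
  have b: "\<bar>x\<bar> \<le> b" if "x \<in> X" for x unfolding b_def using X(1) that by (intro Max_ge) auto
  define M where "M = nat b"
  show thesis
  proof (rule that[of M])
    fix S :: "int set" assume S: "finite S" "S \<inter> {- int M..int M} = {}"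
    have XJ: "X \<subseteq> {- int M..int M}" using b by (force simp: M_def)
    have "dist (sum f {- int M..int M}) (infsum f UNIV) < e / 2" using XJ by (intro X(2)) auto
    moreover have "dist (sum f (S \<union> {- int M..int M})) (infsum f UNIV) < e / 2" using XJ S(1) by (intro X(2)) auto
    moreover have "sum f (S \<union> {- int M..int M}) = sum f S + sum f {- int M..int M}" using S by (intro sum.union_disjoint) auto
    ultimately show "sum f S \<le> e" unfolding dist_real_def by linarith
  qed
qed

section \<open>Spectral weights of the approximants\<close>

text \<open>The last assumption is uniform integrability of the spectral weights: \<open>C\<close>
  depends on \<open>\<epsilon>\<close> alone, not on the approximant, the scale, the set of cells or
  the site.\<close>

locale approx_model =
  fixes Q :: "nat \<Rightarrow> nat" and W :: "nat \<Rightarrow> int \<Rightarrow> real" and V :: "int \<Rightarrow> real"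
    and E :: "nat \<Rightarrow> nat \<Rightarrow> real" and w :: "nat \<Rightarrow> nat \<Rightarrow> int \<Rightarrow> complex" and R :: real
  assumes Q_lim: "filterlim Q at_top sequentially" and Q_pos: "\<And>i. 0 < Q i"
    and ev: "\<And>i j n. j < Q i \<Longrightarrow> hop (W i) (w i j) n = of_real (E i j) * w i j n"
    and cp: "\<And>i n n'. \<bar>n - n'\<bar> < int (Q i) \<Longrightarrow> (\<Sum>j<Q i. w i j n * cnj (w i j n')) = (if n = n' then of_nat (Q i) else 0)"
    and E_bd: "\<And>i j. j < Q i \<Longrightarrow> \<bar>E i j\<bar> \<le> R"
    and W_lim: "\<And>n. (\<lambda>i. W i n) \<longlonglongrightarrow> V n" and W_bd: "\<And>i n. \<bar>W i n\<bar> \<le> R"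
    and cells: "\<And>\<epsilon>. 0 < \<epsilon> \<Longrightarrow> \<exists>C>0. \<forall>i T Z n. 0 < T \<longrightarrow> T + 3 \<le> real (Q i) \<longrightarrow> finite Z \<longrightarrow>
      (\<Sum>j\<in>{j\<in>{..<Q i}. \<lfloor>T * E i j\<rfloor> \<in> Z}. (cmod (w i j n))\<^sup>2) / real (Q i) \<le> \<epsilon> + C * (real (card Z) / T)"
begin

text \<open>With half-width Q/4 two sites of the window differ by at most Q/2, which eventually
  leaves room for any fixed number of hops within one period.\<close>

definition win :: "nat \<Rightarrow> int set" where
  "win i = {- int (Q i div 4)..int (Q i div 4)}"

text \<open>The weight of the eigenvalue \<open>E i j\<close> in the spectral measure of
  \<open>\<psi>\<close> cut to the window.\<close>

definition mass :: "(int \<Rightarrow> complex) \<Rightarrow> nat \<Rightarrow> nat \<Rightarrow> real" where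
  "mass \<psi> i j = (cmod (\<Sum>n\<in>win i. cnj (w i j n) * \<psi> n))\<^sup>2 / real (Q i)"

lemma mass_nonneg: "0 \<le> mass \<psi> i j"
  by (simp add: mass_def)

lemma eventually_Q_ge: "\<forall>\<^sub>F i in sequentially. c \<le> Q i"
  using Q_lim by (simp add: filterlim_at_top)

lemma eventually_Q_ge_real: "\<forall>\<^sub>F i in sequentially. (c::real) \<le> real (Q i)"
  using eventually_Q_ge[of "nat \<lceil>c\<rceil>"] by eventually_elim linarith

lemma window_lim: "filterlim (\<lambda>i. Q i div 4) at_top sequentially"
  unfolding filterlim_at_top
proof
  fix c :: nat
  show "\<forall>\<^sub>F i in sequentially. c \<le> Q i div 4" using eventually_Q_ge[of "4 * c"] by eventually_elim simp
qed

lemma mass_moment: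
  assumes \<psi>: "\<psi> \<in> ell2"
  shows "(\<lambda>i. complex_of_real (\<Sum>j<Q i. mass \<psi> i j * E i j ^ k)) \<longlonglongrightarrow> inner_l2 \<psi> ((hop V ^^ k) \<psi>)"
proof (rule Lim_transform_eventually[OF moment_limit[OF W_lim W_bd \<psi> window_lim]])
  show "\<forall>\<^sub>F i in sequentially. (\<Sum>n\<in>{- int (Q i div 4)..int (Q i div 4)}. cnj (\<psi> n) * (hop (W i) ^^ k) (\<lambda>n. if n \<in> {- int (Q i div 4)..int (Q i div 4)} then \<psi> n else 0) n)
      = complex_of_real (\<Sum>j<Q i. mass \<psi> i j * E i j ^ k)"
    using eventually_Q_ge[of "2 * k + 2"]
  proof eventually_elim
    case (elim i)
    have "complex_of_real (\<Sum>j<Q i. (cmod (\<Sum>n\<in>win i. cnj (w i j n) * \<psi> n))\<^sup>2 * E i j ^ k)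
      = of_nat (Q i) * (\<Sum>n\<in>win i. cnj (\<psi> n) * (hop (W i) ^^ k) (\<lambda>n. if n \<in> win i then \<psi> n else 0) n)"
    proof (rule moment_identity[OF cp ev])
      fix n n' assume "n \<in> win i" "n' \<in> win i"
      then have "\<bar>n - n'\<bar> \<le> 2 * int (Q i div 4)" by (auto simp: win_def)
      then show "\<bar>n - n'\<bar> + int k < int (Q i)" using elim by linarith
    qed (auto simp: win_def)
    moreover have "(\<Sum>j<Q i. mass \<psi> i j * E i j ^ k) = (\<Sum>j<Q i. (cmod (\<Sum>n\<in>win i. cnj (w i j n) * \<psi> n))\<^sup>2 * E i j ^ k) / real (Q i)"
      unfolding mass_def sum_divide_distrib by (rule sum.cong[OF refl]) simp
    ultimately have "complex_of_real (\<Sum>j<Q i. mass \<psi> i j * E i j ^ k) = (\<Sum>n\<in>win i. cnj (\<psi> n) * (hop (W i) ^^ k) (\<lambda>n. if n \<in> win i then \<psi> n else 0) n)"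
      using Q_pos[of i] by (simp only: of_real_divide) simp
    then show ?case unfolding win_def by (rule sym)
  qed
qed

text \<open>A finite block of sites carries all of \<open>\<psi>\<close> up to a small tail. On the
  block Cauchy-Schwarz reduces to the bound at single sites; the tail is bounded by its total
  weight, which by the zeroth moment is its squared norm.\<close>

lemma mass_cells:
  assumes \<psi>: "\<psi> \<in> ell2" and \<epsilon>: "0 < \<epsilon>"
  shows "\<exists>C>0. \<forall>T Z. 0 < T \<longrightarrow> finite Z \<longrightarrow>
    (\<forall>\<^sub>F i in sequentially. (\<Sum>j\<in>{j\<in>{..<Q i}. \<lfloor>T * E i j\<rfloor> \<in> Z}. mass \<psi> i j) \<le> \<epsilon> + C * (real (card Z) / T))"
proof -
  have sq: "(\<lambda>n. (cmod (\<psi> n))\<^sup>2) summable_on UNIV" using \<psi> by (simp add: ell2_def)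
  define P where "P = infsum (\<lambda>n. (cmod (\<psi> n))\<^sup>2) UNIV"
  have Pb: "(\<Sum>n\<in>S. (cmod (\<psi> n))\<^sup>2) \<le> P" if "finite S" for S
    unfolding P_def by (rule finite_sum_le_infsum[OF sq that]) auto
  have P0: "0 \<le> P" using Pb[of "{}"] by simp
  obtain M where M: "\<And>S. finite S \<Longrightarrow> S \<inter> {- int M..int M} = {} \<Longrightarrow> (\<Sum>n\<in>S. (cmod (\<psi> n))\<^sup>2) \<le> \<epsilon> / 4"
    using summable_on_int_tail[OF sq, of "\<epsilon> / 4"] \<epsilon> by auto
  define J where "J = {- int M..int M}"
  define c where "c = real (card J)"
  have c0: "0 < c" unfolding c_def J_def by simp
  \<comment> \<open>Chosen so that the block contributes \<epsilon>/4; the inequality (x + y)^2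
    \<le> 2 x^2 + 2 y^2 doubles it, and the tail supplies the other half of \<epsilon>.\<close>
  define e where "e = \<epsilon> / (4 * (c * (P + 1)))"
  have cP: "0 < c * (P + 1)" using c0 P0 by simp
  have e0: "0 < e" unfolding e_def using \<epsilon> cP by simp
  have e_eq: "c * (P + 1) * e = \<epsilon> / 4" 
  proof -
    have "x * (\<epsilon> / (4 * x)) = \<epsilon> / 4" if "0 < x" for x using that by simp
    from this[OF cP] show ?thesis unfolding e_def .
  qed
  obtain C where C: "0 < C" "\<And>i T Z n. 0 < T \<Longrightarrow> T + 3 \<le> real (Q i) \<Longrightarrow> finite Z \<Longrightarrow>
      (\<Sum>j\<in>{j\<in>{..<Q i}. \<lfloor>T * E i j\<rfloor> \<in> Z}. (cmod (w i j n))\<^sup>2) / real (Q i) \<le> e + C * (real (card Z) / T)"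
    using cells[OF e0] by blast
  show ?thesis
  proof (intro exI[of _ "2 * (c * (P + 1) * C)"] conjI allI impI)
    show "0 < 2 * (c * (P + 1) * C)" using cP C(1) by simp
    fix T :: real and Z :: "int set" assume T: "0 < T" and Z: "finite Z"
    show "\<forall>\<^sub>F i in sequentially. (\<Sum>j\<in>{j\<in>{..<Q i}. \<lfloor>T * E i j\<rfloor> \<in> Z}. mass \<psi> i j) \<le> \<epsilon> + 2 * (c * (P + 1) * C) * (real (card Z) / T)"
      using eventually_Q_ge[of "4 * M"] eventually_Q_ge_real[of "T + 3"]
    proof eventually_elim
      case (elim i)
      have Qr: "0 < real (Q i)" using Q_pos by simp
      have "M \<le> Q i div 4" using elim(1) by simp
      then have JI: "J \<subseteq> win i" unfolding J_def win_def by auto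
      define S where "S = win i - J"
      have fin: "finite S" "finite J" by (auto simp: S_def J_def win_def)
      define zJ where "zJ j = (\<Sum>n\<in>J. cnj (w i j n) * \<psi> n)" for j
      define zS where "zS j = (\<Sum>n\<in>S. cnj (w i j n) * \<psi> n)" for j
      define cell where "cell = {j\<in>{..<Q i}. \<lfloor>T * E i j\<rfloor> \<in> Z}"
      have m: "mass \<psi> i j \<le> 2 * ((cmod (zJ j))\<^sup>2 / real (Q i)) + 2 * ((cmod (zS j))\<^sup>2 / real (Q i))" for j
      proof -
        have "(\<Sum>n\<in>win i. cnj (w i j n) * \<psi> n) = zS j + zJ j"
          unfolding zS_def zJ_def S_def using JI by (rule sum.subset_diff) (simp add: win_def)
        then have "(cmod (\<Sum>n\<in>win i. cnj (w i j n) * \<psi> n))\<^sup>2 \<le> (cmod (zS j) + cmod (zJ j))\<^sup>2"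
          by (simp only:) (intro power_mono norm_triangle_ineq norm_ge_zero)
        also have "\<dots> \<le> 2 * (cmod (zJ j))\<^sup>2 + 2 * (cmod (zS j))\<^sup>2"
          using sum_squares_bound[of "cmod (zS j)" "cmod (zJ j)"] by (simp add: power2_sum)
        finally have "mass \<psi> i j \<le> (2 * (cmod (zJ j))\<^sup>2 + 2 * (cmod (zS j))\<^sup>2) / real (Q i)"
          unfolding mass_def by (rule divide_right_mono) simp
        then show ?thesis by (simp add: add_divide_distrib)
      qed
      have jb: "(\<Sum>j\<in>cell. (cmod (zJ j))\<^sup>2 / real (Q i)) \<le> c * (P + 1) * (e + C * (real (card Z) / T))"
      proof -
        have "(\<Sum>j\<in>cell. (cmod (zJ j))\<^sup>2 / real (Q i)) \<le> (\<Sum>j\<in>cell. c * (\<Sum>n\<in>J. (cmod (w i j n))\<^sup>2 * (cmod (\<psi> n))\<^sup>2) / real (Q i))"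
        proof (intro sum_mono divide_right_mono)
          fix j
          show "(cmod (zJ j))\<^sup>2 \<le> c * (\<Sum>n\<in>J. (cmod (w i j n))\<^sup>2 * (cmod (\<psi> n))\<^sup>2)"
            using cmod_sum_sq_le[OF fin(2), of "\<lambda>n. cnj (w i j n) * \<psi> n"] unfolding zJ_def c_def by (simp add: norm_mult power_mult_distrib)
        qed simp
        also have "\<dots> = (\<Sum>j\<in>cell. \<Sum>n\<in>J. c * ((cmod (\<psi> n))\<^sup>2 * ((cmod (w i j n))\<^sup>2 / real (Q i))))"
          unfolding sum_distrib_left sum_divide_distrib by (simp only: mult_ac times_divide_eq_right times_divide_eq_left)
        also have "\<dots> = (\<Sum>n\<in>J. c * ((cmod (\<psi> n))\<^sup>2 * ((\<Sum>j\<in>cell. (cmod (w i j n))\<^sup>2) / real (Q i))))"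
          unfolding sum_divide_distrib sum_distrib_left by (rule sum.swap)
        also have "\<dots> \<le> (\<Sum>n\<in>J. c * ((cmod (\<psi> n))\<^sup>2 * (e + C * (real (card Z) / T))))"
          unfolding cell_def using c0 by (intro sum_mono mult_left_mono C(2) T Z elim(2)) auto
        also have "\<dots> = c * (\<Sum>n\<in>J. (cmod (\<psi> n))\<^sup>2) * (e + C * (real (card Z) / T))"
          by (simp only: sum_distrib_left sum_distrib_right mult.assoc)
        also have "\<dots> \<le> c * (P + 1) * (e + C * (real (card Z) / T))"
        proof (intro mult_right_mono mult_left_mono)
          show "(\<Sum>n\<in>J. (cmod (\<psi> n))\<^sup>2) \<le> P + 1" using Pb[OF fin(2)] by simp
          show "0 \<le> e + C * (real (card Z) / T)" using e0 C(1) T by simp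
        qed (use c0 in simp)
        finally show ?thesis .
      qed
      have sb: "(\<Sum>j\<in>cell. (cmod (zS j))\<^sup>2 / real (Q i)) \<le> \<epsilon> / 4"
      proof -
        have "complex_of_real (\<Sum>j<Q i. (cmod (zS j))\<^sup>2 * E i j ^ 0) = of_nat (Q i) * (\<Sum>n\<in>S. cnj (\<psi> n) * (hop (W i) ^^ 0) (\<lambda>n. if n \<in> S then \<psi> n else 0) n)"
          unfolding zS_def
        proof (rule moment_identity[OF cp ev fin(1)])
          fix n n' assume "n \<in> S" "n' \<in> S"
          then have "\<bar>n - n'\<bar> \<le> 2 * int (Q i div 4)" by (auto simp: win_def S_def)
          then show "\<bar>n - n'\<bar> + int 0 < int (Q i)" using Q_pos[of i] by linarith
        qed
        also have "\<dots> = of_real (real (Q i) * (\<Sum>n\<in>S. (cmod (\<psi> n))\<^sup>2))"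
        proof -
          have "cnj (\<psi> n) * \<psi> n = of_real ((cmod (\<psi> n))\<^sup>2)" for n by (simp only: complex_norm_square mult.commute)
          then show ?thesis by simp
        qed
        finally have all: "(\<Sum>j<Q i. (cmod (zS j))\<^sup>2) = real (Q i) * (\<Sum>n\<in>S. (cmod (\<psi> n))\<^sup>2)"
          unfolding of_real_eq_iff by simp
        have "(\<Sum>j\<in>cell. (cmod (zS j))\<^sup>2 / real (Q i)) \<le> (\<Sum>j<Q i. (cmod (zS j))\<^sup>2 / real (Q i))"
          by (intro sum_mono2) (auto simp: cell_def)
        also have "\<dots> = (\<Sum>n\<in>S. (cmod (\<psi> n))\<^sup>2)" unfolding sum_divide_distrib[symmetric] all using Qr by simp
        also have "\<dots> \<le> \<epsilon> / 4" by (rule M[OF fin(1)]) (auto simp: S_def J_def)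
        finally show ?thesis .
      qed
      have "(\<Sum>j\<in>cell. mass \<psi> i j) \<le> (\<Sum>j\<in>cell. 2 * ((cmod (zJ j))\<^sup>2 / real (Q i)) + 2 * ((cmod (zS j))\<^sup>2 / real (Q i)))"
        by (intro sum_mono m)
      also have "\<dots> = 2 * (\<Sum>j\<in>cell. (cmod (zJ j))\<^sup>2 / real (Q i)) + 2 * (\<Sum>j\<in>cell. (cmod (zS j))\<^sup>2 / real (Q i))"
        by (simp only: sum.distrib sum_distrib_left)
      also have "\<dots> \<le> 2 * (c * (P + 1) * (e + C * (real (card Z) / T))) + 2 * (\<epsilon> / 4)" using jb sb by linarith
      also have "\<dots> = \<epsilon> + 2 * (c * (P + 1) * C) * (real (card Z) / T)"
      proof -
        have "c * (P + 1) * (e + C * (real (card Z) / T)) = \<epsilon> / 4 + c * (P + 1) * C * (real (card Z) / T)"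
          unfolding distrib_left[of "c * (P + 1)"] e_eq by (simp only: mult.assoc)
        then show ?thesis by (simp only:) simp
      qed
      finally show ?case unfolding cell_def .
    qed
  qed
qed

end

section \<open>Passage to the weak limit\<close>

lemma inner_l2_self:
  assumes \<psi>: "\<psi> \<in> ell2"
  shows "inner_l2 \<psi> \<psi> = of_real (infsum (\<lambda>n. (cmod (\<psi> n))\<^sup>2) UNIV)"
proof -
  have "((\<lambda>n. (cmod (\<psi> n))\<^sup>2) has_sum infsum (\<lambda>n. (cmod (\<psi> n))\<^sup>2) UNIV) UNIV" using \<psi> by (simp add: ell2_def has_sum_infsum)
  from has_sum_bounded_linear[OF bounded_linear_of_real this]
  have "((\<lambda>n. complex_of_real ((cmod (\<psi> n))\<^sup>2)) has_sum of_real (infsum (\<lambda>n. (cmod (\<psi> n))\<^sup>2) UNIV)) UNIV" .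
  moreover have "complex_of_real ((cmod (\<psi> n))\<^sup>2) = cnj (\<psi> n) * \<psi> n" for n by (simp only: complex_norm_square mult.commute)
  ultimately show ?thesis unfolding inner_l2_def by (simp only: infsumI)
qed

lemma finite_pmf_of_weights:
  fixes a :: "nat \<Rightarrow> real"
  assumes a: "\<And>j. 0 \<le> a j" and q: "0 < q"
  shows "\<exists>p :: nat pmf. set_pmf p \<subseteq> {..<q} \<and> (\<forall>j. 0 < (\<Sum>j<q. a j) \<longrightarrow> j < q \<longrightarrow> pmf p j = a j / (\<Sum>j<q. a j))"
proof (cases "0 < (\<Sum>j<q. a j)")
  case False
  \<comment> \<open>Without positive weight there is nothing to normalise; a point mass serves as
    default value.\<close>
  show ?thesis by (rule exI[of _ "return_pmf 0"]) (use False q in auto)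
next
  case True
  define f where "f j = (if j < q then a j / (\<Sum>j<q. a j) else 0)" for j
  have f0: "0 \<le> f j" for j unfolding f_def using a True by simp
  have "(\<integral>\<^sup>+x. ennreal (f x) \<partial>count_space UNIV) = (\<Sum>x\<in>{..<q}. ennreal (f x))"
    by (rule nn_integral_count_space') (auto simp: f_def)
  also have "\<dots> = ennreal (\<Sum>x<q. f x)" by (rule sum_ennreal) (rule f0)
  also have "(\<Sum>x<q. f x) = (\<Sum>x<q. a x) / (\<Sum>j<q. a j)" unfolding sum_divide_distrib by (rule sum.cong) (auto simp: f_def)
  also have "\<dots> = 1" using True by simp
  finally have f1: "(\<integral>\<^sup>+x. ennreal (f x) \<partial>count_space UNIV) = 1" by simp
  show ?thesis
  proof (intro exI[of _ "embed_pmf f"] conjI allI impI)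
    show "set_pmf (embed_pmf f) \<subseteq> {..<q}" unfolding set_embed_pmf[OF f0 f1] by (auto simp: f_def)
    show "pmf (embed_pmf f) j = a j / (\<Sum>j<q. a j)" if "j < q" for j unfolding pmf_embed_pmf[OF f0 f1] using that by (simp add: f_def)
  qed
qed

text \<open>A neighbourhood of \<open>K\<close> lies in an open set of measure at most
  \<open>e\<close>. On a fine grid the cells that meet the 1/T-neighbourhood of \<open>K\<close>
  stay inside that set, and their total length is \<open>card Z / T\<close>.\<close>

lemma compact_null_grid:
  fixes K :: "real set"
  assumes K: "compact K" "emeasure lborel K = 0" and e: "0 < e"
  shows "\<exists>(T::real) (Z::int set). 0 < T \<and> finite Z \<and> real (card Z) / T \<le> e \<and>
    (\<forall>x y. y \<in> K \<longrightarrow> \<bar>x - y\<bar> < 1 / T \<longrightarrow> \<lfloor>T * x\<rfloor> \<in> Z)"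
proof -
  have Kb: "K \<in> sets borel" using K(1) by (simp add: borel_compact)
  have Kl: "K \<in> sets lebesgue" using Kb by simp
  obtain U where U: "open U" "K \<subseteq> U" "U - K \<in> lmeasurable" "emeasure lebesgue (U - K) < ennreal e"
    by (rule sets_lebesgue_outer_open[OF Kl e]) (rule that)
  have Ub: "U \<in> sets borel" using U(1) by simp
  have "emeasure lborel (U - K) < ennreal e" using U(4) Ub Kb by simp
  moreover have "emeasure lborel U \<le> emeasure lborel (U - K) + emeasure lborel K"
  proof -
    have "U = (U - K) \<union> K" using U(2) by blast
    then show ?thesis using emeasure_subadditive[of "U - K" lborel K] Ub Kb by simp
  qed
  ultimately have Ue: "emeasure lborel U \<le> ennreal e" using K(2) by simp
  obtain r where r: "0 < r" "(\<Union>x\<in>K. ball x r) \<subseteq> U" 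
    by (rule compact_subset_open_imp_ball_epsilon_subset[OF K(1) U(1,2)]) (rule that)
  \<comment> \<open>Two cell lengths must stay below \<open>r\<close>: one from \<open>K\<close> to
    a point of the cell and one across the cell.\<close>
  define T where "T = 3 / r"
  have T0: "0 < T" unfolding T_def using r by simp
  have Tr: "2 * (1 / T) < r" unfolding T_def using r by simp
  define Z where "Z = {k. \<exists>x y. \<lfloor>T * x\<rfloor> = k \<and> y \<in> K \<and> \<bar>x - y\<bar> < 1 / T}"
  obtain b where b: "\<And>y. y \<in> K \<Longrightarrow> \<bar>y\<bar> \<le> b" using compact_imp_bounded[OF K(1)] by (auto simp: bounded_iff)
  have finZ: "finite Z"
  proof (rule finite_subset)
    show "Z \<subseteq> {\<lfloor>- (T * b + 1)\<rfloor>..\<lfloor>T * b + 1\<rfloor>}"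
    proof
      fix k assume "k \<in> Z"
      then obtain x y where xy: "\<lfloor>T * x\<rfloor> = k" "y \<in> K" "\<bar>x - y\<bar> < 1 / T" unfolding Z_def by blast
      have "\<bar>x\<bar> \<le> b + 1 / T" using b[OF xy(2)] xy(3) by linarith
      then have "T * \<bar>x\<bar> \<le> T * (b + 1 / T)" using T0 by (intro mult_left_mono) auto
      also have "T * (b + 1 / T) = T * b + 1" using T0 by (simp add: distrib_left)
      finally have "\<bar>T * x\<bar> \<le> T * b + 1" using T0 by (simp add: abs_mult)
      then have x: "- (T * b + 1) \<le> T * x" "T * x \<le> T * b + 1" by linarith+
      show "k \<in> {\<lfloor>- (T * b + 1)\<rfloor>..\<lfloor>T * b + 1\<rfloor>}"
        unfolding xy(1)[symmetric] atLeastAtMost_iff by (intro conjI floor_mono x)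
    qed
  qed simp
  define cl where "cl k = {of_int k / T..<(of_int k + 1) / T}" for k :: int
  have fl: "\<lfloor>T * x\<rfloor> = k \<longleftrightarrow> x \<in> cl k" for x k
    unfolding cl_def floor_eq_iff using T0 by (auto simp: field_simps)
  have "ennreal (real (card Z) / T) = (\<Sum>k\<in>Z. ennreal (1 / T))"
    by (simp add: ennreal_of_nat_eq_real_of_nat ennreal_mult''[symmetric] T0 less_imp_le)
  also have "\<dots> = (\<Sum>k\<in>Z. emeasure lborel (cl k))"
  proof (rule sum.cong[OF refl])
    fix k
    have "of_int k / T \<le> (of_int k + 1) / T" using T0 by (intro divide_right_mono) auto
    then have "emeasure lborel (cl k) = ennreal ((of_int k + 1) / T - of_int k / T)" unfolding cl_def by (rule emeasure_lborel_Ico)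
    then show "ennreal (1 / T) = emeasure lborel (cl k)" by (simp add: add_divide_distrib)
  qed
  also have "\<dots> = emeasure lborel (\<Union>k\<in>Z. cl k)"
  proof (rule sum_emeasure[OF _ _ finZ])
    show "disjoint_family_on cl Z" unfolding disjoint_family_on_def by (auto simp: fl[symmetric])
  qed (auto simp: cl_def)
  also have "\<dots> \<le> emeasure lborel U"
  proof (rule emeasure_mono)
    show "(\<Union>k\<in>Z. cl k) \<subseteq> U"
    proof
      fix u assume "u \<in> (\<Union>k\<in>Z. cl k)"
      then obtain k where "k \<in> Z" "u \<in> cl k" by (rule UN_E)
      then have k: "k \<in> Z" "\<lfloor>T * u\<rfloor> = k" by (simp_all only: fl)
      obtain x y where xy: "\<lfloor>T * x\<rfloor> = k" "y \<in> K" "\<bar>x - y\<bar> < 1 / T" using k(1) unfolding Z_def by blast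
      have "\<bar>T * u - T * x\<bar> < 1" using k(2) xy(1) by linarith
      then have "T * \<bar>u - x\<bar> < 1" using T0 by (simp add: abs_mult flip: right_diff_distrib)
      then have "\<bar>u - x\<bar> < 1 / T" using T0 by (simp add: pos_less_divide_eq mult.commute)
      then have "\<bar>u - y\<bar> < r" using xy(3) Tr by linarith
      then have "u \<in> ball y r" by (simp add: dist_real_def)
      then show "u \<in> U" using r(2) xy(2) by blast
    qed
  qed (use Ub in simp)
  also note Ue
  finally have "real (card Z) / T \<le> e" using e by (simp add: ennreal_le_iff)
  then show ?thesis by (intro exI[of _ T] exI[of _ Z] conjI T0 finZ) (auto simp: Z_def)
qed

context approx_model
begin

lemma R_nonneg: "0 \<le> R"
  using W_bd[of 0 0] by linarith

text \<open>Divided by their total the weights become probability distributions on [-R, R];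
  tightness yields a weakly convergent subsequence, and the factor \<open>N\<close> restores the
  mass.\<close>

lemma mass_weak_limit:
  assumes N: "(\<lambda>i. \<Sum>j<Q i. mass \<psi> i j) \<longlonglongrightarrow> N" "0 < N"
  shows "\<exists>r M. strict_mono r \<and> real_distribution M \<and>
    (\<forall>f B. (\<forall>x::real. isCont f x) \<longrightarrow> (\<forall>x. \<bar>f x\<bar> \<le> B) \<longrightarrow>
      (\<lambda>i. \<Sum>j<Q (r i). mass \<psi> (r i) j * f (E (r i) j)) \<longlonglongrightarrow> N * (\<integral>x. f x \<partial>M))"
proof -
  define S where "S i = (\<Sum>j<Q i. mass \<psi> i j)" for i
  have "\<exists>p::nat pmf. set_pmf p \<subseteq> {..<Q i} \<and> (\<forall>j. 0 < S i \<longrightarrow> j < Q i \<longrightarrow> pmf p j = mass \<psi> i j / S i)" for i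
    unfolding S_def by (rule finite_pmf_of_weights[OF mass_nonneg Q_pos])
  from choice[OF allI[OF this]] obtain p where
    p0: "\<forall>i. set_pmf (p i) \<subseteq> {..<Q i} \<and> (\<forall>j. 0 < S i \<longrightarrow> j < Q i \<longrightarrow> pmf (p i) j = mass \<psi> i j / S i)" by (rule exE)
  have p: "set_pmf (p i) \<subseteq> {..<Q i}" "0 < S i \<Longrightarrow> j < Q i \<Longrightarrow> pmf (p i) j = mass \<psi> i j / S i" for i j using p0 by simp_all
  define \<nu> where "\<nu> i = distr (measure_pmf (p i)) borel (E i)" for i
  have rd: "real_distribution (\<nu> i)" for i unfolding \<nu>_def by (rule prob_space.real_distribution_distr[OF prob_space_measure_pmf]) simp
  have int\<nu>: "(\<integral>x. f x \<partial>\<nu> i) = (\<Sum>j<Q i. f (E i j) * pmf (p i) j)" if "f \<in> borel_measurable borel" for f :: "real \<Rightarrow> real" and i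
  proof -
    have "(\<integral>x. f x \<partial>\<nu> i) = (\<integral>j. f (E i j) \<partial>measure_pmf (p i))" unfolding \<nu>_def using that by (intro integral_distr) auto
    also have "\<dots> = (\<Sum>j<Q i. f (E i j) * pmf (p i) j)" using p(1)[of i] by (intro integral_measure_pmf_real) auto
    finally show ?thesis .
  qed
  have "tight \<nu>" unfolding tight_def
  proof (intro conjI allI impI)
    fix \<epsilon> :: real assume \<epsilon>: "0 < \<epsilon>"
    have "measure (\<nu> i) {- R - 1<..R + 1} = 1" for i
    proof -
      have "measure (\<nu> i) {- R - 1<..R + 1} = measure (measure_pmf (p i)) (E i -` {- R - 1<..R + 1})"
        unfolding \<nu>_def by (subst measure_distr) auto
      also have "\<dots> = 1"
      proof (subst measure_pmf.prob_eq_1)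
        show "AE j in measure_pmf (p i). j \<in> E i -` {- R - 1<..R + 1}" unfolding AE_measure_pmf_iff
        proof
          fix j assume "j \<in> set_pmf (p i)"
          then have "\<bar>E i j\<bar> \<le> R" using p(1)[of i] by (intro E_bd) auto
          then show "j \<in> E i -` {- R - 1<..R + 1}" by auto
        qed
      qed simp
      finally show ?thesis .
    qed
    then show "\<exists>a b. a < b \<and> (\<forall>n. 1 - \<epsilon> < measure (\<nu> n) {a<..b})" using R_nonneg \<epsilon> by (intro exI[of _ "- R - 1"] exI[of _ "R + 1"]) auto
  qed (rule rd)
  from tight_imp_convergent_subsubsequence[OF this strict_mono_id]
  obtain r M where r: "strict_mono r" and M: "real_distribution M" and wc: "weak_conv_m (\<nu> \<circ> id \<circ> r) M"
    by (elim exE conjE) (rule that)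
  show ?thesis
  proof (intro exI[of _ r] exI[of _ M] conjI allI impI r M)
    fix f :: "real \<Rightarrow> real" and B assume "\<forall>x. isCont f x" "\<forall>x. \<bar>f x\<bar> \<le> B"
    then have f: "\<And>x. isCont f x" "\<And>x. \<bar>f x\<bar> \<le> B" by simp_all
    have fm: "f \<in> borel_measurable borel" using f(1) by (intro borel_measurable_continuous_onI continuous_at_imp_continuous_on) auto
    have "(\<lambda>i. \<integral>x. f x \<partial>((\<nu> \<circ> id \<circ> r) i)) \<longlonglongrightarrow> (\<integral>x. f x \<partial>M)"
      by (rule weak_conv_imp_integral_bdd_continuous_conv[OF _ M wc, of f B]) (use rd f in auto)
    then have 1: "(\<lambda>i. \<integral>x. f x \<partial>\<nu> (r i)) \<longlonglongrightarrow> (\<integral>x. f x \<partial>M)" by simp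
    have 2: "(\<lambda>i. S (r i)) \<longlonglongrightarrow> N" using LIMSEQ_subseq_LIMSEQ[OF N(1) r] by (simp add: S_def o_def)
    show "(\<lambda>i. \<Sum>j<Q (r i). mass \<psi> (r i) j * f (E (r i) j)) \<longlonglongrightarrow> N * (\<integral>x. f x \<partial>M)"
    proof (rule Lim_transform_eventually[OF tendsto_mult[OF 2 1]])
      have "\<forall>\<^sub>F i in sequentially. 0 < S (r i)" using order_tendstoD(1)[OF 2 N(2)] .
      then show "\<forall>\<^sub>F i in sequentially. S (r i) * (\<integral>x. f x \<partial>\<nu> (r i)) = (\<Sum>j<Q (r i). mass \<psi> (r i) j * f (E (r i) j))"
      proof eventually_elim
        case (elim i)
        have "S (r i) * (\<integral>x. f x \<partial>\<nu> (r i)) = (\<Sum>j<Q (r i). S (r i) * (f (E (r i) j) * pmf (p (r i)) j))"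
          unfolding int\<nu>[OF fm] by (rule sum_distrib_left)
        also have "\<dots> = (\<Sum>j<Q (r i). mass \<psi> (r i) j * f (E (r i) j))"
          by (rule sum.cong[OF refl]) (use elim p(2)[OF elim] in simp)
        finally show ?case .
      qed
    qed
  qed
qed

text \<open>The supports stay in [-R, R], so truncated powers are admissible test functions and the
  moments pass to the limit. Absolute continuity is checked on compact null sets, which suffices by
  inner regularity.\<close>

theorem spectral_measure_exists_ac:
  assumes \<psi>: "\<psi> \<in> ell2"
  shows "\<exists>\<mu>. is_spectral_measure (hop V) \<psi> \<mu> \<and> absolutely_continuous lborel \<mu>"
proof (cases "\<psi> = (\<lambda>_. 0)")
  case True
  \<comment> \<open>The zero vector has no mass to normalise; its spectral measure is zero.\<close>
  have "is_spectral_measure (hop V) \<psi> (null_measure borel)"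
    unfolding is_spectral_measure_def inner_l2_def True by (auto intro!: finite_measureI)
  moreover have "absolutely_continuous lborel (null_measure borel :: real measure)"
    unfolding absolutely_continuous_def by (auto simp: null_sets_def)
  ultimately show ?thesis by blast
next
  case False
  define N where "N = infsum (\<lambda>n. (cmod (\<psi> n))\<^sup>2) UNIV"
  have N0: "0 < N"
  proof -
    obtain n where n: "\<psi> n \<noteq> 0" using False by auto
    have "(\<Sum>n\<in>{n}. (cmod (\<psi> n))\<^sup>2) \<le> N" unfolding N_def using \<psi> by (intro finite_sum_le_infsum) (auto simp: ell2_def)
    then have "(cmod (\<psi> n))\<^sup>2 \<le> N" by simp
    moreover have "0 < (cmod (\<psi> n))\<^sup>2" using n by simp
    ultimately show ?thesis by linarith
  qed
  have Nl: "(\<lambda>i. \<Sum>j<Q i. mass \<psi> i j) \<longlonglongrightarrow> N"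
  proof -
    have "(\<lambda>i. complex_of_real (\<Sum>j<Q i. mass \<psi> i j)) \<longlonglongrightarrow> of_real N"
      using mass_moment[OF \<psi>, of 0] inner_l2_self[OF \<psi>] by (simp add: N_def)
    from tendsto_Re[OF this] show ?thesis by (simp only: Re_complex_of_real)
  qed
  from mass_weak_limit[OF Nl N0] obtain r M where r: "strict_mono r" and M: "real_distribution M" and lim0:
    "\<forall>f B. (\<forall>x::real. isCont f x) \<longrightarrow> (\<forall>x. \<bar>f x\<bar> \<le> B) \<longrightarrow>
      (\<lambda>i. \<Sum>j<Q (r i). mass \<psi> (r i) j * f (E (r i) j)) \<longlonglongrightarrow> N * (\<integral>x. f x \<partial>M)"
    by (elim exE conjE) (rule that)
  have lim: "(\<lambda>i. \<Sum>j<Q (r i). mass \<psi> (r i) j * f (E (r i) j)) \<longlonglongrightarrow> N * (\<integral>x. f x \<partial>M)"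
    if "\<And>x. isCont f x" "\<And>x. \<bar>f x\<bar> \<le> B" for f B 
  proof -
    have "\<forall>x. isCont f x" "\<forall>x. \<bar>f x\<bar> \<le> B" using that by simp_all
    then show ?thesis by (rule lim0[THEN spec, THEN spec, THEN mp, THEN mp])
  qed
  interpret M: real_distribution M by (rule M)
  have supp: "AE x in M. \<bar>x\<bar> \<le> R"
  proof -
    \<comment> \<open>A test function that vanishes exactly on [-R, R]; as no eigenvalue lies
      outside, its integral in the limit is zero.\<close>
    define h where "h x = min 1 (max 0 (\<bar>x\<bar> - R))" for x :: real
    have hc: "isCont h x" for x unfolding h_def by (intro continuous_intros)
    have hb: "\<bar>h x\<bar> \<le> 1" for x unfolding h_def by auto
    have hm: "h \<in> borel_measurable borel" using hc by (intro borel_measurable_continuous_onI continuous_at_imp_continuous_on) auto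
    have "(\<lambda>i. \<Sum>j<Q (r i). mass \<psi> (r i) j * h (E (r i) j)) \<longlonglongrightarrow> N * (\<integral>x. h x \<partial>M)" by (rule lim[OF hc hb])
    moreover have "(\<Sum>j<Q (r i). mass \<psi> (r i) j * h (E (r i) j)) = 0" for i
    proof (rule sum.neutral, rule ballI)
      fix j assume "j \<in> {..<Q (r i)}"
      then have "\<bar>E (r i) j\<bar> \<le> R" by (intro E_bd) simp
      then show "mass \<psi> (r i) j * h (E (r i) j) = 0" by (simp add: h_def)
    qed
    ultimately have "(\<lambda>i. 0) \<longlonglongrightarrow> N * (\<integral>x. h x \<partial>M)" by simp
    then have "N * (\<integral>x. h x \<partial>M) = 0" using LIMSEQ_unique tendsto_const by blast
    then have "(\<integral>x. h x \<partial>M) = 0" using N0 by simp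
    moreover have "integrable M h" by (rule M.integrable_const_bound[of _ 1]) (use hb hm in auto)
    ultimately have "AE x in M. h x = 0" by (subst (asm) integral_nonneg_eq_0_iff_AE) (auto simp: h_def)
    then show ?thesis by eventually_elim (auto simp: h_def min_def max_def split: if_splits)
  qed
  have pm: "(\<lambda>x::real. x ^ k) \<in> borel_measurable M" for k by simp
  have intk: "integrable M (\<lambda>x. x ^ k)" for k
  proof (rule M.integrable_const_bound[of _ "R ^ k"])
    show "AE x in M. norm (x ^ k) \<le> R ^ k" using supp by eventually_elim (simp add: power_abs power_mono)
  qed (rule pm)
  have mom: "complex_of_real (N * (\<integral>x. x ^ k \<partial>M)) = inner_l2 \<psi> ((hop V ^^ k) \<psi>)" for k
  proof -
    define f where "f x = (max (- R) (min R x)) ^ k" for x :: real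
    have fc: "isCont f x" for x unfolding f_def by (intro continuous_intros)
    have fb: "\<bar>f x\<bar> \<le> R ^ k" for x 
    proof -
      have "\<bar>max (- R) (min R x)\<bar> \<le> R" using R_nonneg by (simp add: abs_le_iff max_def min_def)
      then show ?thesis unfolding f_def power_abs by (rule power_mono) simp
    qed
    have "(\<lambda>i. \<Sum>j<Q (r i). mass \<psi> (r i) j * f (E (r i) j)) \<longlonglongrightarrow> N * (\<integral>x. f x \<partial>M)" by (rule lim[OF fc fb])
    moreover have "(\<Sum>j<Q (r i). mass \<psi> (r i) j * f (E (r i) j)) = (\<Sum>j<Q (r i). mass \<psi> (r i) j * E (r i) j ^ k)" for i
    proof (rule sum.cong[OF refl])
      fix j assume "j \<in> {..<Q (r i)}"
      then have "\<bar>E (r i) j\<bar> \<le> R" by (intro E_bd) simp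
      then have "max (- R) (min R (E (r i) j)) = E (r i) j" by auto
      then show "mass \<psi> (r i) j * f (E (r i) j) = mass \<psi> (r i) j * E (r i) j ^ k" by (simp only: f_def)
    qed
    ultimately have "(\<lambda>i. \<Sum>j<Q (r i). mass \<psi> (r i) j * E (r i) j ^ k) \<longlonglongrightarrow> N * (\<integral>x. f x \<partial>M)" by simp
    from tendsto_of_real[OF this] have 1: "(\<lambda>i. complex_of_real (\<Sum>j<Q (r i). mass \<psi> (r i) j * E (r i) j ^ k)) \<longlonglongrightarrow> of_real (N * (\<integral>x. f x \<partial>M))" .
    have 2: "(\<lambda>i. complex_of_real (\<Sum>j<Q (r i). mass \<psi> (r i) j * E (r i) j ^ k)) \<longlonglongrightarrow> inner_l2 \<psi> ((hop V ^^ k) \<psi>)"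
      using LIMSEQ_subseq_LIMSEQ[OF mass_moment[OF \<psi>, of k] r] by (simp only: o_def)
    have fm: "f \<in> borel_measurable borel" using fc by (intro borel_measurable_continuous_onI continuous_at_imp_continuous_on) auto
    have "(\<integral>x. x ^ k \<partial>M) = (\<integral>x. f x \<partial>M)"
    proof (rule integral_cong_AE)
      show "AE x in M. x ^ k = f x" using supp
      proof eventually_elim
        case (elim x)
        then have "max (- R) (min R x) = x" by auto
        then show ?case by (simp only: f_def)
      qed
    qed (use fm in simp_all)
    then show ?thesis using LIMSEQ_unique[OF 1 2] by (simp only:)
  qed
  define \<mu> where "\<mu> = density M (\<lambda>_. ennreal N)"
  have sm: "is_spectral_measure (hop V) \<psi> \<mu>" unfolding is_spectral_measure_def
  proof (intro conjI allI)
    show "finite_measure \<mu>"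
    proof
      have e: "emeasure \<mu> (space \<mu>) = ennreal N * emeasure M (space M)" unfolding \<mu>_def space_density by (rule emeasure_density_const) (rule sets.top)
      show "emeasure \<mu> (space \<mu>) \<noteq> \<infinity>" unfolding e M.emeasure_space_1 by simp
    qed
    show "sets \<mu> = sets borel" by (simp add: \<mu>_def)
    fix k
    show "integrable \<mu> (\<lambda>x. x ^ k)" unfolding \<mu>_def
      by (subst integrable_density) (use N0 intk[of k] in \<open>auto intro: integrable_mult_right\<close>)
    have "(\<integral>x. x ^ k \<partial>\<mu>) = (\<integral>x. N *\<^sub>R x ^ k \<partial>M)" unfolding \<mu>_def by (rule integral_density) (use N0 in auto)
    also have "\<dots> = N * (\<integral>x. x ^ k \<partial>M)" by simp
    finally show "complex_of_real (\<integral>x. x ^ k \<partial>\<mu>) = inner_l2 \<psi> ((hop V ^^ k) \<psi>)" using mom[of k] by (simp only:)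
  qed
  have cnull: "emeasure M K = 0" if K: "compact K" "emeasure lborel K = 0" for K
  proof (cases "K = {}")
    case True then show ?thesis by simp
  next
    case Kne: False
    have Kb: "K \<in> sets borel" using K(1) by (simp add: borel_compact)
    have bd: "N * measure M K \<le> \<epsilon>" if \<epsilon>: "0 < \<epsilon>" for \<epsilon>
    proof -
      have \<epsilon>2: "0 < \<epsilon> / 2" using \<epsilon> by simp
      from mass_cells[OF \<psi> \<epsilon>2] obtain C where C: "0 < C" "\<forall>T Z. 0 < T \<longrightarrow> finite Z \<longrightarrow>
        (\<forall>\<^sub>F i in sequentially. (\<Sum>j\<in>{j\<in>{..<Q i}. \<lfloor>T * E i j\<rfloor> \<in> Z}. mass \<psi> i j) \<le> \<epsilon> / 2 + C * (real (card Z) / T))"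
        by (elim exE conjE) (rule that)
      have eC: "0 < \<epsilon> / (2 * C)" using \<epsilon> C(1) by simp
      from compact_null_grid[OF K eC] obtain T Z where T: "0 < T" and Z: "finite Z" "real (card Z) / T \<le> \<epsilon> / (2 * C)"
        and TZ: "\<forall>x y. y \<in> K \<longrightarrow> \<bar>x - y\<bar> < 1 / T \<longrightarrow> \<lfloor>T * x\<rfloor> \<in> Z"
        by (elim exE conjE) (rule that)
      from C(2) T Z(1) have Cev: "\<forall>\<^sub>F i in sequentially. (\<Sum>j\<in>{j\<in>{..<Q i}. \<lfloor>T * E i j\<rfloor> \<in> Z}. mass \<psi> i j) \<le> \<epsilon> / 2 + C * (real (card Z) / T)"
        by simp
      have CZ: "\<epsilon> / 2 + C * (real (card Z) / T) \<le> \<epsilon>"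
      proof -
        have "C * (real (card Z) / T) \<le> C * (\<epsilon> / (2 * C))" using Z(2) C(1) by (intro mult_left_mono) auto
        also have "\<dots> = \<epsilon> / 2" using C(1) by simp
        finally show ?thesis by linarith
      qed
      \<comment> \<open>A tent equal to 1 on \<open>K\<close> and vanishing at distance 1/T and
        beyond, so that it sees only eigenvalues in the cells \<open>Z\<close>.\<close>
      define f where "f x = max 0 (1 - T * infdist x K)" for x :: real
      have fc: "isCont f x" for x unfolding f_def by (intro continuous_intros)
      have f0: "0 \<le> f x" for x unfolding f_def by simp
      have f1: "f x \<le> 1" for x unfolding f_def using T infdist_nonneg[of x K] by simp
      have fb: "\<bar>f x\<bar> \<le> 1" for x using f0[of x] f1[of x] by simp
      have fm: "f \<in> borel_measurable borel" using fc by (intro borel_measurable_continuous_onI continuous_at_imp_continuous_on) auto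
      have fZ: "f x = 0" if "\<lfloor>T * x\<rfloor> \<notin> Z" for x
      proof (rule ccontr)
        assume "f x \<noteq> 0"
        then have "T * infdist x K < 1" unfolding f_def by (auto simp: max_def split: if_splits)
        then have "infdist x K < 1 / T" using T by (simp add: pos_less_divide_eq mult.commute)
        then have "(INF a\<in>K. dist x a) < 1 / T" using Kne by (simp add: infdist_notempty)
        then obtain y where "y \<in> K" "dist x y < 1 / T" using cInf_lessD[of "dist x ` K" "1 / T"] Kne by auto
        then show False using TZ that by (simp add: dist_real_def)
      qed
      have "\<forall>\<^sub>F i in sequentially. (\<Sum>j<Q (r i). mass \<psi> (r i) j * f (E (r i) j)) \<le> \<epsilon>"
        using eventually_subseq[OF r Cev]
      proof eventually_elim
        case (elim i)
        have "(\<Sum>j<Q (r i). mass \<psi> (r i) j * f (E (r i) j)) = (\<Sum>j\<in>{j\<in>{..<Q (r i)}. \<lfloor>T * E (r i) j\<rfloor> \<in> Z}. mass \<psi> (r i) j * f (E (r i) j))"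
          by (rule sum.mono_neutral_right) (auto simp: fZ)
        also have "\<dots> \<le> (\<Sum>j\<in>{j\<in>{..<Q (r i)}. \<lfloor>T * E (r i) j\<rfloor> \<in> Z}. mass \<psi> (r i) j)"
          by (intro sum_mono mult_left_le f1 mass_nonneg)
        finally show ?case using elim CZ by linarith
      qed
      then have le: "N * (\<integral>x. f x \<partial>M) \<le> \<epsilon>" by (intro tendsto_upperbound[OF lim[OF fc fb]]) auto
      have "measure M K = (\<integral>x. indicator K x \<partial>M)" using Kb by simp
      also have "\<dots> \<le> (\<integral>x. f x \<partial>M)"
      proof (rule integral_mono)
        show "integrable M (indicator K :: real \<Rightarrow> real)" using Kb by (intro integrable_real_indicator) (auto simp: M.emeasure_finite less_top[symmetric])
        show "integrable M f" by (rule M.integrable_const_bound[of _ 1]) (use fb fm in auto)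
        show "indicator K x \<le> f x" for x using f0[of x] by (cases "x \<in> K") (auto simp: f_def)
      qed
      finally have "N * measure M K \<le> N * (\<integral>x. f x \<partial>M)" using N0 by (intro mult_left_mono) auto
      then show ?thesis using le by linarith
    qed
    have "N * measure M K \<le> 0" by (rule field_le_epsilon) (use bd in simp)
    then have "measure M K = 0" using N0 measure_nonneg[of M K] by (simp add: mult_le_0_iff)
    then show ?thesis by (simp add: M.emeasure_eq_measure)
  qed
  have "absolutely_continuous lborel \<mu>" unfolding absolutely_continuous_def
  proof
    fix A :: "real set" assume A: "A \<in> null_sets lborel"
    have Ab: "A \<in> sets borel" and A0: "emeasure lborel A = 0" using A by (auto simp: null_sets_def)
    have "emeasure M A = (SUP K \<in> {K. K \<subseteq> A \<and> compact K}. emeasure M K)"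
      by (rule inner_regular[OF M.events_eq_borel _ Ab]) simp
    also have "\<dots> \<le> 0"
    proof (rule SUP_least)
      fix K assume "K \<in> {K. K \<subseteq> A \<and> compact K}"
      then have K: "K \<subseteq> A" "compact K" by auto
      have "emeasure lborel K \<le> emeasure lborel A" using K(1) Ab by (intro emeasure_mono) auto
      then show "emeasure M K \<le> 0" using cnull[OF K(2)] A0 by simp
    qed
    finally have "emeasure M A = 0" by simp
    then have "emeasure \<mu> A = 0" unfolding \<mu>_def using Ab by (subst emeasure_density_const) auto
    then show "A \<in> null_sets \<mu>" using Ab by (auto simp: null_sets_def \<mu>_def)
  qed
  then show ?thesis using sm by blast
qed

end

subsection \<open>Absolutely continuous spectrum at small coupling\<close>

text \<open>One existential statement with all quantifiers inside, so that \<open>choice\<close>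
  selects \<open>E\<close> and \<open>w\<close> for all approximants at once. The energies lie
  within 2 + \<epsilon> of the mean \<open>cc 0\<close>, whose modulus is at most 1.\<close>

lemma dual_model_approximant:
  fixes Q :: nat and P :: int and W :: "int \<Rightarrow> real" and B c0 \<epsilon> \<epsilon>1 L :: real and n0 :: nat
  assumes dm: "dual_model Q P W"
    and B: "0 < B" and c0: "0 < c0" "c0 \<le> 1" and \<epsilon>: "0 < \<epsilon>" "sqrt (2 * \<epsilon>) \<le> B"
    and L: "ln 2 + 2 * pi / sqrt (2 * \<epsilon>) \<le> L" "4 * ln 16 + 16 * ln (8 / (3 * c0)) \<le> L"
    and n0a: "\<forall>n\<ge>n0. 1000 \<le> n \<and> 40 * (exp L / c0 + 2) \<le> real n \<and> real n / (2 * \<epsilon>\<^sup>2 * c0 ^ 24) \<le> exp (B * real n) \<and> real n \<le> exp (B * real n)"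
    and dca: "\<forall>d::int. d \<noteq> 0 \<longrightarrow> \<bar>d\<bar> < int Q \<longrightarrow> c0 * exp (- B * real_of_int \<bar>d\<bar>) \<le> dz (of_int d * (of_int P / real Q))"
    and \<epsilon>1: "0 \<le> \<epsilon>1" "\<epsilon>1 \<le> 1" "\<epsilon>1 * (2 * (1 + 1 / (22000 * B))) \<le> \<epsilon>"
    and c: "\<And>d. cmod ((\<Sum>n\<in>{0..<int Q}. of_real (W n) * ee (- (of_int (n * d) * (of_int P / real Q)))) / of_nat Q) \<le> \<epsilon>1 * exp (- (2 * (22000 * B)) * of_int (cyn Q d))"
    and Wb: "\<And>n. \<bar>W n\<bar> \<le> 1"
  shows "\<exists>E w. (\<forall>j n. j < Q \<longrightarrow> hop W (w j) n = of_real (E j) * w j n)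
    \<and> (\<forall>n n'. \<bar>n - n'\<bar> < int Q \<longrightarrow> (\<Sum>j<Q. w j n * cnj (w j n')) = (if n = n' then of_nat Q else 0))
    \<and> (\<forall>j. j < Q \<longrightarrow> \<bar>E j\<bar> \<le> 4 + \<epsilon>)
    \<and> (\<forall>t N N2 K b T Z n. 2 \<le> t \<longrightarrow> 1 \<le> K \<longrightarrow>
        2 * (\<Sum>n. cor_profile B n0 n) / K\<^sup>2 + 4 * (real N2 * (14 / real t) + (\<Sum>n. cor_profile B n0 (n + N2))) \<le> b \<longrightarrow>
        0 < T \<longrightarrow> T + 3 \<le> real Q \<longrightarrow> finite Z \<longrightarrow>
        (\<Sum>j\<in>{j\<in>{..<Q}. \<lfloor>T * E j\<rfloor> \<in> Z}. (cmod (w j n))\<^sup>2) / real Q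
          \<le> 2 * (real N * b + (\<Sum>n. cor_profile B n0 (n + N))) + 64 * K ^ 6 * (2 * ((5 + \<epsilon>) + 1) ^ (t\<^sup>2)) ^ 3 * (real (card Z) / T))"
proof -
  note n0 = n0a[rule_format] and dc = dca[rule_format]
  interpret D: dual_model Q P W by (rule dm)
  obtain E \<phi> where "dual_eig Q P W E \<phi>"
  proof (rule D.exists_dual_eigenbasis)
    fix E :: "nat \<Rightarrow> real" and \<phi> :: "nat \<Rightarrow> int \<Rightarrow> complex"
    assume a: "\<And>j l. \<phi> j (l + int Q) = \<phi> j l"
      "\<And>j i. j < Q \<Longrightarrow> of_real (2 * cos (2 * pi * (D.xx + of_int i * D.om))) * \<phi> j i + (\<Sum>l\<in>{0..<int Q}. D.cc (i - l) * \<phi> j l) = of_real (E j) * \<phi> j i"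
      "\<And>j j'. j < Q \<Longrightarrow> j' < Q \<Longrightarrow> (\<Sum>i\<in>{0..<int Q}. cnj (\<phi> j i) * \<phi> j' i) = (if j = j' then 1 else 0)"
      "\<And>i i'. i \<in> {0..<int Q} \<Longrightarrow> i' \<in> {0..<int Q} \<Longrightarrow> (\<Sum>j<Q. \<phi> j i * cnj (\<phi> j i')) = (if i = i' then 1 else 0)"
    have "dual_eig Q P W E \<phi>" by (intro dual_eig.intro dm dual_eig_axioms.intro a)
    then show thesis by (rule that)
  qed
  then interpret D: dual_eig Q P W E \<phi> .
  have cc: "cmod (D.cc d) \<le> \<epsilon>1 * exp (- (2 * (22000 * B)) * of_int (cyn Q d))" for d
    unfolding D.cc_def D.om_def by (rule c)
  have dc': "c0 * exp (- B * real_of_int \<bar>d\<bar>) \<le> dz (of_int d * D.om)" if "d \<noteq> 0" "\<bar>d\<bar> < int Q" for d :: int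
    unfolding D.om_def by (rule dc[OF that])
  have prof: "D.cor d \<le> cor_profile B n0 (nat (cyn Q d))" for d
    by (rule D.cor_le_profile[OF B c0 \<epsilon> L n0 dc' \<epsilon>1 cc])
  have cc0: "\<bar>Re (D.cc 0)\<bar> \<le> 1"
  proof -
    have "\<bar>Re (D.cc 0)\<bar> \<le> cmod (D.cc 0)" by (rule abs_Re_le_cmod)
    also have "\<dots> \<le> \<epsilon>1" using cc[of 0] D.Q by (simp add: cyn_def)
    finally show ?thesis using \<epsilon>1(2) by linarith
  qed
  have Eb: "\<bar>E j\<bar> \<le> 3 + \<epsilon>" if j: "j < Q" for j
  proof -
    have "0 < 22000 * B" using B by simp
    from D.eigenvalue_bound(1)[OF j this \<epsilon>1(3,1) cc] have "\<bar>E j - Re (D.cc 0)\<bar> \<le> 2 + \<epsilon>" .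
    then show ?thesis using cc0 by linarith
  qed
  have \<Lambda>: "\<bar>E j - W n\<bar> \<le> 5 + \<epsilon>" if "j < Q" for j n using Eb[OF that] Wb[of n] by linarith
  have \<Lambda>0: "0 \<le> 5 + \<epsilon>" using \<epsilon>(1) by simp
  show ?thesis
  proof (intro exI[of _ E] exI[of _ D.ww] conjI allI impI)
    show "hop W (D.ww j) n = of_real (E j) * D.ww j n" if "j < Q" for j n using D.ww_eq[OF that] by (simp only: hop_def)
    show "(\<Sum>j<Q. D.ww j n * cnj (D.ww j n')) = (if n = n' then of_nat Q else 0)" if "\<bar>n - n'\<bar> < int Q" for n n' by (rule D.ww_complete[OF that])
    show "\<bar>E j\<bar> \<le> 4 + \<epsilon>" if "j < Q" for j using Eb[OF that] by linarith
    fix t N N2 :: nat and K b T :: real and Z :: "int set" and n :: int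
    assume H: "2 \<le> t" "1 \<le> K" "2 * (\<Sum>n. cor_profile B n0 n) / K\<^sup>2 + 4 * (real N2 * (14 / real t) + (\<Sum>n. cor_profile B n0 (n + N2))) \<le> b"
      "0 < T" "T + 3 \<le> real Q" "finite Z"
    show "(\<Sum>j\<in>{j\<in>{..<Q}. \<lfloor>T * E j\<rfloor> \<in> Z}. (cmod (D.ww j n))\<^sup>2) / real Q
          \<le> 2 * (real N * b + (\<Sum>n. cor_profile B n0 (n + N))) + 64 * K ^ 6 * (2 * ((5 + \<epsilon>) + 1) ^ (t\<^sup>2)) ^ 3 * (real (card Z) / T)"
    proof (rule D.cell_mass_bound[OF summable_cor_profile[OF B] cor_profile_nonneg[OF B] prof \<Lambda>0])
      show "\<bar>E j - W n\<bar> \<le> 5 + \<epsilon>" if "j < Q" for j n by (rule \<Lambda>[OF that])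
    qed (rule H)+
  qed
qed

text \<open>Dirichlet's theorem at scale \<open>N\<close> gives a coprime fraction; once
  \<open>N\<close> is large, the divisor bound excludes denominators up to \<open>i\<close>.\<close>

lemma large_coprime_approximant:
  fixes \<alpha> B c :: real
  assumes B: "0 < B" and c: "0 < c" and dc: "\<And>(j::nat) (p::int). 1 \<le> j \<Longrightarrow> c * exp (- B * real j) \<le> \<bar>real j * \<alpha> - of_int p\<bar>"
  shows "\<exists>(Q::nat) (P::int). i < Q \<and> coprime P (int Q) \<and> \<bar>\<alpha> - of_int P / real Q\<bar> \<le> 1 / (real Q * real Q)"
proof -
  obtain N0 :: nat where N0: "exp (B * real i) / c \<le> real N0" using real_arch_simple by blast
  define N where "N = Suc N0"
  have N: "0 < N" "exp (B * real i) / c < real N" using N0 by (auto simp: N_def)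
  obtain h k where hk: "coprime h k" "0 < k" "k \<le> int N" "\<bar>of_int k * \<alpha> - of_int h\<bar> < 1 / N"
    by (rule Dirichlet_approx_coprime[OF N(1)]) (rule that)
  define Q where "Q = nat k"
  have Q: "int Q = k" "1 \<le> Q" "real Q = of_int k" "Q \<le> N" using hk(2,3) by (auto simp: Q_def)
  have ap: "\<bar>real Q * \<alpha> - of_int h\<bar> < 1 / real N" using hk(4) Q(3) by simp
  have "c * exp (- B * real Q) < 1 / real N" using dc[OF Q(2), of h] ap by linarith
  also have "1 / real N < c * exp (- B * real i)"
  proof -
    have "exp (B * real i) < real N * c" using N(2) c by (simp only: pos_divide_less_eq)
    then have "1 < real N * (c * exp (- B * real i))" by (simp add: exp_minus field_simps)
    then show ?thesis using N(1) by (simp add: pos_divide_less_eq mult.commute)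
  qed
  finally have "exp (- B * real Q) < exp (- B * real i)" using c by (simp only: mult_less_cancel_left_pos)
  then have "real i < real Q" using B by simp
  then have iQ: "i < Q" by simp
  have Qr: "0 < real Q" using Q(2) by simp
  have "\<bar>\<alpha> - of_int h / real Q\<bar> \<le> 1 / (real Q * real Q)"
  proof -
    have "\<alpha> - of_int h / real Q = (real Q * \<alpha> - of_int h) / real Q" using Qr by (simp add: diff_divide_distrib)
    then have "\<bar>\<alpha> - of_int h / real Q\<bar> = \<bar>real Q * \<alpha> - of_int h\<bar> / real Q" using Qr by simp
    also have "\<dots> \<le> (1 / real Q) / real Q"
    proof (rule divide_right_mono)
      have "1 / real N \<le> 1 / real Q" using Q(4) Qr by (intro divide_left_mono) auto
      then show "\<bar>real Q * \<alpha> - of_int h\<bar> \<le> 1 / real Q" using ap by linarith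
    qed simp
    finally show ?thesis by simp
  qed
  then show ?thesis using iQ hk(1) Q(1) by blast
qed

lemma periodic_real_int:
  fixes v :: "real \<Rightarrow> real"
  assumes "\<And>x. v (x + 1) = v x" shows "v (x + of_int k) = v x"
proof (induction k rule: int_induct[of _ 0])
  case base show ?case by simp
next
  case (step1 i) then show ?case using assms[of "x + of_int i"] by (simp add: add.assoc)
next
  case (step2 i) then show ?case using assms[of "x + of_int (i - 1)"] by (simp add: add.assoc)
qed

lemma ac_spectrum_small_coupling:
  fixes v :: "real \<Rightarrow> real" and b A lam \<theta> \<alpha> :: real
  assumes b: "0 < b" and per: "\<And>x. v (x + 1) = v x" and cont: "\<And>x. isCont v x"
    and A: "0 < A" "\<And>x. \<bar>v x\<bar> \<le> A"
    and dec: "\<And>lam \<theta> (Q::nat) (P::int) (s::int). Q > 0 \<Longrightarrow> coprime P (int Q) \<Longrightarrow>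
      cmod ((\<Sum>n\<in>{0..<int Q}. of_real (lam * v (\<theta> + of_int n * (of_int P / real Q))) * ee (- (of_int (n * s) * (of_int P / real Q)))) / of_nat Q)
        \<le> \<bar>lam\<bar> * (2 * A) * exp (- (2 * (22000 * (2 * b))) * of_int (cyn Q s))"
    and irr: "\<alpha> \<notin> \<rat>" and beta: "beta_exp \<alpha> = ereal b"
    and lam: "\<bar>lam\<bar> * (2 * A) \<le> 1" "\<bar>lam\<bar> * (2 * A) * (2 * (1 + 1 / (22000 * (2 * b)))) \<le> (2 * b)\<^sup>2 / 2"
  shows "purely_ac_spectrum (schr_op lam v \<alpha> \<theta>)"
proof -
  define B where "B = 2 * b"
  have B: "0 < B" using b by (simp add: B_def)
  \<comment> \<open>The largest \<open>\<epsilon>\<close> with sqrt (2 \<epsilon>) \<le> B; it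
    bounds the off-diagonal part that the window argument tolerates and so limits the
    coupling.\<close>
  define \<epsilon> where "\<epsilon> = B\<^sup>2 / 2"
  have \<epsilon>: "0 < \<epsilon>" "sqrt (2 * \<epsilon>) \<le> B" using B by (auto simp: \<epsilon>_def)
  define \<epsilon>1 where "\<epsilon>1 = \<bar>lam\<bar> * (2 * A)"
  have \<epsilon>1: "0 \<le> \<epsilon>1" "\<epsilon>1 \<le> 1" "\<epsilon>1 * (2 * (1 + 1 / (22000 * B))) \<le> \<epsilon>" using A(1) lam by (auto simp: \<epsilon>1_def \<epsilon>_def B_def)
  obtain c where c12: "0 < c" "c \<le> 1" and c3: "\<And>(j::nat) (p::int). 1 \<le> j \<Longrightarrow> c * exp (- (2 * b) * real j) \<le> \<bar>real j * \<alpha> - of_int p\<bar>"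
  proof (rule diophantine_of_beta_exp[OF irr beta b])
    fix c assume "0 < c" "c \<le> 1" "\<And>(j::nat) (p::int). 1 \<le> j \<Longrightarrow> c * exp (- (2 * b) * real j) \<le> \<bar>real j * \<alpha> - of_int p\<bar>"
    then show thesis by (rule that)
  qed
  note c = c12 c3[folded B_def]
  define c0 where "c0 = c / 3"
  have c0: "0 < c0" "c0 \<le> 1" using c(1,2) by (auto simp: c0_def)
  define L where "L = max (ln 2 + 2 * pi / sqrt (2 * \<epsilon>)) (4 * ln 16 + 16 * ln (8 / (3 * c0)))"
  have L: "ln 2 + 2 * pi / sqrt (2 * \<epsilon>) \<le> L" "4 * ln 16 + 16 * ln (8 / (3 * c0)) \<le> L" by (simp_all add: L_def)
  obtain n0 :: nat where n0: "\<And>n. n0 \<le> n \<Longrightarrow> 1000 \<le> n \<and> 40 * (exp L / c0 + 2) \<le> real n \<and> real n / (2 * \<epsilon>\<^sup>2 * c0 ^ 24) \<le> exp (B * real n) \<and> real n \<le> exp (B * real n)"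
  proof (rule decay_threshold[OF B c0(1) \<epsilon>(1), of L])
    fix n0 assume "\<And>n. n0 \<le> n \<Longrightarrow> 1000 \<le> n \<and> 40 * (exp L / c0 + 2) \<le> real n \<and> real n / (2 * \<epsilon>\<^sup>2 * c0 ^ 24) \<le> exp (B * real n) \<and> real n \<le> exp (B * real n)"
    then show thesis by (rule that)
  qed
  have "\<exists>QP :: nat \<times> int. i < fst QP \<and> coprime (snd QP) (int (fst QP)) \<and> \<bar>\<alpha> - of_int (snd QP) / real (fst QP)\<bar> \<le> 1 / (real (fst QP) * real (fst QP))" for i
  proof -
    have "\<exists>(Q::nat) (P::int). i < Q \<and> coprime P (int Q) \<and> \<bar>\<alpha> - of_int P / real Q\<bar> \<le> 1 / (real Q * real Q)"
      by (rule large_coprime_approximant[OF B c(1)]) (rule c(3))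
    then show ?thesis by simp
  qed
  from choice[OF allI[OF this]] obtain QP :: "nat \<Rightarrow> nat \<times> int" where
    QP: "\<forall>i. i < fst (QP i) \<and> coprime (snd (QP i)) (int (fst (QP i))) \<and> \<bar>\<alpha> - of_int (snd (QP i)) / real (fst (QP i))\<bar> \<le> 1 / (real (fst (QP i)) * real (fst (QP i)))"
    by (rule exE)
  define Q where "Q i = fst (QP i)" for i
  define P where "P i = snd (QP i)" for i
  have Q: "i < Q i" and cop: "coprime (P i) (int (Q i))" and app: "\<bar>\<alpha> - of_int (P i) / real (Q i)\<bar> \<le> 1 / (real (Q i) * real (Q i))" for i
    using QP by (simp_all add: Q_def P_def)
  have Q0: "0 < Q i" for i using Q[of i] by simp
  define W where "W i n = lam * v (\<theta> + of_int n * (of_int (P i) / real (Q i)))" for i and n :: int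
  define V where "V n = lam * v (\<theta> + of_int n * \<alpha>)" for n :: int
  have Wb: "\<bar>W i n\<bar> \<le> 1" for i n
  proof -
    have "\<bar>W i n\<bar> \<le> \<bar>lam\<bar> * A" unfolding W_def abs_mult by (intro mult_left_mono A(2)) simp
    also have "\<dots> \<le> \<bar>lam\<bar> * (2 * A)" using A(1) by (intro mult_left_mono) auto
    finally show ?thesis using lam(1) by linarith
  qed
  have dm: "dual_model (Q i) (P i) (W i)" for i
  proof
    show "W i (n + int (Q i)) = W i n" for n
    proof -
      have "\<theta> + of_int (n + int (Q i)) * (of_int (P i) / real (Q i)) = (\<theta> + of_int n * (of_int (P i) / real (Q i))) + of_int (P i)"
        using Q0[of i] by (simp add: distrib_right add_divide_distrib)
      then show ?thesis unfolding W_def by (simp only: periodic_real_int[of v, OF per])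
    qed
  qed (rule Q0, rule cop)
  have dc: "c0 * exp (- B * real_of_int \<bar>d\<bar>) \<le> dz (of_int d * (of_int (P i) / real (Q i)))" if "d \<noteq> 0" "\<bar>d\<bar> < int (Q i)" for d i
    unfolding c0_def by (rule diophantine_rational_approx[OF Q0 cop app c(1) _ that]) (rule c(3))
  have cf: "cmod ((\<Sum>n\<in>{0..<int (Q i)}. of_real (W i n) * ee (- (of_int (n * d) * (of_int (P i) / real (Q i))))) / of_nat (Q i)) \<le> \<epsilon>1 * exp (- (2 * (22000 * B)) * of_int (cyn (Q i) d))" for i d
    unfolding W_def \<epsilon>1_def B_def by (rule dec[OF Q0 cop])
  have n0a: "\<forall>n\<ge>n0. 1000 \<le> n \<and> 40 * (exp L / c0 + 2) \<le> real n \<and> real n / (2 * \<epsilon>\<^sup>2 * c0 ^ 24) \<le> exp (B * real n) \<and> real n \<le> exp (B * real n)"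
    by (intro allI impI n0)
  have dca: "\<forall>d. d \<noteq> 0 \<longrightarrow> \<bar>d\<bar> < int (Q i) \<longrightarrow> c0 * exp (- B * real_of_int \<bar>d\<bar>) \<le> dz (of_int d * (of_int (P i) / real (Q i)))" for i
    by (intro allI impI dc)
  note ex = dual_model_approximant[OF dm B c0 \<epsilon> L n0a dca \<epsilon>1 cf Wb]
  from choice[OF allI[OF ex]] obtain E where "\<forall>i. \<exists>w. (\<forall>j n. j < Q i \<longrightarrow> hop (W i) (w j) n = of_real (E i j) * w j n)
    \<and> (\<forall>n n'. \<bar>n - n'\<bar> < int (Q i) \<longrightarrow> (\<Sum>j<Q i. w j n * cnj (w j n')) = (if n = n' then of_nat (Q i) else 0))
    \<and> (\<forall>j. j < Q i \<longrightarrow> \<bar>E i j\<bar> \<le> 4 + \<epsilon>)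
    \<and> (\<forall>t N N2 K b T Z n. 2 \<le> t \<longrightarrow> 1 \<le> K \<longrightarrow>
        2 * (\<Sum>n. cor_profile B n0 n) / K\<^sup>2 + 4 * (real N2 * (14 / real t) + (\<Sum>n. cor_profile B n0 (n + N2))) \<le> b \<longrightarrow>
        0 < T \<longrightarrow> T + 3 \<le> real (Q i) \<longrightarrow> finite Z \<longrightarrow>
        (\<Sum>j\<in>{j\<in>{..<Q i}. \<lfloor>T * E i j\<rfloor> \<in> Z}. (cmod (w j n))\<^sup>2) / real (Q i)
          \<le> 2 * (real N * b + (\<Sum>n. cor_profile B n0 (n + N))) + 64 * K ^ 6 * (2 * ((5 + \<epsilon>) + 1) ^ (t\<^sup>2)) ^ 3 * (real (card Z) / T))"
    by (rule exE)
  from choice[OF this] obtain w where all: "\<forall>i. (\<forall>j n. j < Q i \<longrightarrow> hop (W i) (w i j) n = of_real (E i j) * w i j n)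
    \<and> (\<forall>n n'. \<bar>n - n'\<bar> < int (Q i) \<longrightarrow> (\<Sum>j<Q i. w i j n * cnj (w i j n')) = (if n = n' then of_nat (Q i) else 0))
    \<and> (\<forall>j. j < Q i \<longrightarrow> \<bar>E i j\<bar> \<le> 4 + \<epsilon>)
    \<and> (\<forall>t N N2 K b T Z n. 2 \<le> t \<longrightarrow> 1 \<le> K \<longrightarrow>
        2 * (\<Sum>n. cor_profile B n0 n) / K\<^sup>2 + 4 * (real N2 * (14 / real t) + (\<Sum>n. cor_profile B n0 (n + N2))) \<le> b \<longrightarrow>
        0 < T \<longrightarrow> T + 3 \<le> real (Q i) \<longrightarrow> finite Z \<longrightarrow>
        (\<Sum>j\<in>{j\<in>{..<Q i}. \<lfloor>T * E i j\<rfloor> \<in> Z}. (cmod (w i j n))\<^sup>2) / real (Q i)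
          \<le> 2 * (real N * b + (\<Sum>n. cor_profile B n0 (n + N))) + 64 * K ^ 6 * (2 * ((5 + \<epsilon>) + 1) ^ (t\<^sup>2)) ^ 3 * (real (card Z) / T))"
    by (rule exE)
  note al = all[THEN spec]
  have "approx_model Q W V E w (4 + \<epsilon>)"
  proof
    show "filterlim Q at_top sequentially"
    proof (rule filterlim_at_top_mono[OF filterlim_ident])
      show "\<forall>\<^sub>F i in sequentially. i \<le> Q i" using Q by (intro always_eventually) (simp add: less_imp_le)
    qed
    show "0 < Q i" for i by (rule Q0)
    show "hop (W i) (w i j) n = of_real (E i j) * w i j n" if "j < Q i" for i j n
      by (rule al[THEN conjunct1, THEN spec, THEN spec, THEN mp, OF that])
    show "(\<Sum>j<Q i. w i j n * cnj (w i j n')) = (if n = n' then of_nat (Q i) else 0)" if "\<bar>n - n'\<bar> < int (Q i)" for i n n'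
      by (rule al[THEN conjunct2, THEN conjunct1, THEN spec, THEN spec, THEN mp, OF that])
    show "\<bar>E i j\<bar> \<le> 4 + \<epsilon>" if "j < Q i" for i j
      by (rule al[THEN conjunct2, THEN conjunct2, THEN conjunct1, THEN spec, THEN mp, OF that])
    show "\<bar>W i n\<bar> \<le> 4 + \<epsilon>" for i n using Wb[of i n] \<epsilon>(1) by linarith
    show "(\<lambda>i. W i n) \<longlonglongrightarrow> V n" for n
    proof -
      have "(\<lambda>i. of_int (P i) / real (Q i) - \<alpha>) \<longlonglongrightarrow> 0"
      proof (rule Lim_null_comparison[OF _ LIMSEQ_inverse_real_of_nat])
        have "norm (of_int (P i) / real (Q i) - \<alpha>) \<le> inverse (real (Suc i))" for i
        proof -
          have "norm (of_int (P i) / real (Q i) - \<alpha>) \<le> 1 / (real (Q i) * real (Q i))" using app[of i] by (simp add: abs_minus_commute)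
          also have "\<dots> \<le> 1 / (real (Suc i) * 1)" using Q[of i] by (intro divide_left_mono mult_mono) auto
          finally show ?thesis by (simp add: inverse_eq_divide)
        qed
        then show "\<forall>\<^sub>F i in sequentially. norm (of_int (P i) / real (Q i) - \<alpha>) \<le> inverse (real (Suc i))" by simp
      qed
      then have "(\<lambda>i. of_int (P i) / real (Q i)) \<longlonglongrightarrow> \<alpha>" by (simp only: LIM_zero_iff)
      then have "(\<lambda>i. \<theta> + of_int n * (of_int (P i) / real (Q i))) \<longlonglongrightarrow> \<theta> + of_int n * \<alpha>" by (intro tendsto_add tendsto_mult tendsto_const)
      from isCont_tendsto_compose[OF cont this] show ?thesis unfolding W_def V_def by (intro tendsto_mult tendsto_const)
    qed
    fix e :: real assume e: "0 < e"
    obtain t N N2 :: nat and K b' :: real where pr: "2 \<le> t" "1 \<le> K"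
      "2 * (\<Sum>n. cor_profile B n0 n) / K\<^sup>2 + 4 * (real N2 * (14 / real t) + (\<Sum>n. cor_profile B n0 (n + N2))) \<le> b'"
      and pe: "2 * (real N * b' + (\<Sum>n. cor_profile B n0 (n + N))) \<le> e"
      by (rule cell_mass_parameters[OF summable_cor_profile[OF B] cor_profile_nonneg[OF B] e]) (rule that)
    show "\<exists>C>0. \<forall>i T Z n. 0 < T \<longrightarrow> T + 3 \<le> real (Q i) \<longrightarrow> finite Z \<longrightarrow>
      (\<Sum>j\<in>{j\<in>{..<Q i}. \<lfloor>T * E i j\<rfloor> \<in> Z}. (cmod (w i j n))\<^sup>2) / real (Q i) \<le> e + C * (real (card Z) / T)"
    proof (intro exI[of _ "64 * K ^ 6 * (2 * ((5 + \<epsilon>) + 1) ^ (t\<^sup>2)) ^ 3"] conjI allI impI)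
      show "0 < 64 * K ^ 6 * (2 * ((5 + \<epsilon>) + 1) ^ (t\<^sup>2)) ^ 3" using pr(2) \<epsilon>(1) by (intro mult_pos_pos zero_less_power) auto
      fix i T Z n assume T: "0 < T" "T + 3 \<le> real (Q i)" "finite (Z :: int set)"
      note cb = al[THEN conjunct2, THEN conjunct2, THEN conjunct2, THEN spec, THEN spec, THEN spec, THEN spec, THEN spec, THEN spec, THEN spec, THEN spec,
        THEN mp, THEN mp, THEN mp, THEN mp, THEN mp, THEN mp, OF pr T]
      show "(\<Sum>j\<in>{j\<in>{..<Q i}. \<lfloor>T * E i j\<rfloor> \<in> Z}. (cmod (w i j n))\<^sup>2) / real (Q i) \<le> e + 64 * K ^ 6 * (2 * ((5 + \<epsilon>) + 1) ^ (t\<^sup>2)) ^ 3 * (real (card Z) / T)"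
        by (rule order_trans[OF cb add_right_mono[OF pe]])
    qed
  qed
  from approx_model.spectral_measure_exists_ac[OF this] show ?thesis
    unfolding purely_ac_spectrum_def schr_op_eq_hop V_def by (rule ballI)
qed

theorem theorem1p1:
  "\<exists>C::real. C > 0 \<and>
     (\<forall>(v::real \<Rightarrow> real) (b::ereal).
        0 < b \<and> b < \<infinity> \<and>
        (\<forall>x. v (x + 1) = v x) \<and>
        (\<exists>V. V holomorphic_on {z. \<bar>Im z\<bar> < C * real_of_ereal b} \<and>
             (\<forall>z. \<bar>Im z\<bar> < C * real_of_ereal b \<longrightarrow> V (z + 1) = V z) \<and>
             (\<forall>x. V (complex_of_real x) = complex_of_real (v x)))
        \<longrightarrow> (\<exists>lam0>0. \<forall>\<alpha>. \<alpha> \<notin> \<rat> \<and> beta_exp \<alpha> = b \<longrightarrow>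
               (\<forall>lam \<theta>. \<bar>lam\<bar> < lam0 \<longrightarrow> purely_ac_spectrum (schr_op lam v \<alpha> \<theta>))))"
proof (rule exI[of _ "200000::real"], intro conjI allI impI)
  show "(0::real) < 200000" by simp
  fix v :: "real \<Rightarrow> real" and be :: ereal
  assume H: "0 < be \<and> be < \<infinity> \<and> (\<forall>x. v (x + 1) = v x) \<and>
        (\<exists>V. V holomorphic_on {z. \<bar>Im z\<bar> < 200000 * real_of_ereal be} \<and>
             (\<forall>z. \<bar>Im z\<bar> < 200000 * real_of_ereal be \<longrightarrow> V (z + 1) = V z) \<and>
             (\<forall>x. V (complex_of_real x) = complex_of_real (v x)))"
  define b where "b = real_of_ereal be"
  have b0: "0 < be" "be < \<infinity>" using H by simp_all
  have be1: "be = ereal b" using b0 by (cases be) (auto simp: b_def)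
  have be: "be = ereal b" "0 < b" using b0(1) be1 by simp_all
  have per: "v (x + 1) = v x" for x using H by simp
  from H[THEN conjunct2, THEN conjunct2, THEN conjunct2, folded b_def] obtain V where
    V0: "V holomorphic_on {z. \<bar>Im z\<bar> < 200000 * b} \<and> (\<forall>z. \<bar>Im z\<bar> < 200000 * b \<longrightarrow> V (z + 1) = V z) \<and>
      (\<forall>x. V (complex_of_real x) = complex_of_real (v x))" by (rule exE)
  note V = V0[THEN conjunct1] V0[THEN conjunct2, THEN conjunct1, rule_format] V0[THEN conjunct2, THEN conjunct2, rule_format]
  \<comment> \<open>Half of 176000 b is twice 22000 B with B = 2 b, the decay rate asked of the
    coefficients.\<close>
  have h: "0 < 176000 * b" "176000 * b < 200000 * b" using be(2) by auto
  obtain A where A: "0 < A" "\<And>x. \<bar>v x\<bar> \<le> A" and dec0: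
    "\<And>lam \<theta> (Q::nat) (P::int) (s::int). Q > 0 \<Longrightarrow> coprime P (int Q) \<Longrightarrow>
      cmod ((\<Sum>n\<in>{0..<int Q}. of_real (lam * v (\<theta> + of_int n * (of_int P / real Q))) * ee (- (of_int (n * s) * (of_int P / real Q)))) / of_nat Q)
        \<le> \<bar>lam\<bar> * (2 * A) * exp (- (176000 * b / 2) * of_int (cyn Q s))"
  proof (rule sampled_coefficient_decay[OF V(1) _ V(3) h])
    show "V (z + 1) = V z" if "\<bar>Im z\<bar> < 200000 * b" for z by (rule V(2)[OF that])
    fix A assume "0 < A" "\<And>x. \<bar>v x\<bar> \<le> A"
      "\<And>lam \<theta> (Q::nat) (P::int) (s::int). Q > 0 \<Longrightarrow> coprime P (int Q) \<Longrightarrow>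
      cmod ((\<Sum>n\<in>{0..<int Q}. of_real (lam * v (\<theta> + of_int n * (of_int P / real Q))) * ee (- (of_int (n * s) * (of_int P / real Q)))) / of_nat Q)
        \<le> \<bar>lam\<bar> * (2 * A) * exp (- (176000 * b / 2) * of_int (cyn Q s))"
    then show thesis by (rule that)
  qed
  have hb: "176000 * b / 2 = 2 * (22000 * (2 * b))" by simp
  note dec = dec0[unfolded hb]
  have cont: "isCont v x" for x
  proof -
    have op: "open {z. \<bar>Im z\<bar> < 200000 * b}" by (intro open_Collect_less continuous_intros)
    have "\<forall>z\<in>{z. \<bar>Im z\<bar> < 200000 * b}. isCont V z"
      using holomorphic_on_imp_continuous_on[OF V(1)] by (simp only: continuous_on_eq_continuous_at[OF op])
    then have "isCont V (complex_of_real x)" using be(2) by simp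
    moreover have "isCont complex_of_real x" by (intro continuous_intros)
    ultimately have "isCont (\<lambda>x. V (complex_of_real x)) x" by (rule isCont_o2[rotated])
    then have "isCont (\<lambda>x. Re (V (complex_of_real x))) x" by (rule continuous_Re)
    then show ?thesis by (simp add: V(3))
  qed
  \<comment> \<open>The threshold for \<open>lam\<close> is built from \<open>b\<close> and the
    bound \<open>A\<close> of \<open>v\<close> alone, so it is uniform in \<open>\<alpha>\<close>
    and \<open>\<theta>\<close>.\<close>
  define s where "s = min 1 (((2 * b)\<^sup>2 / 2) / (2 * (1 + 1 / (22000 * (2 * b)))))"
  have p: "0 < 2 * (1 + 1 / (22000 * (2 * b)))" using be(2) by (simp add: add_pos_pos)
  have s0: "0 < s" unfolding s_def using be(2) p by simp
  show "\<exists>lam0>0. \<forall>\<alpha>. \<alpha> \<notin> \<rat> \<and> beta_exp \<alpha> = be \<longrightarrow> (\<forall>lam \<theta>. \<bar>lam\<bar> < lam0 \<longrightarrow> purely_ac_spectrum (schr_op lam v \<alpha> \<theta>))"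
  proof (intro exI[of _ "s / (2 * A)"] conjI allI impI)
    show "0 < s / (2 * A)" using s0 A(1) by simp
    fix \<alpha> lam \<theta> :: real assume a: "\<alpha> \<notin> \<rat> \<and> beta_exp \<alpha> = be" and l: "\<bar>lam\<bar> < s / (2 * A)"
    have ls: "\<bar>lam\<bar> * (2 * A) \<le> s" using l A(1) by (simp add: pos_less_divide_eq less_imp_le)
    have l1: "\<bar>lam\<bar> * (2 * A) \<le> 1" using ls unfolding s_def by linarith
    have "\<bar>lam\<bar> * (2 * A) \<le> ((2 * b)\<^sup>2 / 2) / (2 * (1 + 1 / (22000 * (2 * b))))" using ls unfolding s_def by linarith
    then have l2: "\<bar>lam\<bar> * (2 * A) * (2 * (1 + 1 / (22000 * (2 * b)))) \<le> (2 * b)\<^sup>2 / 2" using p by (simp only: pos_le_divide_eq)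
    show "purely_ac_spectrum (schr_op lam v \<alpha> \<theta>)"
      by (rule ac_spectrum_small_coupling[OF be(2) per cont A dec _ _ l1 l2]) (use a be(1) in auto)
  qed
qed

end
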